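(* For $\lambda,\mu\in\Lambda$ with $\lambda\ne\mu$ we have $$\langle E(\gamma_\lambda;\cdot),E'(\gamma_\mu^{-1};\cdot)\rangle=0.$$
   Context: Root data. Let $n\ge 2$, $V=\mathbb{R}^n$ with standard scalar product $\langle\cdot,\cdot\rangle$ and orthonormal basis $\epsilon_1,\dots,\epsilon_n$, $\Lambda=\bigoplus_i\mathbb{Z}\epsilon_i$, $\lambda_i=\langle\lambda,\epsilon_i\rangle$. Let $\widehat V=V\oplus\mathbb{R}\delta$ with $\langle\cdot,\cdot\rangle$ extended so that $\delta$ lies in the radical; $f^\vee=2f/\langle f,f\rangle$, $s_f(g)=g-\langle g,f^\vee\rangle f$. $\Sigma^+=\{2\epsilon_i\}_i\cup\{\epsilon_i\pm\epsilon_j\}_{i<j}$, $\Sigma^-=-\Sigma^+$, $\Sigma=\Sigma^+\cup\Sigma^-$; $R=\{\alpha+m\delta:\alpha\in\Sigma,m\in\mathbb{Z}\}$. Simple roots $a_0=\delta-2\epsilon_1$, $a_i=\epsilon_i-\epsilon_{i+1}$ ($1\le i<n$), $a_n=2\epsilon_n$; $s_i=s_{a_i}$; $\mathcal{W}=\langle s_0,\dots,s_n\rangle$ (a Coxeter group on these generators), $W=\langle s_1,\dots,s_n\rangle$; $\mathcal{W}=W\ltimes\tau(\Lambda)$ with $\tau(\lambda)f=f+\langle\lambda,f\rangle\delta$. Parameters. $q$ with a fixed square root $q^{1/2}$, and $\mathbf{t}$ consists of nonzero complex numbers $t_0,t,t_n,t_0^\vee,t_n^\vee$; $t_i=t$ for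 $1\le i<n$. Assume $0<q,t<1$ and that $a=t_0t_0^\vee q^{1/2}$, $b=-t_0(t_0^\vee)^{-1}q^{1/2}$, $c=t_nt_n^\vee$, $d=-t_n(t_n^\vee)^{-1}$ have moduli less than one; the parameters are moreover generic, i.e. outside a countable union of proper algebraic hypersurfaces (in particular the points $\gamma_\lambda$ below are mutually distinct and all denominators are nonzero). Put $t_{\pm\epsilon_i\pm\epsilon_j+m\delta}=t$ ($i<j$); $t_{\pm2\epsilon_i+m\delta}=t_0$ for $m$ odd, $t_n$ for $m$ even; $t_{\pm\epsilon_i+\frac m2\delta}=t_0^\vee$ for $m$ odd, $t_n^\vee$ for $m$ even ($m\in\mathbb{Z}$); $t_f=1$ for all other $f\in\widehat V$. Operators. $\mathcal{A}=\mathbb{C}[x_1^{\pm1},\dots,x_n^{\pm1}]$, $x^\lambda=\prod_ix_i^{\lambda_i}$, $x^{\lambda+c\delta}=q^cx^\lambda$; $\mathcal{W}$ acts on $\mathcal{A}$ by algebra automorphisms with $w(x^\lambda)=x^{w\lambda}$. For $\beta\in R$, $v_\beta(x)=\dfrac{(1-t_\beta t_{\beta/2}x^{\beta/2})(1+t_\beta t_{\beta/2}^{-1}x^{\beta/2})}{1-x^\beta}$. $T_i=t_i+t_i^{-1}v_{a_i}(x)(s_i-1)\in\mathrm{End}_{\mathbb{C}}(\mathcal{A})$ ($0\le i\le n$); these satisfy the braid relations of $\mathcal W$, so $T_w=T_{i_1}\cdots T_{i_r}$ is well defined for a reduced expression $w=s_{i_1}\cdots s_{i_r}\in\mathcal{W}$.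 Non-symmetric Koornwinder polynomials. $\Lambda^+=\{\lambda\in\Lambda:\lambda_1\ge\dots\ge\lambda_n\ge0\}$. $Y^\lambda=T_{\tau(\lambda)}$ for $\lambda\in\Lambda^+$, $Y^{\mu-\nu}=Y^\mu(Y^\nu)^{-1}$ for $\mu,\nu\in\Lambda^+$ (well defined, commuting); $f(Y)=\sum c_\lambda Y^\lambda$ for $f=\sum c_\lambda x^\lambda\in\mathcal{A}$. $\lambda^+$ is the unique element of $W\lambda\cap\Lambda^+$. $\lambda\le\mu$ means $\mu-\lambda$ is a nonnegative integer combination of $a_1,\dots,a_{n-1},\epsilon_n$; $\lambda\preceq\mu$ means $\lambda^+<\mu^+$, or $\lambda^+=\mu^+$ and $\lambda\le\mu$; $\lambda\prec\mu$ means $\lambda\preceq\mu$, $\lambda\ne\mu$. With $\varepsilon(m)=1$ for $m\ge0$ and $-1$ for $m<0$, put $\rho_l(\lambda)=\sum_i\varepsilon(\lambda_i)\epsilon_i$, $\rho_m(\lambda)=\sum_{i<j}[\varepsilon(\lambda_i-\lambda_j)(\epsilon_i-\epsilon_j)+\varepsilon(\lambda_i+\lambda_j)(\epsilon_i+\epsilon_j)]$, and let $\gamma_\lambda\in(\mathbb{C}\setminus\{0\})^n$ have $i$-th component $(t_0t_n)^{\rho_l(\lambda)_i}t^{\rho_m(\lambda)_i}q^{\lambda_i}$. $P_\lambda=P_\lambda(\cdot;\mathbf{t};q)$ ($\lambda\in\Lambda$) is the unique element of $\mathcal{A}$ of the form $x^\lambda+\sum_{\mu\prec\lambda}c_{\lambda,\mu}x^\mu$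 with $f(Y)P_\lambda=f(\gamma_\lambda)P_\lambda$ for all $f\in\mathcal{A}$. Normalization. Let $x_0\in(\mathbb{C}\setminus\{0\})^n$ have $i$-th component $t_n^\vee t_nt^{2(n-i)}$; $y^{-1}$ denotes componentwise inverse. $E(\gamma_\lambda;\cdot)=P_\lambda(\cdot;\mathbf{t};q)/P_\lambda(x_0^{-1};\mathbf{t};q)$ and $E'(\gamma_\lambda^{-1};\cdot)=P_\lambda(\cdot;\mathbf{t}^{-1};q^{-1})/P_\lambda(x_0;\mathbf{t}^{-1};q^{-1})$, where $(\mathbf{t}^{-1},q^{-1})$ means all parameters are inverted (including $q^{1/2}$). Bilinear form. With $(y;q)_\infty=\prod_{j\ge0}(1-yq^j)$, $(y_1,\dots,y_m;q)_\infty=\prod_j(y_j;q)_\infty$, put $$\Delta_+(x)=\prod_{i<j}\frac{(x_ix_j,x_ix_j^{-1},x_i^{-1}x_j,x_i^{-1}x_j^{-1};q)_\infty}{(t^2x_ix_j,t^2x_ix_j^{-1},t^2x_i^{-1}x_j,t^2x_i^{-1}x_j^{-1};q)_\infty}\prod_{i}\frac{(x_i^2,x_i^{-2};q)_\infty}{(ax_i,ax_i^{-1},bx_i,bx_i^{-1},cx_i,cx_i^{-1},dx_i,dx_i^{-1};q)_\infty},$$ $\mathcal{C}(x)=\prod_{\alpha\in\Sigma^-}v_\alpha(x)$, $\Delta=\mathcal{C}\Delta_+$, and for $f,g\in\mathcal{A}$ $$\langle f,g\rangle=\frac{1}{(2\pi i)^n}\int_{\mathbb{T}^n}f(x)\,g(x^{-1})\,\Delta(x)\,\frac{dx_1}{x_1}\cdots\frac{dx_n}{x_n},$$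 $\mathbb{T}$ the positively oriented unit circle. *)

theory Defs
  imports "HOL-Complex_Analysis.Complex_Analysis" "HOL-Library.Poly_Mapping"
begin

section \<open>Vectors, affine vectors and the exponent algebra\<close>

text \<open>
  The space \<open>V = \<real>\<^sup>n\<close> consists of the finitely supported sequences with support in \<open>{1..n}\<close>;
  the pair \<open>(v, m)\<close> stands for \<open>v + m \<delta>\<close>.  Laurent polynomials are elements of the group
  algebra of \<open>V\<close> (basis \<open>x\<^sup>v\<close>, convolution product) all of whose exponents lie in the lattice
  \<open>\<Lambda>\<close>; allowing exponents in \<open>V\<close> gives a meaning to \<open>x\<^bsup>\<beta>/2\<^esup>\<close> for every root \<open>\<beta>\<close>.
\<close>

type_synonym vec = "nat \<Rightarrow>\<^sub>0 real"
type_synonym affvec = "vec \<times> real"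
type_synonym expalg = "vec \<Rightarrow>\<^sub>0 complex"

abbreviation coef :: "('a \<Rightarrow>\<^sub>0 'b::zero) \<Rightarrow> 'a \<Rightarrow> 'b"
  where "coef \<equiv> Poly_Mapping.lookup"

abbreviation supp :: "('a \<Rightarrow>\<^sub>0 'b::zero) \<Rightarrow> 'a set"
  where "supp \<equiv> Poly_Mapping.keys"

definition smul :: "'b::mult_zero \<Rightarrow> ('a \<Rightarrow>\<^sub>0 'b) \<Rightarrow> ('a \<Rightarrow>\<^sub>0 'b)"
  where "smul c f = Poly_Mapping.map ((*) c) f"

definition eps :: "nat \<Rightarrow> vec"
  where "eps i = Poly_Mapping.single i 1"

definition aff_scale :: "real \<Rightarrow> affvec \<Rightarrow> affvec"
  where "aff_scale c f = (smul c (fst f), c * snd f)"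

definition aff_inner :: "affvec \<Rightarrow> affvec \<Rightarrow> real"
  where "aff_inner f g = (\<Sum>i\<in>supp (fst f). coef (fst f) i * coef (fst g) i)"

definition coroot :: "affvec \<Rightarrow> affvec"
  where "coroot f = aff_scale (2 / aff_inner f f) f"

definition aff_reflection :: "affvec \<Rightarrow> affvec \<Rightarrow> affvec"
  where "aff_reflection f g = g - aff_scale (aff_inner g (coroot f)) f"

definition lattice :: "nat \<Rightarrow> vec set"
  where "lattice n = {l. supp l \<subseteq> {1..n} \<and> (\<forall>i. coef l i \<in> \<int>)}"

definition laurent :: "nat \<Rightarrow> expalg set"
  where "laurent n = {f. supp f \<subseteq> lattice n}"

text \<open>Evaluation at a point with nonzero coordinates; the floor is exact for Laurent polynomials.\<close>

definition leval :: "expalg \<Rightarrow> (nat \<Rightarrow> complex) \<Rightarrow> complex"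
  where "leval f x = (\<Sum>l\<in>supp f. coef f l * (\<Prod>i\<in>supp l. x i powi \<lfloor>coef l i\<rfloor>))"

section \<open>The affine root system of type C and its Weyl group\<close>

definition pos_roots :: "nat \<Rightarrow> vec set"
  where "pos_roots n =
    {smul 2 (eps i) | i. 1 \<le> i \<and> i \<le> n}
    \<union> {eps i + eps j | i j. 1 \<le> i \<and> i < j \<and> j \<le> n}
    \<union> {eps i - eps j | i j. 1 \<le> i \<and> i < j \<and> j \<le> n}"

definition neg_roots :: "nat \<Rightarrow> vec set"
  where "neg_roots n = uminus ` pos_roots n"

definition simple_root :: "nat \<Rightarrow> nat \<Rightarrow> affvec"
  where "simple_root n i =
    (if i = 0 then (- smul 2 (eps 1), 1)
     else if i = n then (smul 2 (eps n), 0)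
     else (eps i - eps (i + 1), 0))"

definition simple_refl :: "nat \<Rightarrow> nat \<Rightarrow> affvec \<Rightarrow> affvec"
  where "simple_refl n i = aff_reflection (simple_root n i)"

definition word_elt :: "nat \<Rightarrow> nat list \<Rightarrow> affvec \<Rightarrow> affvec"
  where "word_elt n is = foldr (\<lambda>i w. simple_refl n i \<circ> w) is id"

text \<open>As the generators are involutions, the words already form the generated group.\<close>

definition weyl :: "nat \<Rightarrow> (affvec \<Rightarrow> affvec) set"
  where "weyl n = {word_elt n is | is. set is \<subseteq> {1..n}}"

definition reduced_expr :: "nat \<Rightarrow> nat list \<Rightarrow> (affvec \<Rightarrow> affvec) \<Rightarrow> bool"
  where "reduced_expr n is w \<longleftrightarrow>
    set is \<subseteq> {0..n} \<and> word_elt n is = w \<and>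
    (\<forall>js. set js \<subseteq> {0..n} \<and> word_elt n js = w \<longrightarrow> length is \<le> length js)"

definition transl :: "vec \<Rightarrow> affvec \<Rightarrow> affvec"
  where "transl l f = f + aff_scale (aff_inner (l, 0) f) (0, 1)"

definition dominant :: "nat \<Rightarrow> vec set"
  where "dominant n = {l \<in> lattice n.
    (\<forall>i\<in>{1..<n}. coef l (i + 1) \<le> coef l i) \<and> (\<forall>i\<in>{1..n}. 0 \<le> coef l i)}"

definition dom_part :: "nat \<Rightarrow> vec \<Rightarrow> vec"
  where "dom_part n l = (THE m. m \<in> dominant n \<and> (\<exists>w\<in>weyl n. w (l, 0) = (m, 0)))"

definition dom_le :: "nat \<Rightarrow> vec \<Rightarrow> vec \<Rightarrow> bool"
  where "dom_le n l m \<longleftrightarrow>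
    (\<exists>c :: nat \<Rightarrow> nat. m - l =
       (\<Sum>i = 1..<n. smul (real (c i)) (eps i - eps (i + 1))) + smul (real (c n)) (eps n))"

definition prec_eq :: "nat \<Rightarrow> vec \<Rightarrow> vec \<Rightarrow> bool"
  where "prec_eq n l m \<longleftrightarrow>
    (dom_le n (dom_part n l) (dom_part n m) \<and> dom_part n l \<noteq> dom_part n m)
    \<or> (dom_part n l = dom_part n m \<and> dom_le n l m)"

definition prec :: "nat \<Rightarrow> vec \<Rightarrow> vec \<Rightarrow> bool"
  where "prec n l m \<longleftrightarrow> prec_eq n l m \<and> l \<noteq> m"

section \<open>Parameters\<close>

text \<open>
  The fields are \<open>q\<^bsup>1/2\<^esup>, t\<^sub>0, t, t\<^sub>n, t\<^sub>0\<^sup>\<or>, t\<^sub>n\<^sup>\<or>\<close>; the square root of \<open>q\<close> is the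
  primitive datum, and \<open>q\<^sup>c\<close> is only used for \<open>c \<in> \<int>/2\<close>.
\<close>

record koornwinder_pars =
  q_half :: complex
  par_t0 :: complex
  par_t :: complex
  par_tn :: complex
  par_t0v :: complex
  par_tnv :: complex

definition par_q :: "koornwinder_pars \<Rightarrow> complex"
  where "par_q p = (q_half p)\<^sup>2"

definition q_pow :: "koornwinder_pars \<Rightarrow> real \<Rightarrow> complex"
  where "q_pow p c = q_half p powi \<lfloor>2 * c\<rfloor>"

definition inv_pars :: "koornwinder_pars \<Rightarrow> koornwinder_pars"
  where "inv_pars p =
    \<lparr>q_half = inverse (q_half p), par_t0 = inverse (par_t0 p), par_t = inverse (par_t p),
     par_tn = inverse (par_tn p), par_t0v = inverse (par_t0v p), par_tnv = inverse (par_tnv p)\<rparr>"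

definition aw_a :: "koornwinder_pars \<Rightarrow> complex"
  where "aw_a p = par_t0 p * par_t0v p * q_half p"

definition aw_b :: "koornwinder_pars \<Rightarrow> complex"
  where "aw_b p = - par_t0 p * inverse (par_t0v p) * q_half p"

definition aw_c :: "koornwinder_pars \<Rightarrow> complex"
  where "aw_c p = par_tn p * par_tnv p"

definition aw_d :: "koornwinder_pars \<Rightarrow> complex"
  where "aw_d p = - par_tn p * inverse (par_tnv p)"

text \<open>The multiplicity function \<open>f \<mapsto> t\<^sub>f\<close> on \<open>V + \<real> \<delta>\<close>.\<close>

definition mult_par :: "nat \<Rightarrow> koornwinder_pars \<Rightarrow> affvec \<Rightarrow> complex"
  where "mult_par n p f =
    (let v = fst f; m = snd f in
     if m \<in> \<int> \<and> (\<exists>i j. 1 \<le> i \<and> i < j \<and> j \<le> n \<and>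
          v \<in> {eps i + eps j, eps i - eps j, - eps i + eps j, - eps i - eps j})
       then par_t p
     else if m \<in> \<int> \<and> (\<exists>i\<in>{1..n}. v \<in> {smul 2 (eps i), - smul 2 (eps i)})
       then (if odd \<lfloor>m\<rfloor> then par_t0 p else par_tn p)
     else if 2 * m \<in> \<int> \<and> (\<exists>i\<in>{1..n}. v \<in> {eps i, - eps i})
       then (if odd \<lfloor>2 * m\<rfloor> then par_t0v p else par_tnv p)
     else 1)"

definition hecke_par :: "nat \<Rightarrow> koornwinder_pars \<Rightarrow> nat \<Rightarrow> complex"
  where "hecke_par n p i = (if i = 0 then par_t0 p else if i = n then par_tn p else par_t p)"

section \<open>Difference-reflection operators\<close>

definition xpow :: "koornwinder_pars \<Rightarrow> affvec \<Rightarrow> expalg"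
  where "xpow p f = Poly_Mapping.single (fst f) (q_pow p (snd f))"

definition act :: "koornwinder_pars \<Rightarrow> (affvec \<Rightarrow> affvec) \<Rightarrow> expalg \<Rightarrow> expalg"
  where "act p w f = (\<Sum>l\<in>supp f. smul (coef f l) (xpow p (w (l, 0))))"

text \<open>
  The rational function \<open>v\<^sub>\<beta>\<close> is represented by its numerator and denominator.  When \<open>\<beta>/2\<close> is
  not a lattice vector modulo \<open>\<real> \<delta>\<close>, \<open>t\<^bsub>\<beta>/2\<^esub> = 1\<close> and the terms with exponent \<open>\<beta>/2\<close> cancel,
  so the numerator is always a Laurent polynomial.
\<close>

definition v_num :: "nat \<Rightarrow> koornwinder_pars \<Rightarrow> affvec \<Rightarrow> expalg"
  where "v_num n p b =
    (let h = aff_scale (1/2) b; tb = mult_par n p b; th = mult_par n p h in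
     (1 - smul (tb * th) (xpow p h)) * (1 + smul (tb * inverse th) (xpow p h)))"

definition v_den :: "koornwinder_pars \<Rightarrow> affvec \<Rightarrow> expalg"
  where "v_den p b = 1 - xpow p b"

definition v_val :: "nat \<Rightarrow> koornwinder_pars \<Rightarrow> affvec \<Rightarrow> (nat \<Rightarrow> complex) \<Rightarrow> complex"
  where "v_val n p b x = leval (v_num n p b) x / leval (v_den p b) x"

text \<open>
  For a Laurent polynomial \<open>f\<close> the product \<open>v\<^bsub>a\<^sub>i\<^esub> (s\<^sub>i f - f)\<close> is again a Laurent polynomial,
  namely the quotient \<open>g\<close> below, unique because the exponent algebra has no zero divisors.
  All operators are meant as operators on \<open>laurent n\<close>; their values elsewhere are irrelevant.
\<close>

definition hecke_gen :: "nat \<Rightarrow> koornwinder_pars \<Rightarrow> nat \<Rightarrow> expalg \<Rightarrow> expalg"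
  where "hecke_gen n p i f =
    smul (hecke_par n p i) f + smul (inverse (hecke_par n p i))
      (THE g. g \<in> laurent n \<and>
         v_den p (simple_root n i) * g =
         v_num n p (simple_root n i) * (act p (simple_refl n i) f - f))"

definition hecke_word :: "nat \<Rightarrow> koornwinder_pars \<Rightarrow> nat list \<Rightarrow> expalg \<Rightarrow> expalg"
  where "hecke_word n p is = foldr (\<lambda>i F. hecke_gen n p i \<circ> F) is id"

text \<open>
  By the braid relations the choice of the reduced expression, and below that of
  \<open>\<mu>, \<nu>\<close> with \<open>\<lambda> = \<mu> - \<nu>\<close>, does not affect the operators on \<open>laurent n\<close>.
\<close>

definition hecke_elt :: "nat \<Rightarrow> koornwinder_pars \<Rightarrow> (affvec \<Rightarrow> affvec) \<Rightarrow> expalg \<Rightarrow> expalg"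
  where "hecke_elt n p w = hecke_word n p (SOME is. reduced_expr n is w)"

definition Y_dom :: "nat \<Rightarrow> koornwinder_pars \<Rightarrow> vec \<Rightarrow> expalg \<Rightarrow> expalg"
  where "Y_dom n p l = hecke_elt n p (transl l)"

definition Y_op :: "nat \<Rightarrow> koornwinder_pars \<Rightarrow> vec \<Rightarrow> expalg \<Rightarrow> expalg"
  where "Y_op n p l =
    (let mn = (SOME mn. fst mn \<in> dominant n \<and> snd mn \<in> dominant n \<and> l = fst mn - snd mn)
     in Y_dom n p (fst mn) \<circ> inv_into (laurent n) (Y_dom n p (snd mn)))"

definition Y_subst :: "nat \<Rightarrow> koornwinder_pars \<Rightarrow> expalg \<Rightarrow> expalg \<Rightarrow> expalg"
  where "Y_subst n p f g = (\<Sum>l\<in>supp f. smul (coef f l) (Y_op n p l g))"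

section \<open>Non-symmetric Koornwinder polynomials\<close>

definition pm_sign :: "real \<Rightarrow> real"
  where "pm_sign m = (if 0 \<le> m then 1 else -1)"

definition rho_l :: "nat \<Rightarrow> vec \<Rightarrow> vec"
  where "rho_l n l = (\<Sum>i = 1..n. smul (pm_sign (coef l i)) (eps i))"

definition rho_m :: "nat \<Rightarrow> vec \<Rightarrow> vec"
  where "rho_m n l = (\<Sum>j = 1..n. \<Sum>i = 1..<j.
    smul (pm_sign (coef l i - coef l j)) (eps i - eps j)
    + smul (pm_sign (coef l i + coef l j)) (eps i + eps j))"

text \<open>The components with index outside \<open>{1..n}\<close> are all \<open>1\<close>.\<close>

definition spectral_pt :: "nat \<Rightarrow> koornwinder_pars \<Rightarrow> vec \<Rightarrow> nat \<Rightarrow> complex"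
  where "spectral_pt n p l i =
    (par_t0 p * par_tn p) powi \<lfloor>coef (rho_l n l) i\<rfloor>
    * par_t p powi \<lfloor>coef (rho_m n l) i\<rfloor> * par_q p powi \<lfloor>coef l i\<rfloor>"

definition koornwinder :: "nat \<Rightarrow> koornwinder_pars \<Rightarrow> vec \<Rightarrow> expalg"
  where "koornwinder n p l = (THE P. P \<in> laurent n \<and>
    coef P l = 1 \<and> (\<forall>m \<in> supp P - {l}. prec n m l) \<and>
    (\<forall>f \<in> laurent n. Y_subst n p f P = smul (leval f (spectral_pt n p l)) P))"

definition base_pt :: "nat \<Rightarrow> koornwinder_pars \<Rightarrow> nat \<Rightarrow> complex"
  where "base_pt n p i = par_tnv p * par_tn p * par_t p ^ (2 * (n - i))"

definition pt_inv :: "(nat \<Rightarrow> complex) \<Rightarrow> nat \<Rightarrow> complex"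
  where "pt_inv x i = inverse (x i)"

text \<open>\<open>E(\<gamma>\<^sub>\<lambda>; \<cdot>)\<close> and \<open>E'(\<gamma>\<^sub>\<lambda>\<^sup>-\<^sup>1; \<cdot>)\<close>, indexed by \<open>\<lambda>\<close>.\<close>

definition koornwinder_E :: "nat \<Rightarrow> koornwinder_pars \<Rightarrow> vec \<Rightarrow> expalg"
  where "koornwinder_E n p l =
    smul (inverse (leval (koornwinder n p l) (pt_inv (base_pt n p)))) (koornwinder n p l)"

definition koornwinder_E' :: "nat \<Rightarrow> koornwinder_pars \<Rightarrow> vec \<Rightarrow> expalg"
  where "koornwinder_E' n p l =
    smul (inverse (leval (koornwinder n (inv_pars p) l) (base_pt n p)))
      (koornwinder n (inv_pars p) l)"

section \<open>The bilinear form\<close>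

definition q_poch :: "complex \<Rightarrow> complex \<Rightarrow> complex"
  where "q_poch y q = prodinf (\<lambda>j. 1 - y * q ^ j)"

definition weight_plus :: "nat \<Rightarrow> koornwinder_pars \<Rightarrow> (nat \<Rightarrow> complex) \<Rightarrow> complex"
  where "weight_plus n p x =
    (\<Prod>j = 1..n. \<Prod>i = 1..<j. \<Prod>y \<leftarrow> [x i * x j, x i * inverse (x j),
        inverse (x i) * x j, inverse (x i) * inverse (x j)].
       q_poch y (par_q p) / q_poch ((par_t p)\<^sup>2 * y) (par_q p))
    * (\<Prod>i = 1..n.
       q_poch ((x i)\<^sup>2) (par_q p) * q_poch (inverse (x i) ^ 2) (par_q p)
       / (\<Prod>u \<leftarrow> [aw_a p, aw_b p, aw_c p, aw_d p].
           q_poch (u * x i) (par_q p) * q_poch (u * inverse (x i)) (par_q p)))"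

definition weight_c :: "nat \<Rightarrow> koornwinder_pars \<Rightarrow> (nat \<Rightarrow> complex) \<Rightarrow> complex"
  where "weight_c n p x = (\<Prod>\<alpha>\<in>neg_roots n. v_val n p (\<alpha>, 0) x)"

definition weight :: "nat \<Rightarrow> koornwinder_pars \<Rightarrow> (nat \<Rightarrow> complex) \<Rightarrow> complex"
  where "weight n p x = weight_c n p x * weight_plus n p x"

text \<open>
  The integral of \<open>F dx\<^sub>1 \<dots> dx\<^sub>n\<close> over the \<open>n\<close>-fold product of the positively oriented unit
  circle, pulled back along \<open>circlepath 0 1\<close> to the unit cube as in
  \<open>contour_integral_integral\<close>.
\<close>

definition torus_integral :: "nat \<Rightarrow> ((nat \<Rightarrow> complex) \<Rightarrow> complex) \<Rightarrow> complex"
  where "torus_integral n F =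
    (LINT \<theta> | PiM {1..n} (\<lambda>_. restrict_space lborel {0..1}).
      F (\<lambda>i. circlepath 0 1 (\<theta> i))
      * (\<Prod>i = 1..n. vector_derivative (circlepath 0 1) (at (\<theta> i))))"

definition koornwinder_form :: "nat \<Rightarrow> koornwinder_pars \<Rightarrow> expalg \<Rightarrow> expalg \<Rightarrow> complex"
  where "koornwinder_form n p f g =
    1 / (2 * of_real pi * \<i>) ^ n *
    torus_integral n (\<lambda>x. leval f x * leval g (pt_inv x) * weight n p x * (\<Prod>i = 1..n. 1 / x i))"

text \<open>
  The conditions that genericity of the parameters is used for: the spectral points are
  mutually distinct (hence so are those for the inverted parameters, so that the polynomials
  exist and are unique), and the normalizing denominators do not vanish.
\<close>

definition generic_pars :: "nat \<Rightarrow> koornwinder_pars \<Rightarrow> bool"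
  where "generic_pars n p \<longleftrightarrow>
    inj_on (spectral_pt n p) (lattice n) \<and>
    (\<forall>l \<in> lattice n. leval (koornwinder n p l) (pt_inv (base_pt n p)) \<noteq> 0 \<and>
       leval (koornwinder n (inv_pars p) l) (base_pt n p) \<noteq> 0)"

end

theory Submission
  imports Defs "HOL-Probability.Probability"
begin

text \<open>
  The idea is that of orthogonality of eigenvectors of a unitary operator.  Write \<open>T\<^sub>k'\<close>, \<open>Y'\<^sup>\<lambda>\<close>,
  \<open>P'\<^sub>\<mu>\<close> for the objects at the inverted parameters.  The bilinear form satisfies
  \<open>\<langle>T\<^sub>k f, T\<^sub>k' g\<rangle> = \<langle>f, g\<rangle>\<close> for \<open>0 \<le> k \<le> n\<close>, hence \<open>\<langle>Y\<^sup>\<nu> f, Y'\<^sup>\<nu> g\<rangle> = \<langle>f, g\<rangle>\<close> for dominant \<open>\<nu>\<close>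
  (\<open>form_T\<close>, \<open>form_Y\<close>).  Now \<open>P\<^sub>\<lambda>\<close> has the eigenvalue \<open>\<gamma>\<^sub>\<lambda>\<^sup>\<nu>\<close> for \<open>Y\<^sup>\<nu>\<close>, and \<open>P'\<^sub>\<mu>\<close> has the eigenvalue
  \<open>\<gamma>\<^sub>\<mu>\<^bsup>-\<nu>\<^esup>\<close> for \<open>Y'\<^sup>\<nu>\<close>, so \<open>\<langle>P\<^sub>\<lambda>, P'\<^sub>\<mu>\<rangle>\<close> is multiplied by \<open>\<gamma>\<^sub>\<lambda>\<^sup>\<nu> \<gamma>\<^sub>\<mu>\<^bsup>-\<nu>\<^esup>\<close> when it is rewritten in this way.  The
  spectral points being distinct, some dominant \<open>\<nu>\<close> makes this factor different from \<open>1\<close>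
  (\<open>separating_weight\<close>), and the form vanishes.

  Unitarity.  On values, \<open>T\<^sub>k\<close> sends \<open>f\<close> to \<open>\<beta> f + (t\<^sub>k - \<beta>) (f \<circ> s\<^sub>k)\<close> with a rational function \<open>\<beta>\<close>
  (\<open>T_eval\<close>).  This gives a factorization of the difference of the two integrands: it is
  \<open>(t\<^sub>k - \<beta>) \<Delta>\<close> times a function that changes sign under \<open>x \<mapsto> s\<^sub>k x\<close> (\<open>jump_eq\<close>, \<open>odd_part_odd\<close>), while
  \<open>(t\<^sub>k - \<beta>) \<Delta>\<close> is invariant (\<open>even_short\<close>, \<open>even_n\<close>, \<open>aff_even_refl\<close>).  For \<open>k \<ge> 1\<close> the map \<open>s\<^sub>k\<close> preserves
  the torus and the integral is equal to its own negative.  For \<open>k = 0\<close> it exchanges the circles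
  \<open>|x\<^sub>1| = 1\<close> and \<open>|x\<^sub>1| = q\<close>; the function is holomorphic on an annulus containing both because
  \<open>t, |a|, |b|, |c|, |d| < 1\<close>, so Cauchy's theorem moves one circle to the other.

  Eigenvalues.  The polynomials \<open>P\<^sub>\<lambda>\<close> are given by a definite description, so their existence and
  uniqueness have to be proved.  A Laurent polynomial is determined by its values at the points
  where no denominator vanishes (\<open>regular_eqI\<close>), which turns the quadratic and braid relations into
  identities between rational functions.  The braid relations and the exchange property give
  operators \<open>T\<^sub>w\<close> (\<open>Tw_well_defined\<close>), and since lengths of dominant translations add up,
  \<open>Y\<^bsup>\<lambda> + \<mu>\<^esup> = Y\<^sup>\<lambda> Y\<^sup>\<mu>\<close>; in particular the \<open>Y\<^sup>\<lambda>\<close> commute.  For a reduced word of \<open>w\<close> one has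
  \<open>T\<^sub>w = R\<^bsub>\<beta>\<^sub>1\<^esub> \<dots> R\<^bsub>\<beta>\<^sub>r\<^esub> w\<close> with \<open>\<beta>\<^sub>1, \<dots>, \<beta>\<^sub>r\<close> the inversions of \<open>w\<close> (\<open>Tw_decomp\<close>), and each factor \<open>R\<^sub>\<beta>\<close>
  for an inversion of a dominant translation is triangular for \<open>\<prec>\<close> with a known diagonal
  (\<open>triang_Rmon\<close>).  The product of the diagonal entries over the inversions of \<open>\<tau>(\<nu>)\<close> and the power of
  \<open>q\<close> produced by \<open>\<tau>(\<nu>)\<close> itself is the value of \<open>x\<^sup>\<nu>\<close> at the spectral point (\<open>yev_eq\<close>).  A commuting family of triangular operators whose joint
  diagonal entries are distinct has exactly one joint eigenvector for every leading term
  (\<open>ex_eigen\<close>, \<open>eigen_unique\<close>).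
\<close>

section \<open>Finitely supported functions and linear extension\<close>

lemma coef_smul [simp]: "coef (smul c f) i = c * coef f i"
  for f :: "'a \<Rightarrow>\<^sub>0 'b::mult_zero"
  by (auto simp: smul_def Poly_Mapping.map.rep_eq when_def)

lemma coef_eps: "coef (eps i) j = (if j = i then 1 else 0)"
  by (simp add: eps_def lookup_single when_def)

lemma smul_simps [simp]:
  fixes f :: "'a \<Rightarrow>\<^sub>0 'b::comm_ring_1"
  shows "smul 0 f = 0" "smul 1 f = f" "smul a (smul b f) = smul (a * b) f"
    "smul a 0 = (0 :: 'a \<Rightarrow>\<^sub>0 'b)" "smul (- a) f = - smul a f" "smul a (- f) = - smul a f"
  by (auto intro!: poly_mapping_eqI simp: algebra_simps)

lemma smul_distribs:
  fixes f :: "'a \<Rightarrow>\<^sub>0 'b::comm_ring_1"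
  shows "smul a (f + g) = smul a f + smul a g" "smul a (f - g) = smul a f - smul a g"
    "smul (a + b) f = smul a f + smul b f" "smul (a - b) f = smul a f - smul b f"
  by (auto intro!: poly_mapping_eqI simp: algebra_simps lookup_add lookup_minus)

lemma smul_sum: "smul a (sum F A) = (\<Sum>x\<in>A. smul a (F x))"
  for F :: "'c \<Rightarrow> 'a \<Rightarrow>\<^sub>0 'b::comm_ring_1"
  by (induction A rule: infinite_finite_induct) (simp_all add: smul_distribs)

lemma smul_single [simp]: "smul a (Poly_Mapping.single k b) = Poly_Mapping.single k (a * b)"
  for b :: "'b::comm_ring_1"
  by (auto intro!: poly_mapping_eqI simp: lookup_single when_def)

lemma mult_smul:
  fixes f g :: expalg
  shows "f * smul a g = smul a (f * g)" "smul a f * g = smul a (f * g)"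
  by (simp_all add: smul_def mult_map_scale_conv_mult mult.assoc mult.left_commute)

lemma supp_smul_subset: "supp (smul a f) \<subseteq> supp f"
  for f :: "'a \<Rightarrow>\<^sub>0 'b::comm_ring_1"
  by (auto simp: in_keys_iff)

text \<open>The action of the affine Weyl group and the root operators below are extensions of this kind,
  so identities between them only have to be checked on monomials.\<close>

definition lin :: "(vec \<Rightarrow> expalg) \<Rightarrow> expalg \<Rightarrow> expalg"
  where "lin F f = (\<Sum>l\<in>supp f. smul (coef f l) (F l))"

lemma lin_superset:
  assumes "finite A" "supp f \<subseteq> A"
  shows "lin F f = (\<Sum>l\<in>A. smul (coef f l) (F l))"
  unfolding lin_def using assms by (intro sum.mono_neutral_left) (auto simp: in_keys_iff)

lemma lin_add: "lin F (f + g) = lin F f + lin F g"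
proof -
  have "lin F (f + g) = (\<Sum>l\<in>supp f \<union> supp g. smul (coef (f + g) l) (F l))"
    using keys_add[of f g] by (intro lin_superset) auto
  also have "\<dots> = (\<Sum>l\<in>supp f \<union> supp g. smul (coef f l) (F l))
      + (\<Sum>l\<in>supp f \<union> supp g. smul (coef g l) (F l))"
    by (simp add: lookup_add smul_distribs sum.distrib)
  also have "\<dots> = lin F f + lin F g"
    by (subst (1 2) lin_superset[where A = "supp f \<union> supp g"]) auto
  finally show ?thesis .
qed

lemma lin_smul: "lin F (smul a f) = smul a (lin F f)"
proof -
  have "lin F (smul a f) = (\<Sum>l\<in>supp f. smul (coef (smul a f) l) (F l))"
    by (intro lin_superset supp_smul_subset) auto
  then show ?thesis by (simp add: lin_def smul_sum)
qed

lemma lin_zero [simp]: "lin F 0 = 0"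
  by (simp add: lin_def)

lemma lin_sum: "lin F (sum G A) = (\<Sum>x\<in>A. lin F (G x))"
  by (induction A rule: infinite_finite_induct) (simp_all add: lin_add)

lemma lin_uminus: "lin F (- f) = - lin F f"
  using lin_smul[of F "-1" f] by simp

lemma lin_diff: "lin F (f - g) = lin F f - lin F g"
  using lin_add[of F f "- g"] by (simp add: lin_uminus)

lemma lin_single: "lin F (Poly_Mapping.single l c) = smul c (F l)"
  by (subst lin_superset[where A = "{l}"]) auto

lemma lin_cong: "(\<And>l. l \<in> supp f \<Longrightarrow> F l = G l) \<Longrightarrow> lin F f = lin G f"
  by (simp add: lin_def)

lemma lin_lin: "lin F (lin G f) = lin (\<lambda>l. lin F (G l)) f"
  by (simp add: lin_def[of G] lin_def[of "\<lambda>l. lin F (G l)"] lin_sum lin_smul)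

lemma lin_id: "lin (\<lambda>l. Poly_Mapping.single l 1) f = f"
proof (rule poly_mapping_eqI)
  fix k
  have "coef (lin (\<lambda>l. Poly_Mapping.single l 1) f) k
      = (\<Sum>l\<in>supp f. if l = k then coef f l else 0)"
    by (auto simp: lin_def lookup_sum lookup_single when_def intro!: sum.cong)
  also have "\<dots> = coef f k" by (simp add: in_keys_iff)
  finally show "coef (lin (\<lambda>l. Poly_Mapping.single l 1) f) k = coef f k" .
qed

lemma mult_eq_lin: "g * f = lin (\<lambda>l. g * Poly_Mapping.single l 1) f"
proof -
  have "g * f = g * lin (\<lambda>l. Poly_Mapping.single l 1) f" by (simp add: lin_id)
  also have "\<dots> = lin (\<lambda>l. g * Poly_Mapping.single l 1) f"
    unfolding lin_def sum_distrib_left mult_smul ..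
  finally show ?thesis .
qed

section \<open>The lattice, Laurent polynomials and their values\<close>

lemma lattice_simps [simp, intro]:
  "0 \<in> lattice n"
  "l \<in> lattice n \<Longrightarrow> m \<in> lattice n \<Longrightarrow> l + m \<in> lattice n"
  "l \<in> lattice n \<Longrightarrow> m \<in> lattice n \<Longrightarrow> l - m \<in> lattice n"
  "l \<in> lattice n \<Longrightarrow> - l \<in> lattice n"
  "1 \<le> i \<Longrightarrow> i \<le> n \<Longrightarrow> eps i \<in> lattice n"
proof -
  show "l \<in> lattice n \<Longrightarrow> m \<in> lattice n \<Longrightarrow> l + m \<in> lattice n"
    using keys_add[of l m] by (auto simp: lattice_def lookup_add)
  show "l \<in> lattice n \<Longrightarrow> m \<in> lattice n \<Longrightarrow> l - m \<in> lattice n"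
    by (auto simp: lattice_def lookup_minus in_keys_iff subset_iff) (metis diff_self)+
qed (auto simp: lattice_def in_keys_iff coef_eps subset_iff)

lemma lattice_smul: "l \<in> lattice n \<Longrightarrow> c \<in> \<int> \<Longrightarrow> smul c l \<in> lattice n"
  by (auto simp: lattice_def in_keys_iff subset_iff)

lemma lattice_sum: "(\<And>x. x \<in> A \<Longrightarrow> F x \<in> lattice n) \<Longrightarrow> sum F A \<in> lattice n"
  by (induction A rule: infinite_finite_induct) auto

lemma lattice_outside: "l \<in> lattice n \<Longrightarrow> i \<notin> {1..n} \<Longrightarrow> coef l i = 0"
  by (auto simp: lattice_def in_keys_iff subset_iff)

lemma lattice_Ints: "l \<in> lattice n \<Longrightarrow> coef l i \<in> \<int>"
  by (auto simp: lattice_def)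

lemma lattice_floor: "l \<in> lattice n \<Longrightarrow> of_int \<lfloor>coef l i\<rfloor> = coef l i"
  using lattice_Ints[of l n i] by (auto elim: Ints_cases)

lemma lattice_eqI:
  assumes "l \<in> lattice n" "m \<in> lattice n" "\<And>i. i \<in> {1..n} \<Longrightarrow> coef l i = coef m i"
  shows "l = m"
  by (rule poly_mapping_eqI) (metis assms lattice_outside)

lemma laurent_simps [simp, intro]:
  "0 \<in> laurent n"
  "f \<in> laurent n \<Longrightarrow> g \<in> laurent n \<Longrightarrow> f + g \<in> laurent n"
  "f \<in> laurent n \<Longrightarrow> g \<in> laurent n \<Longrightarrow> f - g \<in> laurent n"
  "f \<in> laurent n \<Longrightarrow> - f \<in> laurent n"
  "f \<in> laurent n \<Longrightarrow> smul c f \<in> laurent n"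
  "1 \<in> laurent n"
proof -
  show "f \<in> laurent n \<Longrightarrow> g \<in> laurent n \<Longrightarrow> f + g \<in> laurent n"
    using keys_add[of f g] by (auto simp: laurent_def)
  show "f \<in> laurent n \<Longrightarrow> g \<in> laurent n \<Longrightarrow> f - g \<in> laurent n"
    by (auto simp: laurent_def lookup_minus in_keys_iff subset_iff) (metis diff_self)
qed (auto simp: laurent_def in_keys_iff subset_iff lookup_one when_def)

lemma laurent_single: "l \<in> lattice n \<Longrightarrow> Poly_Mapping.single l c \<in> laurent n"
  by (auto simp: laurent_def in_keys_iff lookup_single when_def)

lemma laurent_sum: "(\<And>x. x \<in> A \<Longrightarrow> F x \<in> laurent n) \<Longrightarrow> sum F A \<in> laurent n"
  by (induction A rule: infinite_finite_induct) auto

lemma laurent_lin: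
  "f \<in> laurent n \<Longrightarrow> (\<And>l. l \<in> lattice n \<Longrightarrow> F l \<in> laurent n) \<Longrightarrow> lin F f \<in> laurent n"
  unfolding lin_def by (intro laurent_sum laurent_simps) (auto simp: laurent_def)

lemma laurent_mult: "f \<in> laurent n \<Longrightarrow> g \<in> laurent n \<Longrightarrow> f * g \<in> laurent n"
proof -
  assume f: "f \<in> laurent n" and g: "g \<in> laurent n"
  have "Poly_Mapping.single l 1 * f \<in> laurent n" if "l \<in> lattice n" for l
    unfolding mult_eq_lin[of _ f]
    using f that by (intro laurent_lin) (auto simp: mult_single intro!: laurent_single)
  then show ?thesis
    unfolding mult_eq_lin[of f g] by (intro laurent_lin[OF g]) (simp add: mult.commute)
qed

definition mon :: "nat \<Rightarrow> (nat \<Rightarrow> complex) \<Rightarrow> vec \<Rightarrow> complex"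
  where "mon n x l = (\<Prod>i = 1..n. x i powi \<lfloor>coef l i\<rfloor>)"

lemma mon_altdef: "l \<in> lattice n \<Longrightarrow> (\<Prod>i\<in>supp l. x i powi \<lfloor>coef l i\<rfloor>) = mon n x l"
  unfolding mon_def by (intro prod.mono_neutral_left) (auto simp: lattice_def in_keys_iff)

lemma mon_add:
  assumes "l \<in> lattice n" "m \<in> lattice n" "\<And>i. i \<in> {1..n} \<Longrightarrow> x i \<noteq> 0"
  shows "mon n x (l + m) = mon n x l * mon n x m"
proof -
  have "x i powi \<lfloor>coef (l + m) i\<rfloor> = x i powi \<lfloor>coef l i\<rfloor> * x i powi \<lfloor>coef m i\<rfloor>" if "i \<in> {1..n}" for i
  proof -
    have "\<lfloor>coef (l + m) i\<rfloor> = \<lfloor>coef l i\<rfloor> + \<lfloor>coef m i\<rfloor>"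
      using lattice_Ints[OF assms(1), of i] lattice_Ints[OF assms(2), of i]
      by (auto simp: lookup_add elim!: Ints_cases)
    then show ?thesis using assms(3)[OF that] by (simp add: power_int_add)
  qed
  then show ?thesis by (simp add: mon_def prod.distrib)
qed

lemma mon_zero [simp]: "mon n x 0 = 1"
  by (simp add: mon_def)

lemma mon_nonzero: "(\<And>i. i \<in> {1..n} \<Longrightarrow> x i \<noteq> 0) \<Longrightarrow> mon n x l \<noteq> 0"
  by (simp add: mon_def)

lemma mon_uminus:
  assumes "l \<in> lattice n" "\<And>i. i \<in> {1..n} \<Longrightarrow> x i \<noteq> 0"
  shows "mon n x (- l) = inverse (mon n x l)"
proof -
  have "mon n x (- l) * mon n x l = 1"
    using mon_add[of "- l" n l x] assms by simp
  then show ?thesis by (metis inverse_unique mult.commute)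
qed

lemma mon_smul_int:
  assumes "l \<in> lattice n" "\<And>i. i \<in> {1..n} \<Longrightarrow> x i \<noteq> 0"
  shows "mon n x (smul (of_int k) l) = mon n x l powi k"
proof -
  have "x i powi \<lfloor>coef (smul (of_int k) l) i\<rfloor> = (x i powi \<lfloor>coef l i\<rfloor>) powi k" for i
  proof -
    have "\<lfloor>coef (smul (of_int k) l) i\<rfloor> = k * \<lfloor>coef l i\<rfloor>"
      using lattice_Ints[OF assms(1), of i]
      by (auto elim!: Ints_cases simp flip: of_int_mult)
    then show ?thesis by (simp add: power_int_mult mult.commute[of k])
  qed
  moreover have "(\<Prod>i\<in>A. f i powi k) = prod f A powi k" for f :: "nat \<Rightarrow> complex" and A
    by (induction A rule: infinite_finite_induct) (simp_all add: power_int_mult_distrib)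
  ultimately show ?thesis by (simp add: mon_def)
qed

lemma leval_superset:
  assumes "finite A" "supp f \<subseteq> A"
  shows "leval f x = (\<Sum>l\<in>A. coef f l * (\<Prod>i\<in>supp l. x i powi \<lfloor>coef l i\<rfloor>))"
  unfolding leval_def using assms by (intro sum.mono_neutral_left) (auto simp: in_keys_iff)

lemma leval_add: "leval (f + g) x = leval f x + leval g x"
proof -
  have "leval (f + g) x = (\<Sum>l\<in>supp f \<union> supp g. coef (f + g) l * (\<Prod>i\<in>supp l. x i powi \<lfloor>coef l i\<rfloor>))"
    using keys_add[of f g] by (intro leval_superset) auto
  also have "\<dots> = leval f x + leval g x"
    by (subst (1 2) leval_superset[where A = "supp f \<union> supp g"])
      (auto simp: lookup_add algebra_simps sum.distrib)
  finally show ?thesis .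
qed

lemma leval_smul: "leval (smul c f) x = c * leval f x"
proof -
  have "leval (smul c f) x = (\<Sum>l\<in>supp f. coef (smul c f) l * (\<Prod>i\<in>supp l. x i powi \<lfloor>coef l i\<rfloor>))"
    by (intro leval_superset supp_smul_subset) auto
  then show ?thesis by (simp add: leval_def sum_distrib_left mult.assoc)
qed

lemma leval_zero [simp]: "leval 0 x = 0"
  by (simp add: leval_def)

lemma leval_uminus: "leval (- f) x = - leval f x"
  using leval_smul[of "-1" f x] by simp

lemma leval_diff: "leval (f - g) x = leval f x - leval g x"
  using leval_add[of f "- g" x] by (simp add: leval_uminus)

lemma leval_sum: "leval (sum F A) x = (\<Sum>y\<in>A. leval (F y) x)"
  by (induction A rule: infinite_finite_induct) (simp_all add: leval_add)

lemma leval_single: "l \<in> lattice n \<Longrightarrow> leval (Poly_Mapping.single l c) x = c * mon n x l"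
  by (subst leval_superset[where A = "{l}"]) (simp_all add: mon_altdef)

lemma leval_one [simp]: "leval 1 x = 1"
  using leval_single[of 0 n 1 x for n] by simp

lemma leval_lin: "leval (lin F f) x = (\<Sum>l\<in>supp f. coef f l * leval (F l) x)"
  by (simp add: lin_def leval_sum leval_smul)

lemma leval_laurent: "f \<in> laurent n \<Longrightarrow> leval f x = (\<Sum>l\<in>supp f. coef f l * mon n x l)"
  unfolding leval_def by (intro sum.cong) (auto simp: laurent_def mon_altdef)

lemma leval_mult:
  assumes "f \<in> laurent n" "g \<in> laurent n" "\<And>i. i \<in> {1..n} \<Longrightarrow> x i \<noteq> 0"
  shows "leval (f * g) x = leval f x * leval g x"
proof -
  have single: "leval (f * Poly_Mapping.single l 1) x = leval f x * mon n x l" if "l \<in> lattice n" for l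
  proof -
    have "leval (Poly_Mapping.single l 1 * Poly_Mapping.single m 1) x = mon n x m * mon n x l"
      if "m \<in> supp f" for m
    proof -
      have "m \<in> lattice n" using that assms(1) by (auto simp: laurent_def)
      then show ?thesis
        using mon_add[of l n m x] \<open>l \<in> lattice n\<close> assms(3)
        by (simp add: mult_single leval_single[of _ n])
    qed
    then show ?thesis
      unfolding mult.commute[of f] mult_eq_lin[of _ f]
      by (simp add: leval_lin leval_laurent[OF assms(1)] sum_distrib_right mult.assoc)
  qed
  have "leval (f * g) x = (\<Sum>l\<in>supp g. coef g l * (leval f x * mon n x l))"
    unfolding mult_eq_lin[of f g] leval_lin
    using assms(2) by (intro sum.cong) (auto simp: laurent_def single)
  then show ?thesis
    by (simp add: leval_laurent[OF assms(2)] sum_distrib_left mult.left_commute)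
qed

text \<open>A nonzero Laurent polynomial restricted to the curve \<open>z \<mapsto> (z\<^bsup>N\<^esup>, z\<^bsup>N\<^sup>2\<^esup>, \<dots>)\<close> is, for
  suitable \<open>N\<close>, a Laurent polynomial in one variable whose exponents do not collide.\<close>

definition curve :: "nat \<Rightarrow> complex \<Rightarrow> nat \<Rightarrow> complex"
  where "curve N z i = z ^ (N ^ i)"

definition curve_deg :: "nat \<Rightarrow> nat \<Rightarrow> vec \<Rightarrow> int"
  where "curve_deg n N l = (\<Sum>i = 1..n. \<lfloor>coef l i\<rfloor> * int N ^ i)"

lemma mon_curve: "z \<noteq> 0 \<Longrightarrow> mon n (curve N z) l = z powi curve_deg n N l"
proof -
  assume z: "z \<noteq> 0"
  have "z powi (\<Sum>i\<in>A. f i) = (\<Prod>i\<in>A. z powi f i)" for f and A :: "nat set"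
    using z by (induction A rule: infinite_finite_induct) (simp_all add: power_int_add)
  moreover have "(z ^ (N ^ i)) powi k = z powi (k * int N ^ i)" for i k
    by (simp add: power_int_mult mult.commute[of k] flip: of_nat_power power_int_of_nat)
  ultimately show ?thesis
    by (simp add: mon_def curve_deg_def curve_def)
qed

lemma curve_deg_diff:
  assumes "l \<in> lattice n" "m \<in> lattice n"
  shows "curve_deg n N (l - m) = curve_deg n N l - curve_deg n N m"
proof -
  have "\<lfloor>coef (l - m) i\<rfloor> = \<lfloor>coef l i\<rfloor> - \<lfloor>coef m i\<rfloor>" for i
    using lattice_Ints[OF assms(1), of i] lattice_Ints[OF assms(2), of i]
    by (auto simp: lookup_minus elim!: Ints_cases)
  then show ?thesis by (simp add: curve_deg_def left_diff_distrib sum_subtractf)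
qed

text \<open>The degree of \<open>x\<^sup>l\<close> along the curve is a nonzero polynomial in \<open>N\<close> whose coefficients are the
  coordinates of \<open>l\<close>, so each \<open>l\<close> excludes only finitely many \<open>N\<close>.\<close>

lemma ex_curve_deg_nonzero:
  assumes "finite D" "D \<subseteq> lattice n - {0}"
  shows "\<exists>N. 0 < N \<and> (\<forall>l\<in>D. curve_deg n N l \<noteq> 0)"
proof -
  define P where "P l = (\<Sum>i = 1..n. monom (\<lfloor>coef l i\<rfloor>) i)" for l :: vec
  have P: "poly (P l) (int N) = curve_deg n N l" for l N
    by (simp add: P_def curve_deg_def poly_sum poly_monom)
  have "P l \<noteq> 0" if "l \<in> D" for l
  proof
    assume 0: "P l = 0"
    have "coef l i = 0" if "i \<in> {1..n}" for i
    proof -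
      have "coeff (P l) i = \<lfloor>coef l i\<rfloor>"
        using that by (simp add: P_def coeff_sum if_distrib cong: if_cong)
      then show ?thesis using 0 lattice_floor[of l n i] \<open>l \<in> D\<close> assms(2) by auto
    qed
    then have "l = 0" using \<open>l \<in> D\<close> assms(2) by (intro lattice_eqI[of l n 0]) auto
    then show False using \<open>l \<in> D\<close> assms(2) by auto
  qed
  then have "finite (\<Union>l\<in>D. {c. poly (P l) c = 0})"
    using assms(1) by (intro finite_UN_I poly_roots_finite) auto
  then have "finite (int -` (\<Union>l\<in>D. {c. poly (P l) c = 0}))"
    by (intro finite_vimageI) auto
  then obtain N where "N \<notin> insert 0 (int -` (\<Union>l\<in>D. {c. poly (P l) c = 0}))"
    using ex_new_if_finite[of "insert 0 (int -` (\<Union>l\<in>D. {c. poly (P l) c = 0}))"] by auto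
  then show ?thesis by (intro exI[of _ N]) (auto simp: P)
qed

lemma finite_sum_powi_zeros:
  assumes "finite D" "inj_on d D" "\<And>l. l \<in> D \<Longrightarrow> c l \<noteq> 0" "D \<noteq> {}"
  shows "finite {z :: complex. z \<noteq> 0 \<and> (\<Sum>l\<in>D. c l * z powi d l) = 0}"
proof -
  obtain B where B: "\<And>l. l \<in> D \<Longrightarrow> B \<le> d l"
  proof
    fix l assume "l \<in> D"
    then show "Min (d ` D) \<le> d l" using assms(1) by simp
  qed
  define P where "P = (\<Sum>l\<in>D. monom (c l) (nat (d l - B)))"
  have "P \<noteq> 0"
  proof
    assume 0: "P = 0"
    obtain l where l: "l \<in> D" using assms(4) by auto
    have "coeff P (nat (d l - B)) = (\<Sum>k\<in>D. if k = l then c k else 0)"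
      unfolding P_def coeff_sum
    proof (intro sum.cong refl)
      fix k assume k: "k \<in> D"
      have "nat (d k - B) = nat (d l - B) \<longleftrightarrow> k = l"
        using B[OF k] B[OF l] inj_onD[OF assms(2) _ k l] by auto
      then show "coeff (monom (c k) (nat (d k - B))) (nat (d l - B)) = (if k = l then c k else 0)"
        by (simp add: coeff_monom)
    qed
    also have "\<dots> = c l" using l assms(1) by simp
    finally show False using 0 assms(3)[OF l] by simp
  qed
  moreover have "{z. z \<noteq> 0 \<and> (\<Sum>l\<in>D. c l * z powi d l) = 0} \<subseteq> {z. poly P z = 0}"
  proof safe
    fix z :: complex assume z: "z \<noteq> 0" and 0: "(\<Sum>l\<in>D. c l * z powi d l) = 0"
    have "poly P z * z powi B = (\<Sum>l\<in>D. c l * z powi d l)"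
      unfolding P_def poly_sum poly_monom sum_distrib_right
    proof (intro sum.cong refl)
      fix l assume "l \<in> D"
      then have "z ^ nat (d l - B) * z powi B = z powi d l"
        using z B[of l] by (subst power_int_of_nat[symmetric]) (simp flip: power_int_add)
      then show "c l * z ^ nat (d l - B) * z powi B = c l * z powi d l"
        by (simp only: mult.assoc)
    qed
    then show "poly P z = 0" using 0 z by simp
  qed
  ultimately show ?thesis by (rule_tac finite_subset[OF _ poly_roots_finite])
qed

section \<open>Affine roots and simple reflections in coordinates\<close>

lemma affvec_eqI: "(\<And>i. coef (fst f) i = coef (fst g) i) \<Longrightarrow> snd f = snd g \<Longrightarrow> f = (g :: affvec)"
  by (rule prod_eqI, rule poly_mapping_eqI)

lemma aff_scale_simps [simp]:
  "fst (aff_scale c f) = smul c (fst f)" "snd (aff_scale c f) = c * snd f"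
  by (simp_all add: aff_scale_def)

lemma aff_inner_superset:
  assumes "finite A" "supp (fst f) \<subseteq> A \<or> supp (fst g) \<subseteq> A"
  shows "aff_inner f g = (\<Sum>i\<in>A. coef (fst f) i * coef (fst g) i)"
proof (cases "supp (fst f) \<subseteq> A")
  case True
  then show ?thesis
    unfolding aff_inner_def using assms(1) by (intro sum.mono_neutral_left) (auto simp: in_keys_iff)
next
  case False
  then have g: "supp (fst g) \<subseteq> A" using assms(2) by auto
  have "aff_inner f g = (\<Sum>i\<in>supp (fst f) \<inter> A. coef (fst f) i * coef (fst g) i)"
    unfolding aff_inner_def using g by (intro sum.mono_neutral_right) (auto simp: in_keys_iff)
  also have "\<dots> = (\<Sum>i\<in>A. coef (fst f) i * coef (fst g) i)"
    using assms(1) by (intro sum.mono_neutral_left) (auto simp: in_keys_iff)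
  finally show ?thesis .
qed

text \<open>The linear part of the simple reflection \<open>s\<^sub>k\<close> is the signed permutation of the coordinates given
  by \<open>node_swap\<close> and \<open>flip_sign\<close> (see \<open>simple_refl_coords\<close>).\<close>

definition node_swap :: "nat \<Rightarrow> nat \<Rightarrow> nat \<Rightarrow> nat"
  where "node_swap n k i = (if k = 0 \<or> k = n then i else if i = k then k + 1 else if i = k + 1 then k else i)"

definition flip_sign :: "nat \<Rightarrow> nat \<Rightarrow> nat \<Rightarrow> real"
  where "flip_sign n k i = (if k = 0 \<and> i = 1 \<or> k = n \<and> i = n then -1 else 1)"

lemma node_swap_invol [simp]: "node_swap n k (node_swap n k i) = i"
  by (simp add: node_swap_def)

lemma node_swap_in: "k \<le> n \<Longrightarrow> i \<in> {1..n} \<Longrightarrow> node_swap n k i \<in> {1..n}"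
  by (auto simp: node_swap_def)

lemma node_swap_in_iff: "k \<le> n \<Longrightarrow> node_swap n k i \<in> {1..n} \<longleftrightarrow> i \<in> {1..n}"
  by (metis node_swap_in node_swap_invol)

lemma bij_node_swap: "k \<le> n \<Longrightarrow> bij_betw (node_swap n k) {1..n} {1..n}"
  by (rule bij_betw_byWitness[where f' = "node_swap n k"]) (auto dest: node_swap_in[of k n])

lemma abs_flip_sign [simp]: "\<bar>flip_sign n k i\<bar> = 1" "flip_sign n k i * flip_sign n k i = 1"
  "flip_sign n k i \<noteq> 0" "flip_sign n k i \<in> \<int>"
  by (auto simp: flip_sign_def)

lemma flip_sign_node_swap: "flip_sign n k (node_swap n k i) = flip_sign n k i"
  by (auto simp: flip_sign_def node_swap_def)

lemma aff_inner_coroot: "aff_inner f (coroot g) = 2 / aff_inner g g * aff_inner f g"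
proof -
  let ?A = "supp (fst f) \<union> supp (fst g)"
  have "aff_inner f (coroot g) = (\<Sum>i\<in>?A. coef (fst f) i * coef (fst (coroot g)) i)"
    by (rule aff_inner_superset) auto
  moreover have "aff_inner f g = (\<Sum>i\<in>?A. coef (fst f) i * coef (fst g) i)"
    by (rule aff_inner_superset) auto
  ultimately show ?thesis
    by (simp add: coroot_def mult.left_commute[of _ "2 / aff_inner g g"] del: times_divide_eq_left flip: sum_distrib_left)
qed

lemma supp_simple_root:
  "supp (fst (simple_root n k)) \<subseteq> (if k = 0 then {1} else if k = n then {n} else {k, k + 1})"
  by (auto simp: simple_root_def in_keys_iff coef_eps lookup_minus split: if_splits)

lemma aff_inner_self_simple:
  assumes "2 \<le> n" "k \<le> n"
  shows "aff_inner f (coroot (simple_root n k))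
    = (if k = 0 then - coef (fst f) 1 else if k = n then coef (fst f) n
       else coef (fst f) k - coef (fst f) (k + 1))"
proof -
  let ?a = "simple_root n k"
  consider "k = 0" | "k = n" "k \<noteq> 0" | "k \<noteq> 0" "k \<noteq> n" by blast
  then show ?thesis
  proof cases
    case 1
    have "aff_inner g ?a = - 2 * coef (fst g) 1" for g
      using supp_simple_root[of n k] 1
      by (subst aff_inner_superset[of "{1}"]) (simp_all add: simple_root_def coef_eps)
    from this[of f] this[of ?a] show ?thesis
      using 1 by (simp add: aff_inner_coroot simple_root_def coef_eps)
  next
    case 2
    have "aff_inner g ?a = 2 * coef (fst g) n" for g
      using supp_simple_root[of n k] 2
      by (subst aff_inner_superset[of "{n}"]) (simp_all add: simple_root_def coef_eps)
    from this[of f] this[of ?a] show ?thesis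
      using 2 by (simp add: aff_inner_coroot simple_root_def coef_eps)
  next
    case 3
    have "aff_inner g ?a = coef (fst g) k - coef (fst g) (k + 1)" for g
      using supp_simple_root[of n k] 3
      by (subst aff_inner_superset[of "{k, k + 1}"]) (simp_all add: simple_root_def coef_eps lookup_minus)
    from this[of f] this[of ?a] show ?thesis
      using 3 by (simp add: aff_inner_coroot simple_root_def coef_eps lookup_minus)
  qed
qed

lemma simple_refl_coords:
  assumes "2 \<le> n" "k \<le> n"
  shows "coef (fst (simple_refl n k f)) i = flip_sign n k i * coef (fst f) (node_swap n k i)"
    and "snd (simple_refl n k f) = snd f + (if k = 0 then coef (fst f) 1 else 0)"
proof -
  show "coef (fst (simple_refl n k f)) i = flip_sign n k i * coef (fst f) (node_swap n k i)"
    using assms unfolding simple_refl_def aff_reflection_def aff_inner_self_simple[OF assms]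
    by (auto simp: lookup_minus simple_root_def coef_eps flip_sign_def node_swap_def)
  show "snd (simple_refl n k f) = snd f + (if k = 0 then coef (fst f) 1 else 0)"
    using assms unfolding simple_refl_def aff_reflection_def aff_inner_self_simple[OF assms]
    by (auto simp: simple_root_def)
qed

definition l1 :: "nat \<Rightarrow> vec \<Rightarrow> real"
  where "l1 n v = (\<Sum>i = 1..n. \<bar>coef v i\<bar>)"

lemma l1_uminus: "l1 n (- v) = l1 n v"
  by (simp add: l1_def)

lemma l1_eps: "i \<in> {1..n} \<Longrightarrow> l1 n (eps i) = 1"
proof -
  assume i: "i \<in> {1..n}"
  have "l1 n (eps i) = (\<Sum>k = 1..n. if k = i then 1 else 0)"
    unfolding l1_def by (intro sum.cong) (auto simp: coef_eps)
  then show "l1 n (eps i) = 1" using i by simp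
qed

text \<open>In the lattice \<open>\<int>\<^sup>n\<close> the roots of type \<open>C\<close> are the vectors of \<open>l\<^sup>1\<close>-norm \<open>2\<close>, a description that is
  visibly invariant under signed permutations; the positive roots are those whose first nonzero
  coordinate is positive (\<open>pos_roots_eq\<close>).\<close>

definition roots :: "nat \<Rightarrow> vec set"
  where "roots n = {v \<in> lattice n. l1 n v = 2}"

definition lex_pos :: "vec \<Rightarrow> bool"
  where "lex_pos v \<longleftrightarrow> (\<exists>i. 0 < coef v i \<and> (\<forall>j<i. coef v j = 0))"

definition aff_root :: "nat \<Rightarrow> affvec \<Rightarrow> bool"
  where "aff_root n b \<longleftrightarrow> fst b \<in> roots n \<and> snd b \<in> \<int>"

text \<open>The positive system of affine roots whose simple roots are \<open>a\<^sub>0, \<dots>, a\<^sub>n\<close>.\<close>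

definition aff_pos :: "nat \<Rightarrow> affvec \<Rightarrow> bool"
  where "aff_pos n b \<longleftrightarrow> aff_root n b \<and> (0 < snd b \<or> snd b = 0 \<and> lex_pos (fst b))"

lemma sum_two:
  fixes f :: "nat \<Rightarrow> real"
  assumes "i \<noteq> j" "\<And>k. k \<noteq> i \<Longrightarrow> k \<noteq> j \<Longrightarrow> f k = 0" "finite A" "i \<in> A" "j \<in> A"
  shows "sum f A = f i + f j"
proof -
  have "sum f A = sum f {i, j}"
    using assms by (intro sum.mono_neutral_right) auto
  then show ?thesis using assms(1) by simp
qed

text \<open>The coordinates are integers, so the norm \<open>2\<close> is attained either as \<open>2\<close> or as \<open>1 + 1\<close>.\<close>

lemma roots_cases:
  assumes "v \<in> roots n"
  obtains (long) i s where "i \<in> {1..n}" "s = 1 \<or> s = -1" "v = smul (2 * s) (eps i)"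
  | (short) i j s t where "1 \<le> i" "i < j" "j \<le> n" "s = 1 \<or> s = -1" "t = 1 \<or> t = -1"
      "v = smul s (eps i) + smul t (eps j)"
proof -
  have v: "v \<in> lattice n" "l1 n v = 2" using assms by (auto simp: roots_def)
  have int: "\<exists>k. coef v i = of_int k" for i
    using lattice_Ints[OF v(1), of i] by (auto elim: Ints_cases)
  have "\<exists>i\<in>{1..n}. coef v i \<noteq> 0"
  proof (rule ccontr)
    assume "\<not> ?thesis"
    then have "l1 n v = 0" by (simp add: l1_def)
    then show False using v(2) by simp
  qed
  then obtain i where i: "i \<in> {1..n}" "coef v i \<noteq> 0" by blast
  have i1: "1 \<le> \<bar>coef v i\<bar>" using int[of i] i(2) by auto
  have split_i: "\<bar>coef v i\<bar> + (\<Sum>k\<in>{1..n} - {i}. \<bar>coef v k\<bar>) = 2"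
    using v(2) sum.remove[of "{1..n}" i "\<lambda>k. \<bar>coef v k\<bar>"] i(1) by (simp only: l1_def finite_atLeastAtMost)
  show ?thesis
  proof (cases "\<exists>j\<in>{1..n} - {i}. coef v j \<noteq> 0")
    case True
    then obtain j where j: "j \<in> {1..n} - {i}" "coef v j \<noteq> 0" by blast
    have j1: "1 \<le> \<bar>coef v j\<bar>" using int[of j] j(2) by auto
    have split_j: "\<bar>coef v i\<bar> + (\<bar>coef v j\<bar> + (\<Sum>k\<in>{1..n} - {i} - {j}. \<bar>coef v k\<bar>)) = 2"
      using split_i sum.remove[of "{1..n} - {i}" j "\<lambda>k. \<bar>coef v k\<bar>"] j(1)
      by (simp only: finite_Diff finite_atLeastAtMost)
    have ge: "0 \<le> (\<Sum>k\<in>{1..n} - {i} - {j}. \<bar>coef v k\<bar>)" by (simp add: sum_nonneg)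
    have abs: "\<bar>coef v i\<bar> = 1" "\<bar>coef v j\<bar> = 1" "(\<Sum>k\<in>{1..n} - {i} - {j}. \<bar>coef v k\<bar>) = 0"
      using i1 j1 split_j ge by linarith+
    then have zero: "\<forall>k\<in>{1..n} - {i} - {j}. coef v k = 0"
      using sum_nonneg_eq_0_iff[of "{1..n} - {i} - {j}" "\<lambda>k. \<bar>coef v k\<bar>"] by simp
    have eq: "v = smul (coef v i) (eps i) + smul (coef v j) (eps j)"
      using i(1) j(1) zero
      by (intro lattice_eqI[of _ n] lattice_simps lattice_smul lattice_Ints[OF v(1)] v(1))
        (auto simp: lookup_add coef_eps)
    consider "i < j" | "j < i" using j(1) by fastforce
    then show ?thesis
    proof cases
      case 1
      then show ?thesis using i j abs eq by (intro short[of i j "coef v i" "coef v j"]) auto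
    next
      case 2
      then show ?thesis using i j abs eq
        by (intro short[of j i "coef v j" "coef v i"]) (auto simp: add.commute)
    qed
  next
    case False
    then have "(\<Sum>k\<in>{1..n} - {i}. \<bar>coef v k\<bar>) = 0" by simp
    then have "\<bar>coef v i\<bar> = 2" using split_i by simp
    moreover have "v = smul (coef v i) (eps i)"
      using i(1) False
      by (intro lattice_eqI[of _ n] lattice_simps lattice_smul lattice_Ints[OF v(1)] v(1))
        (auto simp: lookup_add coef_eps)
    ultimately show ?thesis using i(1) by (intro long[of i "coef v i / 2"]) auto
  qed
qed

lemma roots_longI: "i \<in> {1..n} \<Longrightarrow> s = 1 \<or> s = -1 \<Longrightarrow> smul (2 * s) (eps i) \<in> roots n"
proof -
  assume i: "i \<in> {1..n}" and s: "s = 1 \<or> s = -1"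
  have "l1 n (smul (2 * s) (eps i)) = (\<Sum>k = 1..n. if k = i then 2 else 0)"
    unfolding l1_def using s by (intro sum.cong) (auto simp: coef_eps)
  then show ?thesis using i s by (auto simp: roots_def intro!: lattice_smul)
qed

lemma roots_shortI:
  assumes "1 \<le> i" "i < j" "j \<le> n" "s = 1 \<or> s = -1" "t = 1 \<or> t = -1"
  shows "smul s (eps i) + smul t (eps j) \<in> roots n"
proof -
  have "l1 n (smul s (eps i) + smul t (eps j))
      = \<bar>coef (smul s (eps i) + smul t (eps j)) i\<bar> + \<bar>coef (smul s (eps i) + smul t (eps j)) j\<bar>"
    unfolding l1_def using assms by (intro sum_two) (auto simp: coef_eps lookup_add)
  then show ?thesis using assms
    by (auto simp: roots_def coef_eps lookup_add intro!: lattice_smul lattice_simps)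
qed

lemma pos_roots_eq: "pos_roots n = {v \<in> roots n. lex_pos v}"
proof (rule set_eqI, rule iffI)
  fix v assume "v \<in> pos_roots n"
  then consider (1) i where "1 \<le> i" "i \<le> n" "v = smul 2 (eps i)"
    | (2) i j where "1 \<le> i" "i < j" "j \<le> n" "v = eps i + eps j"
    | (3) i j where "1 \<le> i" "i < j" "j \<le> n" "v = eps i - eps j"
    unfolding pos_roots_def by blast
  then show "v \<in> {v \<in> roots n. lex_pos v}"
  proof cases
    case 1
    then show ?thesis using roots_longI[of i n 1]
      by (auto simp: lex_pos_def coef_eps intro!: exI[of _ i])
  next
    case 2
    then show ?thesis using roots_shortI[of i j n 1 1]
      by (auto simp: lex_pos_def coef_eps lookup_add intro!: exI[of _ i])
  next
    case 3
    then show ?thesis using roots_shortI[of i j n 1 "-1"]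
      by (auto simp: lex_pos_def coef_eps lookup_minus intro!: exI[of _ i])
  qed
next
  fix v assume v: "v \<in> {v \<in> roots n. lex_pos v}"
  then obtain k where k: "0 < coef v k" "\<And>j. j < k \<Longrightarrow> coef v j = 0" by (auto simp: lex_pos_def)
  from v have "v \<in> roots n" by simp
  then show "v \<in> pos_roots n"
  proof (cases rule: roots_cases)
    case (long i s)
    then have "s = 1" using k(1) by (auto simp: coef_eps split: if_splits)
    then show ?thesis using long by (auto simp: pos_roots_def)
  next
    case (short i j s t)
    have "k = i" using k(1) k(2)[of i] short by (cases "k = j") (auto simp: coef_eps lookup_add split: if_splits)
    then have "s = 1" using k(1) short by (auto simp: coef_eps lookup_add)
    then show ?thesis using short by (auto simp: pos_roots_def)
  qed
qed

lemma lex_pos_uminus: "v \<in> roots n \<Longrightarrow> lex_pos (- v) \<longleftrightarrow> \<not> lex_pos v"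
proof -
  assume v: "v \<in> roots n"
  have "\<exists>i. coef v i \<noteq> 0"
    using v by (rule roots_cases) (auto simp: coef_eps lookup_add)
  then obtain i where i: "coef v i \<noteq> 0" "\<And>j. j < i \<Longrightarrow> coef v j = 0"
    using exists_least_iff[of "\<lambda>i. coef v i \<noteq> 0"] by auto
  have "lex_pos v \<longleftrightarrow> 0 < coef v i"
    unfolding lex_pos_def using i by (metis less_irrefl linorder_neqE_nat)
  moreover have "lex_pos (- v) \<longleftrightarrow> coef v i < 0"
    unfolding lex_pos_def using i by simp (metis less_irrefl linorder_neqE_nat)
  ultimately show ?thesis using i by linarith
qed

lemma roots_uminus: "v \<in> roots n \<Longrightarrow> - v \<in> roots n"
  by (auto simp: roots_def l1_def)

lemma roots_nonzero: "v \<in> roots n \<Longrightarrow> v \<noteq> 0"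
  by (auto simp: roots_def l1_def)

lemma finite_lattice_box: "finite {l \<in> lattice n. \<forall>i\<in>{1..n}. \<bar>coef l i\<bar> \<le> c}"
proof -
  let ?S = "{l \<in> lattice n. \<forall>i\<in>{1..n}. \<bar>coef l i\<bar> \<le> c}"
  let ?r = "\<lambda>l. \<lambda>i\<in>{1..n}. \<lfloor>coef l i\<rfloor>"
  have "?r ` ?S \<subseteq> ({1..n} \<rightarrow>\<^sub>E {-\<lceil>c\<rceil>..\<lceil>c\<rceil>})"
  proof (rule image_subsetI, rule restrict_PiE_iff[THEN iffD2], rule ballI)
    fix l i assume "l \<in> ?S" "i \<in> {1..n}"
    then have "\<bar>coef l i\<bar> \<le> c" by blast
    then have "- c \<le> coef l i" "coef l i \<le> c" by linarith+
    then show "\<lfloor>coef l i\<rfloor> \<in> {-\<lceil>c\<rceil>..\<lceil>c\<rceil>}"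
      using floor_mono[of "- c" "coef l i"] by (simp add: floor_minus) linarith
  qed
  then have "finite (?r ` ?S)" by (rule finite_subset) (intro finite_PiE, auto)
  moreover have "inj_on ?r ?S"
  proof (rule inj_onI)
    fix l m assume lm: "l \<in> ?S" "m \<in> ?S" "?r l = ?r m"
    then have lat: "l \<in> lattice n" "m \<in> lattice n" by auto
    show "l = m"
    proof (rule lattice_eqI[OF lat])
      fix i assume "i \<in> {1..n}"
      then have "\<lfloor>coef l i\<rfloor> = \<lfloor>coef m i\<rfloor>" using fun_cong[OF lm(3), of i] by simp
      then show "coef l i = coef m i" using lattice_floor[OF lat(1)] lattice_floor[OF lat(2)] by metis
    qed
  qed
  ultimately show ?thesis by (rule finite_imageD)
qed

lemma finite_roots: "finite (roots n)"
proof (rule finite_subset[OF _ finite_lattice_box[of n 2]])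
  show "roots n \<subseteq> {l \<in> lattice n. \<forall>i\<in>{1..n}. \<bar>coef l i\<bar> \<le> 2}"
    unfolding roots_def l1_def by (auto intro: order_trans[OF member_le_sum[of _ "{1..n}"]])
qed

section \<open>Simple reflections as isometries\<close>

lemma sum_node_swap: "k \<le> n \<Longrightarrow> (\<Sum>i = 1..n. F (node_swap n k i)) = (\<Sum>i = 1..n. F i)"
  by (rule sum.reindex_bij_betw[OF bij_node_swap])

lemma latticeI:
  assumes "\<And>i. i \<notin> {1..n} \<Longrightarrow> coef l i = 0" "\<And>i. coef l i \<in> \<int>"
  shows "l \<in> lattice n"
proof -
  have "supp l \<subseteq> {1..n}"
  proof
    fix i assume "i \<in> supp l"
    then have "coef l i \<noteq> 0" by (simp add: in_keys_iff)
    then show "i \<in> {1..n}" using assms(1) by blast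
  qed
  then show ?thesis using assms(2) by (simp add: lattice_def)
qed

definition aff_lattice :: "nat \<Rightarrow> affvec set"
  where "aff_lattice n = {f. fst f \<in> lattice n \<and> snd f \<in> \<int>}"

locale rank =
  fixes n :: nat
  assumes n2: "2 \<le> n"
begin

abbreviation s :: "nat \<Rightarrow> affvec \<Rightarrow> affvec"
  where "s \<equiv> simple_refl n"

lemmas coords = simple_refl_coords[OF n2]

lemma s_add: "k \<le> n \<Longrightarrow> s k (f + g) = s k f + s k g"
  by (intro affvec_eqI) (auto simp: coords lookup_add algebra_simps)

lemma s_scale: "k \<le> n \<Longrightarrow> s k (aff_scale c f) = aff_scale c (s k f)"
  by (intro affvec_eqI) (auto simp: coords algebra_simps)

lemma s_uminus: "k \<le> n \<Longrightarrow> s k (- f) = - s k f"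
  by (intro affvec_eqI) (auto simp: coords algebra_simps)

lemma s_diff: "k \<le> n \<Longrightarrow> s k (f - g) = s k f - s k g"
  using s_add[of k f "- g"] s_uminus[of k g] by simp

lemma s_delta: "k \<le> n \<Longrightarrow> s k (0, c) = (0, c)"
  by (intro affvec_eqI) (auto simp: coords)

lemma s_invol: "k \<le> n \<Longrightarrow> s k (s k f) = f"
proof (rule affvec_eqI)
  fix i assume k: "k \<le> n"
  show "coef (fst (s k (s k f))) i = coef (fst f) i"
    using abs_flip_sign(2)[of n k i] k by (simp add: coords flip_sign_node_swap mult.assoc[symmetric])
next
  assume k: "k \<le> n"
  show "snd (s k (s k f)) = snd f"
    using k n2 by (auto simp: coords flip_sign_def node_swap_def)
qed

lemma s_comp_invol: "k \<le> n \<Longrightarrow> s k \<circ> s k = id"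
  by (auto simp: s_invol)

lemma s_lattice: "k \<le> n \<Longrightarrow> fst f \<in> lattice n \<Longrightarrow> fst (s k f) \<in> lattice n"
proof -
  assume k: "k \<le> n" and f: "fst f \<in> lattice n"
  have "coef (fst (s k f)) i = 0" if "i \<notin> {1..n}" for i
  proof -
    have "node_swap n k i \<notin> {1..n}" using node_swap_in_iff[OF k] that by blast
    then show ?thesis using lattice_outside[OF f] k by (simp add: coords)
  qed
  moreover have "coef (fst (s k f)) i \<in> \<int>" for i
    using lattice_Ints[OF f] k by (simp add: coords)
  ultimately show ?thesis by (rule latticeI)
qed

lemma s_aff_lattice: "k \<le> n \<Longrightarrow> f \<in> aff_lattice n \<Longrightarrow> s k f \<in> aff_lattice n"
  using s_lattice[of k f] by (auto simp: aff_lattice_def coords lattice_Ints)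

lemma sum_abs_s:
  "k \<le> n \<Longrightarrow> (\<Sum>i = 1..n. F \<bar>coef (fst (s k f)) i\<bar>) = (\<Sum>i = 1..n. F \<bar>coef (fst f) i\<bar>)"
  using sum_node_swap[of k n "\<lambda>i. F \<bar>coef (fst f) i\<bar>"] by (simp add: coords abs_mult)

lemma l1_s: "k \<le> n \<Longrightarrow> l1 n (fst (s k f)) = l1 n (fst f)"
  using sum_abs_s[of k "\<lambda>x. x" f] by (simp add: l1_def)

lemma aff_root_s: "k \<le> n \<Longrightarrow> aff_root n f \<Longrightarrow> aff_root n (s k f)"
  using s_aff_lattice[of k f] by (auto simp: aff_root_def roots_def aff_lattice_def l1_s)

lemma fst_aff_inner: "supp (fst g) \<subseteq> {1..n} \<Longrightarrow> aff_inner f g = (\<Sum>i = 1..n. coef (fst f) i * coef (fst g) i)"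
  by (rule aff_inner_superset) auto

lemma aff_inner_s:
  assumes "k \<le> n" "fst g \<in> lattice n"
  shows "aff_inner (s k f) (s k g) = aff_inner f g"
proof -
  have "aff_inner (s k f) (s k g) = (\<Sum>i = 1..n. coef (fst (s k f)) i * coef (fst (s k g)) i)"
    using s_lattice[OF assms] by (intro fst_aff_inner) (auto simp: lattice_def)
  also have "\<dots> = (\<Sum>i = 1..n. coef (fst f) (node_swap n k i) * coef (fst g) (node_swap n k i))"
  proof (rule sum.cong[OF refl])
    fix i
    have "(a * b) * (a * c) = (a * a) * (b * c)" for a b c :: real by simp
    then show "coef (fst (s k f)) i * coef (fst (s k g)) i
        = coef (fst f) (node_swap n k i) * coef (fst g) (node_swap n k i)"
      using assms(1) by (simp add: coords)
  qed
  also have "\<dots> = (\<Sum>i = 1..n. coef (fst f) i * coef (fst g) i)"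
    by (rule sum_node_swap[OF assms(1)])
  also have "\<dots> = aff_inner f g"
    using assms(2) by (subst fst_aff_inner) (auto simp: lattice_def)
  finally show ?thesis .
qed

text \<open>The number \<open>\<langle>f, b\<^sup>\<or>\<rangle>\<close>, an integer for a root \<open>b\<close> and a lattice vector \<open>f\<close>.\<close>

definition pairing :: "affvec \<Rightarrow> affvec \<Rightarrow> real"
  where "pairing b f = aff_inner f (coroot b)"

lemma pairing_s: "k \<le> n \<Longrightarrow> fst b \<in> lattice n \<Longrightarrow> pairing (s k b) (s k f) = pairing b f"
  by (simp add: pairing_def aff_inner_coroot aff_inner_s)

lemma pairing_root:
  assumes "fst b = smul (2 * u) (eps i)" "u = 1 \<or> u = -1" "i \<in> {1..n}"
  shows "pairing b f = u * coef (fst f) i"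
proof -
  have "aff_inner g b = 2 * u * coef (fst g) i" for g
    using assms by (subst aff_inner_superset[of "{i}"]) (auto simp: coef_eps in_keys_iff)
  from this[of b] this[of f] show ?thesis
    using assms by (auto simp: pairing_def aff_inner_coroot coef_eps)
qed

lemma pairing_root_short:
  assumes "fst b = smul u (eps i) + smul v (eps j)" "u = 1 \<or> u = -1" "v = 1 \<or> v = -1" "i \<noteq> j"
  shows "pairing b f = u * coef (fst f) i + v * coef (fst f) j"
proof -
  have "aff_inner g b = u * coef (fst g) i + v * coef (fst g) j" for g
    using assms by (subst aff_inner_superset[of "{i, j}"]) (auto simp: coef_eps in_keys_iff lookup_add lookup_minus split: if_splits)
  from this[of b] this[of f] show ?thesis
    using assms by (auto simp: pairing_def aff_inner_coroot coef_eps lookup_add)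
qed

lemma pairing_Ints:
  assumes "fst b \<in> roots n" "fst f \<in> lattice n"
  shows "pairing b f \<in> \<int>"
  using assms(1)
proof (cases rule: roots_cases)
  case (long i u)
  then show ?thesis using pairing_root[of b u i f] lattice_Ints[OF assms(2)] by auto
next
  case (short i j u v)
  then show ?thesis using pairing_root_short[of b u i v j f] lattice_Ints[OF assms(2)] by auto
qed

lemma pairing_self: "fst b \<in> roots n \<Longrightarrow> pairing b b = 2"
proof (erule roots_cases)
  fix i u assume "i \<in> {1..n}" "u = 1 \<or> u = - 1" "fst b = smul (2 * u) (eps i)"
  then show ?thesis using pairing_root[of b u i b] by (auto simp: coef_eps)
next
  fix i j u v assume "1 \<le> i" "i < j" "j \<le> n" "u = 1 \<or> u = -1" "v = 1 \<or> v = -1"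
    "fst b = smul u (eps i) + smul v (eps j)"
  then show ?thesis using pairing_root_short[of b u i v j b] by (auto simp: coef_eps lookup_add)
qed

lemma simple_root_root: "k \<le> n \<Longrightarrow> aff_root n (simple_root n k)"
  using n2 roots_longI[of 1 n "-1"] roots_longI[of n n 1] roots_shortI[of k "k + 1" n 1 "-1"]
  by (auto simp: aff_root_def simple_root_def)

lemma s_eq: "k \<le> n \<Longrightarrow> s k f = f - aff_scale (pairing (simple_root n k) f) (simple_root n k)"
  by (simp add: simple_refl_def aff_reflection_def pairing_def)

lemma pairing_simple: "k \<le> n \<Longrightarrow> pairing (simple_root n k) f
    = (if k = 0 then - coef (fst f) 1 else if k = n then coef (fst f) n
       else coef (fst f) k - coef (fst f) (k + 1))"
  using aff_inner_self_simple[OF n2] by (simp add: pairing_def)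

lemma s_simple_root: "k \<le> n \<Longrightarrow> s k (simple_root n k) = - simple_root n k"
  using pairing_self[of "simple_root n k"] simple_root_root[of k]
  by (intro affvec_eqI) (auto simp: s_eq aff_root_def lookup_minus)

section \<open>The multiplicity function\<close>

definition long :: "vec \<Rightarrow> bool"
  where "long v \<longleftrightarrow> (\<exists>i. \<bar>coef v i\<bar> = 2)"

text \<open>Norm and length of a vector are invariants of signed permutations; in these terms the
  multiplicity function only depends on invariants and on the parity of the coefficient of \<open>\<delta>\<close>.\<close>

lemma mult_par_alt:
  "mult_par n p f =
     (if snd f \<in> \<int> \<and> fst f \<in> roots n \<and> \<not> long (fst f) then par_t p
      else if snd f \<in> \<int> \<and> fst f \<in> roots n \<and> long (fst f)
        then (if odd \<lfloor>snd f\<rfloor> then par_t0 p else par_tn p)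
      else if 2 * snd f \<in> \<int> \<and> fst f \<in> lattice n \<and> l1 n (fst f) = 1
        then (if odd \<lfloor>2 * snd f\<rfloor> then par_t0v p else par_tnv p)
      else 1)"
proof -
  let ?v = "fst f"
  have 1: "(\<exists>i j. 1 \<le> i \<and> i < j \<and> j \<le> n \<and>
      ?v \<in> {eps i + eps j, eps i - eps j, - eps i + eps j, - eps i - eps j})
    \<longleftrightarrow> ?v \<in> roots n \<and> \<not> long ?v"
  proof
    assume "\<exists>i j. 1 \<le> i \<and> i < j \<and> j \<le> n \<and>
      ?v \<in> {eps i + eps j, eps i - eps j, - eps i + eps j, - eps i - eps j}"
    then obtain i j where ij: "1 \<le> i" "i < j" "j \<le> n"
      "?v \<in> {eps i + eps j, eps i - eps j, - eps i + eps j, - eps i - eps j}" by blast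
    then obtain u w :: real where "u = 1 \<or> u = -1" "w = 1 \<or> w = -1" "?v = smul u (eps i) + smul w (eps j)"
      by (elim insertE) (force intro: that)+
    then show "?v \<in> roots n \<and> \<not> long ?v"
      using ij roots_shortI[of i j n u w] by (auto simp: long_def coef_eps lookup_add)
  next
    assume "?v \<in> roots n \<and> \<not> long ?v"
    then have v: "?v \<in> roots n" "\<not> long ?v" by auto
    from v(1) show "\<exists>i j. 1 \<le> i \<and> i < j \<and> j \<le> n \<and>
      ?v \<in> {eps i + eps j, eps i - eps j, - eps i + eps j, - eps i - eps j}"
    proof (cases rule: roots_cases)
      case (long i u)
      then show ?thesis using v(2) by (auto simp: long_def coef_eps dest!: spec[of _ i])
    next
      case (short i j u w)
      then show ?thesis by (intro exI[of _ i] exI[of _ j]) auto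
    qed
  qed
  have 2: "(\<exists>i\<in>{1..n}. ?v \<in> {smul 2 (eps i), - smul 2 (eps i)}) \<longleftrightarrow> ?v \<in> roots n \<and> long ?v"
  proof
    assume "\<exists>i\<in>{1..n}. ?v \<in> {smul 2 (eps i), - smul 2 (eps i)}"
    then obtain i where i: "i \<in> {1..n}" "?v = smul 2 (eps i) \<or> ?v = - smul 2 (eps i)" by blast
    then have "long ?v" by (auto simp: long_def coef_eps intro!: exI[of _ i])
    moreover have "?v \<in> roots n"
      using i roots_longI[OF i(1), of 1] roots_longI[OF i(1), of "-1"] by auto
    ultimately show "?v \<in> roots n \<and> long ?v" by simp
  next
    assume "?v \<in> roots n \<and> long ?v"
    then have v: "?v \<in> roots n" "long ?v" by auto
    from v(1) show "\<exists>i\<in>{1..n}. ?v \<in> {smul 2 (eps i), - smul 2 (eps i)}"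
    proof (cases rule: roots_cases)
      case (long i u)
      then show ?thesis by (intro bexI[of _ i]) auto
    next
      case (short i j u w)
      then show ?thesis using v(2) by (auto simp: long_def coef_eps lookup_add split: if_splits)
    qed
  qed
  have 3: "(\<exists>i\<in>{1..n}. ?v \<in> {eps i, - eps i}) \<longleftrightarrow> ?v \<in> lattice n \<and> l1 n ?v = 1"
  proof
    assume "\<exists>i\<in>{1..n}. ?v \<in> {eps i, - eps i}"
    then obtain i where i: "i \<in> {1..n}" "?v = eps i \<or> ?v = - eps i" by blast
    then have "l1 n ?v = (\<Sum>k = 1..n. if k = i then 1 else 0)"
      unfolding l1_def by (intro sum.cong) (auto simp: coef_eps)
    then show "?v \<in> lattice n \<and> l1 n ?v = 1" using i by auto
  next
    assume v: "?v \<in> lattice n \<and> l1 n ?v = 1"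
    then have "smul 2 ?v \<in> roots n"
      by (auto simp: roots_def lattice_smul l1_def abs_mult simp flip: sum_distrib_left)
    then show "\<exists>i\<in>{1..n}. ?v \<in> {eps i, - eps i}"
    proof (cases rule: roots_cases)
      case (long i u)
      have "smul (1 / 2) (smul 2 ?v) = smul (1 / 2) (smul (2 * u) (eps i))" using long by simp
      then have "?v = smul u (eps i)" by simp
      then show ?thesis using long by auto
    next
      case (short i j u w)
      then have "2 * coef ?v i = u" by (metis coef_smul coef_eps lookup_add add.right_neutral less_irrefl mult.right_neutral mult_zero_right)
      moreover obtain k where "coef ?v i = of_int k" using lattice_Ints[of ?v n i] v by (auto elim: Ints_cases)
      ultimately have "of_int (2 * k) = u" by simp
      then have "2 * k = 1 \<or> 2 * k = -1" using short(4) by (metis of_int_1 of_int_eq_iff of_int_minus)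
      then have False by presburger
      then show ?thesis ..
    qed
  qed
  show ?thesis unfolding mult_par_def Let_def 1 2 3 by auto
qed

lemma long_s: "k \<le> n \<Longrightarrow> long (fst (s k f)) \<longleftrightarrow> long (fst f)"
  unfolding long_def by (metis abs_flip_sign(1) abs_mult coords(1) mult_1 node_swap_invol)

lemma long_root_even:
  assumes "v \<in> roots n" "long v"
  obtains k where "coef v i = 2 * of_int k"
  using assms(1)
proof (cases rule: roots_cases)
  case (long j u)
  then show ?thesis using that[of "if i = j then (if u = 1 then 1 else -1) else 0"] by (auto simp: coef_eps)
next
  case (short i j u w)
  then show ?thesis using assms(2) by (auto simp: long_def coef_eps lookup_add split: if_splits)
qed

text \<open>Only \<open>s\<^sub>0\<close> changes the coefficient of \<open>\<delta>\<close>, by the first coordinate.  That coordinate is even for a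
  long root and integral for half a long root, so the relevant parities are preserved.\<close>

lemma mult_par_s: "k \<le> n \<Longrightarrow> mult_par n p (s k f) = mult_par n p f"
proof -
  assume k: "k \<le> n"
  have lat: "fst (s k f) \<in> lattice n \<longleftrightarrow> fst f \<in> lattice n"
    using s_lattice[OF k, of f] s_lattice[OF k, of "s k f"] s_invol[OF k] by metis
  then have rt: "fst (s k f) \<in> roots n \<longleftrightarrow> fst f \<in> roots n"
    by (simp add: roots_def l1_s[OF k])
  have int: "snd (s k f) \<in> \<int> \<longleftrightarrow> snd f \<in> \<int>" "2 * snd (s k f) \<in> \<int> \<longleftrightarrow> 2 * snd f \<in> \<int>"
    "odd \<lfloor>2 * snd (s k f)\<rfloor> \<longleftrightarrow> odd \<lfloor>2 * snd f\<rfloor>" if l: "fst f \<in> lattice n"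
  proof -
    obtain z where z: "coef (fst f) 1 = of_int z" using lattice_Ints[OF l, of 1] by (auto elim: Ints_cases)
    then have sn: "snd (s k f) = snd f + of_int (if k = 0 then z else 0)" by (simp add: coords[OF k])
    show "snd (s k f) \<in> \<int> \<longleftrightarrow> snd f \<in> \<int>"
      unfolding sn by (metis Ints_add Ints_diff Ints_of_int add_diff_cancel_right')
    have 2: "2 * snd (s k f) = 2 * snd f + of_int (2 * (if k = 0 then z else 0))" unfolding sn by simp
    show "2 * snd (s k f) \<in> \<int> \<longleftrightarrow> 2 * snd f \<in> \<int>"
      unfolding 2 by (metis Ints_add Ints_diff Ints_of_int add_diff_cancel_right')
    show "odd \<lfloor>2 * snd (s k f)\<rfloor> \<longleftrightarrow> odd \<lfloor>2 * snd f\<rfloor>" unfolding 2 floor_add_int[symmetric] by simp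
  qed
  have par: "odd \<lfloor>snd (s k f)\<rfloor> \<longleftrightarrow> odd \<lfloor>snd f\<rfloor>" if l: "fst f \<in> roots n" "long (fst f)"
  proof -
    obtain z where z: "coef (fst f) 1 = 2 * of_int z" using long_root_even[OF l] by blast
    then have sn: "snd (s k f) = snd f + of_int (2 * (if k = 0 then z else 0))" by (simp add: coords[OF k])
    show ?thesis unfolding sn floor_add_int[symmetric] by simp
  qed
  show ?thesis
    unfolding mult_par_alt long_s[OF k] l1_s[OF k] lat rt
    using int par by (auto simp: roots_def)
qed

text \<open>Half of a short root has a half-integral coordinate, hence the trivial parameter.\<close>

lemma mult_par_half_short:
  assumes "fst b \<in> roots n" "\<not> long (fst b)"
  shows "mult_par n p (aff_scale (1/2) b) = 1"
  using assms(1)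
proof (cases rule: roots_cases)
  case (long i u)
  then show ?thesis using assms(2) by (auto simp: long_def coef_eps dest!: spec[of _ i])
next
  case (short i j u v)
  have "coef (smul (1/2) (fst b)) i \<notin> \<int>"
  proof
    assume "coef (smul (1/2) (fst b)) i \<in> \<int>"
    then obtain k where "coef (smul (1/2) (fst b)) i = of_int k" by (auto elim: Ints_cases)
    then have "u = of_int (2 * k)" using short by (simp add: lookup_add coef_eps)
    then have "2 * k = 1 \<or> 2 * k = -1" using short(4) by (metis of_int_1 of_int_eq_iff of_int_minus)
    then show False by presburger
  qed
  then have "smul (1/2) (fst b) \<notin> lattice n" by (auto simp: lattice_def)
  then show ?thesis by (simp add: mult_par_alt roots_def)
qed

lemma half_long_lattice:
  assumes "fst b \<in> roots n" "long (fst b)"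
  shows "smul (1/2) (fst b) \<in> lattice n"
  using assms(1)
proof (cases rule: roots_cases)
  case (long i u)
  then show ?thesis by (auto intro!: lattice_smul)
next
  case (short i j u w)
  then show ?thesis using assms(2) by (auto simp: long_def coef_eps lookup_add split: if_splits)
qed

end

section \<open>The multiplicative action on monomials and on points\<close>

locale koorn = rank n for n :: nat +
  fixes p :: koornwinder_pars
  assumes q_half_nz: "q_half p \<noteq> 0"
    and pars_nz: "par_t0 p \<noteq> 0" "par_t p \<noteq> 0" "par_tn p \<noteq> 0" "par_t0v p \<noteq> 0" "par_tnv p \<noteq> 0"
begin

lemma q_pow_add: "2 * a \<in> \<int> \<Longrightarrow> 2 * b \<in> \<int> \<Longrightarrow> q_pow p (a + b) = q_pow p a * q_pow p b"
proof (elim Ints_cases)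
  fix y z assume yz: "2 * a = of_int y" "2 * b = of_int z"
  then have "2 * (a + b) = of_int (y + z)" by simp
  then have "\<lfloor>2 * (a + b)\<rfloor> = y + z" by linarith
  then show ?thesis using yz by (simp add: q_pow_def q_half_nz power_int_add)
qed

lemma q_pow_zero [simp]: "q_pow p 0 = 1"
  by (simp add: q_pow_def)

lemma q_pow_nz: "q_pow p a \<noteq> 0"
  by (simp add: q_pow_def q_half_nz)

lemma q_pow_int: "q_pow p (of_int k) = par_q p powi k"
proof -
  have "\<lfloor>2 * (of_int k :: real)\<rfloor> = 2 * k" by linarith
  then show ?thesis by (simp add: q_pow_def par_q_def power_int_mult)
qed

lemma q_pow_int_mult: "2 * a \<in> \<int> \<Longrightarrow> q_pow p (of_int k * a) = q_pow p a powi k"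
proof (elim Ints_cases)
  fix z assume z: "2 * a = of_int z"
  have "2 * (of_int k * a) = of_int (z * k)" using z by simp
  then have "\<lfloor>2 * (of_int k * a)\<rfloor> = z * k" by linarith
  then show ?thesis using z by (simp add: q_pow_def power_int_mult)
qed

text \<open>The value \<open>x\<^sup>f\<close> of the affine exponent \<open>f\<close> at a point \<open>x\<close>.\<close>

definition evp :: "(nat \<Rightarrow> complex) \<Rightarrow> affvec \<Rightarrow> complex"
  where "evp x f = q_pow p (snd f) * mon n x (fst f)"

definition nz_point :: "(nat \<Rightarrow> complex) \<Rightarrow> bool"
  where "nz_point x \<longleftrightarrow> (\<forall>i. x i \<noteq> 0)"

text \<open>The transformation of points dual to \<open>s\<^sub>k\<close>: evaluating \<open>x\<^bsup>s\<^sub>k f\<^esup>\<close> at a point amounts to evaluating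
  \<open>x\<^sup>f\<close> at the transformed point (\<open>evp_s\<close>).\<close>

definition ptrefl :: "nat \<Rightarrow> (nat \<Rightarrow> complex) \<Rightarrow> nat \<Rightarrow> complex"
  where "ptrefl k x i =
    (if k = 0 \<and> i = 1 then par_q p / x 1 else if k = n \<and> i = n then inverse (x n)
     else x (node_swap n k i))"

lemma nz_ptrefl: "nz_point x \<Longrightarrow> nz_point (ptrefl k x)"
  by (auto simp: nz_point_def ptrefl_def par_q_def q_half_nz)

lemma evp_nz: "nz_point x \<Longrightarrow> evp x f \<noteq> 0"
  by (simp add: evp_def q_pow_nz mon_nonzero nz_point_def)

lemma evp_add:
  assumes "fst f \<in> lattice n" "fst g \<in> lattice n" "2 * snd f \<in> \<int>" "2 * snd g \<in> \<int>" "nz_point x"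
  shows "evp x (f + g) = evp x f * evp x g"
  using assms by (simp add: evp_def q_pow_add mon_add nz_point_def)

lemma evp_scale_int:
  assumes "fst f \<in> lattice n" "2 * snd f \<in> \<int>" "nz_point x"
  shows "evp x (aff_scale (of_int k) f) = evp x f powi k"
  using assms by (simp add: evp_def q_pow_int_mult mon_smul_int nz_point_def power_int_mult_distrib)

lemma leval_xpow: "fst f \<in> lattice n \<Longrightarrow> leval (xpow p f) x = evp x f"
  by (simp add: xpow_def leval_single evp_def)

lemma evp_s:
  assumes k: "k \<le> n" and f: "fst f \<in> lattice n" "2 * snd f \<in> \<int>" and x: "nz_point x"
  shows "evp x (s k f) = evp (ptrefl k x) f"
proof -
  have int: "of_int \<lfloor>coef (fst f) i\<rfloor> = coef (fst f) i" for i
    by (rule lattice_floor[OF f(1)])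
  have nz: "x i \<noteq> 0" for i using x by (simp add: nz_point_def)
  consider "k = 0" | "k = n" "k \<noteq> 0" | "k \<noteq> 0" "k \<noteq> n" by blast
  then show ?thesis
  proof cases
    case 1
    have "mon n (ptrefl k x) (fst f) =
        (\<Prod>i = 1..n. (if i = 1 then par_q p powi \<lfloor>coef (fst f) 1\<rfloor> else 1) * x i powi \<lfloor>coef (fst (s k f)) i\<rfloor>)"
      unfolding mon_def
    proof (intro prod.cong refl)
      fix i
      have fl: "\<lfloor>- coef (fst f) 1\<rfloor> = - \<lfloor>coef (fst f) 1\<rfloor>"
        using int[of 1] by (metis floor_of_int of_int_minus)
      show "ptrefl k x i powi \<lfloor>coef (fst f) i\<rfloor>
        = (if i = 1 then par_q p powi \<lfloor>coef (fst f) 1\<rfloor> else 1) * x i powi \<lfloor>coef (fst (s k f)) i\<rfloor>"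
        using k 1 n2 fl
        by (auto simp: ptrefl_def coords flip_sign_def node_swap_def power_int_mult_distrib
            power_int_minus divide_inverse power_int_inverse)
    qed
    also have "\<dots> = par_q p powi \<lfloor>coef (fst f) 1\<rfloor> * mon n x (fst (s k f))"
      using n2 by (simp add: prod.distrib mon_def prod.delta)
    finally have "mon n (ptrefl k x) (fst f) = par_q p powi \<lfloor>coef (fst f) 1\<rfloor> * mon n x (fst (s k f))" .
    moreover have "q_pow p (snd (s k f)) = q_pow p (snd f) * par_q p powi \<lfloor>coef (fst f) 1\<rfloor>"
    proof -
      have "snd (s k f) = snd f + of_int \<lfloor>coef (fst f) 1\<rfloor>" using 1 k by (subst int) (simp add: coords)
      moreover have "2 * of_int \<lfloor>coef (fst f) 1\<rfloor> \<in> (\<int> :: real set)" by (metis Ints_mult Ints_numeral Ints_of_int)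
      ultimately show ?thesis using f(2) by (simp add: q_pow_add q_pow_int)
    qed
    ultimately show ?thesis by (simp add: evp_def)
  next
    case 2
    have "mon n (ptrefl k x) (fst f) = mon n x (fst (s k f))"
      unfolding mon_def
    proof (intro prod.cong refl)
      fix i
      have fl: "\<lfloor>- coef (fst f) n\<rfloor> = - \<lfloor>coef (fst f) n\<rfloor>"
        using int[of n] by (metis floor_of_int of_int_minus)
      show "ptrefl k x i powi \<lfloor>coef (fst f) i\<rfloor> = x i powi \<lfloor>coef (fst (s k f)) i\<rfloor>"
        using k 2 n2 fl
        by (auto simp: ptrefl_def coords flip_sign_def node_swap_def power_int_inverse
            power_int_minus)
    qed
    then show ?thesis using 2 k by (simp add: evp_def coords)
  next
    case 3
    have "mon n x (fst (s k f)) = (\<Prod>i = 1..n. x i powi \<lfloor>coef (fst f) (node_swap n k i)\<rfloor>)"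
      using 3 k by (simp add: mon_def coords flip_sign_def)
    also have "\<dots> = (\<Prod>i = 1..n. x (node_swap n k i) powi \<lfloor>coef (fst f) (node_swap n k (node_swap n k i))\<rfloor>)"
      by (rule prod.reindex_bij_betw[OF bij_node_swap[OF k], symmetric])
    also have "\<dots> = mon n (ptrefl k x) (fst f)"
      using 3 by (simp add: mon_def ptrefl_def)
    finally show ?thesis using 3 k by (simp add: evp_def coords)
  qed
qed

lemma act_lin: "act p w = lin (\<lambda>l. xpow p (w (l, 0)))"
  by (rule ext) (simp add: act_def lin_def)

lemma act_laurent: "k \<le> n \<Longrightarrow> f \<in> laurent n \<Longrightarrow> act p (s k) f \<in> laurent n"
  unfolding act_lin xpow_def using s_lattice[of k]
  by (intro laurent_lin laurent_single) (auto simp: laurent_def)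

lemma leval_act:
  assumes "k \<le> n" "f \<in> laurent n" "nz_point x"
  shows "leval (act p (s k) f) x = leval f (ptrefl k x)"
proof -
  have "leval (xpow p (s k (l, 0))) x = mon n (ptrefl k x) l" if "l \<in> supp f" for l
  proof -
    have "l \<in> lattice n" using that assms(2) by (auto simp: laurent_def)
    then show ?thesis
      using assms s_lattice[of k "(l, 0)"] by (simp add: leval_xpow evp_s) (simp add: evp_def)
  qed
  then show ?thesis
    by (simp add: act_lin leval_lin leval_laurent[OF assms(2)])
qed

lemma act_xpow:
  assumes "k \<le> n" "2 * snd f \<in> \<int>" "k = 0 \<Longrightarrow> 2 * coef (fst f) 1 \<in> \<int>"
  shows "act p (s k) (xpow p f) = xpow p (s k f)"
proof -
  have eq: "s k f = s k (fst f, 0) + (0, snd f)"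
    using s_add[OF assms(1), of "(fst f, 0)" "(0, snd f)"] s_delta[OF assms(1), of "snd f"] by simp
  have "2 * snd (s k (fst f, 0)) \<in> \<int>" using assms by (auto simp: coords)
  then have "q_pow p (snd (s k f)) = q_pow p (snd (s k (fst f, 0))) * q_pow p (snd f)"
    using assms(2) by (subst eq) (simp add: q_pow_add)
  moreover have "fst (s k f) = fst (s k (fst f, 0))" by (subst eq) simp
  ultimately show ?thesis
    by (simp add: act_lin xpow_def lin_single mult.commute)
qed

text \<open>At a regular point no denominator of a Hecke operator vanishes.\<close>

definition regular :: "(nat \<Rightarrow> complex) \<Rightarrow> bool"
  where "regular x \<longleftrightarrow> nz_point x \<and> (\<forall>b. aff_root n b \<longrightarrow> evp x b \<noteq> 1)"

lemma regular_nz: "regular x \<Longrightarrow> nz_point x"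
  by (simp add: regular_def)

lemma aff_root_half: "aff_root n b \<Longrightarrow> 2 * snd b \<in> \<int>" "aff_root n b \<Longrightarrow> fst b \<in> lattice n"
  by (auto simp: aff_root_def roots_def)

lemma regular_ptrefl: "k \<le> n \<Longrightarrow> regular x \<Longrightarrow> regular (ptrefl k x)"
proof -
  assume k: "k \<le> n" and x: "regular x"
  have "evp (ptrefl k x) b \<noteq> 1" if b: "aff_root n b" for b
  proof -
    have "evp (ptrefl k x) b = evp x (s k b)"
      by (rule evp_s[OF k aff_root_half(2)[OF b] aff_root_half(1)[OF b] regular_nz[OF x], symmetric])
    then show ?thesis using x aff_root_s[OF k b] by (simp add: regular_def del: split_paired_All)
  qed
  then show ?thesis using nz_ptrefl[OF regular_nz[OF x]] by (simp add: regular_def del: split_paired_All)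
qed

text \<open>On a suitable curve a nonzero Laurent polynomial has finitely many zeros and only countably many
  points fail to be regular, so it does not vanish at all regular points.\<close>

lemma regular_eqI:
  assumes f: "f \<in> laurent n" and g: "g \<in> laurent n"
    and eq: "\<And>x. regular x \<Longrightarrow> leval f x = leval g x"
  shows "f = g"
proof (rule ccontr)
  assume "f \<noteq> g"
  define h where "h = f - g"
  have h: "h \<in> laurent n" "h \<noteq> 0" using f g \<open>f \<noteq> g\<close> by (auto simp: h_def)
  define D where "D = supp h"
  have D: "finite D" "D \<noteq> {}" "D \<subseteq> lattice n"
    using h by (auto simp: D_def laurent_def)
  let ?E = "(\<lambda>(l, m). l - m) ` {(l, m) \<in> D \<times> D. l \<noteq> m} \<union> roots n"
  have "finite {(l, m) \<in> D \<times> D. l \<noteq> m}"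
    by (rule finite_subset[of _ "D \<times> D"]) (use D(1) in auto)
  then have "finite ?E" by (intro finite_UnI finite_imageI finite_roots)
  moreover have "?E \<subseteq> lattice n - {0}"
    using D(3) roots_nonzero[of _ n] by (auto simp: roots_def)
  ultimately obtain N where N: "\<forall>l\<in>?E. curve_deg n N l \<noteq> 0"
    using ex_curve_deg_nonzero[of ?E n] by blast
  have inj: "inj_on (curve_deg n N) D"
  proof (rule inj_onI, rule ccontr)
    fix l m assume lm: "l \<in> D" "m \<in> D" "curve_deg n N l = curve_deg n N m" "l \<noteq> m"
    then have "l - m \<in> ?E" by force
    then have "curve_deg n N (l - m) \<noteq> 0" using N by blast
    then show False using lm D(3) by (subst (asm) curve_deg_diff) auto
  qed
  define Z1 where "Z1 = {z. z \<noteq> 0 \<and> (\<Sum>l\<in>D. coef h l * z powi curve_deg n N l) = 0}"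
  define Z2 where "Z2 a c = {z :: complex. z \<noteq> 0 \<and> (\<Sum>l\<in>{a, 0}. (if l = a then c else - 1) * z powi curve_deg n N l) = 0}"
    for a c
  define S where "S = {0} \<union> Z1 \<union> (\<Union>(a, m)\<in>{(a, of_int m :: real) |a m. a \<in> roots n}. Z2 a (q_pow p m))"
  have "finite Z1" unfolding Z1_def
    using D inj by (intro finite_sum_powi_zeros) (auto simp: D_def in_keys_iff)
  moreover have "finite (Z2 a c)" if "a \<in> roots n" "c \<noteq> 0" for a c
    unfolding Z2_def
  proof (rule finite_sum_powi_zeros)
    have "curve_deg n N a \<noteq> 0" using N that(1) by blast
    then show "inj_on (curve_deg n N) {a, 0}" by (auto simp: curve_deg_def)
  qed (use that in auto)
  moreover have "countable {(a, of_int m :: real) |a m. a \<in> roots n}"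
  proof -
    have "{(a, of_int m :: real) |a m. a \<in> roots n} = (\<lambda>(a, m). (a, of_int m)) ` (roots n \<times> UNIV)" by auto
    then show ?thesis using finite_roots[of n] by (simp add: countable_finite)
  qed
  ultimately have "countable S" unfolding S_def
    using q_pow_nz by (intro countable_Un countable_UN) (auto intro: countable_finite)
  then have "S \<noteq> UNIV" using uncountable_UNIV_complex by auto
  then obtain z where z: "z \<notin> S" by auto
  let ?x = "curve N z"
  have z0: "z \<noteq> 0" using z by (simp add: S_def)
  have nz: "nz_point ?x" using z0 by (auto simp: nz_point_def curve_def)
  have "evp ?x b \<noteq> 1" if "aff_root n b" for b
  proof
    assume 1: "evp ?x b = 1"
    obtain a m where b: "b = (a, of_int m)" "a \<in> roots n"
      using \<open>aff_root n b\<close> by (cases b) (auto simp: aff_root_def elim!: Ints_cases)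
    have "z \<notin> Z2 a (q_pow p (of_int m))" using z b by (auto simp: S_def)
    moreover have "(\<Sum>l\<in>{a, 0}. (if l = a then q_pow p (of_int m) else - 1) * z powi curve_deg n N l) = evp ?x b - 1"
      using roots_nonzero[OF b(2)] z0 by (simp add: b evp_def mon_curve curve_deg_def[of n N 0])
    ultimately show False using 1 z0 by (simp add: Z2_def)
  qed
  then have "regular ?x" using nz by (simp add: regular_def del: split_paired_All)
  then have "leval h ?x = 0" using eq by (simp add: h_def leval_diff)
  moreover have "z \<notin> Z1" using z by (simp add: S_def)
  ultimately show False using z0 by (simp add: Z1_def leval_laurent[OF h(1)] D_def mon_curve)
qed

end

section \<open>Root strings and the Hecke operators\<close>

lemma geometric_down:
  fixes Z :: complex
  assumes "Z \<noteq> 0" "0 \<le> r"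
  shows "(1 - Z) * (\<Sum>j\<in>{1..r}. Z powi (- j)) = Z powi (- r) - 1"
  using assms(2)
proof (induction r rule: int_ge_induct)
  case base
  then show ?case by simp
next
  case (step i)
  have set: "{1..i + 1} = insert (i + 1) {1..i}" using step(1) by auto
  have "Z powi (- i) = Z * Z powi (- (i + 1))"
    using assms(1) power_int_add_1'[of Z "- (i + 1)"] by simp
  then show ?case unfolding set by (simp add: distrib_left step(2)) (simp add: algebra_simps)
qed

lemma geometric_up:
  fixes Z :: complex
  assumes "Z \<noteq> 0" "0 \<le> r"
  shows "(1 - Z) * (\<Sum>j\<in>{0..<r}. Z powi j) = 1 - Z powi r"
  using assms(2)
proof (induction r rule: int_ge_induct)
  case base
  then show ?case by simp
next
  case (step i)
  have set: "{0..<i + 1} = insert i {0..<i}" using step(1) by auto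
  have "Z powi (i + 1) = Z * Z powi i"
    using assms(1) power_int_add_1'[of Z i] by simp
  then show ?case unfolding set by (simp add: distrib_left step(2)) (simp add: algebra_simps)
qed

lemma aff_scale_minus: "aff_scale (- c) f = - aff_scale c f"
  by (rule affvec_eqI) simp_all

context koorn
begin

text \<open>The parameters of a root \<open>b\<close> and of \<open>b / 2\<close>, and the combinations \<open>t - t\<^sup>-\<^sup>1\<close> that enter the
  quadratic relation.\<close>

definition tb :: "affvec \<Rightarrow> complex" where "tb b = mult_par n p b"
definition th :: "affvec \<Rightarrow> complex" where "th b = mult_par n p (aff_scale (1/2) b)"
definition kb :: "affvec \<Rightarrow> complex" where "kb b = tb b - inverse (tb b)"
definition kh :: "affvec \<Rightarrow> complex" where "kh b = th b - inverse (th b)"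

lemma tb_nz: "tb b \<noteq> 0" and th_nz: "th b \<noteq> 0"
  using pars_nz by (auto simp: tb_def th_def mult_par_alt)

lemma tb_s: "k \<le> n \<Longrightarrow> tb (s k b) = tb b" and th_s: "k \<le> n \<Longrightarrow> th (s k b) = th b"
  using mult_par_s[of k p "aff_scale (1/2) b"] by (simp_all add: tb_def th_def mult_par_s s_scale)

lemma kb_s: "k \<le> n \<Longrightarrow> kb (s k b) = kb b" and kh_s: "k \<le> n \<Longrightarrow> kh (s k b) = kh b"
  by (simp_all add: kb_def kh_def tb_s th_s)

lemma kh_short: "aff_root n b \<Longrightarrow> \<not> long (fst b) \<Longrightarrow> kh b = 0"
  by (simp add: kh_def th_def mult_par_half_short aff_root_def)

text \<open>The value of \<open>x\<^bsup>b/2\<^esup>\<close>.  For a short root the factor \<open>kh b\<close> accompanying it is zero, and the default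
  value \<open>0\<close> is never seen.\<close>

definition half_val :: "affvec \<Rightarrow> (nat \<Rightarrow> complex) \<Rightarrow> complex"
  where "half_val b x = (if long (fst b) then evp x (aff_scale (1/2) b) else 0)"

definition strg :: "affvec \<Rightarrow> affvec \<Rightarrow> int \<Rightarrow> expalg"
  where "strg b f e = xpow p (f + aff_scale (of_int e / 2) b)"

text \<open>The operators \<open>R\<^sub>b\<close>, one for every affine root, are made so that \<open>T\<^sub>k = R\<^bsub>a\<^sub>k\<^esub> s\<^sub>k\<close> (\<open>hecke_gen_eq\<close>).  On
  \<open>x\<^sup>f\<close> the value is \<open>t\<^sub>b x\<^sup>f - (k\<^sub>b + k\<^bsub>b/2\<^esub> x\<^bsup>b/2\<^esup>) (x\<^sup>f - x\<^bsup>s\<^sub>b f\<^esup>) / (1 - x\<^sup>b)\<close>; the quotient is a geometric sum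
  over the \<open>b\<close>-string from \<open>f\<close> to \<open>s\<^sub>b f\<close>, written out here according to the sign of \<open>\<langle>f, b\<^sup>\<or>\<rangle>\<close>.  The explicit
  sum shows which monomials occur.\<close>

definition Rmon :: "affvec \<Rightarrow> affvec \<Rightarrow> expalg"
  where "Rmon b f = (let r = \<lfloor>pairing b f\<rfloor> in
    if 0 \<le> r
    then smul (tb b) (xpow p f) +
      (\<Sum>j\<in>{1..r}. smul (kb b) (strg b f (- 2 * j)) + smul (kh b) (strg b f (1 - 2 * j)))
    else smul (tb b) (xpow p f) -
      (\<Sum>j\<in>{0..<- r}. smul (kb b) (strg b f (2 * j)) + smul (kh b) (strg b f (2 * j + 1))))"

definition Rop :: "affvec \<Rightarrow> expalg \<Rightarrow> expalg"
  where "Rop b = lin (\<lambda>l. Rmon b (l, 0))"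

lemma half_root_lattice:
  assumes "aff_root n b" "even e \<or> long (fst b)"
  shows "smul (of_int e / 2) (fst b) \<in> lattice n"
proof (cases "even e")
  case True
  then obtain k where "e = 2 * k" by (auto elim: evenE)
  then show ?thesis using assms(1) by (auto simp: aff_root_def roots_def intro!: lattice_smul)
next
  case False
  then have "smul (of_int e) (smul (1/2) (fst b)) \<in> lattice n"
    using assms by (intro lattice_smul half_long_lattice) (auto simp: aff_root_def)
  then show ?thesis by simp
qed

lemma half_int: "x \<in> \<int> \<Longrightarrow> 2 * (of_int e / 2 * x) \<in> (\<int> :: real set)"
  by simp

lemma strg_laurent:
  assumes "aff_root n b" "f \<in> aff_lattice n" "even e \<or> long (fst b)"
  shows "strg b f e \<in> laurent n"
  unfolding strg_def xpow_def
  using half_root_lattice[OF assms(1,3)] assms(2)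
  by (intro laurent_single) (auto simp: aff_lattice_def)

lemma kh_strg_laurent:
  assumes "aff_root n b" "f \<in> aff_lattice n"
  shows "smul (kh b) (strg b f e) \<in> laurent n"
  using strg_laurent[OF assms, of e] kh_short[OF assms(1)] by (cases "long (fst b)") auto

lemma Rmon_laurent:
  assumes "aff_root n b" "f \<in> aff_lattice n"
  shows "Rmon b f \<in> laurent n"
proof -
  have "xpow p f \<in> laurent n"
    using assms(2) by (auto simp: xpow_def aff_lattice_def intro: laurent_single)
  moreover have "strg b f (2 * j) \<in> laurent n" "strg b f (- 2 * j) \<in> laurent n" for j
    by (rule strg_laurent[OF assms]; simp)+
  ultimately show ?thesis
    unfolding Rmon_def Let_def
    by (simp add: laurent_sum kh_strg_laurent[OF assms] del: mult_minus_left)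
qed

lemma aff_lattice_0: "l \<in> lattice n \<Longrightarrow> (l, 0) \<in> aff_lattice n"
  by (simp add: aff_lattice_def)

lemma Rop_laurent: "aff_root n b \<Longrightarrow> g \<in> laurent n \<Longrightarrow> Rop b g \<in> laurent n"
  unfolding Rop_def by (intro laurent_lin Rmon_laurent aff_lattice_0)

lemma half_val_sq:
  assumes "aff_root n b" "long (fst b)" "nz_point x"
  shows "half_val b x * half_val b x = evp x b"
proof -
  have "evp x (aff_scale (1/2) b + aff_scale (1/2) b) = half_val b x * half_val b x"
    using assms half_long_lattice[of b]
    by (subst evp_add) (auto simp: half_val_def aff_root_def)
  moreover have "aff_scale (1/2) b + aff_scale (1/2) b = b"
    by (rule affvec_eqI; unfold fst_add snd_add lookup_add aff_scale_simps coef_smul; linarith)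
  ultimately show ?thesis by simp
qed

lemma leval_strg:
  assumes b: "aff_root n b" and f: "f \<in> aff_lattice n" and x: "nz_point x"
  shows "leval (strg b f (2 * j)) x = evp x f * evp x b powi j"
    and "long (fst b) \<Longrightarrow> leval (strg b f (2 * j + 1)) x = evp x f * half_val b x * evp x b powi j"
proof -
  have b': "fst b \<in> lattice n" "snd b \<in> \<int>" using b by (auto simp: aff_root_def roots_def)
  have f': "fst f \<in> lattice n" "snd f \<in> \<int>" using f by (auto simp: aff_lattice_def)
  have e1: "aff_scale (of_int (2 * j) / 2) b = aff_scale (of_int j) b" by simp
  show "leval (strg b f (2 * j)) x = evp x f * evp x b powi j"
    unfolding strg_def e1 using b' f' x
    by (subst leval_xpow) (auto simp: evp_add evp_scale_int lattice_smul)
  assume long: "long (fst b)"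
  have e2: "f + aff_scale (of_int (2 * j + 1) / 2) b = (f + aff_scale (1/2) b) + aff_scale (of_int j) b"
    by (rule affvec_eqI; unfold fst_add snd_add lookup_add aff_scale_simps coef_smul;
      simp add: algebra_simps add_divide_distrib)
  have h: "smul (1/2) (fst b) \<in> lattice n" using half_long_lattice[of b] b long by (simp add: aff_root_def)
  show "leval (strg b f (2 * j + 1)) x = evp x f * half_val b x * evp x b powi j"
    unfolding strg_def e2 using b' f' x h long
    by (subst leval_xpow) (auto simp: evp_add evp_scale_int lattice_smul half_val_def)
qed

lemma leval_kh_strg:
  assumes "aff_root n b" "f \<in> aff_lattice n" "nz_point x"
  shows "kh b * leval (strg b f (2 * j + 1)) x = kh b * half_val b x * (evp x f * evp x b powi j)"
  using leval_strg(2)[OF assms, of j] kh_short[OF assms(1)] by (cases "long (fst b)") auto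

lemma Rmon_eval:
  assumes b: "aff_root n b" and f: "f \<in> aff_lattice n" and x: "nz_point x"
  defines "Z \<equiv> evp x b" and "h \<equiv> kb b + kh b * half_val b x"
  shows "(1 - Z) * leval (Rmon b f) x
    = tb b * (1 - Z) * evp x f - h * (evp x f - evp x f * Z powi (- \<lfloor>pairing b f\<rfloor>))"
proof -
  define r where "r = \<lfloor>pairing b f\<rfloor>"
  have Z: "Z \<noteq> 0" using evp_nz[OF x] by (simp add: Z_def)
  have fx: "leval (xpow p f) x = evp x f" using f by (simp add: leval_xpow aff_lattice_def)
  have odd: "kh b * leval (strg b f (1 - 2 * j)) x = kh b * half_val b x * (evp x f * Z powi (- j))" for j
    using leval_kh_strg[OF b f x, of "- j"] by (simp add: Z_def)
  have even: "leval (strg b f (- 2 * j)) x = evp x f * Z powi (- j)" for j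
    using leval_strg(1)[OF b f x, of "- j"] by (simp add: Z_def)
  show ?thesis
  proof (cases "0 \<le> r")
    case True
    have "leval (Rmon b f) x = tb b * evp x f + (\<Sum>j\<in>{1..r}. h * evp x f * Z powi (- j))"
      using True unfolding Rmon_def Let_def r_def[symmetric]
      by (simp add: leval_add leval_smul leval_sum fx odd even[simplified]) (simp add: h_def algebra_simps)
    then have "(1 - Z) * leval (Rmon b f) x
        = tb b * (1 - Z) * evp x f + h * evp x f * ((1 - Z) * (\<Sum>j\<in>{1..r}. Z powi (- j)))"
      by (simp only: sum_distrib_left[symmetric]) (simp add: algebra_simps)
    then show ?thesis
      unfolding geometric_down[OF Z True] r_def[symmetric] by (simp add: algebra_simps)
  next
    case False
    have "leval (Rmon b f) x = tb b * evp x f - (\<Sum>j\<in>{0..<- r}. h * evp x f * Z powi j)"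
      using False unfolding Rmon_def Let_def r_def[symmetric]
      by (simp add: leval_add leval_diff leval_smul leval_sum fx leval_kh_strg[OF b f x]
          leval_strg(1)[OF b f x] flip: Z_def) (simp add: h_def algebra_simps)
    then have "(1 - Z) * leval (Rmon b f) x
        = tb b * (1 - Z) * evp x f - h * evp x f * ((1 - Z) * (\<Sum>j\<in>{0..<- r}. Z powi j))"
      by (simp only: sum_distrib_left[symmetric]) (simp add: algebra_simps)
    moreover have "0 \<le> - r" using False by simp
    ultimately show ?thesis
      unfolding geometric_up[OF Z \<open>0 \<le> - r\<close>] r_def[symmetric] by (simp add: algebra_simps)
  qed
qed

lemma Rmon_shift:
  assumes b: "aff_root n b" and c: "c \<in> \<int>"
  shows "Rmon b (l, c) = smul (q_pow p c) (Rmon b (l, 0))"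
proof -
  have pr: "pairing b (l, c) = pairing b (l, 0)" by (simp add: pairing_def aff_inner_def)
  have x: "xpow p (l, c) = smul (q_pow p c) (xpow p (l, 0))" by (simp add: xpow_def)
  have "strg b (l, c) e = smul (q_pow p c) (strg b (l, 0) e)" for e
  proof -
    have "q_pow p (c + of_int e / 2 * snd b) = q_pow p c * q_pow p (of_int e / 2 * snd b)"
      using b c half_int[of "snd b" e] by (intro q_pow_add) (auto simp: aff_root_def)
    then show ?thesis by (simp add: strg_def xpow_def)
  qed
  then show ?thesis
    by (simp add: Rmon_def Let_def pr x smul_distribs smul_sum mult.left_commute mult.commute)
qed

lemma Rop_xpow:
  assumes "aff_root n b" "f \<in> aff_lattice n"
  shows "Rop b (xpow p f) = Rmon b f"
  using Rmon_shift[OF assms(1), of "snd f" "fst f"] assms(2)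
  by (simp add: Rop_def xpow_def lin_single aff_lattice_def)

text \<open>Conjugating \<open>R\<^sub>\<beta>\<close> by a simple reflection replaces \<open>\<beta>\<close> by its image.\<close>

lemma act_Rmon:
  assumes k: "k \<le> n" and b: "aff_root n b" and f: "f \<in> aff_lattice n"
  shows "act p (s k) (Rmon b f) = Rmon (s k b) (s k f)"
proof -
  have pr: "pairing (s k b) (s k f) = pairing b f"
    using b by (intro pairing_s[OF k]) (auto simp: aff_root_def roots_def)
  have st: "act p (s k) (strg b f e) = strg (s k b) (s k f) e" for e
  proof -
    have "act p (s k) (strg b f e) = xpow p (s k (f + aff_scale (of_int e / 2) b))"
      unfolding strg_def
    proof (rule act_xpow[OF k])
      have i: "snd f \<in> \<int>" "snd b \<in> \<int>" "coef (fst f) 1 \<in> \<int>" "coef (fst b) 1 \<in> \<int>"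
        using b f by (auto simp: aff_root_def roots_def aff_lattice_def lattice_Ints)
      show "2 * snd (f + aff_scale (of_int e / 2) b) \<in> \<int>"
        using i half_int[of "snd b" e] by (simp only: snd_add aff_scale_simps distrib_left) auto
      show "2 * coef (fst (f + aff_scale (of_int e / 2) b)) 1 \<in> \<int>"
        using i half_int[of "coef (fst b) 1" e]
        by (simp only: fst_add aff_scale_simps distrib_left lookup_add coef_smul) auto
    qed
    then show ?thesis by (simp add: strg_def s_add[OF k] s_scale[OF k])
  qed
  have "act p (s k) (xpow p f) = xpow p (s k f)"
    using f by (intro act_xpow[OF k]) (auto simp: aff_lattice_def lattice_Ints)
  moreover have "act p (s k) (sum G A) = (\<Sum>j\<in>A. act p (s k) (G j))"
    "act p (s k) (g + h) = act p (s k) g + act p (s k) h"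
    "act p (s k) (g - h) = act p (s k) g - act p (s k) h"
    "act p (s k) (smul c g) = smul c (act p (s k) g)" for G and A :: "int set" and g h c
    by (simp_all add: act_lin lin_sum lin_add lin_diff lin_smul)
  ultimately show ?thesis
    by (simp add: Rmon_def Let_def pr st tb_s[OF k] kb_s[OF k] kh_s[OF k])
qed

lemma act_Rop:
  assumes k: "k \<le> n" and b: "aff_root n b" and g: "g \<in> laurent n"
  shows "act p (s k) (Rop b g) = Rop (s k b) (act p (s k) g)"
proof -
  have "act p (s k) (Rop b g) = lin (\<lambda>l. act p (s k) (Rmon b (l, 0))) g"
    by (simp add: Rop_def act_lin lin_lin)
  also have "\<dots> = lin (\<lambda>l. Rop (s k b) (xpow p (s k (l, 0)))) g"
  proof (rule lin_cong)
    fix l assume "l \<in> supp g"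
    then have l: "(l, 0) \<in> aff_lattice n" using g by (auto simp: laurent_def aff_lattice_def)
    show "act p (s k) (Rmon b (l, 0)) = Rop (s k b) (xpow p (s k (l, 0)))"
      by (simp add: act_Rmon[OF k b l] Rop_xpow[OF aff_root_s[OF k b] s_aff_lattice[OF k l]])
  qed
  also have "\<dots> = Rop (s k b) (act p (s k) g)"
    by (simp add: Rop_def act_lin lin_lin)
  finally show ?thesis .
qed

text \<open>Summing the geometric series gives the difference-reflection form of \<open>R\<^bsub>a\<^sub>k\<^esub> s\<^sub>k\<close> on values.\<close>

lemma Rop_act_eval:
  assumes k: "k \<le> n" and g: "g \<in> laurent n" and x: "nz_point x"
  defines "a \<equiv> simple_root n k"
  shows "(1 - evp x a) * leval (Rop a (act p (s k) g)) x
    = tb a * (1 - evp x a) * leval g (ptrefl k x)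
      - (kb a + kh a * half_val a x) * (leval g (ptrefl k x) - leval g x)"
proof -
  define h where "h = kb a + kh a * half_val a x"
  have a: "aff_root n a" unfolding a_def by (rule simple_root_root[OF k])
  have mon: "(1 - evp x a) * leval (Rop a (xpow p (s k (l, 0)))) x
      = (tb a * (1 - evp x a) - h) * mon n (ptrefl k x) l + h * mon n x l" if "l \<in> supp g" for l
  proof -
    have l: "(l, 0) \<in> aff_lattice n" using that g by (auto simp: laurent_def aff_lattice_def)
    note sl = s_aff_lattice[OF k l]
    have ev: "evp x (s k (l, 0)) = mon n (ptrefl k x) l"
      using l k x by (subst evp_s) (auto simp: aff_lattice_def evp_def)
    let ?r = "\<lfloor>pairing a (s k (l, 0))\<rfloor>"
    have r: "of_int ?r = pairing a (s k (l, 0))"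
      using pairing_Ints[of a "s k (l, 0)"] a sl by (auto simp: aff_root_def aff_lattice_def elim: Ints_cases)
    have "(l, 0) = s k (l, 0) + aff_scale (of_int (- ?r)) a"
      using s_eq[OF k, of "s k (l, 0)"] unfolding s_invol[OF k] a_def[symmetric]
      by (simp only: of_int_minus r aff_scale_minus diff_conv_add_uminus)
    moreover have "evp x (s k (l, 0) + aff_scale (of_int (- ?r)) a)
        = evp x (s k (l, 0)) * evp x (aff_scale (of_int (- ?r)) a)"
      using sl a x by (intro evp_add) (auto simp: aff_lattice_def aff_root_def roots_def
          simp del: of_int_minus intro: lattice_smul)
    moreover have "evp x (aff_scale (of_int (- ?r)) a) = evp x a powi (- ?r)"
      by (rule evp_scale_int[OF aff_root_half(2)[OF a] aff_root_half(1)[OF a] x])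
    ultimately have "evp x (l, 0) = evp x (s k (l, 0)) * evp x a powi (- ?r)"
      by (simp only:)
    then have "mon n x l = mon n (ptrefl k x) l * evp x a powi (- ?r)"
      by (simp add: ev) (simp add: evp_def)
    then show ?thesis
      by (simp add: Rop_xpow[OF a sl] Rmon_eval[OF a sl x] ev h_def[symmetric]) (simp add: algebra_simps)
  qed
  have "Rop a (act p (s k) g) = lin (\<lambda>l. Rop a (xpow p (s k (l, 0)))) g"
    by (simp add: Rop_def act_lin lin_lin)
  then have "(1 - evp x a) * leval (Rop a (act p (s k) g)) x
      = (\<Sum>l\<in>supp g. coef g l * ((1 - evp x a) * leval (Rop a (xpow p (s k (l, 0)))) x))"
    by (simp add: leval_lin sum_distrib_left mult.left_commute)
  also have "\<dots> = (\<Sum>l\<in>supp g. coef g l * ((tb a * (1 - evp x a) - h) * mon n (ptrefl k x) l + h * mon n x l))"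
    by (intro sum.cong) (simp_all add: mon)
  also have "\<dots> = (tb a * (1 - evp x a) - h) * leval g (ptrefl k x) + h * leval g x"
    by (simp add: leval_laurent[OF g] sum_distrib_left distrib_left mult.left_commute flip: sum.distrib)
  finally show ?thesis by (simp add: h_def algebra_simps)
qed

lemma v_num_eq:
  assumes b: "aff_root n b"
  shows "v_num n p b = 1 - smul (tb b * kh b) (xpow p (aff_scale (1/2) b)) - smul ((tb b)\<^sup>2) (xpow p b)"
proof -
  let ?X = "xpow p (aff_scale (1/2) b)"
  have "snd b \<in> \<int>" using b by (simp add: aff_root_def)
  then have "q_pow p (1/2 * snd b + 1/2 * snd b) = q_pow p (1/2 * snd b) * q_pow p (1/2 * snd b)"
    by (intro q_pow_add) auto
  moreover have "smul (1/2) (fst b) + smul (1/2) (fst b) = fst b"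
    by (rule poly_mapping_eqI; unfold lookup_add coef_smul; linarith)
  ultimately have X: "?X * ?X = xpow p b" by (simp add: xpow_def mult_single)
  have "v_num n p b = (1 - smul (tb b * th b) ?X) * (1 + smul (tb b * inverse (th b)) ?X)"
    by (simp add: v_num_def Let_def tb_def th_def)
  also have "\<dots> = 1 + smul (tb b * inverse (th b)) ?X - smul (tb b * th b) ?X
      - smul (tb b * th b * (tb b * inverse (th b))) (?X * ?X)"
    by (simp add: algebra_simps mult_smul)
  also have "tb b * th b * (tb b * inverse (th b)) = (tb b)\<^sup>2"
    using th_nz by (simp add: power2_eq_square)
  finally show ?thesis
    unfolding X by (simp add: kh_def algebra_simps smul_distribs)
qed

lemma v_num_laurent: "aff_root n b \<Longrightarrow> v_num n p b \<in> laurent n"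
  and v_den_laurent: "aff_root n b \<Longrightarrow> v_den p b \<in> laurent n"
proof -
  assume b: "aff_root n b"
  then have l: "xpow p b \<in> laurent n" by (auto simp: xpow_def aff_root_def roots_def intro: laurent_single)
  then show "v_den p b \<in> laurent n" by (simp add: v_den_def laurent_simps)
  have h: "smul (tb b * kh b) (xpow p (aff_scale (1/2) b)) \<in> laurent n"
  proof (cases "long (fst b)")
    case True
    then have "xpow p (aff_scale (1/2) b) \<in> laurent n"
      using half_long_lattice[of b] b by (auto simp: xpow_def aff_root_def intro: laurent_single)
    then show ?thesis by (rule laurent_simps)
  qed (simp add: kh_short[OF b])
  show "v_num n p b \<in> laurent n"
    unfolding v_num_eq[OF b]
    by (rule laurent_simps(3)[OF laurent_simps(3)[OF laurent_simps(6) h] laurent_simps(5)[OF l]])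
qed

lemma leval_v_den: "aff_root n b \<Longrightarrow> leval (v_den p b) x = 1 - evp x b"
  by (simp add: v_den_def leval_diff leval_xpow aff_root_half)

lemma leval_v_num:
  assumes b: "aff_root n b"
  shows "leval (v_num n p b) x = 1 - tb b * kh b * half_val b x - (tb b)\<^sup>2 * evp x b"
proof -
  have "kh b * leval (xpow p (aff_scale (1/2) b)) x = kh b * half_val b x"
    using half_long_lattice[of b] b kh_short[OF b]
    by (cases "long (fst b)") (auto simp: leval_xpow half_val_def aff_root_def)
  then show ?thesis
    unfolding v_num_eq[OF b] by (simp add: leval_diff leval_smul leval_xpow aff_root_half[OF b] mult.assoc)
qed

lemma hecke_par_eq: "k \<le> n \<Longrightarrow> hecke_par n p k = tb (simple_root n k)"
proof -
  assume k: "k \<le> n"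
  have r: "fst (simple_root n k) \<in> roots n" using simple_root_root[OF k] by (simp add: aff_root_def)
  have "long (fst (simple_root n k)) \<longleftrightarrow> k = 0 \<or> k = n"
    using n2 by (auto simp: long_def simple_root_def coef_eps lookup_minus split: if_splits)
  then show ?thesis using r n2
    by (auto simp: tb_def mult_par_alt hecke_par_def simple_root_def)
qed

text \<open>The operator \<open>R\<^bsub>a\<^sub>k\<^esub> s\<^sub>k\<close> exhibits the quotient required in the definition of \<open>T\<^sub>k\<close>; comparing values at
  regular points shows that it is one, and the only one.\<close>

lemma hecke_gen_eq:
  assumes k: "k \<le> n" and f: "f \<in> laurent n"
  shows "hecke_gen n p k f = Rop (simple_root n k) (act p (s k) f)"
proof -
  define a where "a = simple_root n k"
  have a: "aff_root n a" unfolding a_def by (rule simple_root_root[OF k])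
  define G where "G = smul (tb a) (Rop a (act p (s k) f) - smul (tb a) f)"
  have sf: "act p (s k) f \<in> laurent n" by (rule act_laurent[OF k f])
  have G: "G \<in> laurent n" unfolding G_def using a f sf by (intro laurent_simps Rop_laurent)
  have eq: "v_den p a * G = v_num n p a * (act p (s k) f - f)"
  proof (rule regular_eqI)
    show "v_den p a * G \<in> laurent n" "v_num n p a * (act p (s k) f - f) \<in> laurent n"
      using G f sf v_den_laurent[OF a] v_num_laurent[OF a] by (auto intro!: laurent_mult laurent_simps)
    fix x assume "regular x"
    then have x: "nz_point x" by (rule regular_nz)
    then have x': "\<And>i. i \<in> {1..n} \<Longrightarrow> x i \<noteq> 0" by (simp add: nz_point_def)
    have "leval (v_den p a * G) x = (1 - evp x a) * (tb a * (leval (Rop a (act p (s k) f)) x - tb a * leval f x))"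
      using x' G v_den_laurent[OF a]
      by (subst leval_mult[of _ n]) (auto simp: leval_v_den[OF a] G_def leval_smul leval_diff)
    also have "\<dots> = tb a * ((1 - evp x a) * leval (Rop a (act p (s k) f)) x - (1 - evp x a) * tb a * leval f x)"
      by (simp add: algebra_simps)
    also have "\<dots> = (1 - tb a * kh a * half_val a x - (tb a)\<^sup>2 * evp x a) * (leval f (ptrefl k x) - leval f x)"
      unfolding a_def Rop_act_eval[OF k f x] unfolding a_def[symmetric]
      using tb_nz[of a] by (simp add: kb_def power2_eq_square algebra_simps)
    also have "\<dots> = leval (v_num n p a * (act p (s k) f - f)) x"
      using x' f sf v_num_laurent[OF a]
      by (subst leval_mult[of _ n]) (auto simp: leval_v_num[OF a] leval_diff leval_act[OF k f x])
    finally show "leval (v_den p a * G) x = leval (v_num n p a * (act p (s k) f - f)) x" .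
  qed
  have "(THE g. g \<in> laurent n \<and> v_den p a * g = v_num n p a * (act p (s k) f - f)) = G"
  proof (rule the_equality)
    fix g assume g: "g \<in> laurent n \<and> v_den p a * g = v_num n p a * (act p (s k) f - f)"
    show "g = G"
    proof (rule regular_eqI)
      fix x assume x: "regular x"
      have "leval (v_den p a * f) x = (1 - evp x a) * leval f x" if "f \<in> laurent n" for f
        using that v_den_laurent[OF a] regular_nz[OF x]
        by (simp add: leval_mult[of _ n] nz_point_def leval_v_den[OF a])
      from this[of g] this[of G] have "(1 - evp x a) * leval g x = (1 - evp x a) * leval G x"
        using g G eq by simp
      moreover have "evp x a \<noteq> 1" using x a by (simp add: regular_def del: split_paired_All)
      ultimately show "leval g x = leval G x" by simp
    qed (use g G in auto)
  qed (use G eq in auto)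
  then show ?thesis
    unfolding hecke_gen_def a_def[symmetric] G_def hecke_par_eq[OF k]
    using tb_nz[of a] by (simp add: smul_distribs flip: mult.assoc)
qed

end

section \<open>Relations between the Hecke operators\<close>

lemma aff_scale_uminus: "aff_scale c (- f) = - aff_scale c f"
  by (rule affvec_eqI) simp_all

lemma aff_scale_two: "aff_scale 2 g = g + g"
  by (rule affvec_eqI; unfold fst_add snd_add lookup_add aff_scale_simps coef_smul; simp)

lemma aff_scale_one [simp]: "aff_scale 1 f = f"
  by (rule affvec_eqI) simp_all

text \<open>The rank two identity behind the braid relation of type \<open>B\<^sub>2\<close>; \<open>u, w\<close> belong to the short
  and \<open>v, z\<close> to the long positive roots.\<close>

lemma rank_two_identity:
  fixes A X k1 k2 kap :: complex
  assumes "A \<noteq> 1" "A * X\<^sup>2 \<noteq> 1" "X\<^sup>2 \<noteq> 1" "A\<^sup>2 * X\<^sup>2 \<noteq> 1"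
  defines "u \<equiv> k1 / (1 - A)" and "w \<equiv> k1 / (1 - A * X\<^sup>2)"
    and "v \<equiv> (k2 + kap * X) / (1 - X\<^sup>2)" and "z \<equiv> (k2 + kap * (A * X)) / (1 - A\<^sup>2 * X\<^sup>2)"
  shows "u * v + k1 * z + k2 * w = u * z + v * w + w * z"
proof -
  have u: "u * (1 - A) = k1" and w: "w * (1 - A * X\<^sup>2) = k1"
    and v: "v * (1 - X\<^sup>2) = k2 + kap * X" and z: "z * (1 - A\<^sup>2 * X\<^sup>2) = k2 + kap * (A * X)"
    using assms by (auto simp: field_simps)
  have nz: "(1 - A) * (1 - A * X\<^sup>2) * (1 - X\<^sup>2) * (1 - A\<^sup>2 * X\<^sup>2) \<noteq> 0"
    using assms by simp
  have "(u * v + k1 * z + k2 * w - u * z - v * w - w * z)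
      * ((1 - A) * (1 - A * X\<^sup>2) * (1 - X\<^sup>2) * (1 - A\<^sup>2 * X\<^sup>2))
    = (u * (1 - A)) * (v * (1 - X\<^sup>2)) * ((1 - A * X\<^sup>2) * (1 - A\<^sup>2 * X\<^sup>2))
    + k1 * (z * (1 - A\<^sup>2 * X\<^sup>2)) * ((1 - A) * (1 - A * X\<^sup>2) * (1 - X\<^sup>2))
    + k2 * (w * (1 - A * X\<^sup>2)) * ((1 - A) * (1 - X\<^sup>2) * (1 - A\<^sup>2 * X\<^sup>2))
    - (u * (1 - A)) * (z * (1 - A\<^sup>2 * X\<^sup>2)) * ((1 - A * X\<^sup>2) * (1 - X\<^sup>2))
    - (v * (1 - X\<^sup>2)) * (w * (1 - A * X\<^sup>2)) * ((1 - A) * (1 - A\<^sup>2 * X\<^sup>2))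
    - (w * (1 - A * X\<^sup>2)) * (z * (1 - A\<^sup>2 * X\<^sup>2)) * ((1 - A) * (1 - X\<^sup>2))"
    by algebra
  also have "\<dots> = 0" unfolding u w v z by algebra
  finally have "u * v + k1 * z + k2 * w - u * z - v * w - w * z = 0" using nz by simp
  then show ?thesis by algebra
qed

context koorn
begin

text \<open>On values, \<open>T\<^sub>k\<close> is \<open>\<beta> f + (t\<^sub>k - \<beta>) (f \<circ> s\<^sub>k)\<close> with \<open>\<beta> = bf a\<^sub>k\<close>; the factor \<open>bf b\<close> is transported by
  simple reflections (\<open>bf_ptrefl\<close>), so that an iterated operator at \<open>x\<close> can be expressed by the values
  at \<open>x\<close> of \<open>bf\<close> for several roots.\<close>

definition bf :: "affvec \<Rightarrow> (nat \<Rightarrow> complex) \<Rightarrow> complex"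
  where "bf b x = (kb b + kh b * half_val b x) / (1 - evp x b)"

abbreviation T :: "nat \<Rightarrow> expalg \<Rightarrow> expalg" where "T \<equiv> hecke_gen n p"
abbreviation a :: "nat \<Rightarrow> affvec" where "a \<equiv> simple_root n"

lemma T_laurent: "k \<le> n \<Longrightarrow> f \<in> laurent n \<Longrightarrow> T k f \<in> laurent n"
  by (simp add: hecke_gen_eq Rop_laurent simple_root_root act_laurent)

lemma T_add: "k \<le> n \<Longrightarrow> f \<in> laurent n \<Longrightarrow> g \<in> laurent n \<Longrightarrow> T k (f + g) = T k f + T k g"
  by (simp add: hecke_gen_eq Rop_def act_lin lin_add)

lemma T_smul: "k \<le> n \<Longrightarrow> f \<in> laurent n \<Longrightarrow> T k (smul c f) = smul c (T k f)"
  by (simp add: hecke_gen_eq Rop_def act_lin lin_smul)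

lemma T_eval:
  assumes "k \<le> n" "g \<in> laurent n" "nz_point x" "evp x (a k) \<noteq> 1"
  shows "leval (T k g) x = bf (a k) x * leval g x + (tb (a k) - bf (a k) x) * leval g (ptrefl k x)"
proof -
  have "bf (a k) x * (1 - evp x (a k)) = kb (a k) + kh (a k) * half_val (a k) x"
    using assms(4) by (simp add: bf_def)
  then have "(1 - evp x (a k)) * leval (T k g) x
      = (1 - evp x (a k)) * (bf (a k) x * leval g x + (tb (a k) - bf (a k) x) * leval g (ptrefl k x))"
    unfolding hecke_gen_eq[OF assms(1,2)] Rop_act_eval[OF assms(1-3)] by algebra
  then show ?thesis using assms(4) by simp
qed

lemma regular_root: "regular x \<Longrightarrow> aff_root n b \<Longrightarrow> evp x b \<noteq> 1"
  by (simp add: regular_def del: split_paired_All)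

lemma T_eval_regular:
  assumes "k \<le> n" "g \<in> laurent n" "regular x"
  shows "leval (T k g) x = bf (a k) x * leval g x + (tb (a k) - bf (a k) x) * leval g (ptrefl k x)"
  using assms by (intro T_eval regular_nz regular_root simple_root_root)

lemma half_val_s:
  assumes "k \<le> n" "aff_root n b" "nz_point x"
  shows "half_val b (ptrefl k x) = half_val (s k b) x"
  using assms half_long_lattice[of b]
  by (auto simp: half_val_def long_s aff_root_def evp_s s_scale[symmetric])

lemma bf_ptrefl:
  assumes "k \<le> n" "aff_root n b" "nz_point x"
  shows "bf b (ptrefl k x) = bf (s k b) x"
  using assms by (simp add: bf_def half_val_s kb_s kh_s evp_s aff_root_half)

lemma ptrefl_invol: "k \<le> n \<Longrightarrow> nz_point x \<Longrightarrow> ptrefl k (ptrefl k x) = x"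
  using n2 by (intro ext) (auto simp: ptrefl_def node_swap_def nz_point_def par_q_def q_half_nz)

lemma long_uminus: "long (- v) \<longleftrightarrow> long v"
  by (simp add: long_def)

lemma evp_uminus:
  assumes "fst b \<in> lattice n" "2 * snd b \<in> \<int>" "nz_point x"
  shows "evp x (- b) = inverse (evp x b)"
  using evp_scale_int[OF assms, of "-1"] by (simp add: aff_scale_minus power_int_minus)

lemma half_val_uminus: "aff_root n b \<Longrightarrow> nz_point x \<Longrightarrow> half_val (- b) x = inverse (half_val b x)"
  using half_long_lattice[of b] evp_uminus[of "aff_scale (1/2) b" x]
  by (auto simp: half_val_def long_uminus aff_root_def aff_scale_uminus)

text \<open>A consequence of \<open>1 / (1 - Z\<^sup>-\<^sup>1) = 1 - 1 / (1 - Z)\<close>, and for the second summand of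
  \<open>x\<^bsup>-b/2\<^esup> = x\<^bsup>b/2\<^esup> x\<^bsup>-b\<^esup>\<close>.\<close>

lemma bf_neg_simple:
  assumes k: "k \<le> n" and nz: "nz_point x" and ne: "evp x (a k) \<noteq> 1"
  shows "bf (- a k) x = kb (a k) - bf (a k) x"
proof -
  note r = simple_root_root[OF k]
  define Z X where "Z = evp x (a k)" and "X = half_val (a k) x"
  have Z: "Z \<noteq> 0" "Z \<noteq> 1" using evp_nz[OF nz] ne by (auto simp: Z_def)
  have kb: "kb (- a k) = kb (a k)" and kh: "kh (- a k) = kh (a k)"
    using kb_s[OF k, of "a k"] kh_s[OF k, of "a k"] by (simp_all add: s_simple_root[OF k])
  have X: "kh (a k) * (X * X) = kh (a k) * Z" "kh (a k) = 0 \<or> X \<noteq> 0"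
  proof -
    show "kh (a k) * (X * X) = kh (a k) * Z"
      using half_val_sq[OF r _ nz] kh_short[OF r] by (cases "long (fst (a k))") (auto simp: X_def Z_def)
    have "X \<noteq> 0" if "long (fst (a k))"
      using half_val_sq[OF r that nz] Z by (auto simp: X_def Z_def)
    then show "kh (a k) = 0 \<or> X \<noteq> 0" using kh_short[OF r] by blast
  qed
  have "bf (- a k) x = (kb (a k) + kh (a k) * inverse X) / (1 - inverse Z)"
    by (simp add: bf_def kb kh half_val_uminus[OF r nz] evp_uminus[OF aff_root_half(2)[OF r]
          aff_root_half(1)[OF r] nz] X_def Z_def)
  also have "kh (a k) * inverse X = kh (a k) * X / Z"
    using X Z by (auto simp: field_simps)
  also have "(kb (a k) + kh (a k) * X / Z) / (1 - inverse Z) = kb (a k) - (kb (a k) + kh (a k) * X) / (1 - Z)"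
    using Z by (simp add: divide_simps) (simp add: algebra_simps)
  finally show ?thesis by (simp add: bf_def X_def Z_def)
qed

lemma bf_refl_self:
  "k \<le> n \<Longrightarrow> nz_point x \<Longrightarrow> evp x (a k) \<noteq> 1 \<Longrightarrow> bf (a k) (ptrefl k x) = kb (a k) - bf (a k) x"
  by (simp add: bf_ptrefl simple_root_root s_simple_root bf_neg_simple)

lemma bf_ptrefl_self: "k \<le> n \<Longrightarrow> regular x \<Longrightarrow> bf (a k) (ptrefl k x) = kb (a k) - bf (a k) x"
  by (intro bf_refl_self regular_nz regular_root simple_root_root)

lemma T_quadratic:
  assumes k: "k \<le> n" and f: "f \<in> laurent n"
  shows "T k (T k f) = smul (kb (a k)) (T k f) + f"
proof (rule regular_eqI)
  show "T k (T k f) \<in> laurent n" "smul (kb (a k)) (T k f) + f \<in> laurent n"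
    using k f T_laurent by auto
  fix x assume x: "regular x"
  have t: "tb (a k) * tb (a k) = tb (a k) * kb (a k) + 1"
    using tb_nz by (simp add: kb_def algebra_simps)
  show "leval (T k (T k f)) x = leval (smul (kb (a k)) (T k f) + f) x"
    using k f x regular_ptrefl[OF k x]
    by (simp add: T_eval_regular T_laurent leval_add leval_smul bf_ptrefl_self ptrefl_invol regular_nz)
      (use t in algebra)
qed

lemma T_inverse:
  assumes "k \<le> n" "f \<in> laurent n"
  shows "T k (T k f - smul (kb (a k)) f) = f" and "T k (T k f) - smul (kb (a k)) (T k f) = f"
proof -
  have "T k (T k f - smul (kb (a k)) f) = T k (T k f + smul (- kb (a k)) f)" by simp
  also have "\<dots> = T k (T k f) + smul (- kb (a k)) (T k f)"
    using assms T_laurent by (subst T_add) (auto simp: T_smul simp del: smul_simps)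
  finally show "T k (T k f - smul (kb (a k)) f) = f" using T_quadratic[OF assms] by simp
  show "T k (T k f) - smul (kb (a k)) (T k f) = f" using T_quadratic[OF assms] by simp
qed

lemma T_bij: "k \<le> n \<Longrightarrow> bij_betw (T k) (laurent n) (laurent n)"
  by (rule bij_betw_byWitness[where f' = "\<lambda>f. T k f - smul (kb (a k)) f"])
    (auto simp: T_inverse T_laurent)

lemma T_commute:
  assumes ij: "i \<le> n" "j \<le> n" and orth: "pairing (a i) (a j) = 0" "pairing (a j) (a i) = 0"
    and pt: "\<And>x. ptrefl i (ptrefl j x) = ptrefl j (ptrefl i x)" and f: "f \<in> laurent n"
  shows "T i (T j f) = T j (T i f)"
proof (rule regular_eqI)
  fix x assume x: "regular x"
  have "s i (a j) = a j" "s j (a i) = a i"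
    using ij orth by (simp_all add: s_eq) (simp_all add: aff_scale_def zero_prod_def[symmetric])
  then have "bf (a i) (ptrefl j x) = bf (a i) x" "bf (a j) (ptrefl i x) = bf (a j) x"
    using ij x by (simp_all add: bf_ptrefl simple_root_root regular_nz)
  then show "leval (T i (T j f)) x = leval (T j (T i f)) x"
    using ij f x regular_ptrefl[OF _ x] by (simp add: T_eval_regular T_laurent pt) (simp add: algebra_simps)
qed (use ij f T_laurent in auto)

text \<open>At a regular point both sides are combinations of the values of \<open>f\<close> on the orbit of a rank two
  group.  The coefficients are polynomials in the values of \<open>bf\<close> at the positive roots of the rank two
  subsystem, and they agree by a rational identity between these values (\<open>rel\<close>) and the quadratic
  relation of the parameters.\<close>

lemma T_braid3:
  assumes ij: "i \<le> n" "j \<le> n" and pr: "pairing (a i) (a j) = -1" "pairing (a j) (a i) = -1"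
    and short: "\<not> long (fst (a i))" "\<not> long (fst (a j))" and tb: "tb (a i) = tb (a j)"
    and pt: "\<And>x. nz_point x \<Longrightarrow> ptrefl i (ptrefl j (ptrefl i x)) = ptrefl j (ptrefl i (ptrefl j x))"
    and f: "f \<in> laurent n"
  shows "T i (T j (T i f)) = T j (T i (T j f))"
proof (rule regular_eqI)
  fix x assume x: "regular x"
  note nz = regular_nz[OF x]
  note ri = simple_root_root[OF ij(1)] and rj = simple_root_root[OF ij(2)]
  have sij: "s i (a j) = a i + a j" and sji: "s j (a i) = a i + a j"
    using ij pr by (simp_all add: s_eq aff_scale_minus)
  have ss: "s i (a i + a j) = a j" "s j (a i + a j) = a i"
    using ij sij sji by (simp_all add: s_add s_simple_root)
  note rij = aff_root_s[OF ij(1) rj, unfolded sij]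
  define u v w t k where "u = bf (a i) x" and "v = bf (a j) x" and "w = bf (a i + a j) x"
    and "t = tb (a i)" and "k = kb (a i)"
  have kbj: "kb (a j) = k" using tb by (simp add: k_def kb_def)
  define A B where "A = evp x (a i)" and "B = evp x (a j)"
  have AB: "A \<noteq> 1" "B \<noteq> 1" "A * B \<noteq> 1"
    using regular_root[OF x ri] regular_root[OF x rj] regular_root[OF x rij]
    by (auto simp: A_def B_def evp_add aff_root_half ri rj nz)
  have kij: "kb (a i + a j) = k" "kh (a i + a j) = 0"
    using kb_s[OF ij(1), of "a j"] kh_s[OF ij(1), of "a j"] kbj kh_short[OF rj short(2)] by (simp_all add: sij)
  have vals: "u = k / (1 - A)" "v = k / (1 - B)" "w = k / (1 - A * B)"
    by (simp_all add: u_def v_def w_def bf_def A_def B_def kbj kij kh_short[OF ri short(1)]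
        kh_short[OF rj short(2)] k_def evp_add aff_root_half ri rj nz)
  have rel: "(k - u - v) * w + u * v = 0"
    unfolding vals using AB by (simp add: divide_simps) algebra
  have pts: "regular (ptrefl i x)" "regular (ptrefl j x)" "regular (ptrefl j (ptrefl i x))"
    "regular (ptrefl i (ptrefl j x))"
    using ij x regular_ptrefl by auto
  have "bf (a i) (ptrefl i x) = k - u" "bf (a j) (ptrefl j x) = k - v"
    using ij x by (simp_all add: bf_ptrefl_self kbj flip: u_def v_def k_def)
  moreover have "bf (a j) (ptrefl i x) = w" "bf (a i) (ptrefl j x) = w"
    "bf (a i) (ptrefl j (ptrefl i x)) = v" "bf (a j) (ptrefl i (ptrefl j x)) = u"
    using ij ri rj rij nz pts
    by (simp_all add: bf_ptrefl regular_nz sij sji ss flip: u_def v_def w_def)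
  moreover note b = calculation
  show "leval (T i (T j (T i f))) x = leval (T j (T i (T j f))) x"
    using ij f x pts
    by (simp add: T_eval_regular T_laurent b pt[OF nz] ptrefl_invol nz flip: u_def v_def t_def tb)
      (use rel in algebra)
qed (use ij f T_laurent in auto)

lemma T_braid4:
  assumes ij: "i \<le> n" "j \<le> n" and pr: "pairing (a i) (a j) = -2" "pairing (a j) (a i) = -1"
    and len: "\<not> long (fst (a i))" "long (fst (a j))"
    and pt: "\<And>x. nz_point x \<Longrightarrow> ptrefl i (ptrefl j (ptrefl i (ptrefl j x)))
      = ptrefl j (ptrefl i (ptrefl j (ptrefl i x)))"
    and f: "f \<in> laurent n"
  shows "T i (T j (T i (T j f))) = T j (T i (T j (T i f)))"
proof (rule regular_eqI)
  fix x assume x: "regular x"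
  note nz = regular_nz[OF x]
  note ri = simple_root_root[OF ij(1)] and rj = simple_root_root[OF ij(2)]
  define d c where "d = a i + a j" and "c = a j + aff_scale 2 (a i)"
  have sij: "s i (a j) = c" and sji: "s j (a i) = d"
    using ij pr by (simp_all add: s_eq aff_scale_minus c_def d_def)
  have "s i d = s i (a i) + s i (a j)" "s j c = s j (a j) + (s j (a i) + s j (a i))"
    using ij by (simp_all add: s_add c_def d_def aff_scale_two)
  then have ss: "s i d = d" "s j c = c"
    using ij unfolding sij sji by (simp_all add: s_simple_root c_def d_def aff_scale_two)
  have ss': "s i c = a j" "s j d = a i"
    using ij s_invol sij sji by metis+
  note rji = aff_root_s[OF ij(2) ri, unfolded sji] and rij = aff_root_s[OF ij(1) rj, unfolded sij]
  define u v w z t1 t2 k1 k2 where "u = bf (a i) x" and "v = bf (a j) x" and "w = bf d x"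
    and "z = bf c x" and "t1 = tb (a i)" and "t2 = tb (a j)" and "k1 = kb (a i)" and "k2 = kb (a j)"
  define A X where "A = evp x (a i)" and "X = half_val (a j) x"
  have X2: "evp x (a j) = X\<^sup>2" using half_val_sq[OF rj len(2) nz] by (simp add: X_def power2_eq_square)
  have Aij: "evp x d = A * X\<^sup>2"
    by (simp add: d_def evp_add aff_root_half ri rj nz A_def X2)
  have A2: "evp x (aff_scale 2 (a i)) = A\<^sup>2"
    using evp_scale_int[OF aff_root_half(2)[OF ri] aff_root_half(1)[OF ri] nz, of 2] by (simp add: A_def)
  have Ac: "evp x c = A\<^sup>2 * X\<^sup>2"
    unfolding c_def using ri rj nz
    by (subst evp_add) (auto simp: A2 X2 aff_root_half aff_root_def roots_def intro!: lattice_smul)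
  have hc: "half_val c x = A * X"
  proof -
    have "long (fst c)" using long_s[OF ij(1), of "a j"] len(2) by (simp add: sij)
    moreover have "aff_scale (1/2) c = a i + aff_scale (1/2) (a j)"
      unfolding c_def by (rule affvec_eqI) (simp_all add: lookup_add distrib_left)
    moreover have "evp x (a i + aff_scale (1/2) (a j)) = A * X"
      using half_long_lattice[of "a j"] len(2) rj ri nz
      by (subst evp_add) (auto simp: A_def X_def half_val_def aff_root_half aff_root_def)
    ultimately show ?thesis by (simp add: half_val_def)
  qed
  have ne: "A \<noteq> 1" "A * X\<^sup>2 \<noteq> 1" "X\<^sup>2 \<noteq> 1" "A\<^sup>2 * X\<^sup>2 \<noteq> 1"
    using regular_root[OF x ri] regular_root[OF x rj] regular_root[OF x rij] regular_root[OF x rji]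
    by (simp_all add: A_def X2 Aij Ac)
  have kji: "kb d = k1" "kh d = 0" "kb c = k2" "kh c = kh (a j)"
    using kb_s[OF ij(2), of "a i"] kh_s[OF ij(2), of "a i"] kh_short[OF ri len(1)]
      kb_s[OF ij(1), of "a j"] kh_s[OF ij(1), of "a j"]
    by (simp_all add: sij sji k1_def k2_def)
  have vals: "u = k1 / (1 - A)" "w = k1 / (1 - A * X\<^sup>2)" "v = (k2 + kh (a j) * X) / (1 - X\<^sup>2)"
    "z = (k2 + kh (a j) * (A * X)) / (1 - A\<^sup>2 * X\<^sup>2)"
    by (simp_all add: u_def v_def w_def z_def bf_def kji hc Ac Aij X2 A_def[symmetric] X_def[symmetric]
        kh_short[OF ri len(1)] flip: k1_def k2_def)
  have rel: "u * v + k1 * z + k2 * w = u * z + v * w + w * z"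
    using rank_two_identity[OF ne, of k1 k2 "kh (a j)"] by (simp only: vals)
  have t: "t1 * t1 = t1 * k1 + 1" "t2 * t2 = t2 * k2 + 1"
    using tb_nz by (simp_all add: kb_def t1_def t2_def k1_def k2_def algebra_simps)
  let ?i = "ptrefl i" and ?j = "ptrefl j"
  have pts: "regular (?i x)" "regular (?j x)" "regular (?j (?i x))" "regular (?i (?j x))"
    "regular (?i (?j (?i x)))" "regular (?j (?i (?j x)))"
    using ij x regular_ptrefl by auto
  have neg: "bf (- d) x = k1 - w" "bf (- c) x = k2 - z"
  proof -
    have "bf (- d) x = bf (s j (- a i)) x" using ij by (simp add: s_uminus sji)
    also have "\<dots> = bf (- a i) (?j x)"
      using bf_ptrefl[OF ij(2) aff_root_s[OF ij(1) ri] nz] by (simp add: s_simple_root ij)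
    also have "\<dots> = k1 - bf (a i) (?j x)" using bf_neg_simple[OF ij(1) regular_nz[OF pts(2)] regular_root[OF pts(2) ri]] by (simp add: k1_def)
    finally show "bf (- d) x = k1 - w" using bf_ptrefl[OF ij(2) ri nz] by (simp add: sji w_def)
    have "bf (- c) x = bf (s i (- a j)) x" using ij by (simp add: s_uminus sij)
    also have "\<dots> = bf (- a j) (?i x)"
      using bf_ptrefl[OF ij(1) aff_root_s[OF ij(2) rj] nz] by (simp add: s_simple_root ij)
    also have "\<dots> = k2 - bf (a j) (?i x)" using bf_neg_simple[OF ij(2) regular_nz[OF pts(1)] regular_root[OF pts(1) rj]] by (simp add: k2_def)
    finally show "bf (- c) x = k2 - z" using bf_ptrefl[OF ij(1) rj nz] by (simp add: sij z_def)
  qed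
  have b0: "bf b (?i (?j y)) = bf (s j (s i b)) y" "bf b (?j (?i y)) = bf (s i (s j b)) y"
    if "aff_root n b" "nz_point y" for b y
    using that ij by (simp_all add: bf_ptrefl nz_ptrefl aff_root_s)
  have b3: "bf b (?i (?j (?i x))) = bf (s i (s j (s i b))) x" "bf b (?j (?i (?j x))) = bf (s j (s i (s j b))) x"
    if "aff_root n b" for b
    using that ij nz by (simp_all add: bf_ptrefl nz_ptrefl aff_root_s)
  have "bf (a i) (?i x) = k1 - u" "bf (a j) (?j x) = k2 - v"
    using ij x by (simp_all add: bf_ptrefl_self flip: u_def v_def k1_def k2_def)
  moreover have "bf (a j) (?i x) = z" "bf (a i) (?j x) = w"
    using ij ri rj nz by (simp_all add: bf_ptrefl sij sji flip: z_def w_def)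
  moreover have
    "bf (a i) (?j (?i x)) = w" "bf (a j) (?j (?i x)) = k2 - z"
    "bf (a i) (?i (?j x)) = k1 - w" "bf (a j) (?i (?j x)) = z"
    "bf (a i) (?i (?j (?i x))) = k1 - w" "bf (a j) (?i (?j (?i x))) = v"
    "bf (a i) (?j (?i (?j x))) = u" "bf (a j) (?j (?i (?j x))) = k2 - z"
    using ri rj nz ij
    by (simp_all add: b0 b3 s_simple_root s_uminus sij sji ss ss' neg flip: u_def v_def z_def w_def)
  moreover note b = calculation
  show "leval (T i (T j (T i (T j f)))) x = leval (T j (T i (T j (T i f)))) x"
    using ij f x pts
    by (simp add: T_eval_regular T_laurent b pt[OF nz] ptrefl_invol nz nz_ptrefl flip: u_def v_def t1_def t2_def)
      (use rel t in algebra)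
qed (use ij f T_laurent in auto)

end

section \<open>Length, exchange and translations in the affine Weyl group\<close>

context rank
begin

abbreviation ar :: "nat \<Rightarrow> affvec" where "ar \<equiv> simple_root n"
abbreviation W :: "nat list \<Rightarrow> affvec \<Rightarrow> affvec" where "W \<equiv> word_elt n"

lemma W_Nil [simp]: "W [] = id"
  by (simp add: word_elt_def)

lemma W_Cons: "W (i # is) = s i \<circ> W is"
  by (simp add: word_elt_def)

lemma W_append: "W (u @ v) = W u \<circ> W v"
  by (induction u) (simp_all add: W_Cons comp_assoc)

definition valid :: "nat list \<Rightarrow> bool"
  where "valid is \<longleftrightarrow> set is \<subseteq> {0..n}"

lemma valid_simps [simp]:
  "valid []" "valid (i # is) \<longleftrightarrow> i \<le> n \<and> valid is" "valid (u @ v) \<longleftrightarrow> valid u \<and> valid v"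
  "valid (rev is) \<longleftrightarrow> valid is"
  by (auto simp: valid_def)

lemma W_rev: "valid is \<Longrightarrow> W (rev is) (W is f) = f"
  by (induction "is" arbitrary: f) (auto simp: W_append W_Cons s_invol)

lemma W_rev': "valid is \<Longrightarrow> W is (W (rev is) f) = f"
  using W_rev[of "rev is"] by simp

lemma inv_W: "valid is \<Longrightarrow> inv (W is) = W (rev is)"
  by (rule inv_equality) (simp_all add: W_rev W_rev')

lemma W_linear:
  assumes "valid is"
  shows "W is (f + g) = W is f + W is g" "W is (aff_scale c f) = aff_scale c (W is f)"
    "W is (- f) = - W is f" "W is (f - g) = W is f - W is g"
  using assms by (induction "is") (auto simp: W_Cons s_add s_scale s_uminus s_diff)

lemma W_pairing:
  "valid is \<Longrightarrow> fst b \<in> lattice n \<Longrightarrow> pairing (W is b) (W is f) = pairing b f"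
proof (induction "is")
  case (Cons i "is")
  have "fst (W is b) \<in> lattice n" using Cons.prems by (induction "is") (auto simp: W_Cons s_lattice)
  then show ?case using Cons by (simp add: W_Cons pairing_s)
qed simp

lemma W_aff_lattice: "valid is \<Longrightarrow> f \<in> aff_lattice n \<Longrightarrow> W is f \<in> aff_lattice n"
  by (induction "is") (auto simp: W_Cons s_aff_lattice)

lemma aff_pos_uminus: "aff_root n b \<Longrightarrow> aff_pos n (- b) \<longleftrightarrow> \<not> aff_pos n b"
  using lex_pos_uminus[of "fst b" n] by (auto simp: aff_pos_def aff_root_def roots_uminus)

lemma aff_pos_root: "aff_pos n b \<Longrightarrow> aff_root n b"
  by (simp add: aff_pos_def)

lemma simple_root_pos: "k \<le> n \<Longrightarrow> aff_pos n (ar k)"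
proof -
  assume k: "k \<le> n"
  have "lex_pos (fst (ar k))" if "k \<noteq> 0"
    using that by (auto simp: lex_pos_def simple_root_def coef_eps lookup_minus intro!: exI[of _ k])
  then show ?thesis using simple_root_root[OF k] by (auto simp: aff_pos_def simple_root_def)
qed

lemma lex_posI: "0 < coef v i \<Longrightarrow> (\<And>j. j < i \<Longrightarrow> coef v j = 0) \<Longrightarrow> lex_pos v"
  by (auto simp: lex_pos_def)

text \<open>A simple reflection permutes the positive affine roots other than its own root.  This is
  checked in coordinates for \<open>s\<^sub>0\<close>, for \<open>s\<^sub>n\<close> and for the transpositions in between.\<close>

lemma s_pos_0:
  assumes b: "aff_pos n b" and ne: "b \<noteq> ar 0"
  shows "aff_pos n (s 0 b)"
proof -
  define v m v1 where "v = fst b" and "m = snd b" and "v1 = coef v 1"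
  have root: "v \<in> roots n" "m \<in> \<int>" using b by (auto simp: aff_pos_def aff_root_def v_def m_def)
  have lat: "v \<in> lattice n" using root by (simp add: roots_def)
  obtain z where z: "v1 = of_int z" using lattice_Ints[OF lat, of 1] by (auto simp: v1_def elim: Ints_cases)
  obtain k where k: "m = of_int k" using root(2) by (auto elim: Ints_cases)
  have pos: "0 < m \<or> m = 0 \<and> lex_pos v" using b by (auto simp: aff_pos_def v_def m_def)
  have c: "coef (fst (s 0 b)) i = (if i = 1 then - coef v i else coef v i)" "snd (s 0 b) = m + v1" for i
    using n2 by (auto simp: coords flip_sign_def node_swap_def v_def m_def v1_def)
  have v0: "coef v 0 = 0" using lattice_outside[OF lat, of 0] by simp
  have "0 < m + v1 \<or> m + v1 = 0 \<and> lex_pos (fst (s 0 b))"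
  proof -
    consider "v1 = 0" | "0 < v1" | "v1 < 0" by linarith
    then show ?thesis
    proof cases
      case 1
      then have "fst (s 0 b) = v" using c(1) by (intro poly_mapping_eqI) (auto simp: v1_def)
      then show ?thesis using pos 1 by simp
    next
      case 2
      then show ?thesis using pos by auto
    next
      case 3
      have "\<not> lex_pos v"
      proof
        assume "lex_pos v"
        then obtain i where i: "0 < coef v i" "\<And>j. j < i \<Longrightarrow> coef v j = 0" by (auto simp: lex_pos_def)
        have "i \<noteq> 0" using i(1) v0 by (metis less_irrefl)
        moreover have "i \<noteq> 1" using i(1) 3 by (auto simp: v1_def)
        moreover have "\<not> 1 < i" using i(2)[of 1] 3 by (auto simp: v1_def)
        ultimately show False by linarith
      qed
      then have k1: "1 \<le> k" using pos k by auto
      have lp: "lex_pos (fst (s 0 b))"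
        using 3 v0 c(1) by (intro lex_posI[of _ 1]) (auto simp: v1_def)
      show ?thesis
      proof (cases "z = -1")
        case True
        then show ?thesis using k1 lp z k by auto
      next
        case False
        from root(1) show ?thesis
        proof (cases rule: roots_cases)
          case (long i u)
          then have v: "i = 1" "u = -1" "v = - smul 2 (eps 1)"
            using 3 by (auto simp: v1_def coef_eps split: if_splits)
          then have "v1 = -2" by (simp add: v1_def coef_eps)
          moreover have "k \<noteq> 1"
            using ne v(3) k by (auto simp: simple_root_def v_def m_def prod_eq_iff)
          ultimately show ?thesis using k1 k lp by auto
        next
          case (short i j u w)
          then have "v1 = -1" using 3 by (auto simp: v1_def coef_eps lookup_add split: if_splits)
          then show ?thesis using False z by simp
        qed
      qed
    qed
  qed
  then show ?thesis using aff_root_s[of 0 b] b by (simp add: aff_pos_def c(2))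
qed

lemma s_pos_n:
  assumes b: "aff_pos n b" and ne: "b \<noteq> ar n"
  shows "aff_pos n (s n b)"
proof -
  define v where "v = fst b"
  have root: "v \<in> roots n" using b by (auto simp: aff_pos_def aff_root_def v_def)
  have c: "coef (fst (s n b)) i = (if i = n then - coef v i else coef v i)" "snd (s n b) = snd b" for i
    using n2 by (auto simp: coords flip_sign_def node_swap_def v_def)
  have "lex_pos (fst (s n b))" if zero: "snd b = 0" "lex_pos v"
  proof -
    obtain i where i: "0 < coef v i" "\<And>j. j < i \<Longrightarrow> coef v j = 0" using zero(2) by (auto simp: lex_pos_def)
    show ?thesis
    proof (cases "i = n")
      case False
      then show ?thesis using i by (intro lex_posI[of _ i]) (auto simp: c(1))
    next
      case True
      from root have "b = ar n"
      proof (cases rule: roots_cases)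
        case (long j u)
        then show ?thesis using i True n2 zero by (auto simp: coef_eps simple_root_def v_def prod_eq_iff split: if_splits)
      next
        case (short j k u w)
        then show ?thesis using i(2)[of j] True by (auto simp: coef_eps lookup_add split: if_splits)
      qed
      then show ?thesis using ne by simp
    qed
  qed
  then show ?thesis using aff_root_s[of n b] b by (auto simp: aff_pos_def c(2) v_def)
qed

lemma s_pos_mid:
  assumes k: "0 < k" "k < n" and b: "aff_pos n b" and ne: "b \<noteq> ar k"
  shows "aff_pos n (s k b)"
proof -
  define v where "v = fst b"
  have root: "v \<in> roots n" using b by (auto simp: aff_pos_def aff_root_def v_def)
  have c: "coef (fst (s k b)) i = (if i = k then coef v (k + 1) else if i = k + 1 then coef v k else coef v i)"
    "snd (s k b) = snd b" for i
    using k by (auto simp: coords flip_sign_def node_swap_def v_def)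
  have "lex_pos (fst (s k b))" if zero: "snd b = 0" "lex_pos v"
  proof -
    obtain i where i: "0 < coef v i" "\<And>j. j < i \<Longrightarrow> coef v j = 0" using zero(2) by (auto simp: lex_pos_def)
    consider "i \<noteq> k" "i \<noteq> k + 1" | "i = k + 1" | "i = k" "0 < coef v (k + 1)" | "i = k" "coef v (k + 1) = 0"
      | "i = k" "coef v (k + 1) < 0" by linarith
    then show ?thesis
    proof cases
      case 1
      then show ?thesis using i by (intro lex_posI[of _ i]) (auto simp: c(1))
    next
      case 2
      then show ?thesis using i by (intro lex_posI[of _ k]) (auto simp: c(1))
    next
      case 3
      then show ?thesis using i by (intro lex_posI[of _ k]) (auto simp: c(1))
    next
      case 4
      then show ?thesis using i by (intro lex_posI[of _ "k + 1"]) (auto simp: c(1))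
    next
      case 5
      from root have "b = ar k"
      proof (cases rule: roots_cases)
        case (long j u)
        then show ?thesis using i 5 by (auto simp: coef_eps split: if_splits)
      next
        case (short j l u w)
        then have "j = k" "l = k + 1" "u = 1" "w = -1" using i 5 by (auto simp: coef_eps lookup_add split: if_splits)
        then show ?thesis using short zero k by (auto simp: simple_root_def v_def prod_eq_iff)
      qed
      then show ?thesis using ne by simp
    qed
  qed
  then show ?thesis using aff_root_s[of k b] b k by (auto simp: aff_pos_def c(2) v_def)
qed

lemma s_pos: "k \<le> n \<Longrightarrow> aff_pos n b \<Longrightarrow> b \<noteq> ar k \<Longrightarrow> aff_pos n (s k b)"
  using s_pos_0 s_pos_n s_pos_mid[of k b] by (cases "k = 0"; cases "k = n") auto

definition inversions :: "(affvec \<Rightarrow> affvec) \<Rightarrow> affvec set"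
  where "inversions w = {b. aff_pos n b \<and> \<not> aff_pos n (inv w b)}"

lemma inversions_id [simp]: "inversions id = {}" "inversions (\<lambda>a. a) = {}"
  by (simp_all add: inversions_def inv_id[unfolded id_def] id_def)

text \<open>The roots \<open>s\<^bsub>i\<^sub>1\<^esub> \<dots> s\<^bsub>i\<^bsub>r-1\<^esub>\<^esub> a\<^bsub>i\<^sub>r\<^esub>\<close> for the prefixes of a word; for a reduced word they are the inversions
  of its element, without repetition (\<open>reduced_inversions\<close>).\<close>

fun betas :: "nat list \<Rightarrow> affvec list"
  where "betas [] = []" | "betas (i # is) = ar i # map (s i) (betas is)"

lemma length_betas [simp]: "length (betas is) = length is"
  by (induction "is") auto

lemma in_inversions: "valid is \<Longrightarrow> b \<in> inversions (W is) \<longleftrightarrow> aff_pos n b \<and> \<not> aff_pos n (W (rev is) b)"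
  by (simp add: inversions_def inv_W)

lemma inversions_subset: "valid is \<Longrightarrow> inversions (W is) \<subseteq> set (betas is)"
proof (induction "is")
  case Nil
  then show ?case by (auto simp: in_inversions)
next
  case (Cons i "is")
  show ?case
  proof
    fix b assume "b \<in> inversions (W (i # is))"
    then have b: "aff_pos n b" "\<not> aff_pos n (W (rev is) (s i b))"
      unfolding in_inversions[OF Cons.prems] by (simp_all add: W_append W_Cons)
    show "b \<in> set (betas (i # is))"
    proof (cases "b = ar i")
      case False
      then have "aff_pos n (s i b)" using b(1) Cons.prems by (intro s_pos) auto
      then have "s i b \<in> set (betas is)" using Cons b by (auto simp: in_inversions)
      then have "s i (s i b) \<in> s i ` set (betas is)" by blast
      then show ?thesis using Cons.prems by (simp add: s_invol)
    qed simp
  qed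
qed

lemma finite_inversions: "valid is \<Longrightarrow> finite (inversions (W is))"
  by (rule finite_subset[OF inversions_subset]) auto

lemma card_inversions_le: "valid is \<Longrightarrow> card (inversions (W is)) \<le> length is"
  using card_mono[OF _ inversions_subset, of "is"] card_length[of "betas is"] by simp

lemma inversions_Cons:
  assumes v: "valid (i # is)" and pos: "aff_pos n (W (rev is) (ar i))"
  shows "inversions (W (i # is)) = insert (ar i) (s i ` inversions (W is))"
    and "card (inversions (W (i # is))) = Suc (card (inversions (W is)))"
proof -
  have i: "i \<le> n" and vi: "valid is" "valid (rev is)" using v by auto
  have mem: "b \<in> inversions (W (i # is)) \<longleftrightarrow> aff_pos n b \<and> \<not> aff_pos n (W (rev is) (s i b))" for b
    unfolding in_inversions[OF v] by (simp add: W_append W_Cons)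
  show eq: "inversions (W (i # is)) = insert (ar i) (s i ` inversions (W is))"
  proof (rule set_eqI, rule iffI)
    fix b assume "b \<in> inversions (W (i # is))"
    then have b: "aff_pos n b" "\<not> aff_pos n (W (rev is) (s i b))" by (auto simp: mem)
    show "b \<in> insert (ar i) (s i ` inversions (W is))"
    proof (cases "b = ar i")
      case False
      then have "s i b \<in> inversions (W is)" using b s_pos[OF i b(1)] vi by (simp add: in_inversions)
      then show ?thesis using s_invol[OF i, of b] by (metis image_eqI insertI2)
    qed simp
  next
    fix b assume "b \<in> insert (ar i) (s i ` inversions (W is))"
    then consider "b = ar i" | c where "b = s i c" "c \<in> inversions (W is)" by auto
    then show "b \<in> inversions (W (i # is))"
    proof cases
      case 1
      have "\<not> aff_pos n (- W (rev is) (ar i))"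
        using pos aff_pos_uminus[OF aff_pos_root[OF pos]] by simp
      then show ?thesis
        using simple_root_pos[OF i] by (simp add: mem 1 s_simple_root[OF i] W_linear[OF vi(2)])
    next
      case 2
      then have c: "aff_pos n c" "\<not> aff_pos n (W (rev is) c)" using vi by (auto simp: in_inversions)
      then have "c \<noteq> ar i" using pos by auto
      then show ?thesis using c s_pos[OF i c(1)] by (simp add: mem 2 s_invol[OF i])
    qed
  qed
  have "ar i \<notin> s i ` inversions (W is)"
  proof
    assume "ar i \<in> s i ` inversions (W is)"
    then obtain c where c: "ar i = s i c" "c \<in> inversions (W is)" by auto
    then have "c = - ar i" using s_invol[OF i, of c] s_simple_root[OF i] by metis
    then show False
      using c(2) vi aff_pos_uminus[OF simple_root_root[OF i]] simple_root_pos[OF i] by (simp add: in_inversions)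
  qed
  moreover have "inj_on (s i) (inversions (W is))" by (rule inj_on_inverseI[of _ "s i"]) (simp add: s_invol[OF i])
  ultimately show "card (inversions (W (i # is))) = Suc (card (inversions (W is)))"
    unfolding eq using finite_inversions[OF vi(1)] by (simp add: card_image)
qed

lemma betas_split: "b \<in> set (betas is) \<Longrightarrow> \<exists>us j vs. is = us @ j # vs \<and> b = W us (ar j)"
proof (induction "is" arbitrary: b)
  case (Cons i "is")
  show ?case
  proof (cases "b = ar i")
    case True
    then show ?thesis by (intro exI[of _ "[]"]) auto
  next
    case False
    then obtain c where c: "b = s i c" "c \<in> set (betas is)" using Cons.prems by auto
    from Cons.IH[OF c(2)] obtain us j vs where "is = us @ j # vs" "c = W us (ar j)" by blast
    then show ?thesis by (intro exI[of _ "i # us"]) (auto simp: c(1) W_Cons)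
  qed
qed simp

text \<open>If \<open>a\<^sub>i\<close> is an inversion, it is one of the roots \<open>u a\<^sub>j\<close> belonging to the word, with \<open>u\<close> the prefix
  before the letter \<open>j\<close>.  Then \<open>s\<^sub>i u = u s\<^sub>j\<close>, and the letter can be moved to the front.\<close>

lemma exchange:
  assumes v: "valid is" and i: "i \<le> n" and neg: "\<not> aff_pos n (W (rev is) (ar i))"
  shows "\<exists>us j vs. is = us @ j # vs \<and> W is = W (i # us @ vs)"
proof -
  have "ar i \<in> inversions (W is)" using v simple_root_pos[OF i] neg by (simp add: in_inversions)
  then obtain us j vs where us: "is = us @ j # vs" "ar i = W us (ar j)"
    using inversions_subset[OF v] betas_split by blast
  have vu: "valid us" "j \<le> n" using v us by auto
  have conj: "s i (W us g) = W us (s j g)" for g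
  proof -
    have "pairing (ar i) (W us g) = pairing (ar j) g"
      using W_pairing[OF vu(1), of "ar j" g] simple_root_root[OF vu(2)] us(2)
      by (simp add: aff_root_def roots_def)
    then show ?thesis
      by (simp add: s_eq[OF i] s_eq[OF vu(2)] W_linear[OF vu(1)] us(2)[symmetric])
  qed
  have "W is = W (i # us @ vs)"
    by (rule ext) (simp add: us(1) W_append W_Cons conj)
  then show ?thesis using us(1) by blast
qed

definition reduced :: "nat list \<Rightarrow> bool"
  where "reduced is \<longleftrightarrow> reduced_expr n is (W is)"

lemma reduced_alt:
  "reduced is \<longleftrightarrow> valid is \<and> (\<forall>js. valid js \<and> W js = W is \<longrightarrow> length is \<le> length js)"
  by (simp add: reduced_def reduced_expr_def valid_def)

lemma W_cancel: "i \<le> n \<Longrightarrow> W (i # u) = W (i # v) \<Longrightarrow> W u = W v"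
  by (metis W_Cons comp_assoc id_comp s_comp_invol)

lemma W_cancel_right:
  assumes "valid r" "W (u @ r) = W (v @ r)"
  shows "W u = W v"
proof
  fix f
  have "W (u @ r) (W (rev r) f) = W (v @ r) (W (rev r) f)" using assms(2) by simp
  then show "W u f = W v f" using assms(1) by (simp add: W_append W_rev')
qed

lemma reduced_ConsD:
  assumes "reduced (i # is)"
  shows "reduced is" and "aff_pos n (W (rev is) (ar i))"
proof -
  have v: "i \<le> n" "valid is" using assms by (auto simp: reduced_alt)
  show "reduced is"
    unfolding reduced_alt
  proof (intro conjI allI impI v)
    fix js assume "valid js \<and> W js = W is"
    then have "valid (i # js) \<and> W (i # js) = W (i # is)" using v by (simp add: W_Cons)
    then have "length (i # is) \<le> length (i # js)" using assms by (auto simp only: reduced_alt)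
    then show "length is \<le> length js" by simp
  qed
  show "aff_pos n (W (rev is) (ar i))"
  proof (rule ccontr)
    assume "\<not> ?thesis"
    from exchange[OF v(2,1) this] obtain us j vs
      where us: "is = us @ j # vs" "W is = W (i # us @ vs)" by blast
    have "W (i # is) = W (i # i # us @ vs)" using us(2) by (simp only: W_Cons)
    also have "\<dots> = W (us @ vs)" using v s_comp_invol[of i] by (simp add: W_Cons comp_assoc[symmetric])
    finally have "valid (us @ vs) \<and> W (us @ vs) = W (i # is)" using v us by auto
    then have "length (i # is) \<le> length (us @ vs)" using assms by (auto simp only: reduced_alt)
    then show False using us by simp
  qed
qed

lemma reduced_inversions:
  assumes "reduced is"
  shows "inversions (W is) = set (betas is)" "card (inversions (W is)) = length is"
proof -
  have "inversions (W is) = set (betas is) \<and> card (inversions (W is)) = length is"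
    using assms
  proof (induction "is")
    case Nil
    then show ?case by (auto simp: in_inversions)
  next
    case (Cons i "is")
    have v: "valid (i # is)" using Cons.prems by (simp add: reduced_alt)
    note c = inversions_Cons[OF v reduced_ConsD(2)[OF Cons.prems]]
    have IH: "inversions (W is) = set (betas is)" "card (inversions (W is)) = length is"
      using Cons.IH[OF reduced_ConsD(1)[OF Cons.prems]] by auto
    show ?case unfolding c(1)[unfolded IH(1)] c(2)[unfolded IH(2), unfolded c(1), unfolded IH(1)] by simp
  qed
  then show "inversions (W is) = set (betas is)" "card (inversions (W is)) = length is" by auto
qed

lemma reduced_distinct: "reduced is \<Longrightarrow> distinct (betas is)"
  using reduced_inversions[of "is"] by (intro card_distinct) simp

lemma reducedI_card: "valid is \<Longrightarrow> length is \<le> card (inversions (W is)) \<Longrightarrow> reduced is"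
  using card_inversions_le by (auto simp: reduced_alt) (metis order_trans)

lemma reduced_same_length:
  assumes "reduced is" "valid js" "W js = W is" "length js = length is"
  shows "reduced js"
  using assms by (auto simp: reduced_alt)

lemma reduced_lengths: "reduced is \<Longrightarrow> reduced js \<Longrightarrow> W is = W js \<Longrightarrow> length is = length js"
  by (metis reduced_inversions(2))

lemma ex_reduced:
  assumes "valid is"
  shows "\<exists>js. reduced js \<and> W js = W is"
proof -
  let ?P = "\<lambda>js. valid js \<and> W js = W is"
  obtain js where js: "?P js" "\<forall>ks. ?P ks \<longrightarrow> length js \<le> length ks"
    using arg_min_nat_lemma[of ?P "is" length] assms by blast
  then show ?thesis by (intro exI[of _ js]) (auto simp: reduced_alt)
qed

text \<open>Two reduced words of the same element: the first letter of one can be moved to the front of the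
  other.\<close>

lemma left_descent_exchange:
  assumes "reduced (j # js)" "reduced is" "W is = W (j # js)"
  shows "\<exists>us k vs. is = us @ k # vs \<and> W is = W (j # us @ vs)"
proof (rule exchange)
  have v: "valid (j # js)" "valid is" using assms by (auto simp: reduced_alt)
  then show "valid is" "j \<le> n" by auto
  have "W (rev is) = W (rev (j # js))" using inv_W[OF v(1)] inv_W[OF v(2)] assms(3) by simp
  then have "W (rev is) (ar j) = - W (rev js) (ar j)"
    using v by (simp add: W_append W_Cons s_simple_root W_linear)
  then show "\<not> aff_pos n (W (rev is) (ar j))"
    using aff_pos_uminus[OF aff_pos_root[OF reduced_ConsD(2)[OF assms(1)]]] reduced_ConsD(2)[OF assms(1)] by simp
qed

subsection \<open>Translations\<close>

lemma transl_eq: "transl l f = (fst f, snd f + aff_inner (l, 0) f)"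
  by (intro affvec_eqI) (auto simp: transl_def lookup_add)

lemma aff_inner_vec: "l \<in> lattice n \<Longrightarrow> aff_inner (l, 0) f = (\<Sum>i = 1..n. coef l i * coef (fst f) i)"
  by (subst aff_inner_superset[of "{1..n}"]) (auto simp: lattice_def)

lemma transl_comp:
  "l \<in> lattice n \<Longrightarrow> m \<in> lattice n \<Longrightarrow> transl l (transl m f) = transl (l + m) f"
  by (simp add: transl_eq aff_inner_vec lookup_add distrib_right sum.distrib)

lemma transl_zero [simp]: "transl 0 f = f"
  by (simp add: transl_eq aff_inner_def)

lemma inv_transl: "l \<in> lattice n \<Longrightarrow> inv (transl l) = transl (- l)"
  by (rule inv_equality) (simp_all add: transl_comp)

definition grp :: "(affvec \<Rightarrow> affvec) set"
  where "grp = {W is | is. valid is}"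

lemma grp_comp: "u \<in> grp \<Longrightarrow> w \<in> grp \<Longrightarrow> u \<circ> w \<in> grp"
  unfolding grp_def by (smt (verit) W_append mem_Collect_eq valid_simps(3))

lemma grp_gen: "k \<le> n \<Longrightarrow> s k \<in> grp"
  unfolding grp_def by (auto intro!: exI[of _ "[k]"] simp: W_Cons)

lemma grp_id: "id \<in> grp"
  unfolding grp_def by (auto intro!: exI[of _ "[]"])

text \<open>The reflection in \<open>2\<epsilon>\<^sub>i\<close>, conjugate to \<open>s\<^sub>n\<close>; together with \<open>s\<^sub>0\<close> it produces the translation by \<open>\<epsilon>\<^sub>1\<close>.\<close>

definition neg_coord :: "nat \<Rightarrow> affvec \<Rightarrow> affvec"
  where "neg_coord i f = f - aff_scale (2 * coef (fst f) i) (eps i, 0)"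

lemma neg_coord_coords: "coef (fst (neg_coord i f)) j = (if j = i then - coef (fst f) j else coef (fst f) j)"
  "snd (neg_coord i f) = snd f"
  by (auto simp: neg_coord_def lookup_minus coef_eps)

lemma neg_coord_grp: "i \<le> n \<Longrightarrow> 1 \<le> i \<Longrightarrow> neg_coord i \<in> grp"
proof (induction i rule: inc_induct)
  case base
  have "neg_coord n = s n"
    using n2 by (intro ext affvec_eqI) (auto simp: neg_coord_coords coords flip_sign_def node_swap_def)
  then show ?case by (simp add: grp_gen)
next
  case (step i)
  then have i: "1 \<le> i" "i < n" by auto
  have e: "neg_coord i = s i \<circ> (neg_coord (Suc i) \<circ> s i)"
    using i by (intro ext affvec_eqI) (auto simp: neg_coord_coords coords flip_sign_def node_swap_def)
  show ?case unfolding e by (intro grp_comp grp_gen) (use step i in auto)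
qed

lemma aff_inner_eps: "aff_inner (eps i, 0) f = coef (fst f) i"
  by (subst aff_inner_superset[of "{i}"]) (auto simp: in_keys_iff coef_eps split: if_splits)

lemma transl_eps_grp: "1 \<le> i \<Longrightarrow> i \<le> n \<Longrightarrow> transl (eps i) \<in> grp"
proof (induction i rule: dec_induct)
  case base
  have "transl (eps 1) = neg_coord 1 \<circ> s 0"
    using n2 by (intro ext affvec_eqI)
      (auto simp: transl_eq aff_inner_eps neg_coord_coords coords flip_sign_def node_swap_def)
  moreover have "neg_coord 1 \<circ> s 0 \<in> grp"
    using n2 by (intro grp_comp neg_coord_grp grp_gen) auto
  ultimately show ?case by (simp only:)
next
  case (step i)
  have e: "transl (eps (Suc i)) = s i \<circ> (transl (eps i) \<circ> s i)"
    using step.hyps step.prems by (intro ext affvec_eqI)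
      (auto simp: transl_eq aff_inner_eps coords flip_sign_def node_swap_def)
  show ?case unfolding e by (intro grp_comp grp_gen) (use step in auto)
qed

lemma dominant_lattice: "l \<in> dominant n \<Longrightarrow> l \<in> lattice n"
  by (simp add: dominant_def)

lemma transl_nonneg_grp:
  assumes "l \<in> lattice n" "\<And>i. 0 \<le> coef l i"
  shows "transl l \<in> grp"
  using assms
proof (induction "nat \<lfloor>l1 n l\<rfloor>" arbitrary: l)
  case 0
  show ?case
  proof (cases "l = 0")
    case True
    have "transl 0 = id" by (rule ext) simp
    then show ?thesis using grp_id True by (simp only:)
  next
    case False
    then obtain i where i: "coef l i \<noteq> 0" by (metis lookup_zero poly_mapping_eqI)
    obtain z where z: "coef l i = of_int z" using lattice_Ints[OF 0(2), of i] by (auto elim: Ints_cases)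
    have "1 \<le> z" using i 0(3)[of i] z by auto
    then have "1 \<le> coef l i" using z by simp
    moreover have "i \<in> {1..n}" using i lattice_outside[OF 0(2)] by blast
    ultimately have "1 \<le> l1 n l" unfolding l1_def
      by (intro order_trans[OF _ member_le_sum[of i]]) auto
    then show ?thesis using 0(1) by linarith
  qed
next
  case (Suc m)
  have "\<exists>i\<in>{1..n}. coef l i \<noteq> 0"
  proof (rule ccontr)
    assume "\<not> ?thesis"
    then have "l1 n l = 0" by (simp add: l1_def)
    then show False using Suc(2) by simp
  qed
  then obtain i where i: "i \<in> {1..n}" "coef l i \<noteq> 0" by blast
  obtain z where z: "coef l i = of_int z" using lattice_Ints[OF Suc(3), of i] by (auto elim: Ints_cases)
  have z1: "1 \<le> z" using i(2) Suc(4)[of i] z by auto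
  let ?l = "l - eps i"
  have lat: "?l \<in> lattice n" using Suc(3) i by auto
  have nn: "0 \<le> coef ?l j" for j using Suc(4)[of j] z z1 by (auto simp: lookup_minus coef_eps)
  have "l1 n l = (\<Sum>k = 1..n. coef l k)" "l1 n ?l = (\<Sum>k = 1..n. coef ?l k)"
    using Suc(4) nn by (simp_all add: l1_def)
  moreover have "(\<Sum>k = 1..n. coef ?l k) = (\<Sum>k = 1..n. coef l k) - 1"
    using i(1) by (simp add: lookup_minus coef_eps sum_subtractf)
  ultimately have "nat \<lfloor>l1 n ?l\<rfloor> = m" using Suc(2) by (simp add: nat_eq_iff) linarith
  then have "transl ?l \<in> grp" using Suc(1) lat nn by blast
  moreover have e: "transl l = transl (eps i) \<circ> transl ?l"
    using i lat by (intro ext) (simp add: transl_comp)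
  ultimately show ?case unfolding e using transl_eps_grp i by (intro grp_comp) auto
qed

lemma dominant_mono:
  assumes l: "l \<in> dominant n" and ij: "1 \<le> i" "i \<le> j" "j \<le> n"
  shows "coef l j \<le> coef l i"
  using ij(2,3)
proof (induction j rule: dec_induct)
  case (step k)
  have "coef l (k + 1) \<le> coef l k" using l step ij by (auto simp: dominant_def)
  then show ?case using step by simp
qed simp

lemma dominant_nonneg: "l \<in> dominant n \<Longrightarrow> 0 \<le> coef l i"
  using lattice_outside[of l n i] by (cases "i \<in> {1..n}") (auto simp: dominant_def)

lemma dominant_add: "l \<in> dominant n \<Longrightarrow> m \<in> dominant n \<Longrightarrow> l + m \<in> dominant n"
  by (auto simp: dominant_def lookup_add intro: add_mono)

lemma transl_dominant_grp: "l \<in> dominant n \<Longrightarrow> transl l \<in> grp"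
  by (intro transl_nonneg_grp dominant_lattice dominant_nonneg)

text \<open>The pairing of a vector with a root, as a plain scalar product.\<close>

definition ip :: "vec \<Rightarrow> vec \<Rightarrow> real"
  where "ip l v = aff_inner (l, 0) (v, 0)"

lemma ip_add: "l \<in> lattice n \<Longrightarrow> m \<in> lattice n \<Longrightarrow> ip (l + m) v = ip l v + ip m v"
  by (simp add: ip_def aff_inner_vec lookup_add distrib_right sum.distrib)

lemma ip_uminus: "l \<in> lattice n \<Longrightarrow> ip (- l) v = - ip l v" "l \<in> lattice n \<Longrightarrow> ip l (- v) = - ip l v"
  by (simp_all add: ip_def aff_inner_vec sum_negf)

lemma ip_Ints: "l \<in> lattice n \<Longrightarrow> v \<in> lattice n \<Longrightarrow> ip l v \<in> \<int>"
  by (auto simp: ip_def aff_inner_vec lattice_Ints intro!: Ints_sum Ints_mult)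

lemma ip_long: "l \<in> lattice n \<Longrightarrow> i \<in> {1..n} \<Longrightarrow> ip l (smul c (eps i)) = c * coef l i"
  by (simp add: ip_def aff_inner_vec coef_eps if_distrib cong: if_cong)

lemma ip_add_right: "l \<in> lattice n \<Longrightarrow> ip l (v + w) = ip l v + ip l w"
  by (simp add: ip_def aff_inner_vec lookup_add distrib_left sum.distrib)

lemma ip_eps: "l \<in> lattice n \<Longrightarrow> i \<in> {1..n} \<Longrightarrow> ip l (eps i) = coef l i"
  using ip_long[of l i 1] by simp

lemma ip_diff_right: "l \<in> lattice n \<Longrightarrow> ip l (v - w) = ip l v - ip l w"
  using ip_add_right[of l v "- w"] by (simp add: ip_uminus)

lemma dominant_ip_nonneg:
  assumes l: "l \<in> dominant n" and v: "v \<in> pos_roots n"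
  shows "0 \<le> ip l v"
proof -
  note lat = dominant_lattice[OF l]
  from v consider (1) i where "1 \<le> i" "i \<le> n" "v = smul 2 (eps i)"
    | (2) i j where "1 \<le> i" "i < j" "j \<le> n" "v = eps i + eps j"
    | (3) i j where "1 \<le> i" "i < j" "j \<le> n" "v = eps i - eps j"
    unfolding pos_roots_def by blast
  then show ?thesis
  proof cases
    case 1
    then show ?thesis using dominant_nonneg[OF l] by (simp add: ip_long[OF lat])
  next
    case 2
    then have "ip l v = coef l i + coef l j"
      using lat by (simp add: ip_add_right ip_diff_right ip_eps)
    then show ?thesis using dominant_nonneg[OF l] by simp
  next
    case 3
    then have "ip l v = coef l i - coef l j"
      using lat by (simp add: ip_add_right ip_diff_right ip_eps)
    then show ?thesis using dominant_mono[OF l, of i j] 3 by simp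
  qed
qed

text \<open>The inverse translation lowers the coefficient of \<open>\<delta>\<close> at \<open>v\<close> by \<open>\<langle>l, v\<rangle>\<close>, so \<open>v + m\<delta>\<close> with \<open>m \<ge> 0\<close> becomes
  negative exactly for \<open>m < \<langle>l, v\<rangle>\<close>.\<close>

lemma inversions_transl:
  assumes l: "l \<in> dominant n"
  shows "inversions (transl l)
    = (\<lambda>(v, m). (v, of_int m)) ` (SIGMA v:pos_roots n. {0..<\<lfloor>ip l v\<rfloor>})"
proof (rule set_eqI)
  fix b :: affvec
  note lat = dominant_lattice[OF l]
  obtain v m where b: "b = (v, m)" by (cases b)
  have vin: "v \<in> lattice n" if "v \<in> roots n" using that by (simp add: roots_def)
  have "b \<in> inversions (transl l) \<longleftrightarrow> aff_pos n (v, m) \<and> \<not> aff_pos n (v, m - ip l v)"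
    using lat by (simp add: b inversions_def inv_transl transl_eq ip_def aff_inner_vec sum_negf)
  also have "\<dots> \<longleftrightarrow> v \<in> pos_roots n \<and> m \<in> \<int> \<and> 0 \<le> m \<and> m < ip l v"
  proof (cases "v \<in> roots n \<and> m \<in> \<int>")
    case True
    then have int: "m - ip l v \<in> \<int>" using ip_Ints[OF lat vin] by auto
    show ?thesis
    proof (cases "lex_pos v")
      case True
      then show ?thesis using \<open>v \<in> roots n \<and> m \<in> \<int>\<close> int
        by (auto simp: aff_pos_def aff_root_def pos_roots_eq)
    next
      case False
      then have "- v \<in> pos_roots n" using True lex_pos_uminus[of v n] by (simp add: pos_roots_eq roots_uminus)
      then have "ip l v \<le> 0" using dominant_ip_nonneg[OF l, of "- v"] lat by (simp add: ip_uminus)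
      then show ?thesis using False by (auto simp: aff_pos_def aff_root_def pos_roots_eq True int)
    qed
  qed (auto simp: aff_pos_def aff_root_def pos_roots_eq)
  also have "\<dots> \<longleftrightarrow> b \<in> (\<lambda>(v, m). (v, of_int m)) ` (SIGMA v:pos_roots n. {0..<\<lfloor>ip l v\<rfloor>})"
  proof
    assume *: "v \<in> pos_roots n \<and> m \<in> \<int> \<and> 0 \<le> m \<and> m < ip l v"
    then obtain k where k: "m = of_int k" by (auto elim: Ints_cases)
    have "ip l v = of_int \<lfloor>ip l v\<rfloor>"
      using ip_Ints[OF lat vin] * by (auto simp: pos_roots_eq elim: Ints_cases)
    then have "k < \<lfloor>ip l v\<rfloor>" using * k by (metis of_int_less_iff)
    then have "(v, k) \<in> (SIGMA v:pos_roots n. {0..<\<lfloor>ip l v\<rfloor>})" using * k by simp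
    then show "b \<in> (\<lambda>(v, m). (v, of_int m)) ` (SIGMA v:pos_roots n. {0..<\<lfloor>ip l v\<rfloor>})"
      by (rule rev_image_eqI) (simp add: b k)
  next
    assume "b \<in> (\<lambda>(v, m). (v, of_int m)) ` (SIGMA v:pos_roots n. {0..<\<lfloor>ip l v\<rfloor>})"
    then obtain k where "v \<in> pos_roots n" "m = of_int k" "0 \<le> k" "k < \<lfloor>ip l v\<rfloor>" by (auto simp: b)
    then show "v \<in> pos_roots n \<and> m \<in> \<int> \<and> 0 \<le> m \<and> m < ip l v"
      by (auto simp: less_floor_iff)
  qed
  finally show "b \<in> inversions (transl l) \<longleftrightarrow>
    b \<in> (\<lambda>(v, m). (v, of_int m)) ` (SIGMA v:pos_roots n. {0..<\<lfloor>ip l v\<rfloor>})" .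
qed

lemma finite_pos_roots: "finite (pos_roots n)"
  using finite_roots[of n] by (simp add: pos_roots_eq)

lemma card_inversions_transl:
  assumes "l \<in> dominant n"
  shows "card (inversions (transl l)) = (\<Sum>v\<in>pos_roots n. nat \<lfloor>ip l v\<rfloor>)"
proof -
  have "inj_on (\<lambda>(v, m). (v, of_int m :: real)) (SIGMA v:pos_roots n. {0..<\<lfloor>ip l v\<rfloor>})"
    by (auto simp: inj_on_def)
  then show ?thesis
    unfolding inversions_transl[OF assms] using finite_pos_roots by (simp add: card_image)
qed

lemma card_inversions_transl_add:
  assumes "l \<in> dominant n" "m \<in> dominant n"
  shows "card (inversions (transl (l + m))) = card (inversions (transl l)) + card (inversions (transl m))"
proof -
  have "nat \<lfloor>ip (l + m) v\<rfloor> = nat \<lfloor>ip l v\<rfloor> + nat \<lfloor>ip m v\<rfloor>" if "v \<in> pos_roots n" for v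
  proof -
    have "v \<in> lattice n" using that by (simp add: pos_roots_eq roots_def)
    then obtain y z where "ip l v = of_int y" "ip m v = of_int z"
      using ip_Ints dominant_lattice assms by (metis Ints_cases)
    then show ?thesis
      using dominant_ip_nonneg[OF assms(1) that] dominant_ip_nonneg[OF assms(2) that]
      by (simp add: ip_add dominant_lattice assms nat_add_distrib flip: of_int_add)
  qed
  then show ?thesis
    using assms by (simp add: card_inversions_transl dominant_add sum.distrib)
qed

text \<open>The number of inversions of \<open>\<tau>(l)\<close> is additive in the dominant vector \<open>l\<close>, so no cancellation
  occurs when two reduced words are concatenated.\<close>

lemma reduced_transl_append:
  assumes "l \<in> dominant n" "m \<in> dominant n"
    and "reduced u" "W u = transl l" "reduced v" "W v = transl m"
  shows "reduced (u @ v)" "W (u @ v) = transl (l + m)"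
proof -
  show eq: "W (u @ v) = transl (l + m)"
    using assms by (intro ext) (simp add: W_append transl_comp dominant_lattice)
  show "reduced (u @ v)"
  proof (rule reducedI_card)
    show "valid (u @ v)" using assms by (simp add: reduced_alt)
    show "length (u @ v) \<le> card (inversions (W (u @ v)))"
      unfolding eq card_inversions_transl_add[OF assms(1,2)]
      using reduced_inversions(2)[OF assms(3)] reduced_inversions(2)[OF assms(5)] assms by simp
  qed
qed

lemma ex_reduced_transl: "l \<in> dominant n \<Longrightarrow> \<exists>is. reduced is \<and> W is = transl l"
  using transl_dominant_grp[of l] ex_reduced unfolding grp_def by fastforce

end

section \<open>Hecke operators of reduced words\<close>

lemma simple_roots_inj:
  assumes "2 \<le> n" "i \<le> n" "j \<le> n" "simple_root n i = simple_root n j"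
  shows "i = j"
proof (rule ccontr)
  assume ne: "i \<noteq> j"
  have "coef (fst (simple_root n i)) k = coef (fst (simple_root n j)) k" "snd (simple_root n i) = snd (simple_root n j)" for k
    using assms(4) by simp_all
  from this(1)[of i] this(1)[of j] this(2) show False
    using ne assms(1-3) by (auto simp: simple_root_def coef_eps lookup_minus split: if_splits)
qed

context koorn
begin

abbreviation Tw :: "nat list \<Rightarrow> expalg \<Rightarrow> expalg" where "Tw \<equiv> hecke_word n p"

lemma Tw_Nil [simp]: "Tw [] f = f"
  by (simp add: hecke_word_def)

lemma Tw_Cons: "Tw (i # is) f = T i (Tw is f)"
  by (simp add: hecke_word_def)

lemma Tw_append: "Tw (u @ v) f = Tw u (Tw v f)"
  by (induction u) (simp_all add: Tw_Cons)

lemma Tw_laurent: "valid is \<Longrightarrow> f \<in> laurent n \<Longrightarrow> Tw is f \<in> laurent n"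
  by (induction "is") (auto simp: Tw_Cons T_laurent)

lemma Tw_bij: "valid is \<Longrightarrow> bij_betw (Tw is) (laurent n) (laurent n)"
proof (induction "is")
  case Nil
  then show ?case by (simp add: bij_betw_def inj_on_def)
next
  case (Cons i "is")
  then have "bij_betw (T i \<circ> Tw is) (laurent n) (laurent n)"
    using T_bij by (intro bij_betw_trans) auto
  then show ?case by (simp add: comp_def Tw_Cons[abs_def])
qed

text \<open>The three kinds of braid relation, together with the fact that no shorter one holds.\<close>

definition braid2 :: "nat \<Rightarrow> nat \<Rightarrow> bool"
  where "braid2 i j \<longleftrightarrow> W [i, j] = W [j, i] \<and> (\<forall>f\<in>laurent n. Tw [i, j] f = Tw [j, i] f)"

definition braid3 :: "nat \<Rightarrow> nat \<Rightarrow> bool"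
  where "braid3 i j \<longleftrightarrow> W [i, j] \<noteq> W [j, i] \<and> W [i, j, i] = W [j, i, j] \<and>
    (\<forall>f\<in>laurent n. Tw [i, j, i] f = Tw [j, i, j] f)"

definition braid4 :: "nat \<Rightarrow> nat \<Rightarrow> bool"
  where "braid4 i j \<longleftrightarrow> W [i, j] \<noteq> W [j, i] \<and> W [i, j, i] \<noteq> W [j, i, j] \<and>
    W [i, j, i, j] = W [j, i, j, i] \<and> (\<forall>f\<in>laurent n. Tw [i, j, i, j] f = Tw [j, i, j, i] f)"

lemma braid_sym: "braid2 i j \<longleftrightarrow> braid2 j i" "braid3 i j \<longleftrightarrow> braid3 j i" "braid4 i j \<longleftrightarrow> braid4 j i"
  by (auto simp: braid2_def braid3_def braid4_def)

lemma long_simple: "k \<le> n \<Longrightarrow> long (fst (a k)) \<longleftrightarrow> k = 0 \<or> k = n"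
  using n2 by (auto simp: long_def simple_root_def coef_eps lookup_minus split: if_splits)

lemma coef_simple_root: "coef (fst (a j)) k =
    (if j = 0 then if k = 1 then -2 else 0 else if j = n then if k = n then 2 else 0
     else if k = j then 1 else if k = j + 1 then -1 else 0)"
  by (auto simp: simple_root_def coef_eps lookup_minus)

lemma braid2I:
  assumes "i + 1 < j" "j \<le> n"
  shows "braid2 i j"
proof -
  have "W [i, j] = W [j, i]"
    using assms n2
    by (intro ext affvec_eqI) (auto simp: W_Cons coords flip_sign_def node_swap_def)
  moreover have "T i (T j f) = T j (T i f)" if "f \<in> laurent n" for f
  proof (rule T_commute[OF _ _ _ _ _ that])
    show "pairing (a i) (a j) = 0" "pairing (a j) (a i) = 0"
      using assms n2 by (auto simp: pairing_simple coef_simple_root)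
    show "ptrefl i (ptrefl j x) = ptrefl j (ptrefl i x)" for x
      using assms n2 by (intro ext) (auto simp: ptrefl_def node_swap_def)
  qed (use assms in auto)
  ultimately show ?thesis by (simp add: braid2_def Tw_Cons)
qed

lemma braid3I:
  assumes "0 < i" "i + 1 < n"
  shows "braid3 i (i + 1)"
proof -
  let ?j = "i + 1"
  have ij: "i \<le> n" "?j \<le> n" using assms by auto
  have pr: "pairing (a i) (a ?j) = -1" "pairing (a ?j) (a i) = -1"
    using assms n2 by (auto simp: pairing_simple coef_simple_root)
  have "W [i, ?j, i] = W [?j, i, ?j]"
    using assms n2
    by (intro ext affvec_eqI) (auto simp: W_Cons coords flip_sign_def node_swap_def)
  moreover have "W [i, ?j] \<noteq> W [?j, i]"
  proof
    assume eq: "W [i, ?j] = W [?j, i]"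
    have "s i (a ?j) = a i + a ?j" "s ?j (a i) = a i + a ?j"
      using ij pr by (simp_all add: s_eq aff_scale_minus)
    then have "s ?j (a i + a ?j) = a i" using ij s_invol by metis
    then have "W [?j, i] (a ?j) = a i" "W [i, ?j] (a ?j) = - (a i + a ?j)"
      using ij \<open>s i (a ?j) = _\<close> by (simp_all add: W_Cons s_simple_root s_uminus)
    then have "- (a i + a ?j) = a i" using eq by simp
    then have "coef (fst (- (a i + a ?j))) i = coef (fst (a i)) i" by simp
    then show False using assms n2 by (auto simp: simple_root_def coef_eps lookup_add lookup_minus)
  qed
  moreover have "T i (T ?j (T i f)) = T ?j (T i (T ?j f))" if "f \<in> laurent n" for f
  proof (rule T_braid3[OF ij pr _ _ _ _ that])
    show "\<not> long (fst (a i))" "\<not> long (fst (a ?j))" using assms by (simp_all add: long_simple)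
    show "tb (a i) = tb (a ?j)" using assms by (simp add: hecke_par_eq[symmetric] hecke_par_def)
    show "ptrefl i (ptrefl ?j (ptrefl i x)) = ptrefl ?j (ptrefl i (ptrefl ?j x))" for x
      using assms n2 by (intro ext) (auto simp: ptrefl_def node_swap_def)
  qed
  ultimately show ?thesis by (simp add: braid3_def Tw_Cons)
qed

lemma ptrefl_upd:
  "ptrefl 0 y = y(1 := par_q p / y 1)" "ptrefl n y = y(n := inverse (y n))"
  "0 < k \<Longrightarrow> k < n \<Longrightarrow> ptrefl k y = y(k := y (Suc k), Suc k := y k)"
  using n2 by (auto simp: ptrefl_def node_swap_def fun_eq_iff)

lemma braid4I:
  assumes "i = 1 \<and> j = 0 \<or> i = n - 1 \<and> j = n"
  shows "braid4 i j"
proof -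
  have ij: "i \<le> n" "j \<le> n" using assms n2 by auto
  have pr: "pairing (a i) (a j) = -2" "pairing (a j) (a i) = -1"
    using assms n2 by (auto simp: pairing_simple coef_simple_root)
  have len: "\<not> long (fst (a i))" "long (fst (a j))" using assms n2 by (auto simp: long_simple)
  have W4: "W [i, j, i, j] = W [j, i, j, i]"
    using assms n2
    by (intro ext affvec_eqI) (auto simp: W_Cons coords flip_sign_def node_swap_def)
  define c where "c = s i (a j)"
  have sc: "s j c = c"
  proof -
    have c: "c = a j + aff_scale 2 (a i)" using ij pr by (simp add: c_def s_eq aff_scale_minus)
    have "s j (a i) = a i + a j" using ij pr by (simp add: s_eq aff_scale_minus)
    then show ?thesis
      unfolding c aff_scale_two using ij by (simp add: s_add s_simple_root)
  qed
  have si: "s i c = a j" using ij by (simp add: c_def s_invol)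
  have cpos: "aff_pos n c" unfolding c_def
    using assms n2 simple_roots_inj[of n i j] by (intro s_pos[OF ij(1) simple_root_pos[OF ij(2)]]) auto
  then have cneg: "\<not> aff_pos n (- c)" using aff_pos_uminus aff_pos_root by blast
  have "W [i, j] \<noteq> W [j, i]"
  proof
    assume eq: "W [i, j] = W [j, i]"
    have "W [i, j] (a j) = - c" "W [j, i] (a j) = c"
      using ij sc by (simp_all add: W_Cons s_simple_root s_uminus c_def)
    then show False using eq cpos cneg by simp
  qed
  moreover have "W [i, j, i] \<noteq> W [j, i, j]"
  proof
    assume eq: "W [i, j, i] = W [j, i, j]"
    have "W [i, j, i] (a j) = a j" "W [j, i, j] (a j) = - c"
      using ij sc si by (simp_all add: W_Cons s_simple_root s_uminus c_def)
    then show False using eq simple_root_pos[OF ij(2)] cneg by simp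
  qed
  moreover have "T i (T j (T i (T j f))) = T j (T i (T j (T i f)))" if "f \<in> laurent n" for f
  proof (rule T_braid4[OF ij pr len _ that])
    show "ptrefl i (ptrefl j (ptrefl i (ptrefl j x))) = ptrefl j (ptrefl i (ptrefl j (ptrefl i x)))"
      if "nz_point x" for x
      using assms
    proof
      assume "i = 1 \<and> j = 0"
      then show ?thesis using n2 by (simp add: ptrefl_upd fun_eq_iff)
    next
      assume c: "i = n - 1 \<and> j = n"
      then have "0 < i" "i < n" "j = Suc i" "ptrefl (Suc i) y = y(Suc i := inverse (y (Suc i)))" for y
        using n2 ptrefl_upd(2)[of y] by auto
      then show ?thesis by (simp add: ptrefl_upd(3) fun_eq_iff)
    qed
  qed
  ultimately show ?thesis using W4 by (simp add: braid4_def Tw_Cons)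
qed

lemma braid_cases:
  assumes "i \<le> n" "j \<le> n" "i \<noteq> j"
  shows "braid2 i j \<or> braid3 i j \<or> braid4 i j"
proof -
  have *: "braid2 i j \<or> braid3 i j \<or> braid4 i j" if "i < j" "j \<le> n" for i j
  proof -
    have "i + 1 < j \<or> j = i + 1 \<and> i = 0 \<or> j = i + 1 \<and> 0 < i \<and> j < n \<or> j = i + 1 \<and> j = n"
      using that by linarith
    then consider "i + 1 < j" | "j = i + 1" "i = 0" | "j = i + 1" "0 < i" "j < n" | "j = i + 1" "j = n"
      by blast
    then show ?thesis
    proof cases
      case 1
      then show ?thesis using braid2I that by blast
    next
      case 2
      then show ?thesis using braid4I[of 1 0] braid_sym(3) by auto
    next
      case 3
      then show ?thesis using braid3I[of i] by auto
    next
      case 4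
      then have "braid4 i j" using that by (intro braid4I) linarith
      then show ?thesis by simp
    qed
  qed
  show ?thesis using *[of i j] *[of j i] assms braid_sym by (meson linorder_neqE_nat)
qed

lemma split_Cons2:
  assumes "x # y # r = us @ k # vs"
  shows "us = [] \<or> (us = [x] \<and> k = y \<and> vs = r) \<or> (\<exists>us'. us = x # y # us' \<and> r = us' @ k # vs)"
  using assms by (auto simp: Cons_eq_append_conv)

text \<open>Two reduced words of the same element are connected by braid relations, so they define the
  same operator (Matsumoto's theorem).\<close>

theorem Tw_well_defined:
  assumes "reduced is" "reduced js" "W is = W js" "f \<in> laurent n"
  shows "Tw is f = Tw js f"
  using assms(1-3)
proof (induction "length is" arbitrary: "is" js rule: less_induct)
  case less
  show ?case
  proof (cases "is")
    case Nil
    then have "length js = 0" using reduced_lengths[OF less.prems] by simp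
    then show ?thesis using Nil by simp
  next
    case (Cons i is')
    note lenj = reduced_lengths[OF less.prems]
    then obtain j js' where js: "js = j # js'" using Cons by (cases js) auto
    have v: "i \<le> n" "j \<le> n" "valid is'" "valid js'"
      using less.prems Cons js by (auto simp: reduced_alt)
    have red: "reduced w" if "valid w" "W w = W is" "length w = length is" for w
      using reduced_same_length[OF less.prems(1)] that by auto
    \<comment> \<open>words with a common first letter are settled by the induction hypothesis\<close>
    have head: "Tw (k # u) f = Tw (k # w) f"
      if "reduced (k # u)" "reduced (k # w)" "W (k # u) = W is" "W (k # w) = W is" for k u w
    proof -
      have k: "k \<le> n" using that(1) by (simp add: reduced_alt)
      have "length (k # u) = length is" using reduced_lengths[OF that(1) less.prems(1)] that(3) by simp
      moreover have "W u = W w" using W_cancel[OF k, of u w] that by simp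
      ultimately have "Tw u f = Tw w f"
        using less.hyps[of u w] reduced_ConsD(1)[OF that(1)] reduced_ConsD(1)[OF that(2)] by auto
      then show ?thesis by (simp add: Tw_Cons)
    qed
    have short: "length w \<ge> length is" if "valid w" "W w = W is" for w
      using less.prems(1) that by (auto simp: reduced_alt)
    show ?thesis
    proof (cases "i = j")
      case True
      then show ?thesis using head[of i is' js'] less.prems Cons js by simp
    next
      case False
      obtain us k vs where us: "is = us @ k # vs" "W is = W (j # us @ vs)"
        using left_descent_exchange[of j js' "is"] less.prems js by auto
      have "us \<noteq> []"
      proof
        assume "us = []"
        then have "W (j # is') = W (i # is')" using us Cons by simp
        then have "W [j] = W [i]" using W_cancel_right[OF v(3), of "[j]" "[i]"] by simp
        then have eq: "s j = s i" by (simp add: W_Cons)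
        have "aff_pos n (s j (a i))"
          using False simple_roots_inj[OF n2 v(1,2)] by (intro s_pos v simple_root_pos) auto
        moreover have "\<not> aff_pos n (s i (a i))"
          using aff_pos_uminus[OF simple_root_root[OF v(1)]] simple_root_pos[OF v(1)] s_simple_root[OF v(1)] by simp
        ultimately show False using eq by simp
      qed
      then obtain us' where us': "us = i # us'" "is' = us' @ k # vs" using us(1) Cons by (cases us) auto
      \<comment> \<open>The first exchange gives a reduced word of the same element that begins with \<open>j, i\<close>.\<close>
      define r where "r = us' @ vs"
      have vr: "valid r" "length is = Suc (Suc (length r))" using v(3) us' Cons by (auto simp: r_def)
      have w1: "W (j # i # r) = W is" using us(2) us' by (simp add: r_def)
      have rd1: "reduced (j # i # r)" using red[of "j # i # r"] v vr w1 by simp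
      consider "braid2 i j" | "braid3 i j \<or> braid4 i j" using braid_cases[OF v(1,2) False] by blast
      then show ?thesis
      proof cases
        case 1
        have "W ([i, j] @ r) = W ([j, i] @ r)" using 1 by (simp only: W_append braid2_def)
        then have "W (i # j # r) = W is" using w1 by simp
        then have rd2: "reduced (i # j # r)" using red v vr by simp
        have "Tw js f = Tw (j # i # r) f"
          unfolding js by (rule head) (use less.prems js rd1 w1 in auto)
        also have "\<dots> = Tw (i # j # r) f"
          using 1 Tw_laurent[OF vr(1) assms(4)] by (simp add: braid2_def Tw_Cons)
        also have "\<dots> = Tw is f"
          unfolding Cons by (rule head) (use less.prems Cons rd2 \<open>W (i # j # r) = W is\<close> in auto)
        finally show ?thesis ..
      next
        case 2
        then have nc: "W [i, j] \<noteq> W [j, i]" by (auto simp: braid3_def braid4_def)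
        \<comment> \<open>The second exchange, with \<open>i\<close>; the cases to be excluded contradict minimality or \<open>nc\<close>.\<close>
        obtain us k vs where us2: "j # i # r = us @ k # vs" "W (j # i # r) = W (i # us @ vs)"
          using left_descent_exchange[of i is' "j # i # r"] less.prems Cons rd1 w1 by auto
        have "us \<noteq> []"
        proof
          assume "us = []"
          then have "W (i # i # r) = W is" using us2 w1 by auto
          then have "W r = W is" using s_comp_invol[OF v(1)] by (simp add: W_Cons comp_assoc[symmetric])
          then show False using short[of r] vr by simp
        qed
        moreover have "\<not> (us = [j] \<and> k = i \<and> vs = r)"
        proof
          assume "us = [j] \<and> k = i \<and> vs = r"
          then have "W ([i, j] @ r) = W ([j, i] @ r)" using us2(2) by simp
          then have "W [i, j] = W [j, i]" by (rule W_cancel_right[OF vr(1)])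
          then show False using nc by simp
        qed
        ultimately obtain us' where us': "us = j # i # us'" "r = us' @ k # vs"
          using split_Cons2[OF us2(1)] by blast
        define r' where "r' = us' @ vs"
        have vr': "valid r'" "length is = Suc (Suc (Suc (length r')))" using vr us' by (auto simp: r'_def)
        have w2: "W (i # j # i # r') = W is" using us2(2) us' w1 by (simp add: r'_def)
        show ?thesis
          using 2
        proof
          assume ge3: "braid3 i j"
          have w3: "W (j # i # j # r') = W is"
          proof -
            have "W ([i, j, i] @ r') = W ([j, i, j] @ r')" using ge3 by (simp only: W_append braid3_def)
            then show ?thesis using w2 by simp
          qed
          have rd: "reduced (i # j # i # r')" "reduced (j # i # j # r')" using red v vr' w2 w3 by simp_all
          have "Tw js f = Tw (j # i # j # r') f"
            unfolding js by (rule head) (use less.prems js rd w3 in auto)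
          also have "\<dots> = Tw (i # j # i # r') f"
            using ge3 Tw_laurent[OF vr'(1) assms(4)] by (simp add: braid3_def Tw_Cons)
          also have "\<dots> = Tw is f"
            unfolding Cons by (rule head) (use less.prems Cons rd w2 in auto)
          finally show ?thesis ..
        next
          assume ge4: "braid4 i j"
          \<comment> \<open>The third exchange, with \<open>j\<close>.\<close>
          have rd2: "reduced (i # j # i # r')" using red v vr' w2 by simp
          obtain us k vs where us3: "i # j # i # r' = us @ k # vs" "W (i # j # i # r') = W (j # us @ vs)"
            using left_descent_exchange[of j js' "i # j # i # r'"] less.prems js rd2 w2 by auto
          have "us \<noteq> []"
          proof
            assume "us = []"
            then have "W (j # j # i # r') = W is" using us3 w2 by auto
            then have "W (i # r') = W is" using s_comp_invol[OF v(2)] by (simp add: W_Cons comp_assoc[symmetric])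
            then show False using short[of "i # r'"] vr' v by simp
          qed
          moreover have "\<not> (us = [i] \<and> k = j \<and> vs = i # r')"
          proof
            assume "us = [i] \<and> k = j \<and> vs = i # r'"
            then have "W (j # i # i # r') = W is" using us3(2) w2 by simp
            then have "W (j # r') = W is" using s_comp_invol[OF v(1)] by (simp add: W_Cons comp_assoc[symmetric])
            then show False using short[of "j # r'"] vr' v by simp
          qed
          ultimately obtain us0 where us0: "us = i # j # us0" "i # r' = us0 @ k # vs"
            using split_Cons2[OF us3(1)] by blast
          have "us0 \<noteq> []"
          proof
            assume "us0 = []"
            then have "W ([j, i, j] @ r') = W ([i, j, i] @ r')" using us3(2) us0 by simp
            then have "W [j, i, j] = W [i, j, i]" by (rule W_cancel_right[OF vr'(1)])
            then show False using ge4 by (simp add: braid4_def)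
          qed
          then obtain us1 where us1: "us0 = i # us1" "r' = us1 @ k # vs" using us0(2) by (cases us0) auto
          define r'' where "r'' = us1 @ vs"
          have vr'': "valid r''" "length is = Suc (Suc (Suc (Suc (length r''))))" using vr' us1 by (auto simp: r''_def)
          have w3: "W (j # i # j # i # r'') = W is" using us3(2) us0 us1 w2 by (simp add: r''_def)
          have w4: "W (i # j # i # j # r'') = W is"
          proof -
            have "W ([i, j, i, j] @ r'') = W ([j, i, j, i] @ r'')" using ge4 by (simp only: W_append braid4_def)
            then show ?thesis using w3 by simp
          qed
          have rd: "reduced (j # i # j # i # r'')" "reduced (i # j # i # j # r'')" using red v vr'' w3 w4 by simp_all
          have "Tw js f = Tw (j # i # j # i # r'') f"
            unfolding js by (rule head) (use less.prems js rd w3 in auto)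
          also have "\<dots> = Tw (i # j # i # j # r'') f"
            using ge4 Tw_laurent[OF vr''(1) assms(4)] by (simp add: braid4_def Tw_Cons)
          also have "\<dots> = Tw is f"
            unfolding Cons by (rule head) (use less.prems Cons rd w4 in auto)
          finally show ?thesis ..
        qed
      qed
    qed
  qed
qed

section \<open>The commuting operators \<open>Y\<^sup>\<lambda>\<close>\<close>

abbreviation Y :: "vec \<Rightarrow> expalg \<Rightarrow> expalg" where "Y \<equiv> Y_dom n p"

lemma Y_word:
  assumes "l \<in> dominant n"
  obtains "is" where "reduced is" "W is = transl l" "Y l = Tw is"
proof -
  define "is" where "is = (SOME is. reduced_expr n is (transl l))"
  obtain js where "reduced js" "W js = transl l" using ex_reduced_transl[OF assms] by blast
  then have "reduced_expr n js (transl l)" by (simp add: reduced_def)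
  then have "reduced_expr n is (transl l)" unfolding is_def by (rule someI)
  moreover from this have "W is = transl l" by (simp add: reduced_expr_def)
  ultimately show ?thesis
    using that[of "is"] by (simp add: reduced_def Y_dom_def hecke_elt_def is_def)
qed

lemma Y_laurent: "l \<in> dominant n \<Longrightarrow> f \<in> laurent n \<Longrightarrow> Y l f \<in> laurent n"
  by (metis Y_word Tw_laurent reduced_alt)

lemma Y_bij: "l \<in> dominant n \<Longrightarrow> bij_betw (Y l) (laurent n) (laurent n)"
  by (metis Y_word Tw_bij reduced_alt)

lemma Y_add:
  assumes l: "l \<in> dominant n" and m: "m \<in> dominant n" and f: "f \<in> laurent n"
  shows "Y (l + m) f = Y l (Y m f)"
proof -
  obtain u where u: "reduced u" "W u = transl l" "Y l = Tw u" using Y_word[OF l] .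
  obtain v where v: "reduced v" "W v = transl m" "Y m = Tw v" using Y_word[OF m] .
  obtain w where w: "reduced w" "W w = transl (l + m)" "Y (l + m) = Tw w"
    using Y_word[OF dominant_add[OF l m]] .
  have "Tw w f = Tw (u @ v) f"
    using reduced_transl_append[OF l m u(1,2) v(1,2)] w f by (intro Tw_well_defined) auto
  then show ?thesis by (simp add: u v w Tw_append)
qed

lemma Y_commute:
  assumes "l \<in> dominant n" "m \<in> dominant n" "f \<in> laurent n"
  shows "Y l (Y m f) = Y m (Y l f)"
  using Y_add[OF assms] Y_add[OF assms(2,1,3)] by (simp add: add.commute)

lemma Tw_add: "valid is \<Longrightarrow> f \<in> laurent n \<Longrightarrow> g \<in> laurent n \<Longrightarrow> Tw is (f + g) = Tw is f + Tw is g"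
  by (induction "is") (auto simp: Tw_Cons T_add Tw_laurent)

lemma Tw_smul: "valid is \<Longrightarrow> f \<in> laurent n \<Longrightarrow> Tw is (smul c f) = smul c (Tw is f)"
  by (induction "is") (auto simp: Tw_Cons T_smul Tw_laurent)

lemma Y_lin:
  assumes "l \<in> dominant n" "f \<in> laurent n" "g \<in> laurent n"
  shows "Y l (f + g) = Y l f + Y l g" "Y l (smul c f) = smul c (Y l f)"
proof -
  obtain u where u: "reduced u" "Y l = Tw u" using Y_word[OF assms(1)] by metis
  then show "Y l (f + g) = Y l f + Y l g" "Y l (smul c f) = smul c (Y l f)"
    using assms by (simp_all add: Tw_add Tw_smul reduced_alt)
qed

end

section \<open>The dominance order\<close>

context rank
begin

text \<open>Dominance is the comparison of partial sums, since the partial sums of \<open>m - l\<close> are its coefficients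
  in the basis \<open>a\<^sub>1, \<dots>, a\<^bsub>n-1\<^esub>, \<epsilon>\<^sub>n\<close> (\<open>dom_le_iff\<close>).\<close>

definition psum :: "vec \<Rightarrow> nat \<Rightarrow> real"
  where "psum l k = (\<Sum>i = 1..k. coef l i)"

lemma psum_Suc: "psum l (Suc k) = psum l k + coef l (Suc k)"
  by (simp add: psum_def)

lemma simple_comb_coef:
  fixes c :: "nat \<Rightarrow> real"
  shows "coef ((\<Sum>i = 1..<n. smul (c i) (eps i - eps (i + 1))) + smul (c n) (eps n)) j
    = (if 1 \<le> j \<and> j \<le> n then c j else 0) - (if 2 \<le> j \<and> j \<le> n then c (j - 1) else 0)"
proof -
  have "coef ((\<Sum>i = 1..<n. smul (c i) (eps i - eps (i + 1))) + smul (c n) (eps n)) j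
      = (\<Sum>i = 1..<n. c i * (if j = i then 1 else 0)) - (\<Sum>i = 1..<n. c i * (if j = i + 1 then 1 else 0))
        + c n * (if j = n then 1 else 0)"
    by (simp add: lookup_add lookup_sum lookup_minus coef_eps right_diff_distrib sum_subtractf)
  also have "(\<Sum>i = 1..<n. c i * (if j = i then 1 else 0)) = (if 1 \<le> j \<and> j < n then c j else 0)"
    by (simp add: if_distrib[of "\<lambda>x. _ * x"] sum.delta' cong: if_cong)
  also have "(\<Sum>i = 1..<n. c i * (if j = i + 1 then 1 else 0)) = (if 2 \<le> j \<and> j \<le> n then c (j - 1) else 0)"
  proof -
    have "(\<Sum>i = 1..<n. c i * (if j = i + 1 then 1 else 0))
        = (\<Sum>i = 1..<n. if i = j - 1 then (if j = 0 then 0 else c i) else 0)"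
      by (intro sum.cong) auto
    then show ?thesis by (simp add: sum.delta) (auto simp: not_le)
  qed
  finally show ?thesis using n2 by auto
qed

lemma dom_le_iff:
  assumes l: "l \<in> lattice n" and m: "m \<in> lattice n"
  shows "dom_le n l m \<longleftrightarrow> (\<forall>k\<in>{1..n}. psum l k \<le> psum m k)"
proof
  assume "dom_le n l m"
  then obtain c :: "nat \<Rightarrow> nat" where
    c: "m - l = (\<Sum>i = 1..<n. smul (real (c i)) (eps i - eps (i + 1))) + smul (real (c n)) (eps n)"
    unfolding dom_le_def by blast
  have co: "coef m j - coef l j = real (c j) - (if 2 \<le> j then real (c (j - 1)) else 0)" if "1 \<le> j" "j \<le> n" for j
    using simple_comb_coef[of "\<lambda>i. real (c i)" j] that unfolding c[symmetric] by (simp add: lookup_minus)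
  have "psum m k - psum l k = real (c k)" if "1 \<le> k" "k \<le> n" for k
    using that
  proof (induction k rule: dec_induct)
    case base
    then show ?case using co[of 1] by (simp add: psum_def)
  next
    case (step k)
    then show ?case using co[of "Suc k"] by (simp add: psum_Suc)
  qed
  then show "\<forall>k\<in>{1..n}. psum l k \<le> psum m k" by (metis atLeastAtMost_iff diff_ge_0_iff_ge of_nat_0_le_iff)
next
  assume le: "\<forall>k\<in>{1..n}. psum l k \<le> psum m k"
  define c where "c k = nat \<lfloor>psum m k - psum l k\<rfloor>" for k
  have cr: "real (c k) = psum m k - psum l k" if "1 \<le> k" "k \<le> n" for k
  proof -
    have "psum m k - psum l k \<in> \<int>"
      unfolding psum_def using lattice_Ints[OF l] lattice_Ints[OF m] by (intro Ints_diff Ints_sum) auto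
    then obtain z where "psum m k - psum l k = of_int z" by (auto elim: Ints_cases)
    moreover have "0 \<le> psum m k - psum l k" using le that by simp
    ultimately show ?thesis by (simp add: c_def)
  qed
  have "m - l = (\<Sum>i = 1..<n. smul (real (c i)) (eps i - eps (i + 1))) + smul (real (c n)) (eps n)"
  proof (rule poly_mapping_eqI)
    fix j
    have "coef (m - l) j
        = (if 1 \<le> j \<and> j \<le> n then real (c j) else 0) - (if 2 \<le> j \<and> j \<le> n then real (c (j - 1)) else 0)"
    proof (cases "j \<in> {1..n}")
      case True
      then obtain k where k: "j = Suc k" by (cases j) auto
      show ?thesis
        using True cr[of j] cr[of k] unfolding k by (cases "k = 0") (auto simp: psum_Suc lookup_minus psum_def)
    next
      case False
      then show ?thesis
        using lattice_outside[OF l False] lattice_outside[OF m False] by (auto simp: lookup_minus)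
    qed
    then show "coef (m - l) j = coef ((\<Sum>i = 1..<n. smul (real (c i)) (eps i - eps (i + 1))) + smul (real (c n)) (eps n)) j"
      using simple_comb_coef[of "\<lambda>i. real (c i)" j] by simp
  qed
  then show "dom_le n l m" unfolding dom_le_def by blast
qed

lemma dom_le_trans:
  "l \<in> lattice n \<Longrightarrow> m \<in> lattice n \<Longrightarrow> k \<in> lattice n \<Longrightarrow> dom_le n l m \<Longrightarrow> dom_le n m k \<Longrightarrow> dom_le n l k"
  by (auto simp: dom_le_iff intro: order_trans)

lemma dom_le_antisym:
  assumes l: "l \<in> lattice n" and m: "m \<in> lattice n" and "dom_le n l m" "dom_le n m l"
  shows "l = m"
proof (rule lattice_eqI[OF l m])
  have eq: "psum l k = psum m k" if "k \<le> n" for k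
    using assms that by (cases "k = 0") (auto simp: dom_le_iff psum_def intro: antisym)
  fix i assume "i \<in> {1..n}"
  then obtain k where "i = Suc k" "Suc k \<le> n" by (cases i) auto
  then show "coef l i = coef m i" using eq[of k] eq[of "Suc k"] by (simp add: psum_Suc)
qed

text \<open>The hinge sums are convex and invariant under the Weyl group, and determine the partial sums
  of a dominant vector; so they control both dominance and the dominant representative.\<close>

definition hinge :: "real \<Rightarrow> vec \<Rightarrow> real"
  where "hinge c l = (\<Sum>i = 1..n. max (\<bar>coef l i\<bar> - c) 0)"

definition sqnorm :: "vec \<Rightarrow> real"
  where "sqnorm l = (\<Sum>i = 1..n. (coef l i)\<^sup>2)"

lemma psum_le_hinge:
  assumes "k \<le> n"
  shows "psum l k \<le> real k * c + hinge c l"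
proof -
  have "psum l k \<le> (\<Sum>i = 1..k. c + max (\<bar>coef l i\<bar> - c) 0)"
    unfolding psum_def by (intro sum_mono) auto
  also have "\<dots> = real k * c + (\<Sum>i = 1..k. max (\<bar>coef l i\<bar> - c) 0)"
    by (simp add: sum.distrib)
  also have "\<dots> \<le> real k * c + hinge c l"
    unfolding hinge_def using assms by (intro add_left_mono sum_mono2) auto
  finally show ?thesis .
qed

lemma psum_dominant:
  assumes d: "d \<in> dominant n" and k: "1 \<le> k" "k \<le> n"
  shows "psum d k = real k * coef d k + hinge (coef d k) d"
proof -
  have "hinge (coef d k) d = (\<Sum>i = 1..k. coef d i - coef d k)"
    unfolding hinge_def
  proof (rule sum.mono_neutral_cong_right)
    show "\<forall>i\<in>{1..n} - {1..k}. max (\<bar>coef d i\<bar> - coef d k) 0 = 0"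
      using dominant_mono[OF d, of k] dominant_nonneg[OF d] k by auto
    show "max (\<bar>coef d i\<bar> - coef d k) 0 = coef d i - coef d k" if "i \<in> {1..k}" for i
      using dominant_mono[OF d, of i k] dominant_nonneg[OF d, of i] that k by auto
  qed (use k in auto)
  then show ?thesis by (simp add: sum_subtractf psum_def)
qed

lemma dom_le_hinge:
  assumes d: "d \<in> dominant n" and l: "l \<in> lattice n" and le: "\<And>c. 0 \<le> c \<Longrightarrow> hinge c l \<le> hinge c d"
  shows "dom_le n l d"
  unfolding dom_le_iff[OF l dominant_lattice[OF d]]
proof
  fix k assume k: "k \<in> {1..n}"
  have "psum l k \<le> real k * coef d k + hinge (coef d k) l" using k by (intro psum_le_hinge) auto
  also have "\<dots> \<le> psum d k" using psum_dominant[OF d, of k] le[OF dominant_nonneg[OF d]] k by simp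
  finally show "psum l k \<le> psum d k" .
qed

text \<open>Equality of the multisets of absolute values of the coordinates, in a form that can be applied
  to any invariant given by a sum.\<close>

definition rearr :: "vec \<Rightarrow> vec \<Rightarrow> bool"
  where "rearr l m \<longleftrightarrow> (\<forall>F :: real \<Rightarrow> real. (\<Sum>i = 1..n. F \<bar>coef l i\<bar>) = (\<Sum>i = 1..n. F \<bar>coef m i\<bar>))"

lemma weyl_props:
  assumes "w \<in> weyl n" "l \<in> lattice n"
  shows "\<exists>l'. w (l, 0) = (l', 0) \<and> l' \<in> lattice n \<and> rearr l' l"
proof -
  obtain "is" where w: "w = W is" "set is \<subseteq> {1..n}" using assms(1) by (auto simp: weyl_def)
  from w(2) have "\<exists>l'. W is (l, 0) = (l', 0) \<and> l' \<in> lattice n \<and> rearr l' l"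
  proof (induction "is")
    case Nil
    then show ?case using assms(2) by (simp add: rearr_def)
  next
    case (Cons i "is")
    then obtain l' where l': "W is (l, 0) = (l', 0)" "l' \<in> lattice n" "rearr l' l" by auto
    have i: "i \<le> n" "i \<noteq> 0" using Cons.prems by auto
    have "snd (s i (l', 0)) = 0" using i by (simp add: coords)
    moreover have "W (i # is) (l, 0) = s i (l', 0)" by (simp add: W_Cons l'(1))
    ultimately have "W (i # is) (l, 0) = (fst (s i (l', 0)), 0)" by (simp add: prod_eq_iff)
    moreover have "fst (s i (l', 0)) \<in> lattice n" using s_lattice[OF i(1), of "(l', 0)"] l' by simp
    moreover have "rearr (fst (s i (l', 0))) l"
      unfolding rearr_def
    proof
      fix F :: "real \<Rightarrow> real"
      show "(\<Sum>j = 1..n. F \<bar>coef (fst (s i (l', 0))) j\<bar>) = (\<Sum>j = 1..n. F \<bar>coef l j\<bar>)"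
        using l'(3) sum_abs_s[OF i(1), of F "(l', 0)"] unfolding rearr_def by simp
    qed
    ultimately show ?case by auto
  qed
  then show ?thesis by (simp add: w)
qed

text \<open>A reflection in a simple root that pairs negatively with \<open>l\<close> increases the height \<open>ht\<close>, which is
  bounded on the orbit because the \<open>l\<^sup>1\<close>-norm is invariant.\<close>

lemma ex_dominant_rep:
  assumes "l \<in> lattice n"
  shows "\<exists>m\<in>dominant n. \<exists>is. set is \<subseteq> {1..n} \<and> W is (l, 0) = (m, 0)"
proof -
  define ht where "ht l = (\<Sum>i = 1..n. real (n + 1 - i) * coef l i)" for l
  define B where "B l = real (n + 1) * l1 n l - ht l" for l
  have B0: "0 \<le> B l" for l
  proof -
    have "ht l \<le> (\<Sum>i = 1..n. real (n + 1) * \<bar>coef l i\<bar>)"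
      unfolding ht_def by (intro sum_mono) (simp add: order_trans[OF mult_left_mono[OF abs_ge_self] mult_right_mono])
    then show ?thesis by (simp add: B_def l1_def sum_distrib_left)
  qed
  show ?thesis
    using assms
  proof (induction "nat \<lfloor>B l\<rfloor>" arbitrary: l rule: less_induct)
    case less
    show ?case
    proof (cases "l \<in> dominant n")
      case True
      then show ?thesis by (intro bexI[of _ l] exI[of _ "[]"]) auto
    next
      case False
      have "\<exists>i\<in>{1..n}. pairing (ar i) (l, 0) < 0"
      proof (rule ccontr)
        assume "\<not> ?thesis"
        then have p: "0 \<le> pairing (ar i) (l, 0)" if "i \<in> {1..n}" for i using that by (meson not_le)
        have step: "coef l (i + 1) \<le> coef l i" if "i \<in> {1..<n}" for i
          using p[of i] that by (simp add: pairing_simple)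
        have cn: "0 \<le> coef l n" using p[of n] n2 by (simp add: pairing_simple)
        have "0 \<le> coef l i" if "i \<le> n" "1 \<le> i" for i
          using that
        proof (induction i rule: inc_induct)
          case base
          show ?case by (rule cn)
        next
          case (step i)
          then show ?case using step.IH \<open>\<And>i. i \<in> {1..<n} \<Longrightarrow> coef l (i + 1) \<le> coef l i\<close>[of i] by simp
        qed
        then have "l \<in> dominant n" using step less.prems by (auto simp: dominant_def)
        then show False using False by simp
      qed
      then obtain i where i: "i \<in> {1..n}" "pairing (ar i) (l, 0) < 0" by blast
      let ?l = "fst (s i (l, 0))"
      have il: "i \<le> n" "i \<noteq> 0" using i by auto
      have lat: "?l \<in> lattice n" using s_lattice[OF il(1), of "(l, 0)"] less.prems by simp
      have eq: "s i (l, 0) = (?l, 0)" using il by (simp add: prod_eq_iff coords)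
      have co: "coef ?l j = coef l j - pairing (ar i) (l, 0) * coef (fst (ar i)) j" for j
        by (simp add: s_eq[OF il(1)] lookup_minus)
      have hta: "1 \<le> ht (fst (ar i))"
      proof (cases "i = n")
        case True
        have "ht (fst (ar i)) = (\<Sum>k = 1..n. if k = n then 2 else 0)"
          unfolding ht_def using True n2 by (intro sum.cong) (auto simp: simple_root_def coef_eps)
        then show ?thesis using n2 by simp
      next
        case False
        then have "ht (fst (ar i)) = real (n + 1 - i) * coef (fst (ar i)) i + real (n + 1 - (i + 1)) * coef (fst (ar i)) (i + 1)"
          unfolding ht_def using i by (intro sum_two) (auto simp: simple_root_def coef_eps lookup_minus)
        then show ?thesis using False i by (simp add: simple_root_def coef_eps lookup_minus of_nat_diff)
      qed
      have "pairing (ar i) (l, 0) \<in> \<int>"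
        using simple_root_root[OF il(1)] less.prems by (intro pairing_Ints) (auto simp: aff_root_def)
      then obtain z where z: "pairing (ar i) (l, 0) = of_int z" by (auto elim: Ints_cases)
      then have z1: "pairing (ar i) (l, 0) \<le> -1" using i(2) by simp
      have "ht ?l = ht l - pairing (ar i) (l, 0) * ht (fst (ar i))"
        unfolding ht_def co by (simp add: right_diff_distrib sum_subtractf sum_distrib_left mult.left_commute)
      moreover have "1 * 1 \<le> - pairing (ar i) (l, 0) * ht (fst (ar i))"
        using z1 hta by (intro mult_mono) auto
      ultimately have "B ?l \<le> B l - 1"
        using l1_s[OF il(1), of "(l, 0)"] by (simp add: B_def)
      then have "nat \<lfloor>B ?l\<rfloor> < nat \<lfloor>B l\<rfloor>" using B0[of ?l] by linarith
      from less.hyps[OF this lat] obtain m "is"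
        where m: "m \<in> dominant n" "set is \<subseteq> {1..n}" "W is (?l, 0) = (m, 0)" by blast
      have "W (is @ [i]) (l, 0) = (m, 0)" using m(3) eq by (simp add: W_append W_Cons)
      then show ?thesis using m i by (intro bexI[of _ m] exI[of _ "is @ [i]"]) auto
    qed
  qed
qed

lemma hinge_inv: "rearr l m \<Longrightarrow> hinge c l = hinge c m"
  unfolding hinge_def rearr_def by (elim allE)

lemma sqnorm_inv: "rearr l m \<Longrightarrow> sqnorm l = sqnorm m"
  unfolding rearr_def sqnorm_def by (drule spec[of _ "\<lambda>x. x\<^sup>2"]) simp

lemma dominant_hinge_eq:
  assumes "d \<in> dominant n" "e \<in> dominant n" "\<And>c. 0 \<le> c \<Longrightarrow> hinge c d = hinge c e"
  shows "d = e"
  using assms by (intro dom_le_antisym dom_le_hinge dominant_lattice) auto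

lemma dom_part_props:
  assumes l: "l \<in> lattice n"
  shows "dom_part n l \<in> dominant n" "hinge c (dom_part n l) = hinge c l" "sqnorm (dom_part n l) = sqnorm l"
proof -
  let ?P = "\<lambda>m. m \<in> dominant n \<and> (\<exists>w\<in>weyl n. w (l, 0) = (m, 0))"
  have inv: "rearr m l" if P: "?P m" for m
  proof -
    obtain w where w: "w \<in> weyl n" "w (l, 0) = (m, 0)" using P by blast
    show ?thesis using weyl_props[OF w(1) l] w(2) by auto
  qed
  obtain m "is" where "m \<in> dominant n" "set is \<subseteq> {1..n}" "W is (l, 0) = (m, 0)"
    using ex_dominant_rep[OF l] by blast
  then have m: "?P m" by (auto simp: weyl_def)
  have "dom_part n l = m"
    unfolding dom_part_def
  proof (rule the_equality[where P = ?P, OF m])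
    fix m' assume m': "?P m'"
    show "m' = m"
      using m m' hinge_inv[OF inv[OF m]] hinge_inv[OF inv[OF m']] by (intro dominant_hinge_eq) auto
  qed
  then show "dom_part n l \<in> dominant n" "hinge c (dom_part n l) = hinge c l" "sqnorm (dom_part n l) = sqnorm l"
    using m hinge_inv[OF inv[OF m]] sqnorm_inv[OF inv[OF m]] by auto
qed

lemma dom_part_lattice: "l \<in> lattice n \<Longrightarrow> dom_part n l \<in> lattice n"
  by (rule dominant_lattice[OF dom_part_props(1)])

lemma dom_part_le:
  assumes "l \<in> lattice n" "m \<in> lattice n" "\<And>c. 0 \<le> c \<Longrightarrow> hinge c l \<le> hinge c m"
  shows "dom_le n (dom_part n l) (dom_part n m)"
  using assms dom_part_props[of l] dom_part_props[of m] dom_part_lattice by (intro dom_le_hinge) auto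

lemma prec_irrefl: "\<not> prec n l l"
  by (simp add: prec_def)

lemma prec_trans:
  assumes "k \<in> lattice n" "l \<in> lattice n" "m \<in> lattice n" "prec n k l" "prec n l m"
  shows "prec n k m"
proof -
  note lat = assms(1-3) assms(1-3)[THEN dom_part_lattice]
  have eq: "prec_eq n k m"
    using assms(4,5) lat unfolding prec_def prec_eq_def
    by (smt (verit) dom_le_antisym dom_le_trans)
  moreover have "k \<noteq> m"
  proof
    assume "k = m"
    then have "prec_eq n k l" "prec_eq n l k" using assms by (auto simp: prec_def)
    then have "k = l" using lat unfolding prec_eq_def by (metis dom_le_antisym)
    then show False using assms(4) prec_irrefl by simp
  qed
  ultimately show ?thesis by (simp add: prec_def)
qed

lemma prec_imp_dom_le:
  assumes "l \<in> lattice n" "prec n l m"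
  shows "dom_le n (dom_part n l) (dom_part n m)"
proof -
  have "dom_le n (dom_part n l) (dom_part n l)" using dom_part_lattice[OF assms(1)] by (simp add: dom_le_iff)
  then show ?thesis using assms unfolding prec_def prec_eq_def by auto
qed

lemma finite_below:
  assumes m: "m \<in> lattice n"
  shows "finite {l \<in> lattice n. prec n l m}"
proof (rule finite_subset[OF _ finite_lattice_box])
  let ?c = "coef (dom_part n m) 1"
  show "{l \<in> lattice n. prec n l m} \<subseteq> {l \<in> lattice n. \<forall>i\<in>{1..n}. \<bar>coef l i\<bar> \<le> ?c}"
  proof clarify
    fix l i assume l: "l \<in> lattice n" "prec n l m" and i: "i \<in> {1..n}"
    note d = dom_part_props(1)[OF l(1)]
    have "psum (dom_part n l) 1 \<le> psum (dom_part n m) 1"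
      using prec_imp_dom_le[OF l] l(1) m n2 by (simp add: dom_le_iff dom_part_lattice)
    then have le: "coef (dom_part n l) 1 \<le> ?c" by (simp add: psum_def)
    have "\<bar>coef (dom_part n l) k\<bar> \<le> ?c" if "k \<in> {1..n}" for k
      using dominant_mono[OF d, of 1 k] dominant_nonneg[OF d, of k] le that by auto
    then have "hinge ?c (dom_part n l) = 0" by (auto simp: hinge_def intro!: sum.neutral)
    then have "(\<Sum>i = 1..n. max (\<bar>coef l i\<bar> - ?c) 0) = 0"
      using dom_part_props(2)[OF l(1)] by (simp add: hinge_def)
    then have "\<forall>i\<in>{1..n}. max (\<bar>coef l i\<bar> - ?c) 0 = 0"
      by (subst (asm) sum_nonneg_eq_0_iff) auto
    then have "max (\<bar>coef l i\<bar> - ?c) 0 = 0" using i by blast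
    then show "\<bar>coef l i\<bar> \<le> ?c" by linarith
  qed
qed

subsection \<open>Root strings and the order\<close>

lemma reflect_abs_sum:
  assumes l: "l \<in> lattice n" and v: "v \<in> roots n"
  defines "r \<equiv> pairing (v, 0) (l, 0)"
  shows "(\<Sum>i = 1..n. F \<bar>coef (l - smul r v) i\<bar>) = (\<Sum>i = 1..n. (F \<bar>coef l i\<bar> :: real))"
  using v
proof (cases rule: roots_cases)
  case (long i u)
  have r: "r = u * coef l i" using pairing_root[of "(v, 0)" u i "(l, 0)"] long by (simp add: r_def)
  then have "\<bar>coef (l - smul r v) k\<bar> = \<bar>coef l k\<bar>" for k
    using long by (auto simp: lookup_minus coef_eps)
  then show ?thesis by simp
next
  case (short i j u w)
  have r: "r = u * coef l i + w * coef l j"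
    using pairing_root_short[of "(v, 0)" u i w j "(l, 0)"] short by (simp add: r_def)
  let ?t = "\<lambda>k. if k = i then j else if k = j then i else k"
  have abs: "\<bar>coef (l - smul r v) k\<bar> = \<bar>coef l (?t k)\<bar>" for k
    using short r by (auto simp: lookup_minus lookup_add coef_eps)
  have "bij_betw ?t {1..n} {1..n}"
    using short by (intro bij_betw_byWitness[where f' = ?t]) auto
  then have "(\<Sum>k = 1..n. F \<bar>coef l (?t k)\<bar>) = (\<Sum>i = 1..n. F \<bar>coef l i\<bar>)"
    by (rule sum.reindex_bij_betw)
  then show ?thesis by (simp only: abs)
qed

lemma reflect_lattice:
  assumes l: "l \<in> lattice n" and v: "v \<in> roots n"
  shows "l - smul (pairing (v, 0) (l, 0)) v \<in> lattice n"
  using assms pairing_Ints[of "(v, 0)" "(l, 0)"]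
  by (intro lattice_simps lattice_smul) (auto simp: roots_def)

lemma sqnorm_pairing:
  assumes l: "l \<in> lattice n" and v: "v \<in> roots n"
  shows "2 * ip l v = pairing (v, 0) (l, 0) * sqnorm v" "0 < sqnorm v"
proof -
  have lat: "v \<in> lattice n" using v by (simp add: roots_def)
  have sq: "aff_inner (v, 0) (v, 0) = sqnorm v"
    using lat by (simp add: aff_inner_vec sqnorm_def power2_eq_square)
  have "\<exists>i\<in>{1..n}. coef v i \<noteq> 0"
  proof (rule ccontr)
    assume "\<not> ?thesis"
    then have "l1 n v = 0" by (simp add: l1_def)
    then show False using v by (simp add: roots_def)
  qed
  then obtain i where "i \<in> {1..n}" "coef v i \<noteq> 0" by blast
  then show pos: "0 < sqnorm v" unfolding sqnorm_def by (intro sum_pos2[of _ i]) auto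
  show "2 * ip l v = pairing (v, 0) (l, 0) * sqnorm v"
    using pos by (simp add: pairing_def aff_inner_coroot ip_def sq)
qed

lemma hinge_convex:
  assumes "0 \<le> th" "th \<le> 1"
  shows "hinge c (smul (1 - th) l + smul th m) \<le> (1 - th) * hinge c l + th * hinge c m"
  unfolding hinge_def sum_distrib_left sum.distrib[symmetric]
proof (rule sum_mono)
  fix i
  have *: "\<bar>(1 - th) * x + th * y\<bar> \<le> (1 - th) * \<bar>x\<bar> + th * \<bar>y\<bar>" for x y :: real
    using assms abs_triangle_ineq[of "(1 - th) * x" "th * y"] by (simp add: abs_mult)
  have **: "max ((1 - th) * x + th * y) 0 \<le> (1 - th) * max x 0 + th * max y 0" for x y :: real
    using assms by (auto intro!: max.boundedI add_mono mult_left_mono add_nonneg_nonneg mult_nonneg_nonneg)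
  have "max (\<bar>coef (smul (1 - th) l + smul th m) i\<bar> - c) 0
      \<le> max ((1 - th) * (\<bar>coef l i\<bar> - c) + th * (\<bar>coef m i\<bar> - c)) 0"
    using *[of "coef l i" "coef m i"] by (intro max.mono) (auto simp: lookup_add algebra_simps)
  also have "\<dots> \<le> (1 - th) * max (\<bar>coef l i\<bar> - c) 0 + th * max (\<bar>coef m i\<bar> - c) 0" by (rule **)
  finally show "max (\<bar>coef (smul (1 - th) l + smul th m) i\<bar> - c) 0
      \<le> (1 - th) * max (\<bar>coef l i\<bar> - c) 0 + th * max (\<bar>coef m i\<bar> - c) 0" .
qed

text \<open>A lattice point strictly between \<open>l\<close> and its reflection \<open>s\<^sub>v l\<close>: by convexity its hinge sums are at
  most those of the end points, and by strict convexity its Euclidean norm is smaller, so its dominant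
  representative is strictly below that of \<open>l\<close>.\<close>

lemma prec_interior:
  assumes l: "l \<in> lattice n" and v: "v \<in> roots n"
  defines "r \<equiv> pairing (v, 0) (l, 0)"
  assumes th: "0 < th" "th < 1" and r: "r \<noteq> 0" and x: "l - smul (th * r) v \<in> lattice n"
  shows "prec n (l - smul (th * r) v) l"
proof -
  let ?x = "l - smul (th * r) v"
  have comb: "?x = smul (1 - th) l + smul th (l - smul r v)"
    by (rule poly_mapping_eqI) (simp add: lookup_add lookup_minus algebra_simps)
  have hr: "hinge c (l - smul r v) = hinge c l" for c
    unfolding hinge_def r_def by (rule reflect_abs_sum[OF l v])
  have "hinge c ?x \<le> hinge c l" for c
    using hinge_convex[of th c l "l - smul r v"] th unfolding comb[symmetric] hr by (simp add: algebra_simps)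
  then have le: "dom_le n (dom_part n ?x) (dom_part n l)" by (intro dom_part_le x l)
  have "sqnorm ?x = sqnorm l - th * r * (2 * ip l v) + (th * r)\<^sup>2 * sqnorm v"
    using l by (simp add: sqnorm_def ip_def aff_inner_vec lookup_minus power2_diff sum.distrib sum_subtractf
        sum_distrib_left power_mult_distrib) (simp add: algebra_simps)
  also have "\<dots> = sqnorm l - th * (1 - th) * r\<^sup>2 * sqnorm v"
    unfolding sqnorm_pairing(1)[OF l v, folded r_def] by (simp add: algebra_simps power2_eq_square)
  also have "\<dots> < sqnorm l"
    using th r sqnorm_pairing(2)[OF l v] by (simp add: zero_less_mult_iff)
  finally have lt: "sqnorm ?x < sqnorm l" .
  then have "dom_part n ?x \<noteq> dom_part n l" "?x \<noteq> l"
    using dom_part_props(3)[OF l] dom_part_props(3)[OF x] by auto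
  then show ?thesis using le by (simp add: prec_def prec_eq_def)
qed

lemma psum_pos_root:
  assumes "v \<in> pos_roots n"
  shows "0 \<le> psum v k"
proof -
  have e: "psum (eps i) k = (if 1 \<le> i \<and> i \<le> k then 1 else 0)" for i
    by (simp add: psum_def coef_eps)
  have lin: "psum (x + y) k = psum x k + psum y k" "psum (x - y) k = psum x k - psum y k"
    "psum (smul c x) k = c * psum x k" for x y c
    by (simp_all add: psum_def lookup_add lookup_minus sum.distrib sum_subtractf sum_distrib_left)
  show ?thesis using assms unfolding pos_roots_def by (auto simp: lin e)
qed

text \<open>The reflected point has the same dominant representative, and it is lower by a positive multiple
  of a positive root.\<close>

lemma prec_reflect:
  assumes l: "l \<in> lattice n" and v: "v \<in> pos_roots n"
  defines "r \<equiv> pairing (v, 0) (l, 0)"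
  assumes r: "0 < r"
  shows "prec n (l - smul r v) l"
proof -
  let ?x = "l - smul r v"
  have vr: "v \<in> roots n" using v by (simp add: pos_roots_eq)
  have x: "?x \<in> lattice n" unfolding r_def by (rule reflect_lattice[OF l vr])
  have "hinge c ?x = hinge c l" for c
    unfolding hinge_def r_def by (rule reflect_abs_sum[OF l vr])
  then have "dom_part n ?x = dom_part n l"
    using dom_part_props[OF l] dom_part_props[OF x] by (intro dominant_hinge_eq) auto
  moreover have "dom_le n ?x l"
    unfolding dom_le_iff[OF x l]
  proof
    fix k
    have "psum ?x k = psum l k - r * psum v k"
      by (simp add: psum_def lookup_minus sum_subtractf sum_distrib_left)
    then show "psum ?x k \<le> psum l k" using psum_pos_root[OF v] r by simp
  qed
  moreover have "?x \<noteq> l"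
  proof
    assume "?x = l"
    then have "smul r v = 0" by simp
    then have "smul (1 / r) (smul r v) = 0" by simp
    then show False using r roots_nonzero[OF vr] by simp
  qed
  ultimately show ?thesis by (simp add: prec_def prec_eq_def)
qed

end

section \<open>Triangularity and eigenvalues\<close>

context rank
begin

lemma prod_pos_roots:
  "prod F (pos_roots n) = (\<Prod>i = 1..n. F (smul 2 (eps i)))
    * (\<Prod>j = 1..n. \<Prod>i = 1..<j. F (eps i + eps j) * F (eps i - eps j))"
proof -
  let ?P = "SIGMA j:{1..n}. {1..<j}"
  let ?f = "\<lambda>i. smul 2 (eps i) :: vec"
  let ?g = "\<lambda>(j, i). eps i + eps j" and ?h = "\<lambda>(j, i). eps i - eps j"
  have eq: "pos_roots n = ?f ` {1..n} \<union> (?g ` ?P \<union> ?h ` ?P)"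
    unfolding pos_roots_def by (fastforce simp: image_iff)
  have c: "coef (?f i) k = (if k = i then 2 else 0)" "coef (eps i + eps j) k = (if k = i then 1 else 0) + (if k = j then 1 else 0)"
    "coef (eps i - eps j) k = (if k = i then 1 else 0) - (if k = j then 1 else 0)" for i j k
    by (simp_all add: coef_eps lookup_add lookup_minus)
  have inj: "inj_on ?f {1..n}" "inj_on ?g ?P" "inj_on ?h ?P"
  proof -
    show "inj_on ?f {1..n}"
    proof (rule inj_onI)
      fix i j assume "?f i = ?f j"
      then have "coef (?f i) i = coef (?f j) i" by simp
      then show "i = j" unfolding c by (simp split: if_splits)
    qed
    show "inj_on ?g ?P"
    proof (rule inj_onI)
      fix x y assume x: "x \<in> ?P" "y \<in> ?P" "?g x = ?g y"
      obtain j i j' i' where xy: "x = (j, i)" "y = (j', i')" by (cases x, cases y)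
      then have e: "coef (eps i + eps j) k = coef (eps i' + eps j') k" for k using x(3) by simp
      show "x = y" using e[of i] e[of j] e[of i'] e[of j'] x(1,2) unfolding c xy by (auto split: if_splits)
    qed
    show "inj_on ?h ?P"
    proof (rule inj_onI)
      fix x y assume x: "x \<in> ?P" "y \<in> ?P" "?h x = ?h y"
      obtain j i j' i' where xy: "x = (j, i)" "y = (j', i')" by (cases x, cases y)
      then have e: "coef (eps i - eps j) k = coef (eps i' - eps j') k" for k using x(3) by simp
      have lt: "i < j" "i' < j'" using x(1,2) by (auto simp: xy)
      have "i = i'" using e[of i] lt unfolding c by (simp split: if_splits)
      moreover have "j = j'" using e[of j] lt unfolding c by (simp split: if_splits)
      ultimately show "x = y" by (simp add: xy)
    qed
  qed
  have dis1: "?f k \<noteq> eps i + eps j" "?f k \<noteq> eps i - eps j" "eps i + eps j \<noteq> eps i' - eps j'"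
    if "i < j" "i' < j'" for i j i' j' k
  proof -
    show "?f k \<noteq> eps i + eps j"
    proof
      assume "?f k = eps i + eps j"
      then have "coef (?f k) l = coef (eps i + eps j) l" for l by simp
      from this[of i] this[of j] show False unfolding c using that by (auto split: if_splits)
    qed
    show "?f k \<noteq> eps i - eps j"
    proof
      assume "?f k = eps i - eps j"
      then have "coef (?f k) l = coef (eps i - eps j) l" for l by simp
      from this[of i] this[of j] show False unfolding c using that by (auto split: if_splits)
    qed
    show "eps i + eps j \<noteq> eps i' - eps j'"
    proof
      assume "eps i + eps j = eps i' - eps j'"
      then have "coef (eps i + eps j) l = coef (eps i' - eps j') l" for l by simp
      from this[of j'] show False unfolding c using that by (auto split: if_splits)
    qed
  qed
  have dis: "?f ` {1..n} \<inter> (?g ` ?P \<union> ?h ` ?P) = {}" "?g ` ?P \<inter> ?h ` ?P = {}"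
    using dis1 by auto
  have "prod F (pos_roots n) = prod F (?f ` {1..n}) * (prod F (?g ` ?P) * prod F (?h ` ?P))"
    unfolding eq using dis by (simp add: prod.union_disjoint)
  also have "\<dots> = (\<Prod>i = 1..n. F (?f i)) * ((\<Prod>x\<in>?P. F (?g x)) * (\<Prod>x\<in>?P. F (?h x)))"
    using inj by (simp add: prod.reindex)
  also have "(\<Prod>x\<in>?P. F (?g x)) * (\<Prod>x\<in>?P. F (?h x))
      = (\<Prod>j = 1..n. \<Prod>i = 1..<j. F (eps i + eps j) * F (eps i - eps j))"
    unfolding prod.distrib[symmetric] by (subst prod.Sigma) (auto simp: case_prod_unfold)
  finally show ?thesis .
qed

definition triang :: "vec \<Rightarrow> complex \<Rightarrow> expalg \<Rightarrow> bool"
  where "triang u c P \<longleftrightarrow> P \<in> laurent n \<and> coef P u = c \<and> (\<forall>l\<in>supp P. l = u \<or> prec n l u)"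

lemma triang_zero: "triang u 0 0"
  by (simp add: triang_def)

lemma triang_add: "triang u c P \<Longrightarrow> triang u d Q \<Longrightarrow> triang u (c + d) (P + Q)"
  unfolding triang_def using keys_add[of P Q] by (auto simp: lookup_add)

lemma triang_smul: "triang u c P \<Longrightarrow> triang u (d * c) (smul d P)"
  unfolding triang_def using supp_smul_subset[of d P] by (auto simp: laurent_simps)

lemma triang_diff: "triang u c P \<Longrightarrow> triang u d Q \<Longrightarrow> triang u (c - d) (P - Q)"
  using triang_add[of u c P "- d" "- Q"] triang_smul[of u d Q "-1"] by simp

lemma triang_sum: "finite A \<Longrightarrow> (\<And>x. x \<in> A \<Longrightarrow> triang u (c x) (G x)) \<Longrightarrow> triang u (sum c A) (sum G A)"
  by (induction A rule: finite_induct) (auto simp: triang_zero intro: triang_add)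

lemma triang_single: "u \<in> lattice n \<Longrightarrow> triang u c (Poly_Mapping.single u c)"
  by (auto simp: triang_def laurent_single)

lemma triang_single_below:
  "l \<in> lattice n \<Longrightarrow> prec n l u \<Longrightarrow> triang u 0 (Poly_Mapping.single l c)"
  using prec_irrefl by (auto simp: triang_def laurent_single lookup_single when_def)

lemma triang_below:
  assumes "triang l c P" "prec n l u" "l \<in> lattice n" "u \<in> lattice n"
  shows "triang u 0 P"
proof -
  have lat: "k \<in> lattice n" if "k \<in> supp P" for k using assms(1) that by (auto simp: triang_def laurent_def)
  have below: "prec n k u" if "k \<in> supp P" for k
    using assms that prec_trans[OF lat[OF that] assms(3,4)] by (auto simp: triang_def)
  then have "coef P u = 0" using prec_irrefl by (metis in_keys_iff)
  then show ?thesis using assms(1) below by (auto simp: triang_def)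
qed

lemma triang_lin:
  assumes u: "u \<in> lattice n" and P: "triang u c P" and F: "\<And>l. l \<in> lattice n \<Longrightarrow> triang l (d l) (F l)"
  shows "triang u (c * d u) (lin F P)"
proof -
  have "triang u (coef P l * (if l = u then d l else 0)) (smul (coef P l) (F l))" if "l \<in> supp P" for l
  proof (rule triang_smul)
    have l: "l \<in> lattice n" "l = u \<or> prec n l u" using P that by (auto simp: triang_def laurent_def)
    then show "triang u (if l = u then d l else 0) (F l)"
      using F[OF l(1)] triang_below[OF F[OF l(1)] _ l(1) u] prec_irrefl by auto
  qed
  then have "triang u (\<Sum>l\<in>supp P. coef P l * (if l = u then d l else 0)) (lin F P)"
    unfolding lin_def by (intro triang_sum) auto
  moreover have "(\<Sum>l\<in>supp P. coef P l * (if l = u then d l else 0)) = c * d u"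
    using P by (auto simp: triang_def if_distrib[of "\<lambda>x. _ * x"] in_keys_iff cong: if_cong)
  ultimately show ?thesis by simp
qed

end

context koorn
begin

text \<open>The diagonal coefficient of \<open>R\<^sub>b\<close> at \<open>x\<^sup>u\<close>.\<close>

definition rsgn :: "vec \<Rightarrow> affvec \<Rightarrow> complex"
  where "rsgn u b = (if 0 \<le> ip u (fst b) then tb b else inverse (tb b))"

text \<open>The exponents in \<open>R\<^sub>b x\<^sup>u\<close> lie on the segment from \<open>u\<close> to \<open>s\<^sub>b u\<close>, and the interior ones are lower than
  \<open>u\<close> by \<open>prec_interior\<close>.  The end point \<open>s\<^sub>b u\<close> occurs only if \<open>\<langle>u, b\<^sup>\<or>\<rangle> > 0\<close>, when it is lower by
  \<open>prec_reflect\<close>; if \<open>\<langle>u, b\<^sup>\<or>\<rangle> < 0\<close>, the sum contains \<open>x\<^sup>u\<close> itself and turns the coefficient \<open>t\<close> into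
  \<open>t - (t - t\<^sup>-\<^sup>1)\<close>.\<close>

lemma triang_Rmon:
  assumes v: "fst b \<in> pos_roots n" and m: "snd b \<in> \<int>" and u: "u \<in> lattice n"
  shows "triang u (rsgn u b) (Rmon b (u, 0))"
proof -
  have vr: "fst b \<in> roots n" using v by (simp add: pos_roots_eq)
  have b: "aff_root n b" using vr m by (simp add: aff_root_def)
  have u': "(u, 0) \<in> aff_lattice n" by (rule aff_lattice_0[OF u])
  define r where "r = \<lfloor>pairing (fst b, 0) (u, 0)\<rfloor>"
  have pb: "pairing b f = pairing (fst b, 0) f" for f
    unfolding pairing_def aff_inner_coroot by (simp add: aff_inner_def)
  have r: "pairing (fst b, 0) (u, 0) = of_int r"
    using pairing_Ints[of "(fst b, 0)" "(u, 0)"] vr u by (auto simp: r_def elim: Ints_cases)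
  have sg: "0 \<le> r \<longleftrightarrow> 0 \<le> ip u (fst b)"
  proof -
    have "0 \<le> ip u (fst b) \<longleftrightarrow> 0 \<le> of_int r * sqnorm (fst b)"
      using sqnorm_pairing(1)[OF u vr] unfolding r by linarith
    then show ?thesis using sqnorm_pairing(2)[OF u vr] by (simp add: zero_le_mult_iff)
  qed
  have st: "strg b (u, 0) e = Poly_Mapping.single (u - smul (of_int (- e) / 2) (fst b)) (q_pow p (of_int e / 2 * snd b))" for e
    by (simp add: strg_def xpow_def)
  have th: "triang u 0 (strg b (u, 0) e)"
    if e: "0 < - e * sgn r" "- e * sgn r < 2 * abs r" "even e \<or> long (fst b)" for e
  proof -
    have r0: "r \<noteq> 0" using e by auto
    define th where "th = of_int (- e) / (2 * of_int r :: real)"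
    have e2: "of_int (- e) / 2 = th * pairing (fst b, 0) (u, 0)" using r0 by (simp add: th_def r)
    have thb: "0 < th" "th < 1"
    proof -
      have "th = of_int (- e * sgn r) / of_int (2 * abs r)"
        using r0 by (auto simp: th_def sgn_if abs_if)
      then show "0 < th" "th < 1" using e r0 by (simp_all only: divide_less_eq_1 of_int_0_less_iff zero_less_divide_iff of_int_less_iff) auto
    qed
    have lat: "u - smul (th * pairing (fst b, 0) (u, 0)) (fst b) \<in> lattice n"
      unfolding e2[symmetric]
      by (rule lattice_simps(3)[OF u half_root_lattice[OF b]]) (use e(3) in simp)
    show ?thesis unfolding st e2
      by (rule triang_single_below[OF lat prec_interior[OF u vr thb _ lat]]) (use r r0 in simp)
  qed
  have kh: "triang u 0 (smul (kh b) (strg b (u, 0) e))" if "0 < - e * sgn r" "- e * sgn r < 2 * abs r" for e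
  proof (cases "long (fst b)")
    case True
    then show ?thesis using triang_smul[OF th[OF that], of "kh b"] by simp
  next
    case False
    then show ?thesis using kh_short[OF b] triang_zero by simp
  qed
  have x: "triang u (tb b) (smul (tb b) (xpow p (u, 0)))"
    using triang_smul[OF triang_single[OF u, of 1], of "tb b"] by (simp add: xpow_def)
  show ?thesis
  proof (cases "0 \<le> r")
    case True
    have "triang u (kb b * 0) (smul (kb b) (strg b (u, 0) (- 2 * j)))" if j: "j \<in> {1..r}" for j
    proof (rule triang_smul, cases "j = r")
      case False
      then show "triang u 0 (strg b (u, 0) (- 2 * j))" using j by (intro th) auto
    next
      case True
      have e2: "of_int (- (- 2 * j)) / 2 = pairing (fst b, 0) (u, 0)" by (simp add: True r)
      show "triang u 0 (strg b (u, 0) (- 2 * j))" unfolding st e2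
        by (rule triang_single_below[OF reflect_lattice[OF u vr] prec_reflect[OF u v]]) (use j r in simp)
    qed
    moreover have "triang u 0 (smul (kh b) (strg b (u, 0) (1 - 2 * j)))" if j: "j \<in> {1..r}" for j
      using j by (intro kh) auto
    ultimately have "triang u (\<Sum>j\<in>{1..r}. kb b * 0 + 0)
        (\<Sum>j\<in>{1..r}. smul (kb b) (strg b (u, 0) (- 2 * j)) + smul (kh b) (strg b (u, 0) (1 - 2 * j)))"
      by (intro triang_sum triang_add) auto
    then have "triang u (tb b + (\<Sum>j\<in>{1..r}. kb b * 0 + 0)) (Rmon b (u, 0))"
      unfolding Rmon_def Let_def pb r_def[symmetric] using True by (simp only: if_True) (rule triang_add[OF x])
    then show ?thesis using True sg by (simp add: rsgn_def)
  next
    case False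
    have "triang u (kb b * (if j = 0 then 1 else 0)) (smul (kb b) (strg b (u, 0) (2 * j)))" if j: "j \<in> {0..<- r}" for j
    proof (rule triang_smul, cases "j = 0")
      case True
      then show "triang u (if j = 0 then 1 else 0) (strg b (u, 0) (2 * j))"
        using triang_single[OF u, of 1] by (simp add: st)
    next
      case nz: False
      then have "triang u 0 (strg b (u, 0) (2 * j))" using j False by (intro th) auto
      then show "triang u (if j = 0 then 1 else 0) (strg b (u, 0) (2 * j))" using nz by simp
    qed
    moreover have "triang u 0 (smul (kh b) (strg b (u, 0) (2 * j + 1)))" if j: "j \<in> {0..<- r}" for j
      using j False by (intro kh) auto
    ultimately have "triang u (\<Sum>j\<in>{0..<- r}. kb b * (if j = 0 then 1 else 0) + 0)
        (\<Sum>j\<in>{0..<- r}. smul (kb b) (strg b (u, 0) (2 * j)) + smul (kh b) (strg b (u, 0) (2 * j + 1)))"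
      by (intro triang_sum triang_add) auto
    then have "triang u (tb b - (\<Sum>j\<in>{0..<- r}. kb b * (if j = 0 then 1 else 0) + 0)) (Rmon b (u, 0))"
      unfolding Rmon_def Let_def pb r_def[symmetric] using False by (simp only: if_False) (rule triang_diff[OF x])
    moreover have "(\<Sum>j\<in>{0..<- r}. kb b * (if j = 0 then 1 else 0) + 0) = kb b"
      using False by (simp add: if_distrib[of "\<lambda>x. _ * x"] cong: if_cong)
    ultimately show ?thesis using False sg by (simp add: rsgn_def kb_def)
  qed
qed

lemma triang_Rop:
  "fst b \<in> pos_roots n \<Longrightarrow> snd b \<in> \<int> \<Longrightarrow> u \<in> lattice n \<Longrightarrow> triang u c P \<Longrightarrow>
    triang u (c * rsgn u b) (Rop b P)"
  unfolding Rop_def by (rule triang_lin) (auto intro: triang_Rmon)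

text \<open>Pushing all reflections to the right turns the operator of a word into a product of root
  operators followed by the action of the group element.\<close>

lemma act_foldr_Rop:
  assumes "k \<le> n" "\<forall>b\<in>set bs. aff_root n b" "g \<in> laurent n"
  shows "act p (s k) (foldr Rop bs g) = foldr Rop (map (s k) bs) (act p (s k) g)"
    and "foldr Rop bs g \<in> laurent n"
  using assms(2) by (induction bs) (auto simp: assms(1,3) act_Rop Rop_laurent)

lemma betas_root: "valid is \<Longrightarrow> \<forall>b\<in>set (betas is). aff_root n b"
  by (induction "is") (auto simp: simple_root_root aff_root_s)

lemma act_W_laurent: "valid is \<Longrightarrow> f \<in> laurent n \<Longrightarrow> act p (W is) f \<in> laurent n"
  unfolding act_lin xpow_def using W_aff_lattice
  by (intro laurent_lin laurent_single) (auto simp: aff_lattice_def)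

lemma act_s_W:
  assumes "k \<le> n" "valid is" "f \<in> laurent n"
  shows "act p (s k) (act p (W is) f) = act p (W (k # is)) f"
proof -
  have "act p (s k) (act p (W is) f) = lin (\<lambda>l. act p (s k) (xpow p (W is (l, 0)))) f"
    by (simp add: act_lin lin_lin)
  also have "\<dots> = lin (\<lambda>l. xpow p (s k (W is (l, 0)))) f"
  proof (rule lin_cong)
    fix l assume "l \<in> supp f"
    then have "(l, 0) \<in> aff_lattice n" using assms(3) by (auto simp: laurent_def aff_lattice_def)
    from W_aff_lattice[OF assms(2) this]
    show "act p (s k) (xpow p (W is (l, 0))) = xpow p (s k (W is (l, 0)))"
      by (intro act_xpow[OF assms(1)]) (auto simp: aff_lattice_def lattice_Ints)
  qed
  finally show ?thesis by (simp add: act_lin W_Cons)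
qed

lemma Tw_decomp:
  assumes "valid is" "f \<in> laurent n"
  shows "Tw is f = foldr Rop (betas is) (act p (W is) f)"
  using assms(1)
proof (induction "is")
  case Nil
  show ?case using lin_id[of f] by (simp add: act_lin xpow_def)
next
  case (Cons i "is")
  then have i: "i \<le> n" "valid is" by auto
  note g = act_W_laurent[OF i(2) assms(2)]
  have "Tw (i # is) f = Rop (a i) (act p (s i) (foldr Rop (betas is) (act p (W is) f)))"
    using Cons.IH i act_foldr_Rop(2)[OF i(1) betas_root[OF i(2)] g] by (simp add: Tw_Cons hecke_gen_eq)
  also have "\<dots> = foldr Rop (betas (i # is)) (act p (W (i # is)) f)"
    by (simp add: act_foldr_Rop(1)[OF i(1) betas_root[OF i(2)] g] act_s_W[OF i assms(2)])
  finally show ?case .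
qed

text \<open>The eigenvalue of \<open>Y\<^sup>l\<close> at the leading exponent \<open>u\<close>: a power of \<open>q\<close> from the translation and one
  factor from each of the root operators.\<close>

definition yev :: "vec \<Rightarrow> vec \<Rightarrow> complex"
  where "yev l u = q_pow p (ip l u) * (\<Prod>b\<in>inversions (transl l). rsgn u b)"

lemma triang_Y:
  assumes l: "l \<in> dominant n" and u: "u \<in> lattice n" and P: "triang u c P"
  shows "triang u (c * yev l u) (Y l P)"
proof -
  obtain "is" where w: "reduced is" "W is = transl l" "Y l = Tw is" using Y_word[OF l] .
  have v: "valid is" using w(1) by (simp add: reduced_alt)
  have Pl: "P \<in> laurent n" using P by (simp add: triang_def)
  have "triang u (c * q_pow p (ip l u)) (act p (transl l) P)"
    unfolding act_lin
  proof (rule triang_lin[OF u P])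
    fix k assume "k \<in> lattice n"
    then show "triang k (q_pow p (ip l k)) (xpow p (transl l (k, 0)))"
      using triang_single by (simp add: xpow_def transl_eq ip_def)
  qed
  moreover have "triang u (d * (\<Prod>b\<leftarrow>bs. rsgn u b)) (foldr Rop bs Q)"
    if "set bs \<subseteq> inversions (transl l)" "triang u d Q" for bs d Q
    using that
  proof (induction bs)
    case (Cons b bs)
    have "fst b \<in> pos_roots n \<and> snd b \<in> \<int>"
      using Cons.prems(1) unfolding inversions_transl[OF l] by auto
    then have "triang u (d * (\<Prod>b\<leftarrow>bs. rsgn u b) * rsgn u b) (Rop b (foldr Rop bs Q))"
      using Cons u by (intro triang_Rop) auto
    then show ?case by (simp add: mult.commute mult.left_commute)
  qed simp
  ultimately have "triang u (c * q_pow p (ip l u) * (\<Prod>b\<leftarrow>betas is. rsgn u b)) (foldr Rop (betas is) (act p (transl l) P))"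
    using reduced_inversions(1)[OF w(1)] w(2) by simp
  moreover have "(\<Prod>b\<leftarrow>betas is. rsgn u b) = (\<Prod>b\<in>inversions (transl l). rsgn u b)"
    using reduced_inversions(1)[OF w(1)] w(2) reduced_distinct[OF w(1)]
    by (simp add: prod.distinct_set_conv_list)
  ultimately show ?thesis
    unfolding w(3) Tw_decomp[OF v Pl] w(2) by (simp add: yev_def mult.assoc)
qed

subsection \<open>The eigenvalue as a spectral point\<close>

lemma prod_alternating:
  fixes x y :: complex
  shows "0 \<le> k \<Longrightarrow> (\<Prod>j\<in>{0..<2 * k}. if odd (j :: int) then x else y) = (x * y) powi k"
proof (induction k rule: int_ge_induct)
  case (step k)
  have "{0..<2 * (k + 1)} = insert (2 * k) (insert (2 * k + 1) {0..<2 * k})" using step(1) by auto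
  moreover have "(x * y) powi (k + 1) = x * y * (x * y) powi k"
    using step(1) by (intro power_int_add_1') auto
  ultimately show ?case using step(2) by (simp add: mult_ac)
qed simp

text \<open>Integer powers with an integral real exponent; this makes the exponents of a spectral point
  additive without moving floors around.\<close>

definition zp :: "complex \<Rightarrow> real \<Rightarrow> complex"
  where "zp z x = z powi \<lfloor>x\<rfloor>"

lemma zp_add: "z \<noteq> 0 \<Longrightarrow> x \<in> \<int> \<Longrightarrow> y \<in> \<int> \<Longrightarrow> zp z (x + y) = zp z x * zp z y"
  by (elim Ints_cases) (simp add: zp_def power_int_add flip: of_int_add)

lemma zp_mult: "x \<in> \<int> \<Longrightarrow> y \<in> \<int> \<Longrightarrow> zp z x powi \<lfloor>y\<rfloor> = zp z (x * y)"
  by (elim Ints_cases) (simp add: zp_def power_int_mult flip: of_int_mult)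

lemma zp_sum: "z \<noteq> 0 \<Longrightarrow> (\<And>i. i \<in> A \<Longrightarrow> f i \<in> \<int>) \<Longrightarrow> zp z (sum f A) = (\<Prod>i\<in>A. zp z (f i))"
proof (induction A rule: infinite_finite_induct)
  case (insert i A)
  then have "zp z (f i + sum f A) = zp z (f i) * zp z (sum f A)" by (intro zp_add Ints_sum) auto
  then show ?case using insert by simp
qed (simp_all add: zp_def)

lemma pm_sign_Ints [simp]: "pm_sign x \<in> \<int>"
  by (simp add: pm_sign_def)

lemma rho_lattice: "rho_m n u \<in> lattice n" "rho_l n u \<in> lattice n"
  unfolding rho_m_def rho_l_def
  by (intro lattice_sum lattice_simps lattice_smul pm_sign_Ints; auto)+

lemma coef_rho_l: "i \<in> {1..n} \<Longrightarrow> coef (rho_l n u) i = pm_sign (coef u i)"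
  by (simp add: rho_l_def lookup_sum coef_eps if_distrib[of "\<lambda>x. _ * x"] cong: if_cong)

lemma ip_smul_right: "l \<in> lattice n \<Longrightarrow> ip l (smul c v) = c * ip l v"
  by (simp add: ip_def aff_inner_vec sum_distrib_left mult.left_commute)

lemma ip_sum_right: "l \<in> lattice n \<Longrightarrow> ip l (sum G A) = (\<Sum>x\<in>A. ip l (G x))"
  by (induction A rule: infinite_finite_induct)
    (simp_all add: ip_add_right, simp_all add: ip_def aff_inner_vec)

lemma tb_root:
  assumes "v \<in> roots n"
  shows "tb (v, of_int k) = (if long v then if odd k then par_t0 p else par_tn p else par_t p)"
  using assms by (simp add: tb_def mult_par_alt)

lemma prod_rsgn_short:
  assumes v: "v \<in> roots n" "\<not> long v" and l: "l \<in> lattice n" "0 \<le> ip l v"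
  shows "(\<Prod>k\<in>{0..<\<lfloor>ip l v\<rfloor>}. rsgn u (v, of_int k)) = zp (par_t p) (pm_sign (ip u v) * ip l v)"
proof -
  obtain z where z: "ip l v = of_int z" using ip_Ints[OF l(1)] v(1) by (auto simp: roots_def elim: Ints_cases)
  then have z0: "0 \<le> z" using l(2) by simp
  have "(\<Prod>k\<in>{0..<\<lfloor>ip l v\<rfloor>}. rsgn u (v, of_int k))
      = (if 0 \<le> ip u v then par_t p else inverse (par_t p)) ^ nat z"
    using v by (simp add: rsgn_def tb_root z)
  also have "\<dots> = (if 0 \<le> ip u v then par_t p else inverse (par_t p)) powi z"
    using z0 by (simp add: power_int_def)
  finally show ?thesis by (simp add: zp_def pm_sign_def z power_int_inverse power_int_minus flip: of_int_minus)
qed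

lemma prod_rsgn_long:
  assumes i: "i \<in> {1..n}" and l: "l \<in> lattice n" "0 \<le> coef l i" and u: "u \<in> lattice n"
  shows "(\<Prod>k\<in>{0..<\<lfloor>ip l (smul 2 (eps i))\<rfloor>}. rsgn u (smul 2 (eps i), of_int k))
    = zp (par_t0 p * par_tn p) (pm_sign (coef u i) * coef l i)"
proof -
  obtain z where z: "coef l i = of_int z" using lattice_Ints[OF l(1), of i] by (auto elim: Ints_cases)
  then have z0: "0 \<le> z" using l(2) by simp
  have v: "smul 2 (eps i) \<in> roots n" using roots_longI[OF i, of 1] by simp
  have lg: "long (smul 2 (eps i))" by (auto simp: long_def coef_eps intro!: exI[of _ i])
  have fl: "\<lfloor>ip l (smul 2 (eps i))\<rfloor> = 2 * z"
  proof -
    have "ip l (smul 2 (eps i)) = of_int (2 * z)" using ip_long[OF l(1) i, of 2] by (simp add: z)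
    then show ?thesis by (simp only: floor_of_int)
  qed
  have sg: "0 \<le> ip u (smul 2 (eps i)) \<longleftrightarrow> 0 \<le> coef u i" using ip_long[OF u i, of 2] by simp
  have "(\<Prod>k\<in>{0..<2 * z}. rsgn u (smul 2 (eps i), of_int k))
      = (\<Prod>k\<in>{0..<2 * z}. if odd k then (if 0 \<le> coef u i then par_t0 p else inverse (par_t0 p))
          else (if 0 \<le> coef u i then par_tn p else inverse (par_tn p)))"
    by (intro prod.cong) (auto simp: rsgn_def tb_root[OF v] lg sg)
  also have "\<dots> = ((if 0 \<le> coef u i then par_t0 p else inverse (par_t0 p))
      * (if 0 \<le> coef u i then par_tn p else inverse (par_tn p))) powi z"
    by (rule prod_alternating[OF z0])
  finally show ?thesis unfolding fl
    by (simp add: zp_def pm_sign_def z power_int_inverse power_int_minus flip: of_int_minus inverse_mult_distrib)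
qed

text \<open>A positive root \<open>v\<close> contributes the inversions \<open>v + k\<delta>\<close> with \<open>0 \<le> k < \<langle>l, v\<rangle>\<close>, all with the same sign
  \<open>\<epsilon>(\<langle>u, v\<rangle>)\<close>.  For \<open>v = \<epsilon>\<^sub>i \<plusminus> \<epsilon>\<^sub>j\<close> their parameter is \<open>t\<close>, and for \<open>v = 2\<epsilon>\<^sub>i\<close> the parameters \<open>t\<^sub>n\<close> and \<open>t\<^sub>0\<close>
  alternate over an even number of steps, so that the total exponents are those given by \<open>\<rho>\<^sub>m\<close> and \<open>\<rho>\<^sub>l\<close>.\<close>

theorem yev_eq:
  assumes l: "l \<in> dominant n" and u: "u \<in> lattice n"
  shows "yev l u = mon n (spectral_pt n p u) l"
proof -
  note lat = dominant_lattice[OF l]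
  define T where "T = par_t0 p * par_tn p"
  have nz: "T \<noteq> 0" "par_t p \<noteq> 0" "par_q p \<noteq> 0"
    using pars_nz q_half_nz by (auto simp: T_def par_q_def)
  have li: "coef l i \<in> \<int>" "coef u i \<in> \<int>" "coef (rho_m n u) i \<in> \<int>" for i
    using lattice_Ints lat u rho_lattice by auto
  have spec: "spectral_pt n p u i powi \<lfloor>coef l i\<rfloor>
      = zp T (pm_sign (coef u i) * coef l i) * zp (par_t p) (coef l i * coef (rho_m n u) i) * zp (par_q p) (coef l i * coef u i)"
    if i: "i \<in> {1..n}" for i
  proof -
    have "spectral_pt n p u i = zp T (pm_sign (coef u i)) * zp (par_t p) (coef (rho_m n u) i) * zp (par_q p) (coef u i)"
      unfolding spectral_pt_def coef_rho_l[OF i] zp_def T_def ..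
    then show ?thesis
      by (simp add: power_int_mult_distrib zp_mult li mult.commute)
  qed
  have "mon n (spectral_pt n p u) l = (\<Prod>i = 1..n. zp T (pm_sign (coef u i) * coef l i))
      * (\<Prod>i = 1..n. zp (par_t p) (coef l i * coef (rho_m n u) i)) * (\<Prod>i = 1..n. zp (par_q p) (coef l i * coef u i))"
    unfolding mon_def by (simp add: spec prod.distrib)
  also have "(\<Prod>i = 1..n. zp (par_q p) (coef l i * coef u i)) = q_pow p (ip l u)"
  proof -
    have "(\<Prod>i = 1..n. zp (par_q p) (coef l i * coef u i)) = zp (par_q p) (ip l u)"
      using nz li lat by (subst zp_sum[symmetric]) (auto simp: ip_def aff_inner_vec)
    also obtain z where "ip l u = of_int z" using ip_Ints[OF lat u] by (auto elim: Ints_cases)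
    then have "zp (par_q p) (ip l u) = q_pow p (ip l u)" by (simp add: zp_def q_pow_int)
    finally show ?thesis .
  qed
  also have "(\<Prod>i = 1..n. zp (par_t p) (coef l i * coef (rho_m n u) i)) = zp (par_t p) (ip l (rho_m n u))"
    using nz li lat by (subst zp_sum[symmetric]) (auto simp: ip_def aff_inner_vec)
  also have "ip l (rho_m n u) = (\<Sum>j = 1..n. \<Sum>i = 1..<j.
      pm_sign (coef u i - coef u j) * (coef l i - coef l j) + pm_sign (coef u i + coef u j) * (coef l i + coef l j))"
    unfolding rho_m_def
    by (simp add: ip_sum_right[OF lat] ip_add_right[OF lat] ip_diff_right[OF lat] ip_smul_right[OF lat] ip_eps[OF lat])
  also have "zp (par_t p) \<dots> = (\<Prod>j = 1..n. \<Prod>i = 1..<j.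
      zp (par_t p) (pm_sign (coef u i - coef u j) * (coef l i - coef l j)) * zp (par_t p) (pm_sign (coef u i + coef u j) * (coef l i + coef l j)))"
    using nz li by (simp add: zp_sum zp_add Ints_sum)
  finally have R: "mon n (spectral_pt n p u) l = (\<Prod>i = 1..n. zp T (pm_sign (coef u i) * coef l i))
      * (\<Prod>j = 1..n. \<Prod>i = 1..<j. zp (par_t p) (pm_sign (coef u i - coef u j) * (coef l i - coef l j))
          * zp (par_t p) (pm_sign (coef u i + coef u j) * (coef l i + coef l j))) * q_pow p (ip l u)" .
  let ?F = "\<lambda>v. \<Prod>k\<in>{0..<\<lfloor>ip l v\<rfloor>}. rsgn u (v, of_int k)"
  have "(\<Prod>b\<in>inversions (transl l). rsgn u b) = prod ?F (pos_roots n)"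
  proof -
    have inj: "inj_on (\<lambda>(v, m). (v, of_int m :: real)) (SIGMA v:pos_roots n. {0..<\<lfloor>ip l v\<rfloor>})"
      by (auto simp: inj_on_def)
    have "(\<Prod>b\<in>inversions (transl l). rsgn u b)
        = (\<Prod>(v, k)\<in>(SIGMA v:pos_roots n. {0..<\<lfloor>ip l v\<rfloor>}). rsgn u (v, of_int k))"
      unfolding inversions_transl[OF l] prod.reindex[OF inj] by (simp add: case_prod_unfold)
    also have "\<dots> = prod ?F (pos_roots n)"
      by (subst prod.Sigma) (auto simp: finite_pos_roots)
    finally show ?thesis .
  qed
  also have "\<dots> = (\<Prod>i = 1..n. ?F (smul 2 (eps i))) * (\<Prod>j = 1..n. \<Prod>i = 1..<j. ?F (eps i + eps j) * ?F (eps i - eps j))"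
    by (rule prod_pos_roots)
  also have "(\<Prod>i = 1..n. ?F (smul 2 (eps i))) = (\<Prod>i = 1..n. zp T (pm_sign (coef u i) * coef l i))"
    unfolding T_def by (intro prod.cong refl prod_rsgn_long[OF _ lat dominant_nonneg[OF l] u])
  also have "(\<Prod>j = 1..n. \<Prod>i = 1..<j. ?F (eps i + eps j) * ?F (eps i - eps j))
      = (\<Prod>j = 1..n. \<Prod>i = 1..<j. zp (par_t p) (pm_sign (coef u i - coef u j) * (coef l i - coef l j))
          * zp (par_t p) (pm_sign (coef u i + coef u j) * (coef l i + coef l j)))"
  proof (intro prod.cong refl)
    fix j i assume j: "j \<in> {1..n}" and i: "i \<in> {1..<j}"
    have pr: "eps i + eps j \<in> pos_roots n" "eps i - eps j \<in> pos_roots n"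
      using i j unfolding pos_roots_def by (simp, blast)+
    have ns: "\<not> long (eps i + eps j)" "\<not> long (eps i - eps j)"
      using i by (auto simp: long_def coef_eps lookup_add lookup_minus)
    have ip: "ip w (eps i + eps j) = coef w i + coef w j" "ip w (eps i - eps j) = coef w i - coef w j"
      if "w \<in> lattice n" for w
      using that i j by (simp_all add: ip_add_right ip_diff_right ip_eps)
    have "?F (eps i + eps j) = zp (par_t p) (pm_sign (coef u i + coef u j) * (coef l i + coef l j))"
      using prod_rsgn_short[OF _ ns(1) lat dominant_ip_nonneg[OF l pr(1)], of u] pr(1)
      unfolding ip(1)[OF u] ip(1)[OF lat] by (simp add: pos_roots_eq)
    moreover have "?F (eps i - eps j) = zp (par_t p) (pm_sign (coef u i - coef u j) * (coef l i - coef l j))"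
      using prod_rsgn_short[OF _ ns(2) lat dominant_ip_nonneg[OF l pr(2)], of u] pr(2)
      unfolding ip(2)[OF u] ip(2)[OF lat] by (simp add: pos_roots_eq)
    ultimately show "?F (eps i + eps j) * ?F (eps i - eps j)
        = zp (par_t p) (pm_sign (coef u i - coef u j) * (coef l i - coef l j))
          * zp (par_t p) (pm_sign (coef u i + coef u j) * (coef l i + coef l j))" by simp
  qed
  finally show ?thesis unfolding yev_def R by simp
qed

end

section \<open>Existence and uniqueness of the joint eigenfunctions\<close>

lemma ex_maximal_prec:
  assumes fin: "finite S" "S \<noteq> {}" and irr: "\<And>x. \<not> r x x"
    and tr: "\<And>x y z. x \<in> S \<Longrightarrow> y \<in> S \<Longrightarrow> z \<in> S \<Longrightarrow> r x y \<Longrightarrow> r y z \<Longrightarrow> r x z"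
  shows "\<exists>m\<in>S. \<forall>x\<in>S. \<not> r m x"
  using fin tr
proof (induction S rule: finite_ne_induct)
  case (singleton x)
  then show ?case using irr by auto
next
  case (insert x S)
  then obtain m where m: "m \<in> S" "\<forall>y\<in>S. \<not> r m y" by (metis insertI2)
  show ?case
  proof (cases "r m x")
    case True
    have "\<not> r x y" if "y \<in> S" for y
      using insert.prems[of m x y] m that True by auto
    then show ?thesis using irr by auto
  next
    case False
    then show ?thesis using m by auto
  qed
qed

context koorn
begin

definition omega :: "nat \<Rightarrow> vec"
  where "omega k = (\<Sum>i = 1..k. eps i)"

lemma coef_omega: "coef (omega k) i = (if i \<in> {1..k} then 1 else 0)"
  by (auto simp: omega_def lookup_sum coef_eps)

lemma omega_dominant: "k \<le> n \<Longrightarrow> omega k \<in> dominant n"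
  by (auto simp: dominant_def coef_omega intro!: latticeI)

lemma spectral_nz: "spectral_pt n p u i \<noteq> 0"
  using pars_nz q_half_nz by (simp add: spectral_pt_def par_q_def)

lemma spectral_outside: "u \<in> lattice n \<Longrightarrow> i \<notin> {1..n} \<Longrightarrow> spectral_pt n p u i = 1"
  using lattice_outside[of u n i] lattice_outside[OF rho_lattice(1), of i u] lattice_outside[OF rho_lattice(2), of i u]
  by (simp add: spectral_pt_def)

lemma yev_nz: "l \<in> dominant n \<Longrightarrow> u \<in> lattice n \<Longrightarrow> yev l u \<noteq> 0"
  by (simp add: yev_eq mon_nonzero spectral_nz)

text \<open>The eigenvalues for \<open>\<epsilon>\<^sub>1 + \<dots> + \<epsilon>\<^sub>k\<close> are the partial products of the coordinates of the spectral
  point, which determine it.\<close>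

lemma separating_weight:
  assumes inj: "inj_on (spectral_pt n p) (lattice n)"
    and uv: "u \<in> lattice n" "v \<in> lattice n" "u \<noteq> v"
  shows "\<exists>l\<in>dominant n. yev l u \<noteq> yev l v"
proof (rule ccontr)
  assume "\<not> ?thesis"
  then have eq: "mon n (spectral_pt n p u) (omega k) = mon n (spectral_pt n p v) (omega k)" if "k \<le> n" for k
    using omega_dominant[OF that] uv by (metis yev_eq)
  have mo: "mon n x (omega k) = (\<Prod>i = 1..k. x i)" if "k \<le> n" for k x
  proof -
    have "mon n x (omega k) = (\<Prod>i = 1..n. if i \<in> {1..k} then x i else 1)"
      unfolding mon_def coef_omega by (intro prod.cong) auto
    also have "\<dots> = (\<Prod>i = 1..k. x i)"
      using that by (intro prod.mono_neutral_cong_right) auto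
    finally show ?thesis .
  qed
  have "spectral_pt n p u i = spectral_pt n p v i" for i
  proof (cases "i \<in> {1..n}")
    case True
    then obtain k where k: "i = Suc k" "Suc k \<le> n" by (cases i) auto
    have "(\<Prod>i = 1..k. spectral_pt n p u i) * spectral_pt n p u i
        = (\<Prod>i = 1..k. spectral_pt n p v i) * spectral_pt n p v i"
      using eq[of "Suc k"] k by (simp add: mo)
    moreover have "(\<Prod>i = 1..k. spectral_pt n p u i) = (\<Prod>i = 1..k. spectral_pt n p v i)"
      using eq[of k] k by (simp add: mo)
    moreover have "(\<Prod>i = 1..k. spectral_pt n p v i) \<noteq> 0" by (simp add: spectral_nz)
    ultimately show ?thesis by simp
  next
    case False
    then show ?thesis using spectral_outside uv by simp
  qed
  then have "spectral_pt n p u = spectral_pt n p v" by (rule ext)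
  then show False using inj uv by (auto dest: inj_onD)
qed

lemma Y_diff: "l \<in> dominant n \<Longrightarrow> f \<in> laurent n \<Longrightarrow> g \<in> laurent n \<Longrightarrow> Y l (f - g) = Y l f - Y l g"
  using Y_lin(1)[of l f "smul (-1) g"] Y_lin(2)[of l g g "-1"] by (simp add: laurent_simps)

lemma Y_zero: "l \<in> dominant n \<Longrightarrow> Y l 0 = 0"
  using Y_lin(2)[of l 0 0 0] by simp

lemma Y_sum:
  assumes "l \<in> dominant n" "finite A" "\<And>x. x \<in> A \<Longrightarrow> G x \<in> laurent n"
  shows "Y l (sum G A) = (\<Sum>x\<in>A. Y l (G x))"
  using assms(2,3) by (induction A rule: finite_induct) (auto simp: Y_zero assms(1) Y_lin laurent_sum)

lemma Y_expand:
  assumes l: "l \<in> dominant n" and f: "f \<in> laurent n"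
  shows "Y l f = (\<Sum>k\<in>supp f. smul (coef f k) (Y l (Poly_Mapping.single k 1)))"
proof -
  have s: "Poly_Mapping.single k 1 \<in> laurent n" if "k \<in> supp f" for k
    using f that by (auto simp: laurent_def intro: laurent_single)
  have "Y l f = Y l (\<Sum>k\<in>supp f. smul (coef f k) (Poly_Mapping.single k 1))"
    using lin_id[of f] by (simp add: lin_def)
  also have "\<dots> = (\<Sum>k\<in>supp f. Y l (smul (coef f k) (Poly_Mapping.single k 1)))"
    using s by (intro Y_sum l) (auto simp: laurent_simps simp del: smul_single)
  also have "\<dots> = (\<Sum>k\<in>supp f. smul (coef f k) (Y l (Poly_Mapping.single k 1)))"
    using s by (intro sum.cong Y_lin(2)[OF l]) auto
  finally show ?thesis .
qed

definition eigen :: "vec \<Rightarrow> expalg \<Rightarrow> bool"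
  where "eigen u P \<longleftrightarrow> P \<in> laurent n \<and> (\<forall>l\<in>dominant n. Y l P = smul (yev l u) P)"

text \<open>Starting from \<open>x\<^sup>u\<close>, one weight of the error term is removed at a time, by a factor
  \<open>(Y\<^sup>l - y)\<close> that annihilates a maximal one.\<close>

lemma ex_eigen_step:
  assumes inj: "inj_on (spectral_pt n p) (lattice n)" and u: "u \<in> lattice n"
    and S: "finite S" "S \<subseteq> {l \<in> lattice n. prec n l u}" "\<And>k l. k \<in> lattice n \<Longrightarrow> l \<in> S \<Longrightarrow> prec n k l \<Longrightarrow> k \<in> S"
    and P: "triang u 1 P" "\<And>l. l \<in> dominant n \<Longrightarrow> supp (Y l P - smul (yev l u) P) \<subseteq> S"
  shows "\<exists>Q. triang u 1 Q \<and> eigen u Q"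
  using S P
proof (induction "card S" arbitrary: S P)
  case 0
  then have "S = {}" by simp
  then have "Y l P = smul (yev l u) P" if "l \<in> dominant n" for l
    using 0(6)[OF that] by simp
  then have "eigen u P" using 0(5) by (simp add: eigen_def triang_def)
  then show ?case using 0(5) by blast
next
  case (Suc m)
  have "S \<noteq> {}" using Suc(2) by auto
  have lat: "k \<in> lattice n" if "k \<in> S" for k using Suc(4) that by auto
  obtain w where w: "w \<in> S" "\<forall>k\<in>S. \<not> prec n w k"
    using ex_maximal_prec[OF Suc(3) \<open>S \<noteq> {}\<close>, of "prec n"] prec_irrefl prec_trans lat by metis
  have wl: "w \<in> lattice n" "prec n w u" using w(1) Suc(4) by auto
  then have "u \<noteq> w" using prec_irrefl by auto
  then obtain d where d: "d \<in> dominant n" "yev d u \<noteq> yev d w"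
    using separating_weight[OF inj u wl(1)] by blast
  define e where "e = inverse (yev d u - yev d w)"
  have e: "e * (yev d u - yev d w) = 1" using d(2) by (simp add: e_def)
  let ?L = "\<lambda>f. Y d f - smul (yev d w) f"
  define Q where "Q = smul e (?L P)"
  have Pl: "P \<in> laurent n" using Suc(6) by (simp add: triang_def)
  have triQ: "triang u 1 Q"
    using triang_smul[OF triang_diff[OF triang_Y[OF d(1) u Suc(6)] triang_smul[OF Suc(6), of "yev d w"]], of e]
    by (simp add: Q_def e)
  have L_supp: "supp (?L f) \<subseteq> S - {w}" if f: "supp f \<subseteq> S" for f
  proof -
    have fl: "f \<in> laurent n" using f lat by (auto simp: laurent_def)
    have mono: "supp (?L (Poly_Mapping.single k 1)) \<subseteq> S - {w}" if k: "k \<in> S" for k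
    proof
      note kl = lat[OF k]
      have t: "triang k (yev d k - yev d w) (?L (Poly_Mapping.single k 1))"
        using triang_diff[OF triang_Y[OF d(1) kl triang_single[OF kl, of 1]] triang_smul[OF triang_single[OF kl, of 1], of "yev d w"]]
        by simp
      fix j assume j: "j \<in> supp (?L (Poly_Mapping.single k 1))"
      have jl: "j \<in> lattice n" and jk: "j = k \<or> prec n j k" using t j by (auto simp: triang_def laurent_def)
      have "j \<in> S" using jk k Suc(5)[OF jl k] by auto
      moreover have "j \<noteq> w"
      proof
        assume "j = w"
        then have "k = w" using jk w k by auto
        then have "coef (?L (Poly_Mapping.single k 1)) j = 0" using t \<open>j = w\<close> by (simp add: triang_def)
        then show False using j by (simp add: in_keys_iff)
      qed
      ultimately show "j \<in> S - {w}" by simp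
    qed
    have "?L f = (\<Sum>k\<in>supp f. smul (coef f k) (Y d (Poly_Mapping.single k 1))) - smul (yev d w) (lin (\<lambda>l. Poly_Mapping.single l 1) f)"
      using Y_expand[OF d(1) fl] by (simp add: lin_id)
    also have "\<dots> = (\<Sum>k\<in>supp f. smul (coef f k) (?L (Poly_Mapping.single k 1)))"
      unfolding lin_def smul_sum sum_subtractf[symmetric] by (simp add: smul_distribs mult.commute)
    finally have eq: "?L f = (\<Sum>k\<in>supp f. smul (coef f k) (?L (Poly_Mapping.single k 1)))" .
    show ?thesis
    proof
      fix j assume "j \<in> supp (?L f)"
      then have "(\<Sum>k\<in>supp f. coef f k * coef (?L (Poly_Mapping.single k 1)) j) \<noteq> 0"
        unfolding eq by (simp add: in_keys_iff lookup_sum)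
      then obtain k where k: "k \<in> supp f" "coef f k * coef (?L (Poly_Mapping.single k 1)) j \<noteq> 0"
        by (meson sum.not_neutral_contains_not_neutral)
      then have "j \<in> supp (?L (Poly_Mapping.single k 1))" by (simp add: in_keys_iff)
      then show "j \<in> S - {w}" using mono f k by blast
    qed
  qed
  have h1: "supp (Y l Q - smul (yev l u) Q) \<subseteq> S - {w}" if l: "l \<in> dominant n" for l
  proof -
    define R where "R = Y l P - smul (yev l u) P"
    have YP: "Y d P \<in> laurent n" "Y l P \<in> laurent n" using Y_laurent d l Pl by auto
    have a: "Y l Q = smul e (Y d (Y l P) - smul (yev d w) (Y l P))"
      using l YP Pl by (simp add: Q_def Y_lin(2)[OF l _ Pl] Y_diff Y_commute[OF d(1) l Pl] laurent_simps)
    have b: "Y d R = Y d (Y l P) - smul (yev l u) (Y d P)"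
      using d YP Pl by (simp add: R_def Y_diff Y_lin(2)[OF d(1) _ Pl] laurent_simps)
    have "Y l Q - smul (yev l u) Q = smul e (?L R)"
      unfolding a b unfolding Q_def R_def
      by (rule poly_mapping_eqI, unfold lookup_minus coef_smul, algebra)
    then show ?thesis
      using L_supp[OF Suc(7)[OF l, folded R_def]] supp_smul_subset[of e "?L R"] by auto
  qed
  have h2: "m = card (S - {w})" using Suc(2,3) w(1) by simp
  have h3: "k \<in> S - {w}" if "k \<in> lattice n" "l \<in> S - {w}" "prec n k l" for k l
    using Suc(5)[OF that(1) _ that(3)] that w by auto
  show ?case
  proof (rule Suc(1)[OF h2 _ _ h3 triQ h1])
    show "finite (S - {w})" "S - {w} \<subseteq> {l \<in> lattice n. prec n l u}" using Suc(3,4) by auto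
  qed
qed

lemma ex_eigen:
  assumes inj: "inj_on (spectral_pt n p) (lattice n)" and u: "u \<in> lattice n"
  shows "\<exists>Q. triang u 1 Q \<and> eigen u Q"
proof (rule ex_eigen_step[OF inj u finite_below[OF u] order_refl])
  let ?P = "Poly_Mapping.single u 1 :: expalg"
  show P: "triang u 1 ?P" by (rule triang_single[OF u])
  show "k \<in> {l \<in> lattice n. prec n l u}" if "k \<in> lattice n" "l \<in> {l \<in> lattice n. prec n l u}" "prec n k l" for k l
    using that prec_trans[of k l u] u by auto
  fix l assume l: "l \<in> dominant n"
  have "triang u 0 (Y l ?P - smul (yev l u) ?P)"
    using triang_diff[OF triang_Y[OF l u P] triang_smul[OF P, of "yev l u"]] by simp
  then show "supp (Y l ?P - smul (yev l u) ?P) \<subseteq> {l \<in> lattice n. prec n l u}"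
    unfolding triang_def by (auto simp: laurent_def in_keys_iff)
qed

text \<open>At a maximal exponent \<open>w\<close> of \<open>D\<close>, triangularity gives the coefficient of \<open>Y\<^sup>d D\<close> as \<open>\<gamma>\<^sub>w\<^sup>d\<close> times that of \<open>D\<close>,
  whereas the eigenvalue is \<open>\<gamma>\<^sub>u\<^sup>d\<close>.\<close>

lemma eigen_unique:
  assumes inj: "inj_on (spectral_pt n p) (lattice n)" and u: "u \<in> lattice n"
    and D: "eigen u D" "\<And>k. k \<in> supp D \<Longrightarrow> prec n k u"
  shows "D = 0"
proof (rule ccontr)
  assume "D \<noteq> 0"
  have lat: "k \<in> lattice n" if "k \<in> supp D" for k using D(1) that by (auto simp: eigen_def laurent_def)
  obtain w where w: "w \<in> supp D" "\<forall>k\<in>supp D. \<not> prec n w k"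
    using ex_maximal_prec[of "supp D" "prec n"] prec_irrefl prec_trans lat \<open>D \<noteq> 0\<close> by (metis finite_keys keys_eq_empty)
  have "u \<noteq> w" using D(2)[OF w(1)] prec_irrefl by auto
  then obtain d where d: "d \<in> dominant n" "yev d u \<noteq> yev d w"
    using separating_weight[OF inj u lat[OF w(1)]] by blast
  have "coef (Y d D) w = (\<Sum>k\<in>supp D. coef D k * coef (Y d (Poly_Mapping.single k 1)) w)"
    using D(1) by (subst Y_expand[OF d(1)]) (simp_all add: eigen_def lookup_sum)
  also have "\<dots> = (\<Sum>k\<in>supp D. if k = w then coef D w * yev d w else 0)"
  proof (intro sum.cong refl)
    fix k assume k: "k \<in> supp D"
    have t: "triang k (yev d k) (Y d (Poly_Mapping.single k 1))"
      using triang_Y[OF d(1) lat[OF k] triang_single[OF lat[OF k], of 1]] by simp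
    show "coef D k * coef (Y d (Poly_Mapping.single k 1)) w = (if k = w then coef D w * yev d w else 0)"
    proof (cases "k = w")
      case True
      then show ?thesis using t by (simp add: triang_def)
    next
      case False
      then have "w \<notin> supp (Y d (Poly_Mapping.single k 1))" using t w k by (auto simp: triang_def)
      then show ?thesis using False by (simp add: in_keys_iff)
    qed
  qed
  also have "\<dots> = coef D w * yev d w" using w(1) by simp
  finally have "coef (Y d D) w = coef D w * yev d w" .
  moreover have "coef (Y d D) w = yev d u * coef D w" using D(1) d(1) by (simp add: eigen_def)
  ultimately have "coef D w * (yev d u - yev d w) = 0" by (simp add: algebra_simps)
  then show False using w(1) d(2) by (simp add: in_keys_iff)
qed

subsection \<open>The operators \<open>f(Y)\<close>\<close>

text \<open>Any lattice vector becomes dominant after adding a large multiple of \<open>n\<epsilon>\<^sub>1 + \<dots> + 1\<epsilon>\<^sub>n\<close>.\<close>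

lemma dominant_difference:
  assumes l: "l \<in> lattice n"
  shows "\<exists>a b. a \<in> dominant n \<and> b \<in> dominant n \<and> l = a - b"
proof -
  define b where "b = (\<Sum>i = 1..n. smul (real (n + 1 - i) * (2 * l1 n l)) (eps i))"
  have bound: "\<bar>coef l i\<bar> \<le> l1 n l" for i
  proof (cases "i \<in> {1..n}")
    case True
    then show ?thesis unfolding l1_def by (intro member_le_sum) auto
  next
    case False
    then show ?thesis using lattice_outside[OF l False] by (simp add: l1_def sum_nonneg)
  qed
  have l1: "l1 n l \<in> \<int>" unfolding l1_def using lattice_Ints[OF l] by (intro Ints_sum) (auto simp: abs_if)
  have bl: "b \<in> lattice n"
    unfolding b_def by (intro lattice_sum lattice_smul Ints_mult l1) auto
  have cb: "coef b i = (if i \<in> {1..n} then real (n + 1 - i) * (2 * l1 n l) else 0)" for i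
    by (simp add: b_def lookup_sum coef_eps if_distrib[of "\<lambda>x. _ * x"] cong: if_cong)
  have nn: "0 \<le> l1 n l" using bound[of 0] by linarith
  have bd: "b \<in> dominant n" unfolding dominant_def
    using bl nn by (auto simp: cb of_nat_diff intro!: mult_right_mono)
  have st: "2 * l1 n l + coef b (i + 1) \<le> coef b i" if "i \<in> {1..<n}" for i
    using that by (simp add: cb of_nat_diff algebra_simps)
  have "l + b \<in> dominant n"
    unfolding dominant_def
  proof (intro CollectI conjI ballI)
    show "l + b \<in> lattice n" using l bl by simp
    fix i assume i: "i \<in> {1..<n}"
    show "coef (l + b) (i + 1) \<le> coef (l + b) i"
      using st[OF i] bound[of i] bound[of "i + 1"] by (simp add: lookup_add)
  next
    fix i assume i: "i \<in> {1..n}"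
    have "1 * (2 * l1 n l) \<le> real (n + 1 - i) * (2 * l1 n l)"
      using i nn by (intro mult_right_mono) auto
    then have "2 * l1 n l \<le> coef b i" using i by (simp add: cb)
    then show "0 \<le> coef (l + b) i" using bound[of i] nn by (simp add: lookup_add)
  qed
  then show ?thesis using bd by (intro exI[of _ "l + b"] exI[of _ b]) simp
qed

lemma Y_op_split:
  assumes "l \<in> lattice n"
  obtains a b where "a \<in> dominant n" "b \<in> dominant n" "l = a - b"
    "\<And>f. Y_op n p l f = Y a (inv_into (laurent n) (Y b) f)"
proof -
  define mn where "mn = (SOME mn. fst mn \<in> dominant n \<and> snd mn \<in> dominant n \<and> l = fst mn - snd mn)"
  have "\<exists>mn. fst mn \<in> dominant n \<and> snd mn \<in> dominant n \<and> l = fst mn - snd mn"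
    using dominant_difference[OF assms] by fastforce
  then have mn: "fst mn \<in> dominant n \<and> snd mn \<in> dominant n \<and> l = fst mn - snd mn"
    unfolding mn_def by (rule someI_ex)
  show ?thesis
  proof (rule that)
    show "fst mn \<in> dominant n" "snd mn \<in> dominant n" "l = fst mn - snd mn" using mn by blast+
    show "Y_op n p l f = Y (fst mn) (inv_into (laurent n) (Y (snd mn)) f)" for f
      unfolding Y_op_def Let_def mn_def[symmetric] by (rule comp_apply)
  qed
qed

lemma Y_op_dominant:
  assumes l: "l \<in> dominant n" and f: "f \<in> laurent n"
  shows "Y_op n p l f = Y l f"
proof -
  obtain a b where ab: "a \<in> dominant n" "b \<in> dominant n" "l = a - b"
    "\<And>f. Y_op n p l f = Y a (inv_into (laurent n) (Y b) f)" using Y_op_split[OF dominant_lattice[OF l]] by blast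
  have im: "f \<in> Y b ` laurent n" using Y_bij[OF ab(2)] f by (simp add: bij_betw_def)
  have g: "inv_into (laurent n) (Y b) f \<in> laurent n" "Y b (inv_into (laurent n) (Y b) f) = f"
    using inv_into_into[OF im] f_inv_into_f[OF im] by auto
  have "a = l + b" using ab(3) by simp
  then show ?thesis using Y_add[OF l ab(2) g(1)] g(2) ab(4) by simp
qed

lemma Y_op_eigen:
  assumes l: "l \<in> lattice n" and u: "u \<in> lattice n" and P: "eigen u P"
  shows "Y_op n p l P = smul (mon n (spectral_pt n p u) l) P"
proof -
  obtain a b where ab: "a \<in> dominant n" "b \<in> dominant n" "l = a - b"
    "\<And>f. Y_op n p l f = Y a (inv_into (laurent n) (Y b) f)" using Y_op_split[OF l] by blast
  have Pl: "P \<in> laurent n" using P by (simp add: eigen_def)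
  have nz: "yev b u \<noteq> 0" by (rule yev_nz[OF ab(2) u])
  have "Y b (smul (inverse (yev b u)) P) = P"
    using Y_lin(2)[OF ab(2) Pl Pl] P ab(2) nz by (simp add: eigen_def)
  then have "inv_into (laurent n) (Y b) P = smul (inverse (yev b u)) P"
    using Y_bij[OF ab(2)] Pl by (intro inv_into_f_eq) (auto simp: bij_betw_def laurent_simps)
  then have "Y_op n p l P = smul (inverse (yev b u) * yev a u) P"
    using Y_lin(2)[OF ab(1) Pl Pl] P ab by (simp add: eigen_def)
  moreover have "inverse (yev b u) * yev a u = mon n (spectral_pt n p u) l"
  proof -
    have "mon n (spectral_pt n p u) (l + b) = mon n (spectral_pt n p u) l * mon n (spectral_pt n p u) b"
      using l dominant_lattice[OF ab(2)] spectral_nz by (intro mon_add) auto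
    moreover have "l + b = a" using ab(3) by simp
    ultimately have "yev a u = mon n (spectral_pt n p u) l * yev b u"
      unfolding yev_eq[OF ab(1) u] yev_eq[OF ab(2) u] by metis
    then show ?thesis using nz by simp
  qed
  ultimately show ?thesis by simp
qed

text \<open>Being an eigenfunction of all \<open>f(Y)\<close> is the same as being one of \<open>Y\<^sup>l\<close> for dominant \<open>l\<close>, so the
  definite description is satisfied by exactly one polynomial.\<close>

theorem koornwinder_eigen:
  assumes inj: "inj_on (spectral_pt n p) (lattice n)" and u: "u \<in> lattice n"
  shows "eigen u (koornwinder n p u)"
proof -
  let ?C = "\<lambda>P. P \<in> laurent n \<and> coef P u = 1 \<and> (\<forall>m \<in> supp P - {u}. prec n m u) \<and>
    (\<forall>f \<in> laurent n. Y_subst n p f P = smul (leval f (spectral_pt n p u)) P)"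
  have sub: "Y_subst n p f P = smul (leval f (spectral_pt n p u)) P" if f: "f \<in> laurent n" and P: "eigen u P" for f P
  proof -
    have "Y_subst n p f P = (\<Sum>l\<in>supp f. smul (coef f l * mon n (spectral_pt n p u) l) P)"
      unfolding Y_subst_def
    proof (intro sum.cong refl)
      fix l assume "l \<in> supp f"
      then have "l \<in> lattice n" using f by (auto simp: laurent_def)
      then show "smul (coef f l) (Y_op n p l P) = smul (coef f l * mon n (spectral_pt n p u) l) P"
        using Y_op_eigen[OF _ u P] by simp
    qed
    also have "\<dots> = smul (\<Sum>l\<in>supp f. coef f l * mon n (spectral_pt n p u) l) P"
      by (rule poly_mapping_eqI) (simp add: lookup_sum sum_distrib_right)
    finally show ?thesis by (simp add: leval_laurent[OF f])
  qed
  have eig: "eigen u P" if P: "?C P" for P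
    unfolding eigen_def
  proof (intro conjI ballI)
    show "P \<in> laurent n" using P by simp
    fix l assume l: "l \<in> dominant n"
    note lat = dominant_lattice[OF l]
    let ?f = "Poly_Mapping.single l 1 :: expalg"
    have f: "?f \<in> laurent n" by (rule laurent_single[OF lat])
    have "Y_subst n p ?f P = Y_op n p l P" by (simp add: Y_subst_def)
    moreover have "leval ?f (spectral_pt n p u) = yev l u" using lat l u by (simp add: leval_single yev_eq)
    moreover have "Y_subst n p ?f P = smul (leval ?f (spectral_pt n p u)) P" using P f by blast
    ultimately show "Y l P = smul (yev l u) P" using Y_op_dominant[OF l, of P] P by simp
  qed
  obtain Q where Q: "triang u 1 Q" "eigen u Q" using ex_eigen[OF inj u] by blast
  have CQ: "?C Q" using Q sub by (auto simp: triang_def)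
  have "koornwinder n p u = Q"
    unfolding koornwinder_def
  proof (rule the_equality[where P = ?C, OF CQ])
    fix P assume P: "?C P"
    have "P - Q = 0"
    proof (rule eigen_unique[OF inj u])
      show "eigen u (P - Q)"
        using eig[OF P] Q(2) by (auto simp: eigen_def Y_diff smul_distribs)
      show "prec n k u" if k: "k \<in> supp (P - Q)" for k
      proof -
        have "k \<noteq> u" using k P CQ by (auto simp: in_keys_iff lookup_minus)
        moreover have "k \<in> supp P \<or> k \<in> supp Q" using k by (auto simp: in_keys_iff lookup_minus)
        ultimately show ?thesis using P CQ by blast
      qed
    qed
    then show "P = Q" by simp
  qed
  then show ?thesis using Q by simp
qed

end

section \<open>The infinite \<open>q\<close>-shifted factorial\<close>

context
  fixes q :: complex
  assumes q: "norm q < 1"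
begin

lemma convergent_q_poch: "convergent_prod (\<lambda>j. 1 - y * q ^ j)"
proof (rule abs_convergent_prod_imp_convergent_prod)
  have "summable (\<lambda>j. norm y * norm q ^ j)" using q by (intro summable_mult summable_geometric) simp
  then show "abs_convergent_prod (\<lambda>j. 1 - y * q ^ j)"
    by (simp add: abs_convergent_prod_conv_summable norm_mult norm_power)
qed

lemma q_poch_LIMSEQ: "(\<lambda>N. \<Prod>j<N. 1 - y * q ^ j) \<longlonglongrightarrow> q_poch y q"
  using convergent_prod_LIMSEQ[OF convergent_q_poch[of y]]
  by (simp add: LIMSEQ_lessThan_iff_atMost q_poch_def)

lemma q_poch_rec: "q_poch y q = (1 - y) * q_poch (y * q) q"
proof -
  have "(\<lambda>N. \<Prod>j<Suc N. 1 - y * q ^ j) \<longlonglongrightarrow> q_poch y q"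
    using q_poch_LIMSEQ[of y] by (rule LIMSEQ_Suc)
  moreover have "(\<Prod>j<Suc N. 1 - y * q ^ j) = (1 - y) * (\<Prod>j<N. 1 - (y * q) * q ^ j)" for N
    by (subst prod.lessThan_Suc_shift) (simp add: mult.assoc)
  ultimately have "(\<lambda>N. (1 - y) * (\<Prod>j<N. 1 - (y * q) * q ^ j)) \<longlonglongrightarrow> q_poch y q" by simp
  moreover have "(\<lambda>N. (1 - y) * (\<Prod>j<N. 1 - (y * q) * q ^ j)) \<longlonglongrightarrow> (1 - y) * q_poch (y * q) q"
    by (intro tendsto_mult_left q_poch_LIMSEQ)
  ultimately show ?thesis by (rule LIMSEQ_unique)
qed

lemma q_poch_nz: "norm y < 1 \<Longrightarrow> q_poch y q \<noteq> 0"
  unfolding q_poch_def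
proof (rule prodinf_nonzero[OF convergent_q_poch])
  fix j assume y: "norm y < 1"
  have "norm (y * q ^ j) \<le> norm y * 1"
    unfolding norm_mult norm_power using q by (intro mult_left_mono power_le_one) auto
  then have "y * q ^ j \<noteq> 1" using y by (metis norm_one not_less mult.right_neutral)
  then show "1 - y * q ^ j \<noteq> 0" by simp
qed

lemma q_poch_holo: "(\<lambda>y. q_poch y q) holomorphic_on UNIV"
proof (rule holomorphic_uniform_sequence[where f = "\<lambda>N y. \<Prod>j<N. 1 - y * q ^ j"])
  show "(\<lambda>y. \<Prod>j<N. 1 - y * q ^ j) holomorphic_on UNIV" for N
    by (intro holomorphic_intros)
  fix x :: complex
  have "uniformly_convergent_on (cball x 1) (\<lambda>N y. \<Prod>j<N. 1 - y * q ^ j)"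
  proof (rule uniformly_convergent_on_prod')
    show "uniformly_convergent_on (cball x 1) (\<lambda>N y. \<Sum>j<N. norm (1 - y * q ^ j - 1))"
    proof (rule Weierstrass_m_test')
      show "summable (\<lambda>j. (norm x + 1) * norm q ^ j)"
        using q by (intro summable_mult summable_geometric) simp
      fix j y assume "y \<in> cball x 1"
      then have "norm (y - x) \<le> 1" by (simp add: dist_norm norm_minus_commute)
      then have "norm y \<le> norm x + 1" using norm_triangle_ineq2[of y x] by linarith
      then show "norm (norm (1 - y * q ^ j - 1)) \<le> (norm x + 1) * norm q ^ j"
        by (simp add: norm_mult norm_power mult_right_mono)
    qed
  qed (auto intro!: continuous_intros)
  then have "uniform_limit (cball x 1) (\<lambda>N y. \<Prod>j<N. 1 - y * q ^ j)
      (\<lambda>y. lim (\<lambda>N. \<Prod>j<N. 1 - y * q ^ j)) sequentially"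
    by (simp add: uniformly_convergent_uniform_limit_iff)
  moreover have "lim (\<lambda>N. \<Prod>j<N. 1 - y * q ^ j) = q_poch y q" for y
    by (rule limI[OF q_poch_LIMSEQ])
  ultimately show "\<exists>d>0. cball x d \<subseteq> UNIV \<and> uniform_limit (cball x d) (\<lambda>N y. \<Prod>j<N. 1 - y * q ^ j) (\<lambda>y. q_poch y q) sequentially"
    by (intro exI[of _ 1]) simp
qed auto

end

section \<open>Integration over the torus\<close>

text \<open>The unit interval, which parametrizes the unit circle by \<open>ex\<close>.\<close>

definition U :: "real measure"
  where "U = restrict_space lborel {0..1}"

abbreviation ex :: "real \<Rightarrow> complex"
  where "ex \<equiv> circlepath 0 1"

lemma ex_eq: "ex x = exp (2 * of_real pi * \<i> * of_real x)"
  by (simp add: circlepath)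

lemma norm_ex [simp]: "norm (ex x) = 1"
  by (simp add: ex_eq norm_exp_eq_Re)

lemma ex_nz [simp]: "ex x \<noteq> 0"
  using norm_ex[of x] by (metis norm_zero zero_neq_one)

lemma ex_reflect: "ex (1 - x) = inverse (ex x)"
proof -
  have "2 * of_real pi * \<i> * of_real (1 - x) = 2 * of_real pi * \<i> - 2 * of_real pi * \<i> * of_real x"
    by (simp add: algebra_simps)
  then show ?thesis unfolding ex_eq by (simp only: exp_diff exp_two_pi_i divide_inverse mult_1)
qed

lemma prob_U: "prob_space U"
  unfolding U_def by (rule prob_space_restrict_space) auto

lemma U_integral: "(LINT x|U. f x) = (LINT x|lborel. indicator {0..1} x *\<^sub>R f x)"
  for f :: "real \<Rightarrow> complex"
  unfolding U_def by (rule integral_restrict_space) simp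

lemma U_reflect: "(LINT x|U. f (1 - x)) = (LINT x|U. f x)"
  for f :: "real \<Rightarrow> complex"
proof -
  have "(LINT x|U. f x) = \<bar>-1\<bar> *\<^sub>R (LINT x|lborel. indicator {0..1} (1 + (-1) * x) *\<^sub>R f (1 + (-1) * x))"
    unfolding U_integral by (rule lborel_integral_real_affine) simp
  also have "\<dots> = (LINT x|lborel. indicator {0..1} x *\<^sub>R f (1 - x))"
    by (auto intro!: Bochner_Integration.integral_cong simp: indicator_def)
  finally show ?thesis by (simp add: U_integral)
qed

lemma U_integral_continuous:
  fixes f :: "real \<Rightarrow> complex"
  assumes "continuous_on {0..1} f"
  shows "(LINT x|U. f x) = integral {0..1} f"
  using set_borel_integral_eq_integral(2)[OF borel_integrable_atLeastAtMost'[OF assms]]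
  by (simp add: U_integral set_lebesgue_integral_def)

text \<open>The circle integral of a function holomorphic on an annulus does not depend on the radius.\<close>

lemma circle_shift:
  assumes holo: "H holomorphic_on {z. r1 < norm z \<and> norm z < r2}"
    and r: "0 \<le> r1" "r1 < \<rho>" "\<rho> \<le> 1" "1 < r2"
  shows "(LINT x|U. H (ex x)) = (LINT x|U. H (of_real \<rho> * ex x))"
proof -
  let ?A = "{z :: complex. r1 < norm z \<and> norm z < r2}"
  have rho: "0 < \<rho>" using r by simp
  have opA: "open ?A"
    unfolding Collect_conj_eq by (intro open_Int open_Collect_less continuous_intros)
  have on: "circlepath 0 r x = of_real r * ex x" for r x by (simp add: circlepath)
  have "(\<lambda>z. H z / z) holomorphic_on ?A"
    using r by (intro holomorphic_intros holo) auto
  moreover have "homotopic_loops ?A (circlepath 0 1) (circlepath 0 \<rho>)"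
  proof (rule homotopic_loops_linear)
    fix t :: real assume "t \<in> {0..1}"
    show "closed_segment (ex t) (circlepath 0 \<rho> t) \<subseteq> ?A"
    proof
      fix z assume "z \<in> closed_segment (ex t) (circlepath 0 \<rho> t)"
      then obtain u where u: "0 \<le> u" "u \<le> 1" "z = (1 - u) *\<^sub>R ex t + u *\<^sub>R (of_real \<rho> * ex t)"
        unfolding on[of \<rho>] by (auto simp: in_segment)
      then have "z = of_real (1 - u + u * \<rho>) * ex t" by (simp add: scaleR_conv_of_real algebra_simps)
      then have nz: "norm z = \<bar>1 - u + u * \<rho>\<bar>" by (simp only: norm_mult norm_of_real norm_ex) simp
      have "\<rho> \<le> 1 - u + u * \<rho>" "1 - u + u * \<rho> \<le> 1"
        using u r mult_left_mono[of \<rho> 1 "1 - u"] mult_left_mono[of \<rho> 1 u] by (auto simp: algebra_simps)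
      then show "z \<in> ?A" using r rho nz by simp
    qed
  qed auto
  ultimately have "contour_integral (circlepath 0 1) (\<lambda>z. H z / z) = contour_integral (circlepath 0 \<rho>) (\<lambda>z. H z / z)"
    using opA by (intro Cauchy_theorem_homotopic_loops) auto
  moreover have "contour_integral (circlepath 0 r) (\<lambda>z. H z / z) = 2 * of_real pi * \<i> * (LINT x|U. H (of_real r * ex x))"
    if "r1 < r" "r < r2" for r
  proof -
    have r0: "0 < r" using that assms by simp
    have "continuous_on {0..1} (\<lambda>x. H (of_real r * ex x))"
    proof (rule continuous_on_compose2[OF holomorphic_on_imp_continuous_on[OF holo]])
      show "continuous_on {0..1} (\<lambda>x. of_real r * ex x)" unfolding ex_eq by (intro continuous_intros)
      show "(\<lambda>x. of_real r * ex x) ` {0..1} \<subseteq> ?A" using that r0 by (auto simp: norm_mult)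
    qed
    then have "(LINT x|U. H (of_real r * ex x)) = integral {0..1} (\<lambda>x. H (of_real r * ex x))"
      by (rule U_integral_continuous)
    moreover have "contour_integral (circlepath 0 r) (\<lambda>z. H z / z)
        = integral {0..1} (\<lambda>x. 2 * of_real pi * \<i> * H (of_real r * ex x))"
      unfolding contour_integral_integral
    proof (rule Henstock_Kurzweil_Integration.integral_cong)
      fix x :: real
      have d: "vector_derivative (circlepath 0 r) (at x) = 2 * of_real pi * \<i> * (of_real r * ex x)"
        by (simp add: vector_derivative_circlepath ex_eq)
      have nz: "of_real r * ex x \<noteq> 0" using r0 by simp
      have cancel: "h / w * (c * w) = c * h" if "w \<noteq> 0" for h w c :: complex using that by simp
      show "H (circlepath 0 r x) / circlepath 0 r x * vector_derivative (circlepath 0 r) (at x)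
          = 2 * of_real pi * \<i> * H (of_real r * ex x)"
        unfolding on[of r] d by (rule cancel[OF nz])
    qed
    ultimately show ?thesis by (simp only: integral_mult_right)
  qed
  from this[of 1] this[of \<rho>] have "contour_integral (circlepath 0 1) (\<lambda>z. H z / z) = 2 * of_real pi * \<i> * (LINT x|U. H (ex x))"
    "contour_integral (circlepath 0 \<rho>) (\<lambda>z. H z / z) = 2 * of_real pi * \<i> * (LINT x|U. H (of_real \<rho> * ex x))"
    using r by simp_all
  ultimately show ?thesis by simp
qed

text \<open>The transformation \<open>z \<mapsto> \<rho> / z\<close> exchanges the unit circle with the circle of radius \<open>\<rho>\<close>.  If \<open>H\<close> is odd
  for it, its integrals over the two circles are opposite, and by Cauchy's theorem they are equal.\<close>

lemma odd_on_annulus: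
  assumes holo: "H holomorphic_on {z. r1 < norm z \<and> norm z < r2}"
    and r: "0 \<le> r1" "r1 < \<rho>" "\<rho> \<le> 1" "1 < r2"
    and odd: "\<And>x. H (of_real \<rho> * ex x) = - H (ex (1 - x))"
  shows "(LINT x|U. H (ex x)) = 0"
proof -
  have "(LINT x|U. H (ex x)) = (LINT x|U. - H (ex (1 - x)))"
    using circle_shift[OF holo r] by (simp add: odd)
  also have "\<dots> = - (LINT x|U. H (ex x))"
    using U_reflect[of "\<lambda>x. H (ex x)"] by simp
  finally have "2 * (LINT x|U. H (ex x)) = 0" by (simp add: eq_neg_iff_add_eq_0)
  then show ?thesis by simp
qed

definition torus :: "nat \<Rightarrow> (nat \<Rightarrow> real) measure"
  where "torus n = PiM {1..n} (\<lambda>_. U)"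

definition pt :: "(nat \<Rightarrow> real) \<Rightarrow> nat \<Rightarrow> complex"
  where "pt \<theta> i = ex (\<theta> i)"

text \<open>Bounded measurable functions on the torus; all integrands belong to this class.\<close>

definition bm :: "nat \<Rightarrow> ((nat \<Rightarrow> real) \<Rightarrow> complex) \<Rightarrow> bool"
  where "bm n G \<longleftrightarrow> G \<in> borel_measurable (torus n) \<and> (\<exists>B. \<forall>\<theta>\<in>space (torus n). norm (G \<theta>) \<le> B)"

lemma bm_const: "bm n (\<lambda>\<theta>. c)"
  by (auto simp: bm_def)

lemma bm_add: "bm n F \<Longrightarrow> bm n G \<Longrightarrow> bm n (\<lambda>\<theta>. F \<theta> + G \<theta>)"
  unfolding bm_def
proof (elim conjE exE, intro conjI)
  fix A B assume "\<forall>\<theta>\<in>space (torus n). norm (F \<theta>) \<le> A" "\<forall>\<theta>\<in>space (torus n). norm (G \<theta>) \<le> B"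
  then have "\<forall>\<theta>\<in>space (torus n). norm (F \<theta> + G \<theta>) \<le> A + B"
    by (auto intro: order_trans[OF norm_triangle_ineq] add_mono)
  then show "\<exists>B. \<forall>\<theta>\<in>space (torus n). norm (F \<theta> + G \<theta>) \<le> B" by blast
qed auto

lemma bm_mult: "bm n F \<Longrightarrow> bm n G \<Longrightarrow> bm n (\<lambda>\<theta>. F \<theta> * G \<theta>)"
  unfolding bm_def
proof (elim conjE exE, intro conjI)
  fix A B assume AB: "\<forall>\<theta>\<in>space (torus n). norm (F \<theta>) \<le> A" "\<forall>\<theta>\<in>space (torus n). norm (G \<theta>) \<le> B"
  have "norm (F \<theta> * G \<theta>) \<le> A * B" if "\<theta> \<in> space (torus n)" for \<theta>
    unfolding norm_mult using AB that by (intro mult_mono') auto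
  then show "\<exists>B. \<forall>\<theta>\<in>space (torus n). norm (F \<theta> * G \<theta>) \<le> B" by blast
qed auto

lemma bm_sum: "(\<And>x. x \<in> A \<Longrightarrow> bm n (G x)) \<Longrightarrow> bm n (\<lambda>\<theta>. \<Sum>x\<in>A. G x \<theta>)"
  by (induction A rule: infinite_finite_induct) (auto intro: bm_const bm_add)

lemma bm_prod: "(\<And>x. x \<in> A \<Longrightarrow> bm n (G x)) \<Longrightarrow> bm n (\<lambda>\<theta>. \<Prod>x\<in>A. G x \<theta>)"
  by (induction A rule: infinite_finite_induct) (auto intro: bm_const bm_mult)

lemma bm_comp:
  assumes h: "continuous_on (sphere 0 1) h" and u: "bm n u" "\<And>\<theta>. norm (u \<theta>) = 1"
  shows "bm n (\<lambda>\<theta>. h (u \<theta>))"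
  unfolding bm_def
proof
  have "u \<in> measurable (torus n) (restrict_space borel (sphere 0 1))"
    using u by (intro measurable_restrict_space2) (auto simp: bm_def)
  from measurable_compose[OF this borel_measurable_continuous_on_restrict[OF h]]
  show "(\<lambda>\<theta>. h (u \<theta>)) \<in> borel_measurable (torus n)" by simp
  have "bounded (h ` sphere 0 1)"
    by (intro compact_imp_bounded compact_continuous_image h) simp
  then obtain B where "\<forall>z\<in>h ` sphere 0 1. norm z \<le> B" by (auto simp: bounded_iff)
  then show "\<exists>B. \<forall>\<theta>\<in>space (torus n). norm (h (u \<theta>)) \<le> B" using u(2) by (intro exI[of _ B]) auto
qed

lemma norm_pt [simp]: "norm (pt \<theta> i) = 1"
  by (simp add: pt_def)

lemma bm_pt: "i \<in> {1..n} \<Longrightarrow> bm n (\<lambda>\<theta>. pt \<theta> i)"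
  unfolding bm_def
proof
  assume i: "i \<in> {1..n}"
  have "(\<lambda>x. x) \<in> measurable U borel"
    unfolding U_def by (intro measurable_restrict_space1) simp
  moreover have "ex \<in> borel_measurable borel"
    unfolding ex_eq[abs_def] by (intro borel_measurable_continuous_onI continuous_intros)
  ultimately have exU: "ex \<in> borel_measurable U" by (rule measurable_compose)
  have "(\<lambda>\<theta>. \<theta> i) \<in> measurable (torus n) U"
    unfolding torus_def by (rule measurable_component_singleton[OF i])
  from measurable_compose[OF this exU]
  show "(\<lambda>\<theta>. pt \<theta> i) \<in> borel_measurable (torus n)" by (simp add: pt_def)
qed (auto intro: exI[of _ 1])

lemma bm_integrable: "bm n G \<Longrightarrow> integrable (torus n) G"
proof -
  assume G: "bm n G"
  interpret prob_space "torus n" unfolding torus_def by (intro prob_space_PiM prob_U)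
  obtain B where "\<forall>\<theta>\<in>space (torus n). norm (G \<theta>) \<le> B" using G by (auto simp: bm_def)
  then show ?thesis using G by (intro integrable_const_bound[where B = B]) (auto simp: bm_def)
qed

text \<open>An integrable function integrates to zero if it does so along one coordinate circle.\<close>

lemma integral_zero_slices:
  fixes J :: "(nat \<Rightarrow> real) \<Rightarrow> complex"
  assumes i: "i \<in> {1..n}" and J: "integrable (torus n) J"
    and zero: "\<And>\<theta>. (LINT y|U. J (\<theta>(i := y))) = 0"
  shows "integral\<^sup>L (torus n) J = 0"
proof -
  interpret product_sigma_finite "\<lambda>_ :: nat. U"
    using prob_U by (simp add: product_sigma_finite_def prob_space.finite_measure finite_measure.axioms(1)
        finite_measure.sigma_finite_measure prob_space_imp_sigma_finite)
  have eq: "insert i ({1..n} - {i}) = {1..n}" using i by auto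
  have "integral\<^sup>L (PiM (insert i ({1..n} - {i})) (\<lambda>_. U)) J
      = (LINT x|PiM ({1..n} - {i}) (\<lambda>_. U). LINT y|U. J (x(i := y)))"
  proof (rule product_integral_insert)
    show "integrable (PiM (insert i ({1..n} - {i})) (\<lambda>_. U)) J" unfolding eq using J by (simp add: torus_def)
  qed auto
  then show ?thesis unfolding eq by (simp add: zero torus_def)
qed

lemma integral_zero_swap:
  fixes J :: "(nat \<Rightarrow> real) \<Rightarrow> complex"
  assumes k: "k \<le> n" and J: "J \<in> borel_measurable (torus n)"
    and odd: "\<And>\<theta>. J (\<lambda>i\<in>{1..n}. \<theta> (node_swap n k i)) = - J \<theta>"
  shows "integral\<^sup>L (torus n) J = 0"
proof -
  let ?t = "\<lambda>\<theta>. \<lambda>i\<in>{1..n}. \<theta> (node_swap n k i)"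
  have inj: "inj_on (node_swap n k) {1..n}" "node_swap n k \<in> {1..n} \<rightarrow> {1..n}"
    using bij_node_swap[OF k] by (auto simp: bij_betw_def)
  have d: "distr (torus n) (torus n) ?t = torus n"
    unfolding torus_def by (rule distr_PiM_reindex[OF prob_U inj])
  have t: "?t \<in> measurable (torus n) (torus n)"
    unfolding torus_def using inj(2)
    by (intro measurable_restrict measurable_component_singleton) auto
  have "integral\<^sup>L (torus n) J = integral\<^sup>L (distr (torus n) (torus n) ?t) J" by (simp only: d)
  also have "\<dots> = (LINT \<theta>|torus n. J (?t \<theta>))" by (rule integral_distr[OF t J])
  also have "\<dots> = - integral\<^sup>L (torus n) J" unfolding odd by (rule integral_minus)
  finally have "2 * integral\<^sup>L (torus n) J = 0" by (simp add: eq_neg_iff_add_eq_0)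
  then show ?thesis by simp
qed

section \<open>The weight function on the torus\<close>

locale koorn_weight = koorn n p for n :: nat and p :: koornwinder_pars +
  fixes q t :: real
  assumes q01: "0 < q" "q < 1" and t01: "0 < t" "t < 1"
    and q_half_sq: "(q_half p)\<^sup>2 = complex_of_real q" and par_t_eq: "par_t p = complex_of_real t"
    and aw_small: "norm (aw_a p) < 1" "norm (aw_b p) < 1" "norm (aw_c p) < 1" "norm (aw_d p) < 1"
begin

abbreviation Q :: complex where "Q \<equiv> complex_of_real q"
abbreviation qp :: "complex \<Rightarrow> complex" where "qp y \<equiv> q_poch y Q"

lemma par_q_eq: "par_q p = Q"
  by (simp add: par_q_def q_half_sq)

lemma norm_Q: "norm Q < 1" "norm Q = q"
  using q01 by auto

lemma Q_nz: "Q \<noteq> 0"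
  using q01 by simp

lemmas qp_rec = q_poch_rec[OF norm_Q(1)]
lemmas qp_nz = q_poch_nz[OF norm_Q(1)]

text \<open>On the torus the weight is a product of a factor \<open>\<Phi>(x\<^sup>\<alpha>)\<close> for every short positive root and a factor
  \<open>\<Psi>(x\<^sub>i)\<close> for every coordinate.  The factor \<open>v\<^bsub>-\<alpha>\<^esub>\<close> from \<open>\<C>\<close> cancels the first terms of the infinite
  products in \<open>x\<^bsup>-\<alpha>\<^esup>\<close>, which replaces \<open>x\<^bsup>-\<alpha>\<^esup>\<close> by \<open>q x\<^bsup>-\<alpha>\<^esup>\<close> and makes \<open>\<Phi>\<close> invariant under \<open>y \<mapsto> q / y\<close>.\<close>

definition Phi :: "complex \<Rightarrow> complex"
  where "Phi y = qp y * qp (Q / y) / (qp (of_real t ^ 2 * y) * qp (of_real t ^ 2 * (Q / y)))"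

definition Psi_den :: "complex \<Rightarrow> complex"
  where "Psi_den x = qp (aw_a p * x) * qp (aw_b p * x) * qp (aw_c p * x) * qp (aw_d p * x)"

definition Psi :: "complex \<Rightarrow> complex"
  where "Psi x = qp (x\<^sup>2) * qp (Q / x\<^sup>2)
    / (Psi_den x * (qp (aw_a p / x) * qp (aw_b p / x) * qp (aw_c p * (Q / x)) * qp (aw_d p * (Q / x))))"

definition wt :: "(nat \<Rightarrow> complex) \<Rightarrow> complex"
  where "wt x = (\<Prod>j = 1..n. \<Prod>i = 1..<j. Phi (x i * x j) * Phi (x i / x j)) * (\<Prod>i = 1..n. Psi (x i))"

lemma Phi_inv: "y \<noteq> 0 \<Longrightarrow> Phi (Q / y) = Phi y"
  using Q_nz by (simp add: Phi_def mult.commute)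

lemma t2: "norm (of_real t ^ 2 :: complex) < 1"
  using t01 by (simp add: norm_power power_less_one_iff)

text \<open>Splitting off the first factors exhibits a part that is invariant under \<open>y \<mapsto> y\<^sup>-\<^sup>1\<close>.\<close>

lemma Phi_expand:
  assumes "norm y = 1"
  shows "Phi y * (1 - of_real t ^ 2 * y)
    = (1 - y) * (qp (Q * y) * qp (Q / y) / (qp (of_real t ^ 2 * (Q * y)) * qp (of_real t ^ 2 * (Q / y))))"
proof -
  have "norm (of_real t ^ 2 * y) < 1" using t2 assms by (simp add: norm_mult)
  then have ne: "1 - of_real t ^ 2 * y \<noteq> 0" by (metis norm_one less_irrefl right_minus_eq)
  show ?thesis
    unfolding Phi_def qp_rec[of y] qp_rec[of "of_real t ^ 2 * y"]
    using ne by (simp add: mult_ac)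
qed

text \<open>If \<open>y = 1\<close>, the quotient by \<open>1 - y\<^sup>-\<^sup>1\<close> has the value \<open>0\<close> by convention, and the other side
  vanishes with \<open>(1; q)\<^sub>\<infinity>\<close>.\<close>

lemma weight_pair:
  assumes y: "norm y = 1"
  shows "(1 - of_real t ^ 2 * inverse y) / (1 - inverse y)
      * (qp y / qp (of_real t ^ 2 * y) * (qp (inverse y) / qp (of_real t ^ 2 * inverse y))) = Phi y"
proof (cases "y = 1")
  case True
  have "qp 1 = 0" using qp_rec[of 1] by simp
  then show ?thesis using True by (simp add: Phi_def)
next
  case False
  then have y1: "1 - inverse y \<noteq> 0" by (metis inverse_1 inverse_inverse_eq right_minus_eq)
  have "norm (of_real t ^ 2 * inverse y) < 1" using t2 y by (simp add: norm_mult norm_inverse)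
  then have ne: "1 - of_real t ^ 2 * inverse y \<noteq> 0" by (metis norm_one less_irrefl right_minus_eq)
  show ?thesis
    unfolding Phi_def qp_rec[of "inverse y"] qp_rec[of "of_real t ^ 2 * inverse y"]
    using ne y1 by (simp add: divide_inverse mult_ac)
qed

lemma weight_single:
  assumes x: "norm x = 1"
  shows "(1 - aw_c p * inverse x) * (1 - aw_d p * inverse x) / (1 - inverse x ^ 2)
      * (qp (x\<^sup>2) * qp (inverse x ^ 2) / (Psi_den x * Psi_den (inverse x))) = Psi x"
proof (cases "x\<^sup>2 = 1")
  case True
  have "qp 1 = 0" using qp_rec[of 1] by simp
  then show ?thesis using True by (simp add: Psi_def)
next
  case False
  then have x1: "1 - inverse x ^ 2 \<noteq> 0" by (metis inverse_1 inverse_inverse_eq power_inverse right_minus_eq)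
  have "norm (u * inverse x) < 1 \<Longrightarrow> 1 - u * inverse x \<noteq> 0" for u
    by (metis norm_one less_irrefl right_minus_eq)
  then have ne: "1 - aw_c p * inverse x \<noteq> 0" "1 - aw_d p * inverse x \<noteq> 0"
    using aw_small x by (auto simp: norm_mult norm_inverse)
  have "(1 - aw_c p * inverse x) * ((1 - aw_d p * inverse x)
      * (inverse (1 - aw_c p * inverse x) * inverse (1 - aw_d p * inverse x))) = 1"
    using right_inverse[OF ne(1)] right_inverse[OF ne(2)] by algebra
  then show ?thesis
    unfolding Psi_def Psi_den_def[of "inverse x"] qp_rec[of "inverse x ^ 2"]
      qp_rec[of "aw_c p * inverse x"] qp_rec[of "aw_d p * inverse x"]
    using ne x1 by (simp add: divide_inverse mult_ac power_inverse)
qed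

lemma mon_eps: "i \<in> {1..n} \<Longrightarrow> mon n x (eps i) = x i"
proof -
  assume i: "i \<in> {1..n}"
  have "mon n x (eps i) = (\<Prod>k = 1..n. if k = i then x k else 1)"
    unfolding mon_def by (intro prod.cong) (auto simp: coef_eps)
  then show ?thesis using i by simp
qed

lemma v_val_eq:
  "aff_root n b \<Longrightarrow> v_val n p b x = (1 - tb b * kh b * half_val b x - (tb b)\<^sup>2 * evp x b) / (1 - evp x b)"
  by (simp add: v_val_def leval_v_num leval_v_den)

lemma evp_0: "evp x (v, 0) = mon n x v"
  by (simp add: evp_def)

lemma v_val_short:
  assumes "v \<in> roots n" "\<not> long v"
  shows "v_val n p (v, 0) x = (1 - of_real t ^ 2 * mon n x v) / (1 - mon n x v)"
proof -
  have "aff_root n (v, 0)" using assms by (simp add: aff_root_def)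
  moreover have "tb (v, 0) = of_real t" using tb_root[OF assms(1), of 0] assms(2) by (simp add: par_t_eq)
  ultimately show ?thesis using kh_short[of "(v, 0)"] assms(2) by (simp add: v_val_eq evp_0)
qed

lemma v_val_long:
  assumes i: "i \<in> {1..n}" and x: "nz_point x"
  shows "v_val n p (- smul 2 (eps i), 0) x
    = (1 - aw_c p * inverse (x i)) * (1 - aw_d p * inverse (x i)) / (1 - inverse (x i) ^ 2)"
proof -
  let ?v = "- smul 2 (eps i)"
  have v: "?v \<in> roots n" using roots_longI[OF i, of "-1"] by simp
  then have b: "aff_root n (?v, 0)" by (simp add: aff_root_def)
  have lg: "long ?v" by (auto simp: long_def coef_eps intro!: exI[of _ i])
  have l: "- eps i \<in> lattice n" using i by auto
  have half: "aff_scale (1/2) (?v, 0) = (- eps i, 0)"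
    by (simp add: aff_scale_def)
  have me: "mon n x (- eps i) = inverse (x i)"
    using i x by (subst mon_uminus) (auto simp: mon_eps nz_point_def)
  have hv: "half_val (?v, 0) x = inverse (x i)" by (simp add: half_val_def lg half evp_0 me)
  have ev: "evp x (?v, 0) = inverse (x i) ^ 2"
    using half_val_sq[OF b _ x] lg by (simp add: hv power2_eq_square)
  have tb: "tb (?v, 0) = par_tn p" using tb_root[OF v, of 0] lg by simp
  have "l1 n (- eps i) = 1" by (simp only: l1_uminus l1_eps[OF i])
  then have th: "th (?v, 0) = par_tnv p"
    using l by (simp add: th_def half mult_par_alt roots_def)
  have "1 - par_tn p * (par_tnv p - inverse (par_tnv p)) * X - (par_tn p)\<^sup>2 * X\<^sup>2 = (1 - aw_c p * X) * (1 - aw_d p * X)" for X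
    using right_inverse[OF pars_nz(5)] unfolding aw_c_def aw_d_def by algebra
  then show ?thesis
    unfolding v_val_eq[OF b] ev hv tb kh_def th by simp
qed

lemma weight_eq:
  assumes x: "\<And>i. norm (x i) = 1"
  shows "weight n p x = wt x"
proof -
  have nz: "x i \<noteq> 0" for i using x[of i] by auto
  have nzp: "nz_point x" using nz by (simp add: nz_point_def)
  have W1: "weight_c n p x = (\<Prod>i = 1..n. (1 - aw_c p * inverse (x i)) * (1 - aw_d p * inverse (x i)) / (1 - inverse (x i) ^ 2))
      * (\<Prod>j = 1..n. \<Prod>i = 1..<j. (1 - of_real t ^ 2 * inverse (x i * x j)) / (1 - inverse (x i * x j))
          * ((1 - of_real t ^ 2 * inverse (x i / x j)) / (1 - inverse (x i / x j))))"
  proof -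
    have "weight_c n p x = (\<Prod>v\<in>pos_roots n. v_val n p (- v, 0) x)"
      unfolding weight_c_def neg_roots_def by (subst prod.reindex) (auto simp: inj_on_def)
    also have "\<dots> = (\<Prod>i = 1..n. v_val n p (- smul 2 (eps i), 0) x)
        * (\<Prod>j = 1..n. \<Prod>i = 1..<j. v_val n p (- (eps i + eps j), 0) x * v_val n p (- (eps i - eps j), 0) x)"
      by (rule prod_pos_roots)
    also have "(\<Prod>i = 1..n. v_val n p (- smul 2 (eps i), 0) x)
        = (\<Prod>i = 1..n. (1 - aw_c p * inverse (x i)) * (1 - aw_d p * inverse (x i)) / (1 - inverse (x i) ^ 2))"
      by (intro prod.cong refl v_val_long nzp)
    also have "(\<Prod>j = 1..n. \<Prod>i = 1..<j. v_val n p (- (eps i + eps j), 0) x * v_val n p (- (eps i - eps j), 0) x)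
      = (\<Prod>j = 1..n. \<Prod>i = 1..<j. (1 - of_real t ^ 2 * inverse (x i * x j)) / (1 - inverse (x i * x j))
          * ((1 - of_real t ^ 2 * inverse (x i / x j)) / (1 - inverse (x i / x j))))"
    proof (intro prod.cong refl)
      fix j i assume j: "j \<in> {1..n}" and i: "i \<in> {1..<j}"
      have r: "- (eps i + eps j) \<in> roots n" "- (eps i - eps j) \<in> roots n"
        using roots_shortI[of i j n "-1" "-1"] roots_shortI[of i j n "-1" 1] i j by auto
      have ns: "\<not> long (- (eps i + eps j))" "\<not> long (- (eps i - eps j))"
        using i by (auto simp: long_def coef_eps lookup_add lookup_minus)
      have l: "eps i \<in> lattice n" "eps j \<in> lattice n" using i j by auto
      have "mon n x (eps i + eps j) = x i * x j" using l i j nz by (subst mon_add) (auto simp: mon_eps)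
      then have m1: "mon n x (- (eps i + eps j)) = inverse (x i * x j)"
        using l nz by (subst mon_uminus) auto
      have "mon n x (eps i + - eps j) = x i / x j"
        using l i j nz by (subst mon_add) (auto simp: mon_eps mon_uminus divide_inverse)
      then have m2: "mon n x (- (eps i - eps j)) = inverse (x i / x j)"
        using l nz by (subst mon_uminus) auto
      show "v_val n p (- (eps i + eps j), 0) x * v_val n p (- (eps i - eps j), 0) x
        = (1 - of_real t ^ 2 * inverse (x i * x j)) / (1 - inverse (x i * x j))
          * ((1 - of_real t ^ 2 * inverse (x i / x j)) / (1 - inverse (x i / x j)))"
        unfolding v_val_short[OF r(1) ns(1)] v_val_short[OF r(2) ns(2)] m1 m2 ..
    qed
    finally show ?thesis .
  qed
  let ?r = "\<lambda>y. qp y / qp (of_real t ^ 2 * y)"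
  have W2: "weight_plus n p x = (\<Prod>j = 1..n. \<Prod>i = 1..<j.
        ?r (x i * x j) * ?r (inverse (x i * x j)) * (?r (x i / x j) * ?r (inverse (x i / x j))))
      * (\<Prod>i = 1..n. qp ((x i)\<^sup>2) * qp (inverse (x i) ^ 2) / (Psi_den (x i) * Psi_den (inverse (x i))))"
    unfolding weight_plus_def par_q_eq par_t_eq
    by (intro arg_cong2[where f = "(*)"] prod.cong refl) (simp_all add: divide_inverse Psi_den_def mult_ac)
  have "weight n p x = (\<Prod>j = 1..n. \<Prod>i = 1..<j.
      ((1 - of_real t ^ 2 * inverse (x i * x j)) / (1 - inverse (x i * x j))
          * (?r (x i * x j) * ?r (inverse (x i * x j))))
      * ((1 - of_real t ^ 2 * inverse (x i / x j)) / (1 - inverse (x i / x j))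
          * (?r (x i / x j) * ?r (inverse (x i / x j)))))
    * (\<Prod>i = 1..n. (1 - aw_c p * inverse (x i)) * (1 - aw_d p * inverse (x i)) / (1 - inverse (x i) ^ 2)
        * (qp ((x i)\<^sup>2) * qp (inverse (x i) ^ 2) / (Psi_den (x i) * Psi_den (inverse (x i)))))"
    unfolding weight_def W1 W2 prod.distrib by (simp only: mult_ac)
  also have "\<dots> = wt x"
    unfolding wt_def
    using x by (intro arg_cong2[where f = "(*)"] prod.cong refl weight_pair weight_single)
      (simp_all add: norm_mult norm_divide)
  finally show ?thesis .
qed

end

section \<open>The Hecke operators are unitary for the bilinear form\<close>

lemma leval_cong:
  assumes "f \<in> laurent n" "\<And>i. i \<in> {1..n} \<Longrightarrow> x i = y i"
  shows "leval f x = leval f y"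
proof -
  have "mon n x l = mon n y l" for l unfolding mon_def by (intro prod.cong) (auto simp: assms(2))
  then show ?thesis by (simp add: leval_laurent[OF assms(1)])
qed

lemma leval_holo:
  assumes f: "f \<in> laurent n" and X: "\<And>i. i \<in> {1..n} \<Longrightarrow> (\<lambda>z. X z i) holomorphic_on A"
    and nz: "\<And>i z. i \<in> {1..n} \<Longrightarrow> z \<in> A \<Longrightarrow> X z i \<noteq> 0"
  shows "(\<lambda>z. leval f (X z)) holomorphic_on A"
  unfolding leval_laurent[OF f] mon_def
  by (intro holomorphic_intros X) (use nz in auto)

lemma mon_pt_inv: "mon n (pt_inv x) l = inverse (mon n x l)"
  by (simp add: mon_def pt_inv_def power_int_inverse prod_inversef[symmetric] comp_def)

context koorn_weight
begin

sublocale inv: koorn n "inv_pars p"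
  using q_half_nz pars_nz by unfold_locales (auto simp: inv_pars_def)

lemma inv_mult_par: "mult_par n (inv_pars p) b = inverse (mult_par n p b)"
  by (simp add: mult_par_alt inv_pars_def)

lemma inv_params: "inv.tb b = inverse (tb b)" "inv.kb b = - kb b" "inv.kh b = - kh b"
  by (simp_all add: inv.tb_def tb_def inv.kb_def kb_def inv.kh_def kh_def inv.th_def th_def inv_mult_par)

lemma inv_q_pow: "q_pow (inv_pars p) c = inverse (q_pow p c)"
  by (simp add: q_pow_def inv_pars_def power_int_inverse)

lemma inv_evp: "inv.evp (pt_inv x) b = inverse (evp x b)"
  by (simp add: inv.evp_def evp_def inv_q_pow mon_pt_inv)

lemma inv_half_val: "inv.half_val b (pt_inv x) = inverse (half_val b x)"
  by (simp add: inv.half_val_def half_val_def inv_evp)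

lemma inv_ptrefl: "inv.ptrefl k (pt_inv x) = pt_inv (ptrefl k x)"
proof
  have "par_q (inv_pars p) = inverse (par_q p)" by (simp add: par_q_def inv_pars_def power_inverse)
  then show "inv.ptrefl k (pt_inv x) i = pt_inv (ptrefl k x) i" for i
    unfolding inv.ptrefl_def ptrefl_def pt_inv_def by (simp add: divide_inverse)
qed

lemma inv_nz: "nz_point x \<Longrightarrow> inv.nz_point (pt_inv x)"
  by (simp add: nz_point_def inv.nz_point_def pt_inv_def)

lemma minus_diff_left_divide: "(- u - v) / w = - ((u + v) / (w :: complex))"
  by (metis diff_conv_add_uminus minus_add_distrib minus_divide_left)

text \<open>Inverting the parameters and the point replaces \<open>\<beta>\<close> by \<open>\<beta> - (t\<^sub>k - t\<^sub>k\<^sup>-\<^sup>1)\<close>, because the factor \<open>bf\<close> turns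
  into minus the one of \<open>- a\<^sub>k\<close>.\<close>

lemma inv_T_eval:
  assumes k: "k \<le> n" and g: "g \<in> laurent n" and x: "nz_point x" and ne: "evp x (a k) \<noteq> 1"
  shows "leval (hecke_gen n (inv_pars p) k g) (pt_inv x)
    = (bf (a k) x - kb (a k)) * leval g (pt_inv x) + (tb (a k) - bf (a k) x) * leval g (pt_inv (ptrefl k x))"
proof -
  note r = simple_root_root[OF k]
  have ne': "inv.evp (pt_inv x) (a k) \<noteq> 1"
    using ne by (simp add: inv_evp inverse_eq_1_iff)
  have "kb (- a k) = kb (a k)" "kh (- a k) = kh (a k)"
    using kb_s[OF k, of "a k"] kh_s[OF k, of "a k"] by (simp_all add: s_simple_root[OF k])
  then have "inv.bf (a k) (pt_inv x) = - bf (- a k) x"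
    unfolding inv.bf_def bf_def inv_params inv_half_val inv_evp half_val_uminus[OF r x]
      evp_uminus[OF aff_root_half(2)[OF r] aff_root_half(1)[OF r] x]
    by (simp add: minus_diff_left_divide)
  then have bf: "inv.bf (a k) (pt_inv x) = bf (a k) x - kb (a k)"
    using bf_neg_simple[OF k x ne] by simp
  have "inverse (tb (a k)) - (bf (a k) x - kb (a k)) = tb (a k) - bf (a k) x" by (simp add: kb_def)
  then show ?thesis
    using inv.T_eval[OF k g inv_nz[OF x] ne'] by (simp add: bf inv_params inv_ptrefl)
qed

text \<open>\<open>odd_part\<close> is odd under the reflection of the point, while the factor in front of it
  combines with the weight to something even.\<close>

definition odd_part :: "nat \<Rightarrow> expalg \<Rightarrow> expalg \<Rightarrow> (nat \<Rightarrow> complex) \<Rightarrow> complex"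
  where "odd_part k f g x =
    leval (T k f) x * (leval g (pt_inv (ptrefl k x)) - leval g (pt_inv x))
    + inverse (tb (a k)) * leval g (pt_inv x) * (leval f (ptrefl k x) - leval f x)"

text \<open>The difference of the two integrands, apart from the weight.\<close>

definition jump :: "nat \<Rightarrow> expalg \<Rightarrow> expalg \<Rightarrow> (nat \<Rightarrow> complex) \<Rightarrow> complex"
  where "jump k f g x = leval (T k f) x * leval (hecke_gen n (inv_pars p) k g) (pt_inv x)
    - leval f x * leval g (pt_inv x)"

lemma jump_eq:
  assumes k: "k \<le> n" and f: "f \<in> laurent n" and g: "g \<in> laurent n" and x: "nz_point x" and ne: "evp x (a k) \<noteq> 1"
  shows "jump k f g x = (tb (a k) - bf (a k) x) * odd_part k f g x"
proof -
  have t: "tb (a k) * inverse (tb (a k)) = 1" "kb (a k) = tb (a k) - inverse (tb (a k))"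
    using tb_nz by (simp_all add: kb_def)
  show ?thesis
    unfolding jump_def odd_part_def inv_T_eval[OF k g x ne] T_eval[OF k f x ne] using t by algebra
qed

lemma evp_ptrefl_self: "k \<le> n \<Longrightarrow> nz_point x \<Longrightarrow> evp (ptrefl k x) (a k) = inverse (evp x (a k))"
  using aff_root_half[OF simple_root_root[of k]] by (simp add: evp_s[symmetric] s_simple_root evp_uminus)

lemma evp_simple:
  assumes x: "nz_point x"
  shows "evp x (a 0) = par_q p / (x 1)\<^sup>2" "evp x (a n) = (x n)\<^sup>2"
    "0 < k \<Longrightarrow> k < n \<Longrightarrow> evp x (a k) = x k / x (Suc k)"
proof -
  have nz: "x i \<noteq> 0" for i using x by (simp add: nz_point_def)
  have two: "mon n x (smul 2 (eps i)) = (x i)\<^sup>2" if "i \<in> {1..n}" for i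
    using mon_smul_int[of "eps i" n x 2] that nz by (simp add: mon_eps)
  have "q_pow p 1 = par_q p" using q_pow_int[of 1] by simp
  moreover have "mon n x (- smul 2 (eps 1)) = inverse ((x 1)\<^sup>2)"
    using nz n2 two[of 1] by (subst mon_uminus) (auto intro: lattice_smul)
  ultimately show "evp x (a 0) = par_q p / (x 1)\<^sup>2"
    by (simp add: simple_root_def evp_def divide_inverse)
  show "evp x (a n) = (x n)\<^sup>2" using two[of n] n2 by (simp add: simple_root_def evp_0)
  assume k: "0 < k" "k < n"
  have "mon n x (eps k + - eps (Suc k)) = x k / x (Suc k)"
    using k nz by (subst mon_add) (auto simp: mon_eps mon_uminus divide_inverse)
  then show "evp x (a k) = x k / x (Suc k)" using k by (simp add: simple_root_def evp_0)
qed

lemma ptrefl_fixed: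
  assumes k: "k \<le> n" and x: "nz_point x" and 1: "evp x (a k) = 1"
  shows "ptrefl k x = x"
proof -
  have nz: "x i \<noteq> 0" for i using x by (simp add: nz_point_def)
  consider "k = 0" | "k = n" "k \<noteq> 0" | "0 < k" "k < n" using k by linarith
  then show ?thesis
  proof cases
    case 1
    then have "par_q p = x 1 * x 1" using assms(3) evp_simple(1)[OF x] nz[of 1] by (simp add: power2_eq_square)
    then show ?thesis using nz[of 1] 1 by (auto simp: ptrefl_upd fun_eq_iff)
  next
    case 2
    then have "x n * x n = 1" using assms(3) evp_simple(2)[OF x] by (simp add: power2_eq_square)
    then have "inverse (x n) = x n" by (metis inverse_unique)
    then show ?thesis using 2 by (auto simp: ptrefl_upd fun_eq_iff)
  next
    case 3
    then have "x k = x (Suc k)" using assms(3) evp_simple(3)[OF x 3] nz[of "Suc k"] by simp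
    then show ?thesis using 3 by (auto simp: ptrefl_upd fun_eq_iff)
  qed
qed

lemma odd_part_odd:
  assumes k: "k \<le> n" and f: "f \<in> laurent n" and g: "g \<in> laurent n" and x: "nz_point x"
  shows "odd_part k f g (ptrefl k x) = - odd_part k f g x"
proof (cases "evp x (a k) = 1")
  case True
  then show ?thesis using ptrefl_fixed[OF k x] by (simp add: odd_part_def)
next
  case False
  have F: "evp (ptrefl k x) (a k) \<noteq> 1" using False by (simp add: evp_ptrefl_self[OF k x] inverse_eq_1_iff)
  have t: "tb (a k) * inverse (tb (a k)) = 1" "kb (a k) = tb (a k) - inverse (tb (a k))"
    using tb_nz by (simp_all add: kb_def)
  show ?thesis
    unfolding odd_part_def T_eval[OF k f x False] T_eval[OF k f nz_ptrefl[OF x] F] ptrefl_invol[OF k x]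
      bf_refl_self[OF k x False]
    using t by algebra
qed

subsection \<open>Behaviour of the weight under simple reflections\<close>

lemma wt_parts:
  "\<exists>R. wt x = R * Psi (x n) \<and> (x n \<noteq> 0 \<longrightarrow> wt (ptrefl n x) = R * Psi (inverse (x n)))"
proof (intro exI conjI impI)
  let ?R = "(\<Prod>j = 1..n. \<Prod>i = 1..<j. Phi (x i * x j) * Phi (x i / x j)) * (\<Prod>i \<in> {1..n} - {n}. Psi (x i))"
  have rm: "prod F {1..n} = F n * prod F ({1..n} - {n})" for F :: "nat \<Rightarrow> complex"
    using n2 by (intro prod.remove) auto
  show "wt x = ?R * Psi (x n)" unfolding wt_def rm[of "\<lambda>i. Psi (x i)"] by (simp only: mult_ac)
  assume "x n \<noteq> 0"
  let ?y = "ptrefl n x"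
  have y: "?y i = (if i = n then inverse (x n) else x i)" for i by (simp add: ptrefl_upd)
  have "(\<Prod>j = 1..n. \<Prod>i = 1..<j. Phi (?y i * ?y j) * Phi (?y i / ?y j))
      = (\<Prod>j = 1..n. \<Prod>i = 1..<j. Phi (x i * x j) * Phi (x i / x j))"
    by (intro prod.cong refl) (auto simp: y divide_inverse mult.commute)
  moreover have "(\<Prod>i\<in>{1..n} - {n}. Psi (?y i)) = (\<Prod>i\<in>{1..n} - {n}. Psi (x i))"
    by (intro prod.cong) (auto simp: y)
  moreover have "Psi (?y n) = Psi (inverse (x n))" by (simp add: y)
  ultimately show "wt ?y = ?R * Psi (inverse (x n))"
    unfolding wt_def rm[of "\<lambda>i. Psi (?y i)"] by (simp only: mult_ac)
qed

lemma wt_swap: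
  assumes k: "0 < k" "k < n"
  shows "\<exists>R. wt x = R * Phi (x k / x (Suc k)) \<and> wt (ptrefl k x) = R * Phi (x (Suc k) / x k)"
proof -
  let ?P = "SIGMA j:{1..n}. {1..<j}" and ?s = "node_swap n k" and ?y = "ptrefl k x"
  let ?G = "\<lambda>x (j, i). Phi (x i * x j) * Phi (x i / (x j :: complex))"
  have W: "wt x = (\<Prod>e\<in>?P. ?G x e) * (\<Prod>i = 1..n. Psi (x i))" for x
    unfolding wt_def by (subst prod.Sigma) (auto simp: case_prod_unfold)
  have y: "?y i = x (?s i)" for i using k by (simp add: ptrefl_def)
  have in_P: "(Suc k, k) \<in> ?P" and fin: "finite ?P" using k by auto
  have rm: "(\<Prod>e\<in>?P. F e) = F (Suc k, k) * (\<Prod>e\<in>?P - {(Suc k, k)}. F e)" for F :: "nat \<times> nat \<Rightarrow> complex"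
    by (rule prod.remove[OF fin in_P])
  have bij: "bij_betw (\<lambda>(j, i). (?s j, ?s i)) (?P - {(Suc k, k)}) (?P - {(Suc k, k)})"
    using k by (intro bij_betw_byWitness[where f' = "\<lambda>(j, i). (?s j, ?s i)"])
      (auto simp: node_swap_def split: if_splits)
  have "(\<Prod>e\<in>?P - {(Suc k, k)}. ?G ?y e) = (\<Prod>e\<in>?P - {(Suc k, k)}. ?G x ((\<lambda>(j, i). (?s j, ?s i)) e))"
    by (intro prod.cong refl) (auto simp: y)
  also have "\<dots> = (\<Prod>e\<in>?P - {(Suc k, k)}. ?G x e)"
    by (rule prod.reindex_bij_betw[OF bij])
  finally have rest: "(\<Prod>e\<in>?P - {(Suc k, k)}. ?G ?y e) = (\<Prod>e\<in>?P - {(Suc k, k)}. ?G x e)" .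
  have "(\<Prod>i = 1..n. Psi (?y i)) = (\<Prod>i = 1..n. Psi (x i))"
    unfolding y using k by (intro prod.reindex_bij_betw bij_node_swap) simp
  moreover have "?G ?y (Suc k, k) = Phi (x k * x (Suc k)) * Phi (x (Suc k) / x k)"
    using k by (simp add: y node_swap_def mult.commute)
  ultimately show ?thesis
    unfolding W rm[of "?G x"] rm[of "?G ?y"] rest
    by (intro exI[of _ "Phi (x k * x (Suc k)) * (\<Prod>e\<in>?P - {(Suc k, k)}. ?G x e) * (\<Prod>i = 1..n. Psi (x i))"]) simp
qed

lemma norm_ne: "norm z < 1 \<Longrightarrow> 1 - z \<noteq> (0 :: complex)"
  by (metis norm_one less_irrefl right_minus_eq)

lemma factor_short:
  assumes k: "0 < k" "k < n" and x: "nz_point x"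
  shows "tb (a k) - bf (a k) x = (if evp x (a k) = 1 then of_real t
    else inverse (of_real t) * (1 - of_real t ^ 2 * evp x (a k)) / (1 - evp x (a k)))"
proof -
  have kn: "k \<le> n" using k by simp
  have "\<not> long (fst (a k))" using k by (simp add: long_simple)
  then have kh: "kh (a k) = 0" by (rule kh_short[OF simple_root_root[OF kn]])
  have tb: "tb (a k) = of_real t" using hecke_par_eq[OF kn] k by (simp add: hecke_par_def par_t_eq)
  have t0: "complex_of_real t \<noteq> 0" using t01 by simp
  show ?thesis
    using t0 by (auto simp: bf_def kh kb_def tb) (simp add: field_simps power2_eq_square)
qed

lemma half_simple:
  assumes x: "nz_point x"
  shows "half_val (a n) x = x n" "half_val (a 0) x = q_half p / x 1"
proof -
  have nz: "x i \<noteq> 0" for i using x by (simp add: nz_point_def)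
  show "half_val (a n) x = x n"
    using n2 long_simple[of n] by (simp add: half_val_def simple_root_def aff_scale_def evp_0 mon_eps)
  have m: "mon n x (- eps 1) = inverse (x 1)" using nz n2 by (subst mon_uminus) (auto simp: mon_eps)
  have h: "q_pow p (1 / 2) = q_half p" by (simp add: q_pow_def)
  have s: "aff_scale (1 / 2) (a 0) = (- eps 1, 1 / 2)"
    by (simp add: simple_root_def aff_scale_def)
  have "long (fst (a 0))" by (simp add: long_simple)
  then have "half_val (a 0) x = evp x (- eps 1, 1 / 2)" by (simp only: half_val_def s if_True)
  also have "\<dots> = q_half p / x 1" by (simp only: evp_def fst_conv snd_conv m h) (simp add: divide_inverse)
  finally show "half_val (a 0) x = q_half p / x 1" .
qed

lemma params_ends:
  "tb (a 0) = par_t0 p" "th (a 0) = par_t0v p" "tb (a n) = par_tn p" "th (a n) = par_tnv p"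
proof -
  show "tb (a 0) = par_t0 p" "tb (a n) = par_tn p"
    using hecke_par_eq[of 0] hecke_par_eq[of n] n2 by (simp_all add: hecke_par_def)
  show "th (a 0) = par_t0v p" "th (a n) = par_tnv p"
    using n2 l1_eps[of 1] l1_eps[of n]
    by (simp_all add: th_def simple_root_def aff_scale_def mult_par_alt roots_def l1_uminus)
qed

lemma long_factor:
  fixes tb th X :: complex
  assumes "tb \<noteq> 0" "th \<noteq> 0" "X\<^sup>2 \<noteq> 1"
  shows "tb - (tb - inverse tb + (th - inverse th) * X) / (1 - X\<^sup>2)
    = inverse tb * (1 - tb * th * X) * (1 + tb * inverse th * X) / (1 - X\<^sup>2)"
proof -
  have ne: "1 - X\<^sup>2 \<noteq> 0" using assms by simp
  have "tb * (1 - X\<^sup>2) - (tb - inverse tb + (th - inverse th) * X)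
      = inverse tb * (1 - tb * th * X) * (1 + tb * inverse th * X)"
    using right_inverse[OF assms(1)] right_inverse[OF assms(2)] by algebra
  then show ?thesis using ne by (simp add: field_simps)
qed

lemma factor_n:
  assumes x: "nz_point x" and ne: "(x n)\<^sup>2 \<noteq> 1"
  shows "tb (a n) - bf (a n) x
    = inverse (par_tn p) * (1 - aw_c p * x n) * (1 - aw_d p * x n) / (1 - (x n)\<^sup>2)"
  unfolding bf_def kb_def kh_def params_ends half_simple[OF x] evp_simple(2)[OF x]
  using long_factor[OF pars_nz(3) pars_nz(5) ne] by (simp add: aw_c_def aw_d_def)

lemma factor_0:
  assumes x: "nz_point x" and ne: "(x 1)\<^sup>2 \<noteq> Q"
  shows "tb (a 0) - bf (a 0) x
    = inverse (par_t0 p) * (1 - aw_a p / x 1) * (1 - aw_b p / x 1) / (1 - Q / (x 1)\<^sup>2)"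
proof -
  have sq: "(q_half p / x 1)\<^sup>2 = Q / (x 1)\<^sup>2" by (simp add: power_divide q_half_sq)
  have "x 1 \<noteq> 0" using x by (simp add: nz_point_def)
  then have "(q_half p / x 1)\<^sup>2 \<noteq> 1" using ne unfolding sq by (auto simp: divide_eq_1_iff)
  from long_factor[OF pars_nz(1) pars_nz(4) this] show ?thesis
    unfolding bf_def kb_def kh_def params_ends half_simple[OF x] evp_simple(1)[OF x] par_q_eq sq
    by (simp add: aw_a_def aw_b_def)
qed

text \<open>On the torus \<open>t\<^sub>k - \<beta>\<close> is \<open>t\<^sup>-\<^sup>1 (1 - t\<^sup>2 y) / (1 - y)\<close> with \<open>y = x\<^bsup>a\<^sub>k\<^esup>\<close>.  It completes the factor \<open>\<Phi>(y)\<close> of the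
  weight to a function of \<open>y\<close> that is invariant under \<open>y \<mapsto> y\<^sup>-\<^sup>1\<close>, and \<open>s\<^sub>k\<close> permutes the other factors.\<close>

lemma even_short:
  assumes k: "0 < k" "k < n" and x: "nz_point x" "norm (x k) = 1" "norm (x (Suc k)) = 1"
    and ne: "evp x (a k) \<noteq> 1"
  shows "(tb (a k) - bf (a k) x) * wt x = (tb (a k) - bf (a k) (ptrefl k x)) * wt (ptrefl k x)"
proof -
  define y where "y = x k / x (Suc k)"
  have y: "norm y = 1" "evp x (a k) = y" "y \<noteq> 1" "norm (inverse y) = 1" "inverse y \<noteq> 1"
    using x ne evp_simple(3)[OF x(1) k] by (auto simp: y_def norm_divide norm_inverse inverse_eq_1_iff)
  have nzp: "nz_point (ptrefl k x)" by (rule nz_ptrefl[OF x(1)])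
  have ev': "evp (ptrefl k x) (a k) = inverse y" using evp_ptrefl_self[of k x] k x y by simp
  obtain R where R: "wt x = R * Phi y" "wt (ptrefl k x) = R * Phi (inverse y)"
    using wt_swap[OF k, of x] by (auto simp: y_def inverse_eq_divide)
  let ?S = "\<lambda>y. qp (Q * y) * qp (Q / y) / (qp (of_real t ^ 2 * (Q * y)) * qp (of_real t ^ 2 * (Q / y)))"
  have F: "(1 - of_real t ^ 2 * y) / (1 - y) * Phi y = ?S y" if "norm y = 1" "y \<noteq> 1" for y
    using Phi_expand[OF that(1)] that(2) by (simp add: field_simps)
  have "?S (inverse y) = ?S y" by (simp add: divide_inverse mult.commute)
  then have "(1 - of_real t ^ 2 * y) / (1 - y) * Phi y
      = (1 - of_real t ^ 2 * inverse y) / (1 - inverse y) * Phi (inverse y)"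
    using F[OF y(1,3)] F[OF y(4,5)] by simp
  then have "inverse (of_real t) * R * ((1 - of_real t ^ 2 * y) / (1 - y) * Phi y)
      = inverse (of_real t) * R * ((1 - of_real t ^ 2 * inverse y) / (1 - inverse y) * Phi (inverse y))"
    by (rule arg_cong)
  then show ?thesis
    unfolding factor_short[OF k x(1)] factor_short[OF k nzp] y(2) ev' R
    using y(3,5) by (simp only: if_False) (simp only: times_divide_eq_right times_divide_eq_left mult_ac)
qed

lemma Psi_even:
  assumes x: "norm x = 1" "x\<^sup>2 \<noteq> 1"
  shows "(1 - aw_c p * x) * (1 - aw_d p * x) / (1 - x\<^sup>2) * Psi x
    = qp (Q * x\<^sup>2) * qp (Q / x\<^sup>2)
      / (qp (aw_a p * x) * qp (aw_b p * x) * qp (aw_c p * (Q * x)) * qp (aw_d p * (Q * x))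
        * (qp (aw_a p / x) * qp (aw_b p / x) * qp (aw_c p * (Q / x)) * qp (aw_d p * (Q / x))))"
proof -
  have ne: "1 - aw_c p * x \<noteq> 0" "1 - aw_d p * x \<noteq> 0" "1 - x\<^sup>2 \<noteq> 0"
    using norm_ne[of "aw_c p * x"] norm_ne[of "aw_d p * x"] aw_small x by (auto simp: norm_mult)
  have "(1 - aw_c p * x) * ((1 - aw_d p * x) * (inverse (1 - aw_c p * x) * inverse (1 - aw_d p * x))) = 1"
    using right_inverse[OF ne(1)] right_inverse[OF ne(2)] by algebra
  then show ?thesis
    unfolding Psi_def Psi_den_def qp_rec[of "x\<^sup>2"] qp_rec[of "aw_c p * x"] qp_rec[of "aw_d p * x"]
    using ne by (simp add: divide_inverse mult_ac)
qed

lemma even_n: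
  assumes x: "nz_point x" "norm (x n) = 1" and ne: "evp x (a n) \<noteq> 1"
  shows "(tb (a n) - bf (a n) x) * wt x = (tb (a n) - bf (a n) (ptrefl n x)) * wt (ptrefl n x)"
proof -
  have x2: "(x n)\<^sup>2 \<noteq> 1" using ne evp_simple(2)[OF x(1)] by simp
  have nzp: "nz_point (ptrefl n x)" by (rule nz_ptrefl[OF x(1)])
  have y: "ptrefl n x n = inverse (x n)" by (simp add: ptrefl_upd)
  have y2: "(inverse (x n))\<^sup>2 \<noteq> 1" using x2 by (simp add: power_inverse inverse_eq_1_iff)
  have "x n \<noteq> 0" using x by (simp add: nz_point_def)
  then obtain R where R: "wt x = R * Psi (x n)" "wt (ptrefl n x) = R * Psi (inverse (x n))"
    using wt_parts[of x] by blast
  have "norm (inverse (x n)) = 1" using x by (simp add: norm_inverse)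
  have "(1 - aw_c p * x n) * (1 - aw_d p * x n) / (1 - (x n)\<^sup>2) * Psi (x n)
      = (1 - aw_c p * inverse (x n)) * (1 - aw_d p * inverse (x n)) / (1 - (inverse (x n))\<^sup>2) * Psi (inverse (x n))"
    unfolding Psi_even[OF x(2) x2] Psi_even[OF \<open>norm (inverse (x n)) = 1\<close> y2]
    by (simp add: divide_inverse power_inverse mult_ac)
  then have "inverse (par_tn p) * R * ((1 - aw_c p * x n) * (1 - aw_d p * x n) / (1 - (x n)\<^sup>2) * Psi (x n))
      = inverse (par_tn p) * R * ((1 - aw_c p * inverse (x n)) * (1 - aw_d p * inverse (x n)) / (1 - (inverse (x n))\<^sup>2) * Psi (inverse (x n)))"
    by (rule arg_cong)
  then show ?thesis
    unfolding factor_n[OF x(1) x2] factor_n[OF nzp, unfolded y, OF y2] R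
    by (simp only: times_divide_eq_right times_divide_eq_left mult_ac)
qed

end

context koorn_weight
begin

text \<open>At the fixed points of \<open>s\<^sub>k\<close> on the torus, where \<open>\<beta>\<close> has a pole, the weight vanishes because of a
  factor \<open>(1; q)\<^sub>\<infinity>\<close>.\<close>

lemma wt_fixed:
  assumes k: "0 < k" "k \<le> n" and x: "nz_point x" and 1: "evp x (a k) = 1"
  shows "wt x = 0"
proof -
  have "qp 1 = 0" using qp_rec[of 1] by simp
  then have z: "Phi 1 = 0" "y\<^sup>2 = 1 \<Longrightarrow> Psi y = 0" for y by (simp_all add: Phi_def Psi_def)
  show ?thesis
  proof (cases "k = n")
    case True
    then have "(x n)\<^sup>2 = 1" using evp_simple(2)[OF x] 1 by simp
    then show ?thesis using wt_parts[of x] z(2)[of "x n"] by auto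
  next
    case False
    then have kn: "k < n" using k by simp
    then have "x k / x (Suc k) = 1" using evp_simple(3)[OF x k(1)] 1 by simp
    then show ?thesis using wt_swap[OF k(1) kn, of x] z(1) by auto
  qed
qed

lemma jump_wt_odd:
  assumes k: "0 < k" "k \<le> n" and f: "f \<in> laurent n" and g: "g \<in> laurent n" and x: "\<And>i. norm (x i) = 1"
  shows "jump k f g (ptrefl k x) * wt (ptrefl k x) = - (jump k f g x * wt x)"
proof -
  have "x i \<noteq> 0" for i using x[of i] by auto
  then have nz: "nz_point x" by (simp add: nz_point_def)
  show ?thesis
  proof (cases "evp x (a k) = 1")
    case True
    then show ?thesis using wt_fixed[OF k nz] ptrefl_fixed[OF k(2) nz] by simp
  next
    case False
    have ne: "evp (ptrefl k x) (a k) \<noteq> 1"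
      using False by (simp add: evp_ptrefl_self[OF k(2) nz] inverse_eq_1_iff)
    have ev: "(tb (a k) - bf (a k) x) * wt x = (tb (a k) - bf (a k) (ptrefl k x)) * wt (ptrefl k x)"
    proof (cases "k = n")
      case True
      then show ?thesis using even_n[OF nz x] False by simp
    next
      case n: False
      then show ?thesis using even_short[OF k(1) _ nz x x False] k by simp
    qed
    show ?thesis
      unfolding jump_eq[OF k(2) f g nz False] jump_eq[OF k(2) f g nz_ptrefl[OF nz] ne] odd_part_odd[OF k(2) f g nz]
      using ev by algebra
  qed
qed

subsection \<open>Measurability and holomorphy of the integrands\<close>

text \<open>If \<open>r < 1\<close> bounds \<open>t\<^sup>2\<close> and the moduli of \<open>a, b, c, d\<close>, this annulus contains the circles of radius \<open>1\<close>
  and \<open>q\<close>, is stable under \<open>z \<mapsto> q / z\<close>, and avoids the zeros of the denominators of \<open>\<Phi>\<close> and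
  \<open>aff_even\<close>.\<close>

definition annulus :: "real \<Rightarrow> complex set"
  where "annulus r = {z. q * r < norm z \<and> norm z < 1 / r}"

lemma qp_holo [holomorphic_intros]: "h holomorphic_on A \<Longrightarrow> (\<lambda>z. qp (h z)) holomorphic_on A"
  using holomorphic_on_compose_gen[OF _ q_poch_holo[OF norm_Q(1)], of h A] by (simp add: o_def)

lemma annulusD:
  assumes r: "0 < r" and z: "z \<in> annulus r" and u: "norm u \<le> r"
  shows "z \<noteq> 0" "norm (u * z) < 1" "norm (u * (Q / z)) < 1"
proof -
  have z': "q * r < norm z" "r * norm z < 1" "0 < norm z"
  proof -
    show "q * r < norm z" "r * norm z < 1" using z r by (simp_all add: annulus_def field_simps)
    moreover have "0 < q * r" using r q01 by simp
    ultimately show "0 < norm z" by linarith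
  qed
  show "z \<noteq> 0" using z'(3) by auto
  have "norm u * norm z \<le> r * norm z" using u by (intro mult_right_mono) auto
  then show "norm (u * z) < 1" unfolding norm_mult using z'(2) by linarith
  have "norm u * q \<le> r * q" using u q01 by (intro mult_right_mono) auto
  then have "norm u * q < norm z" unfolding mult.commute[of r] using z'(1) by linarith
  then show "norm (u * (Q / z)) < 1" using z'(3) q01 by (simp add: norm_mult norm_divide)
qed

lemma Phi_holo:
  assumes r: "0 < r" "t\<^sup>2 \<le> r"
  shows "Phi holomorphic_on annulus r"
proof -
  have u: "norm (of_real t ^ 2 :: complex) \<le> r" using r t01 by (simp add: norm_power)
  have "y \<noteq> 0" "qp (of_real t ^ 2 * y) \<noteq> 0" "qp (of_real t ^ 2 * (Q / y)) \<noteq> 0" if "y \<in> annulus r" for y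
    using annulusD[OF r(1) that u] qp_nz by blast+
  then show ?thesis
    unfolding Phi_def[abs_def] by (intro holomorphic_intros) auto
qed

lemma sphere_annulus: "0 < r \<Longrightarrow> r < 1 \<Longrightarrow> sphere 0 1 \<subseteq> annulus r"
proof
  fix z :: complex assume r: "0 < r" "r < 1" and z: "z \<in> sphere 0 1"
  have "q * r < 1 * 1" using r q01 by (intro mult_strict_mono) auto
  then show "z \<in> annulus r" using r z by (simp add: annulus_def)
qed

lemma qp_cont [continuous_intros]: "continuous_on A h \<Longrightarrow> continuous_on A (\<lambda>z. qp (h z))"
  by (rule continuous_on_compose2[OF holomorphic_on_imp_continuous_on[OF q_poch_holo[OF norm_Q(1)]]]) auto

lemma Phi_cont: "continuous_on (sphere 0 1) Phi"
  by (rule continuous_on_subset[OF holomorphic_on_imp_continuous_on[OF Phi_holo[of "t\<^sup>2"]] sphere_annulus])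
    (use t01 in \<open>auto simp: power_less_one_iff\<close>)

lemma Psi_cont: "continuous_on (sphere 0 1) Psi"
proof -
  have "norm (u * z) < 1" "norm (u / z) < 1" "norm (u * (Q / z)) < 1" if "norm u < 1" "norm z = 1" for u z
  proof -
    show "norm (u * z) < 1" "norm (u / z) < 1" using that by (auto simp: norm_mult norm_divide)
    have "norm u * q < 1 * 1" using that q01 by (intro mult_strict_mono) auto
    then show "norm (u * (Q / z)) < 1" using that q01 by (simp add: norm_mult norm_divide)
  qed
  then have nz: "qp (u * z) \<noteq> 0" "qp (u / z) \<noteq> 0" "qp (u * (Q / z)) \<noteq> 0" if "norm u < 1" "norm z = 1" for u z
    using that qp_nz by blast+
  let ?D = "\<lambda>z. Psi_den z * (qp (aw_a p / z) * qp (aw_b p / z) * qp (aw_c p * (Q / z)) * qp (aw_d p * (Q / z)))"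
  have "?D z \<noteq> 0" if "norm z = 1" for z
    unfolding Psi_den_def mult_eq_0_iff de_Morgan_disj using that by (intro conjI nz aw_small)
  then have D: "\<forall>z\<in>sphere 0 1. ?D z \<noteq> 0" by simp
  have z0: "\<forall>z\<in>sphere (0 :: complex) 1. z \<noteq> 0" "\<forall>z\<in>sphere (0 :: complex) 1. z\<^sup>2 \<noteq> 0" by auto
  have "continuous_on (sphere 0 1) ?D"
    unfolding Psi_den_def by (intro continuous_intros z0)
  moreover have "continuous_on (sphere 0 1) (\<lambda>z. qp (z\<^sup>2) * qp (Q / z\<^sup>2))"
    by (intro continuous_intros z0)
  ultimately show ?thesis
    unfolding Psi_def[abs_def] by (intro continuous_on_divide D)
qed

lemma pt_nz [simp]: "pt \<theta> i \<noteq> 0"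
  using norm_pt[of \<theta> i] by (metis norm_zero zero_neq_one)

lemma bm_mon: "bm n (\<lambda>\<theta>. mon n (pt \<theta>) l)"
  unfolding mon_def
proof (rule bm_prod)
  fix i assume i: "i \<in> {1..n}"
  show "bm n (\<lambda>\<theta>. pt \<theta> i powi \<lfloor>coef l i\<rfloor>)"
    by (rule bm_comp[OF _ bm_pt[OF i]]) (auto intro!: continuous_intros)
qed

lemma bm_inverse:
  assumes "bm n u" "\<And>\<theta>. norm (u \<theta>) = 1"
  shows "bm n (\<lambda>\<theta>. inverse (u \<theta>))"
  by (rule bm_comp[OF _ assms]) (auto intro!: continuous_intros)

lemma norm_mon_pt: "norm (mon n (pt \<theta>) l) = 1"
  unfolding mon_def by (simp add: prod_norm[symmetric] norm_power_int)

lemma bm_leval: "f \<in> laurent n \<Longrightarrow> bm n (\<lambda>\<theta>. leval f (pt \<theta>))"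
  by (simp add: leval_laurent) (intro bm_sum bm_mult bm_const bm_mon)

lemma bm_leval_inv: "f \<in> laurent n \<Longrightarrow> bm n (\<lambda>\<theta>. leval f (pt_inv (pt \<theta>)))"
  by (simp add: leval_laurent mon_pt_inv) (intro bm_sum bm_mult bm_const bm_inverse bm_mon norm_mon_pt)

lemma bm_wt: "bm n (\<lambda>\<theta>. wt (pt \<theta>))"
  unfolding wt_def
proof (intro bm_mult bm_prod)
  fix i j assume ij: "j \<in> {1..n}" "i \<in> {1..<j}"
  then have i: "i \<in> {1..n}" by auto
  show "bm n (\<lambda>\<theta>. Phi (pt \<theta> i * pt \<theta> j))"
    by (rule bm_comp[OF Phi_cont bm_mult[OF bm_pt[OF i] bm_pt[OF ij(1)]]]) (simp add: norm_mult)
  show "bm n (\<lambda>\<theta>. Phi (pt \<theta> i / pt \<theta> j))"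
    unfolding divide_inverse
    by (rule bm_comp[OF Phi_cont bm_mult[OF bm_pt[OF i] bm_inverse[OF bm_pt[OF ij(1)]]]])
      (simp_all add: norm_mult norm_inverse)
next
  fix i assume i: "i \<in> {1..n}"
  show "bm n (\<lambda>\<theta>. Psi (pt \<theta> i))" by (rule bm_comp[OF Psi_cont bm_pt[OF i]]) simp
qed

lemma bm_jump:
  assumes k: "k \<le> n" and f: "f \<in> laurent n" and g: "g \<in> laurent n"
  shows "bm n (\<lambda>\<theta>. jump k f g (pt \<theta>) * wt (pt \<theta>))"
proof -
  have "bm n (\<lambda>\<theta>. leval (T k f) (pt \<theta>) * leval (hecke_gen n (inv_pars p) k g) (pt_inv (pt \<theta>))
      + (-1) * (leval f (pt \<theta>) * leval g (pt_inv (pt \<theta>))))"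
    using k f g by (intro bm_add bm_mult bm_const bm_leval bm_leval_inv T_laurent inv.T_laurent)
  then have "bm n (\<lambda>\<theta>. jump k f g (pt \<theta>))" by (simp add: jump_def)
  then show ?thesis by (intro bm_mult bm_wt)
qed

subsection \<open>The three kinds of simple reflections\<close>

lemma wt_cong: "(\<And>i. i \<in> {1..n} \<Longrightarrow> x i = y i) \<Longrightarrow> wt x = wt y"
  unfolding wt_def by (intro arg_cong2[where f = "(*)"] prod.cong refl) auto

lemma jump_cong:
  assumes k: "k \<le> n" and f: "f \<in> laurent n" and g: "g \<in> laurent n" and xy: "\<And>i. i \<in> {1..n} \<Longrightarrow> x i = y i"
  shows "jump k f g x = jump k f g y"
proof -
  have iv: "pt_inv x i = pt_inv y i" if "i \<in> {1..n}" for i using xy[OF that] by (simp add: pt_inv_def)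
  have "leval f x = leval f y" "leval (T k f) x = leval (T k f) y"
    by (rule leval_cong[OF f xy], assumption) (rule leval_cong[OF T_laurent[OF k f] xy], assumption)
  moreover have "leval g (pt_inv x) = leval g (pt_inv y)" "leval (inv.T k g) (pt_inv x) = leval (inv.T k g) (pt_inv y)"
    by (rule leval_cong[OF g iv], assumption) (rule leval_cong[OF inv.T_laurent[OF k g] iv], assumption)
  ultimately show ?thesis unfolding jump_def by simp
qed

lemma jump_integral_mid:
  assumes k: "0 < k" "k < n" and f: "f \<in> laurent n" and g: "g \<in> laurent n"
  shows "(LINT \<theta>|torus n. jump k f g (pt \<theta>) * wt (pt \<theta>)) = 0"
proof (rule integral_zero_swap[where k = k])
  have kn: "k \<le> n" using k by simp
  show "k \<le> n" by (rule kn)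
  show "(\<lambda>\<theta>. jump k f g (pt \<theta>) * wt (pt \<theta>)) \<in> borel_measurable (torus n)"
    using bm_jump[OF kn f g] by (simp add: bm_def)
  fix \<theta> :: "nat \<Rightarrow> real"
  let ?\<theta> = "\<lambda>i\<in>{1..n}. \<theta> (node_swap n k i)"
  have c: "pt ?\<theta> i = ptrefl k (pt \<theta>) i" if "i \<in> {1..n}" for i
    using that k by (simp add: pt_def ptrefl_def)
  show "jump k f g (pt ?\<theta>) * wt (pt ?\<theta>) = - (jump k f g (pt \<theta>) * wt (pt \<theta>))"
    using jump_wt_odd[of k f g "pt \<theta>"] jump_cong[OF kn f g, of "pt ?\<theta>" "ptrefl k (pt \<theta>)"]
      wt_cong[of "pt ?\<theta>" "ptrefl k (pt \<theta>)"] c k kn f g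
    by (simp only: norm_pt)
qed

lemma jump_integral_n:
  assumes f: "f \<in> laurent n" and g: "g \<in> laurent n"
  shows "(LINT \<theta>|torus n. jump n f g (pt \<theta>) * wt (pt \<theta>)) = 0"
proof (rule integral_zero_slices[where i = n])
  show "n \<in> {1..n}" using n2 by simp
  show "integrable (torus n) (\<lambda>\<theta>. jump n f g (pt \<theta>) * wt (pt \<theta>))"
    by (intro bm_integrable bm_jump f g) simp
  fix \<theta> :: "nat \<Rightarrow> real"
  let ?J = "\<lambda>y. jump n f g (pt (\<theta>(n := y))) * wt (pt (\<theta>(n := y)))"
  have "pt (\<theta>(n := 1 - y)) = ptrefl n (pt (\<theta>(n := y)))" for y
    by (auto simp: pt_def ptrefl_upd ex_reflect fun_eq_iff)
  then have "?J (1 - y) = - ?J y" for y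
    using jump_wt_odd[of n f g "pt (\<theta>(n := y))"] f g n2 by simp
  then have "(LINT y|U. ?J y) = - (LINT y|U. ?J y)" using U_reflect[of ?J] by simp
  then have "2 * (LINT y|U. ?J y) = 0" by (simp add: eq_neg_iff_add_eq_0)
  then show "(LINT y|U. ?J y) = 0" by simp
qed

text \<open>The product of \<open>\<Psi>(z)\<close> and the factor \<open>t\<^sub>0 - \<beta>\<close> at \<open>k = 0\<close>, up to the constant \<open>t\<^sub>0\<^sup>-\<^sup>1\<close>
  (\<open>Psi_factor_0\<close>).\<close>

definition aff_even :: "complex \<Rightarrow> complex"
  where "aff_even z = qp (z\<^sup>2) * qp (Q * (Q / z\<^sup>2)) / (Psi_den z * Psi_den (Q / z))"

definition wt_rest :: "(nat \<Rightarrow> complex) \<Rightarrow> complex"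
  where "wt_rest x = (\<Prod>j = 1..n. \<Prod>i = 1..<j. Phi (x i * x j) * Phi (x i / x j)) * (\<Prod>i \<in> {1..n} - {1}. Psi (x i))"

lemma wt_rest_eq: "wt x = wt_rest x * Psi (x 1)"
proof -
  have "(\<Prod>i = 1..n. Psi (x i)) = Psi (x 1) * (\<Prod>i \<in> {1..n} - {1}. Psi (x i))"
    using n2 by (intro prod.remove) auto
  then show ?thesis unfolding wt_def wt_rest_def by (simp only: mult_ac)
qed

text \<open>For \<open>1 < j\<close> the transformation \<open>x\<^sub>1 \<mapsto> q / x\<^sub>1\<close> exchanges \<open>x\<^sub>1 x\<^sub>j\<close> with \<open>q / (x\<^sub>1 / x\<^sub>j)\<close>, and \<open>\<Phi>\<close> is invariant under
  \<open>y \<mapsto> q / y\<close>.\<close>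

lemma wt_rest_refl:
  assumes x: "nz_point x"
  shows "wt_rest (ptrefl 0 x) = wt_rest x"
proof -
  have nz: "x i \<noteq> 0" for i using x by (simp add: nz_point_def)
  let ?y = "ptrefl 0 x"
  have y: "?y i = (if i = 1 then Q / x 1 else x i)" for i by (simp add: ptrefl_upd par_q_eq)
  have "Phi (?y i * ?y j) * Phi (?y i / ?y j) = Phi (x i * x j) * Phi (x i / x j)" if "i \<in> {1..<j}" for i j
  proof (cases "i = 1")
    case True
    then have "?y i * ?y j = Q / (x i / x j)" "?y i / ?y j = Q / (x i * x j)" using that y by auto
    then show ?thesis using Phi_inv[of "x i / x j"] Phi_inv[of "x i * x j"] nz by simp
  next
    case False
    then show ?thesis using that y by auto
  qed
  moreover have "Psi (?y i) = Psi (x i)" if "i \<in> {1..n} - {1}" for i using that y by simp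
  ultimately show ?thesis unfolding wt_rest_def by simp
qed

lemma aff_even_refl: "z \<noteq> 0 \<Longrightarrow> aff_even (Q / z) = aff_even z"
  using Q_nz by (simp add: aff_even_def power2_eq_square mult_ac)

lemma Psi_factor_0:
  assumes z: "norm z = 1"
  shows "(1 - aw_a p / z) * (1 - aw_b p / z) / (1 - Q / z\<^sup>2) * Psi z = aff_even z"
proof -
  have ne: "1 - aw_a p / z \<noteq> 0" "1 - aw_b p / z \<noteq> 0" "1 - Q / z\<^sup>2 \<noteq> 0"
    using norm_ne[of "aw_a p / z"] norm_ne[of "aw_b p / z"] norm_ne[of "Q / z\<^sup>2"] aw_small z q01
    by (auto simp: norm_divide norm_power)
  have "(1 - aw_a p / z) * ((1 - aw_b p / z) * (inverse (1 - aw_a p / z) * inverse (1 - aw_b p / z))) = 1"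
    using right_inverse[OF ne(1)] right_inverse[OF ne(2)] by algebra
  then show ?thesis
    unfolding Psi_def aff_even_def Psi_den_def qp_rec[of "Q / z\<^sup>2"] qp_rec[of "aw_a p / z"] qp_rec[of "aw_b p / z"]
    using ne by (simp add: divide_inverse mult_ac)
qed

text \<open>Along the first coordinate the integrand extends holomorphically to the annulus, once the
  zeros and poles of \<open>t\<^sub>0 - \<beta>\<close> and of \<open>\<Psi>\<close> have been cancelled in \<open>aff_even\<close>.\<close>

lemma jump_integral_0:
  assumes f: "f \<in> laurent n" and g: "g \<in> laurent n"
  shows "(LINT \<theta>|torus n. jump 0 f g (pt \<theta>) * wt (pt \<theta>)) = 0"
proof (rule integral_zero_slices[where i = 1])
  show "1 \<in> {1..n}" using n2 by simp
  show "integrable (torus n) (\<lambda>\<theta>. jump 0 f g (pt \<theta>) * wt (pt \<theta>))"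
    by (intro bm_integrable bm_jump f g) simp
  fix \<theta>
  define r where "r = Max {t\<^sup>2, norm (aw_a p), norm (aw_b p), norm (aw_c p), norm (aw_d p)}"
  have r_ge: "t\<^sup>2 \<le> r" "norm (aw_a p) \<le> r" "norm (aw_b p) \<le> r" "norm (aw_c p) \<le> r" "norm (aw_d p) \<le> r"
    unfolding r_def by (auto intro!: Max_ge)
  have "0 < t\<^sup>2" using t01 by simp
  then have r0: "0 < r" using r_ge(1) by linarith
  have r1: "r < 1" unfolding r_def using aw_small t01 by (subst Max_less_iff) (auto simp: power_less_one_iff)
  define X where "X = (\<lambda>z. (pt \<theta>)(1 := z))"
  have X1: "X z 1 = z" and Xi: "i \<noteq> 1 \<Longrightarrow> X z i = pt \<theta> i" for z i by (simp_all add: X_def)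
  have Xnz: "nz_point (X z)" if "z \<noteq> 0" for z using that by (simp add: X_def nz_point_def)
  have Xr: "X (Q / z) = ptrefl 0 (X z)" for z by (simp add: X_def ptrefl_upd par_q_eq)
  define H where "H = (\<lambda>z. wt_rest (X z) * aff_even z * odd_part 0 f g (X z))"
  have anz: "z \<noteq> 0" if "z \<in> annulus r" for z using annulusD(1)[OF r0 that, of 0] r0 by simp
  have Hholo: "H holomorphic_on annulus r"
  proof -
    have Ph: "(\<lambda>z. Phi (X z i * X z j) * Phi (X z i / X z j)) holomorphic_on annulus r" if "i \<in> {1..<j}" for i j
    proof (cases "i = 1")
      case True
      let ?w = "pt \<theta> j"
      have j: "j \<noteq> 1" using that by auto
      have "(\<lambda>z. Phi (z * w)) holomorphic_on annulus r" if "norm w = 1" for w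
        using that
        by (intro holomorphic_on_compose_gen[OF _ Phi_holo[OF r0 r_ge(1)], unfolded o_def, where f = "\<lambda>z. z * w"])
          (auto intro!: holomorphic_intros simp: annulus_def norm_mult)
      from this[of ?w] this[of "inverse ?w"] show ?thesis
        unfolding True X1 Xi[OF j] divide_inverse by (intro holomorphic_intros) (auto simp: norm_inverse)
    next
      case False
      then show ?thesis using that by (simp add: Xi)
    qed
    have Ps: "(\<lambda>z. Psi (X z i)) holomorphic_on annulus r" if "i \<in> {1..n} - {1}" for i using that by (simp add: Xi)
    have R: "(\<lambda>z. wt_rest (X z)) holomorphic_on annulus r"
      unfolding wt_rest_def
      by (rule holomorphic_on_mult[OF holomorphic_on_prod[OF holomorphic_on_prod[OF Ph]] holomorphic_on_prod[OF Ps]])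
    have dn: "Psi_den z \<noteq> 0" "Psi_den (Q / z) \<noteq> 0" if "z \<in> annulus r" for z
      using r_ge annulusD(2,3)[OF r0 that] by (auto simp: Psi_den_def qp_nz)
    have dh: "(\<lambda>z. Psi_den (h z)) holomorphic_on annulus r" if "h holomorphic_on annulus r" for h
      unfolding Psi_den_def using that by (intro holomorphic_intros)
    have E: "aff_even holomorphic_on annulus r"
      unfolding aff_even_def[abs_def] using dn anz by (intro holomorphic_intros dh) auto
    have Xh: "(\<lambda>z. X (h z) i) holomorphic_on annulus r" if "h holomorphic_on annulus r" for h i
      by (cases "i = 1") (use that X1 Xi in simp_all)
    have Xn: "X z i \<noteq> 0" if "z \<noteq> 0" for z i
      by (cases "i = 1") (use that X1 Xi in simp_all)
    have Qh: "(\<lambda>z. Q / z) holomorphic_on annulus r"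
      by (intro holomorphic_intros) (rule anz)
    have Qn: "Q / z \<noteq> 0" if "z \<in> annulus r" for z
      using anz[OF that] Q_nz by simp
    have O: "(\<lambda>z. odd_part 0 f g (X z)) holomorphic_on annulus r"
      unfolding odd_part_def
      unfolding pt_inv_def[abs_def] Xr[symmetric]
      by (intro holomorphic_intros leval_holo[OF f] leval_holo[OF g] leval_holo[OF T_laurent[OF le0 f]] Xh Qh
          nonzero_imp_inverse_nonzero Xn Qn anz)
    show ?thesis unfolding H_def by (intro holomorphic_intros R E O)
  qed
  have "(LINT y|U. H (ex y)) = 0"
  proof (rule odd_on_annulus[where ?r1.0 = "q * r" and ?r2.0 = "1 / r" and \<rho> = q])
    show "H holomorphic_on {z. q * r < norm z \<and> norm z < 1 / r}" using Hholo by (simp add: annulus_def)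
    show "0 \<le> q * r" "q * r < q" "q \<le> 1" "1 < 1 / r" using q01 r0 r1 by auto
    fix y
    let ?z = "ex (1 - y)"
    have z: "?z \<noteq> 0" and "of_real q * ex y = Q / ?z" by (simp_all add: ex_reflect divide_inverse)
    then show "H (of_real q * ex y) = - H ?z"
      using wt_rest_refl[OF Xnz[OF z]] aff_even_refl[OF z] odd_part_odd[OF le0 f g Xnz[OF z]]
      by (simp add: H_def Xr)
  qed
  moreover have "jump 0 f g (pt (\<theta>(1 := y))) * wt (pt (\<theta>(1 := y))) = inverse (par_t0 p) * H (ex y)" for y
  proof -
    have e: "pt (\<theta>(1 := y)) = X (ex y)" by (auto simp: X_def pt_def fun_eq_iff)
    have nzX: "nz_point (X (ex y))" by (rule Xnz) simp
    have "norm ((ex y)\<^sup>2) \<noteq> norm Q" using q01 by (simp add: norm_power)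
    then have ne: "(X (ex y) 1)\<^sup>2 \<noteq> Q" unfolding X1 by metis
    then have ne1: "evp (X (ex y)) (a 0) \<noteq> 1"
      unfolding evp_simple(1)[OF nzX] par_q_eq X1 by (auto simp: divide_eq_1_iff)
    show ?thesis
      unfolding e jump_eq[OF le0 f g nzX ne1] factor_0[OF nzX ne] wt_rest_eq H_def X1
        Psi_factor_0[OF norm_ex, symmetric]
      by (simp only: times_divide_eq_right times_divide_eq_left mult_ac)
  qed
  ultimately show "(LINT y|U. jump 0 f g (pt (\<theta>(1 := y))) * wt (pt (\<theta>(1 := y)))) = 0" by simp
qed

lemma jump_integral:
  assumes k: "k \<le> n" and f: "f \<in> laurent n" and g: "g \<in> laurent n"
  shows "(LINT \<theta>|torus n. jump k f g (pt \<theta>) * wt (pt \<theta>)) = 0"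
proof -
  consider "k = 0" | "0 < k" "k < n" | "k = n" using k by linarith
  then show ?thesis by cases (use f g jump_integral_0 jump_integral_mid jump_integral_n in auto)
qed

end

section \<open>Orthogonality\<close>

context koorn_weight
begin

abbreviation form :: "expalg \<Rightarrow> expalg \<Rightarrow> complex"
  where "form \<equiv> koornwinder_form n p"

lemma form_eq: "form f g = (LINT \<theta>|torus n. leval f (pt \<theta>) * leval g (pt_inv (pt \<theta>)) * wt (pt \<theta>))"
proof -
  define c where "c = 2 * of_real pi * \<i>"
  have c: "c \<noteq> 0" by (simp add: c_def)
  have d: "vector_derivative ex (at x) = c * ex x" for x
    by (simp add: vector_derivative_circlepath ex_eq c_def)
  have pt: "(\<lambda>i. ex (\<theta> i)) = pt \<theta>" for \<theta> by (simp add: pt_def fun_eq_iff)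
  have w: "weight n p (pt \<theta>) = wt (pt \<theta>)" for \<theta> by (rule weight_eq) simp
  have cancel: "(\<Prod>i = 1..n. 1 / pt \<theta> i) * (\<Prod>i = 1..n. c * pt \<theta> i) = c ^ n" for \<theta>
    unfolding prod.distrib[symmetric] by simp
  have "torus_integral n (\<lambda>x. leval f x * leval g (pt_inv x) * weight n p x * (\<Prod>i = 1..n. 1 / x i))
      = (LINT \<theta>|torus n. leval f (pt \<theta>) * leval g (pt_inv (pt \<theta>)) * wt (pt \<theta>)
          * ((\<Prod>i = 1..n. 1 / pt \<theta> i) * (\<Prod>i = 1..n. c * pt \<theta> i)))"
    unfolding torus_integral_def torus_def U_def d pt w
    by (simp only: pt_def mult.assoc)
  also have "\<dots> = (LINT \<theta>|torus n. leval f (pt \<theta>) * leval g (pt_inv (pt \<theta>)) * wt (pt \<theta>)) * c ^ n"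
    unfolding cancel by simp
  finally show ?thesis
    using c by (simp add: koornwinder_form_def c_def[symmetric])
qed

lemma form_smul: "form (smul u f) (smul v g) = u * v * form f g"
proof -
  have "form (smul u f) (smul v g)
      = (LINT \<theta>|torus n. u * v * (leval f (pt \<theta>) * leval g (pt_inv (pt \<theta>)) * wt (pt \<theta>)))"
    unfolding form_eq leval_smul by (simp only: mult_ac)
  then show ?thesis unfolding form_eq by simp
qed

lemma form_integrable:
  assumes "f \<in> laurent n" "g \<in> laurent n"
  shows "integrable (torus n) (\<lambda>\<theta>. leval f (pt \<theta>) * leval g (pt_inv (pt \<theta>)) * wt (pt \<theta>))"
  using assms by (intro bm_integrable bm_mult bm_leval bm_leval_inv bm_wt)

lemma form_T:
  assumes k: "k \<le> n" and f: "f \<in> laurent n" and g: "g \<in> laurent n"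
  shows "form (T k f) (inv.T k g) = form f g"
proof -
  have "form (T k f) (inv.T k g) - form f g = (LINT \<theta>|torus n. jump k f g (pt \<theta>) * wt (pt \<theta>))"
    unfolding form_eq
    by (subst Bochner_Integration.integral_diff[symmetric])
      (use k f g T_laurent inv.T_laurent in \<open>auto intro!: form_integrable simp: jump_def left_diff_distrib\<close>)
  then show ?thesis using jump_integral[OF assms] by simp
qed

lemma form_Tw:
  assumes "valid is" "f \<in> laurent n" "g \<in> laurent n"
  shows "form (Tw is f) (inv.Tw is g) = form f g"
  using assms
proof (induction "is")
  case (Cons k "is")
  then have "k \<le> n" "valid is" by (auto simp: valid_def)
  then show ?case using Cons by (simp add: Tw_Cons inv.Tw_Cons form_T Tw_laurent inv.Tw_laurent)
qed simp

text \<open>The same reduced word is chosen for both sets of parameters, because the choice depends on the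
  translation only.\<close>

lemma form_Y:
  assumes l: "l \<in> dominant n" and f: "f \<in> laurent n" and g: "g \<in> laurent n"
  shows "form (Y l f) (inv.Y l g) = form f g"
proof -
  let ?w = "SOME is. reduced_expr n is (transl l)"
  obtain "is" where "reduced is" "W is = transl l" using ex_reduced_transl[OF l] by blast
  then have "reduced_expr n is (transl l)" by (simp add: reduced_def)
  then have "reduced_expr n ?w (transl l)" by (rule someI)
  then have "valid ?w" by (auto simp: reduced_expr_def valid_def)
  from form_Tw[OF this f g] show ?thesis by (simp add: Y_dom_def hecke_elt_def)
qed

lemma inv_spectral: "spectral_pt n (inv_pars p) u = (\<lambda>i. inverse (spectral_pt n p u i))"
  by (rule ext) (simp add: spectral_pt_def inv_pars_def par_q_def power_int_inverse power_inverse
      inverse_mult_distrib[symmetric] del: inverse_mult_distrib)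

lemma inv_inj:
  assumes "inj_on (spectral_pt n p) (lattice n)"
  shows "inj_on (spectral_pt n (inv_pars p)) (lattice n)"
proof (rule inj_onI)
  fix u v assume uv: "u \<in> lattice n" "v \<in> lattice n" "spectral_pt n (inv_pars p) u = spectral_pt n (inv_pars p) v"
  have "spectral_pt n p u i = spectral_pt n p v i" for i
    using fun_cong[OF uv(3), of i] by (simp add: inv_spectral)
  then show "u = v" using inj_onD[OF assms _ uv(1,2)] by blast
qed

lemma inv_yev: "l \<in> dominant n \<Longrightarrow> u \<in> lattice n \<Longrightarrow> inv.yev l u = inverse (yev l u)"
  using mon_pt_inv[of n "spectral_pt n p u" l]
  by (simp add: yev_eq inv.yev_eq inv_spectral pt_inv_def[abs_def])

theorem form_koornwinder:
  assumes inj: "inj_on (spectral_pt n p) (lattice n)"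
    and lm: "l \<in> lattice n" "m \<in> lattice n" "l \<noteq> m"
  shows "form (koornwinder n p l) (koornwinder n (inv_pars p) m) = 0"
proof -
  let ?P = "koornwinder n p l" and ?Q = "koornwinder n (inv_pars p) m"
  have P: "eigen l ?P" by (rule koornwinder_eigen[OF inj lm(1)])
  have Q: "inv.eigen m ?Q" by (rule inv.koornwinder_eigen[OF inv_inj[OF inj] lm(2)])
  obtain d where d: "d \<in> dominant n" "yev d l \<noteq> yev d m"
    using separating_weight[OF inj lm] by blast
  have nz: "yev d m \<noteq> 0" by (rule yev_nz[OF d(1) lm(2)])
  have "form ?P ?Q = form (Y d ?P) (inv.Y d ?Q)"
    by (rule form_Y[OF d(1), symmetric]) (use P Q in \<open>auto simp: eigen_def inv.eigen_def\<close>)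
  also have "\<dots> = form (smul (yev d l) ?P) (smul (inverse (yev d m)) ?Q)"
    using P Q d(1) lm(2) by (simp add: eigen_def inv.eigen_def inv_yev)
  also have "\<dots> = yev d l / yev d m * form ?P ?Q"
    by (simp add: form_smul divide_inverse)
  finally have "(yev d l / yev d m - 1) * form ?P ?Q = 0" by (simp add: left_diff_distrib)
  moreover have "yev d l / yev d m - 1 \<noteq> 0" using d(2) nz by (simp add: divide_eq_1_iff)
  ultimately show ?thesis by (simp only: mult_eq_0_iff simp_thms)
qed

end

theorem corollary8p5:
  fixes n :: nat and q t :: real and p :: koornwinder_pars and l m :: vec
  assumes "2 \<le> n"
    and "0 < q" "q < 1" "0 < t" "t < 1"
    and "(q_half p)\<^sup>2 = complex_of_real q" "par_t p = complex_of_real t"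
    and "par_t0 p \<noteq> 0" "par_tn p \<noteq> 0" "par_t0v p \<noteq> 0" "par_tnv p \<noteq> 0"
    and "cmod (aw_a p) < 1" "cmod (aw_b p) < 1" "cmod (aw_c p) < 1" "cmod (aw_d p) < 1"
    and "generic_pars n p"
    and "l \<in> lattice n" "m \<in> lattice n" "l \<noteq> m"
  shows "koornwinder_form n p (koornwinder_E n p l) (koornwinder_E' n p m) = 0"
proof -
  interpret koorn_weight n p q t
    by unfold_locales (use assms in auto)
  have "inj_on (spectral_pt n p) (lattice n)" using \<open>generic_pars n p\<close> by (simp add: generic_pars_def)
  from form_koornwinder[OF this \<open>l \<in> lattice n\<close> \<open>m \<in> lattice n\<close> \<open>l \<noteq> m\<close>]
  show ?thesis by (simp add: koornwinder_E_def koornwinder_E'_def form_smul)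
qed

end
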